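(* Let $G=(V,E)$ be a weighted graph, with $n=|V|$. For any integer $k\ge1$ and any numbers $\frac{1}{2k-1}<q<k$ and $1<\rho\le2$, a $\left(\rho\cdot(2k-1)\cdot\left(1+\frac{2}{q}\right)+\frac{2}{q}\right)$-spanner of $G$ with $O\left(n^{1+1/k}\cdot\left(1+\frac{q}{\rho-1}\right)\right)$ edges and lightness $O\left(k\cdot n^{1/k}\cdot\frac{q}{\rho-1}\right)$ can be built in $O(k\cdot n^{2+1/k})$ time.
   Context: Graphs are undirected with positive edge weights $\omega$; $dist_H(u,v)$ denotes the weighted shortest-path distance in $H$. For $t\ge1$, a $t$-spanner of $G=(V,E)$ is a subgraph $H=(V,E')$, $E'\subseteq E$, such that $dist_H(u,v)\le t\cdot dist_G(u,v)$ for every edge $(u,v)\in E$. The lightness of $H$ is $\omega(H)/\omega(MST(G))$, where $\omega(H)$ is the total edge weight of $H$ and $\omega(MST(G))$ is the weight of a minimum spanning tree of $G$ ($G$ is assumed connected). *)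

theory Defs
  imports Complex_Main "HOL-Library.Extended_Real"
begin

section \<open>Weighted graphs, spanners and lightness\<close>

text \<open>
  Finite simple undirected graphs are given by a vertex set and a set of two-element edges; the
  weight function is only relevant on edges.
\<close>

definition weighted_graph :: "'v set \<Rightarrow> 'v set set \<Rightarrow> ('v set \<Rightarrow> real) \<Rightarrow> bool" where
  "weighted_graph V E w \<longleftrightarrow>
     finite V \<and> (\<forall>e\<in>E. \<exists>u\<in>V. \<exists>v\<in>V. u \<noteq> v \<and> e = {u, v}) \<and> (\<forall>e\<in>E. w e > 0)"

definition walk :: "'v set \<Rightarrow> 'v set set \<Rightarrow> 'v list \<Rightarrow> bool" where
  "walk V E p \<longleftrightarrow> p \<noteq> [] \<and> set p \<subseteq> V \<and> successively (\<lambda>u v. {u, v} \<in> E) p"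

definition walk_weight :: "('v set \<Rightarrow> real) \<Rightarrow> 'v list \<Rightarrow> real" where
  "walk_weight w p = (\<Sum>i<length p - 1. w {p ! i, p ! Suc i})"

text \<open>The distance between vertices in different components is \<open>\<infinity>\<close>, the infimum of the empty set.\<close>

definition graph_dist :: "'v set \<Rightarrow> 'v set set \<Rightarrow> ('v set \<Rightarrow> real) \<Rightarrow> 'v \<Rightarrow> 'v \<Rightarrow> ereal" where
  "graph_dist V E w u v =
     (INF p\<in>{p. walk V E p \<and> hd p = u \<and> last p = v}. ereal (walk_weight w p))"

definition graph_connected :: "'v set \<Rightarrow> 'v set set \<Rightarrow> bool" where
  "graph_connected V E \<longleftrightarrow>
     V \<noteq> {} \<and> (\<forall>u\<in>V. \<forall>v\<in>V. \<exists>p. walk V E p \<and> hd p = u \<and> last p = v)"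

definition graph_acyclic :: "'v set \<Rightarrow> 'v set set \<Rightarrow> bool" where
  "graph_acyclic V E \<longleftrightarrow>
     \<not> (\<exists>p. walk V E p \<and> distinct p \<and> length p \<ge> 3 \<and> {last p, hd p} \<in> E)"

definition spanning_tree :: "'v set \<Rightarrow> 'v set set \<Rightarrow> 'v set set \<Rightarrow> bool" where
  "spanning_tree V E T \<longleftrightarrow> T \<subseteq> E \<and> graph_connected V T \<and> graph_acyclic V T"

definition total_weight :: "('v set \<Rightarrow> real) \<Rightarrow> 'v set set \<Rightarrow> real" where
  "total_weight w E = (\<Sum>e\<in>E. w e)"

definition mst_weight :: "'v set \<Rightarrow> 'v set set \<Rightarrow> ('v set \<Rightarrow> real) \<Rightarrow> real" where
  "mst_weight V E w = Min (total_weight w ` {T. spanning_tree V E T})"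

definition is_spanner ::
    "'v set \<Rightarrow> 'v set set \<Rightarrow> ('v set \<Rightarrow> real) \<Rightarrow> real \<Rightarrow> 'v set set \<Rightarrow> bool" where
  "is_spanner V E w t E' \<longleftrightarrow>
     E' \<subseteq> E \<and>
     (\<forall>u v. {u, v} \<in> E \<longrightarrow> graph_dist V E' w u v \<le> ereal t * graph_dist V E w u v)"

text \<open>On a one-vertex graph the quotient is \<open>0 / 0 = 0\<close>.\<close>

definition lightness :: "'v set \<Rightarrow> 'v set set \<Rightarrow> ('v set \<Rightarrow> real) \<Rightarrow> 'v set set \<Rightarrow> real" where
  "lightness V E w E' = total_weight w E' / mst_weight V E w"


section \<open>Running time: a real RAM\<close>

text \<open>
  The model of computation is a unit-cost RAM with natural-number and real-number registers and
  arrays, programmed in a structured imperative language. It is deliberately weak: natural numbers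
  have addition, truncated subtraction and comparison only; reals have the four field operations
  and comparison, but no rounding, and there are no real literals, so no information can be hidden
  in a program constant. Register and array names are static and cannot be computed at run time.
\<close>

datatype nexp =
    NConst nat
  | NVar string
  | NArr string nexp
  | NPlus nexp nexp
  | NMinus nexp nexp

datatype rexp =
    RNat nexp
  | RVar string
  | RArr string nexp
  | RPlus rexp rexp
  | RMinus rexp rexp
  | RTimes rexp rexp
  | RDiv rexp rexp

datatype bexp =
    NLess nexp nexp
  | RLess rexp rexp
  | BNot bexp
  | BAnd bexp bexp

datatype com =
    Skip
  | NAssign string nexp
  | RAssign string rexp
  | NStore string nexp nexp  \<comment> \<open>array, index, value\<close>
  | RStore string nexp rexp
  | Seq com com
  | Cond bexp com com
  | While bexp com

record state =
  nvar :: "string \<Rightarrow> nat"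
  rvar :: "string \<Rightarrow> real"
  narr :: "string \<Rightarrow> nat \<Rightarrow> nat"
  rarr :: "string \<Rightarrow> nat \<Rightarrow> real"

fun nval :: "nexp \<Rightarrow> state \<Rightarrow> nat" where
  "nval (NConst c) s = c"
| "nval (NVar x) s = nvar s x"
| "nval (NArr a i) s = narr s a (nval i s)"
| "nval (NPlus e f) s = nval e s + nval f s"
| "nval (NMinus e f) s = nval e s - nval f s"

fun rval :: "rexp \<Rightarrow> state \<Rightarrow> real" where
  "rval (RNat e) s = real (nval e s)"
| "rval (RVar x) s = rvar s x"
| "rval (RArr a i) s = rarr s a (nval i s)"
| "rval (RPlus e f) s = rval e s + rval f s"
| "rval (RMinus e f) s = rval e s - rval f s"
| "rval (RTimes e f) s = rval e s * rval f s"
| "rval (RDiv e f) s = rval e s / rval f s"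

fun bval :: "bexp \<Rightarrow> state \<Rightarrow> bool" where
  "bval (NLess e f) s \<longleftrightarrow> nval e s < nval f s"
| "bval (RLess e f) s \<longleftrightarrow> rval e s < rval f s"
| "bval (BNot b) s \<longleftrightarrow> \<not> bval b s"
| "bval (BAnd b c) s \<longleftrightarrow> bval b s \<and> bval c s"

text \<open>
  \<open>exec c s t s'\<close>: started in \<open>s\<close>, the program \<open>c\<close> halts after \<open>t\<close> steps in \<open>s'\<close>. Every assignment
  and every test costs one step. The expressions in a fixed program have bounded size, so charging
  for each of their operations would change the running time by a constant factor only.
\<close>

inductive exec :: "com \<Rightarrow> state \<Rightarrow> nat \<Rightarrow> state \<Rightarrow> bool" where
  Skip: "exec Skip s 1 s"
| NAssign: "exec (NAssign x e) s 1 (s\<lparr>nvar := (nvar s)(x := nval e s)\<rparr>)"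
| RAssign: "exec (RAssign x e) s 1 (s\<lparr>rvar := (rvar s)(x := rval e s)\<rparr>)"
| NStore: "exec (NStore a i e) s 1
    (s\<lparr>narr := (narr s)(a := (narr s a)(nval i s := nval e s))\<rparr>)"
| RStore: "exec (RStore a i e) s 1
    (s\<lparr>rarr := (rarr s)(a := (rarr s a)(nval i s := rval e s))\<rparr>)"
| Seq: "exec c s t s' \<Longrightarrow> exec d s' t' s'' \<Longrightarrow> exec (Seq c d) s (t + t') s''"
| CondTrue: "bval b s \<Longrightarrow> exec c s t s' \<Longrightarrow> exec (Cond b c d) s (1 + t) s'"
| CondFalse: "\<not> bval b s \<Longrightarrow> exec d s t s' \<Longrightarrow> exec (Cond b c d) s (1 + t) s'"
| WhileFalse: "\<not> bval b s \<Longrightarrow> exec (While b c) s 1 s"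
| WhileTrue: "bval b s \<Longrightarrow> exec c s t s' \<Longrightarrow> exec (While b c) s' t' s'' \<Longrightarrow>
    exec (While b c) s (1 + t + t') s''"

text \<open>
  A graph on the vertices \<open>0, \<dots>, n - 1\<close> is presented to a program as a list of its edges, each
  occurring once, in an arbitrary order and orientation, together with its weight.
\<close>

definition is_edge_list ::
    "nat set set \<Rightarrow> (nat set \<Rightarrow> real) \<Rightarrow> (nat \<times> nat \<times> real) list \<Rightarrow> bool" where
  "is_edge_list E w es \<longleftrightarrow>
     distinct (map (\<lambda>(u, v, x). {u, v}) es) \<and>
     set (map (\<lambda>(u, v, x). {u, v}) es) = E \<and>
     (\<forall>(u, v, x)\<in>set es. x = w {u, v})"

text \<open>All registers and array cells that do not hold the input are initially zero.\<close>

definition input_state ::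
    "nat \<Rightarrow> (nat \<times> nat \<times> real) list \<Rightarrow> nat \<Rightarrow> real \<Rightarrow> real \<Rightarrow> state" where
  "input_state n es k q \<rho> =
     \<lparr>nvar = (\<lambda>x. 0)(''n'' := n, ''m'' := length es, ''k'' := k),
      rvar = (\<lambda>x. 0)(''q'' := q, ''rho'' := \<rho>),
      narr = (\<lambda>a i. 0)(
        ''src'' := (\<lambda>i. if i < length es then fst (es ! i) else 0),
        ''dst'' := (\<lambda>i. if i < length es then fst (snd (es ! i)) else 0)),
      rarr = (\<lambda>a i. 0)(
        ''wt'' := (\<lambda>i. if i < length es then snd (snd (es ! i)) else 0))\<rparr>"

definition output_edges :: "state \<Rightarrow> nat set set" where
  "output_edges s =
     (\<lambda>j. {narr s ''outsrc'' j, narr s ''outdst'' j}) ` {..<nvar s ''outm''}"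

end

theory Submission imports Defs begin

text \<open>
  Prim's algorithm yields a minimum spanning tree of weight \<open>W\<close>, which is part of the spanner. The edges
  are scanned by increasing weight in scales \<open>[x, 2 x)\<close>. At scale \<open>x\<close> the forest of the tree edges lighter
  than \<open>2 x\<close> is cut bottom-up into clusters of radius at most \<open>R = x / q\<close>. Every cut except those at
  heavy tree edges uses up a path of weight \<open>R\<close>, and a cluster that meets no such cut is isolated
  in the cluster graph, so that at most \<open>2 (q / x) (\<Sum>\<^bsub>w(e) < 2 x\<^esub> w(e))\<close> clusters are not isolated, the sum ranging
  over tree edges. Within the scale, windows \<open>[z, \<rho> z)\<close> of weights are treated as
  unweighted: a ball in the cluster graph is grown while the next layer multiplies
  its size by more than \<open>b\<close>, where \<open>b\<close> is about the \<open>k\<close>-th root of the number of clusters. Hence its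
  radius is less than \<open>k\<close>; its breadth-first tree is output and its interior is deleted. This
  replaces an edge by at most \<open>2 k - 1\<close> edges of the window and \<open>2 k\<close> passages through
  clusters, which gives the stretch.

  As the scales grow geometrically, exchanging the sums over scales and tree edges bounds the
  number of output edges, with no spanner for the light edges needed. For the lightness, the
  \<open>k\<close>-th root of the number \<open>O(q W / x)\<close> of clusters is summed over the scales, a geometric
  series with ratio \<open>2\<^bsup>-1/k\<^esup>\<close>, whence the factor \<open>k\<close>.

  A scale with no tree edge of weight between \<open>x / (q n)\<close> and \<open>2 x\<close> is skipped, since the tree
  itself is good enough there; thus only \<open>O(n log n)\<close> scales are processed, and \<open>n\<^sup>2 log n\<close> is within the
  time bound because \<open>k n\<^bsup>1/k\<^esup> \<ge> ln n\<close>. If \<open>n \<le> k\<close>, the tree alone is a spanner.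
\<close>

section \<open>Walks and distances\<close>

text \<open>The machine has no roots, no rounding and no multiplication of naturals, so scales and
  windows are not taken from a grid: each starts at the weight of the first edge in sorted order
  that is not yet served. Hence distinct scales are only known to differ by a factor of at least 2,
  and every series is bounded for such sets. The lower end \<open>x / (q n)\<close> of the range
  that activates a scale is chosen so that a tree detour of at most \<open>2 (n - 1)\<close> lighter
  edges costs at most \<open>2 / q\<close> times the weight of the edge, and \<open>2 / q\<close> is
  a summand of the stretch. The bound \<open>q > 1 / (2 k - 1)\<close> enters as
  \<open>2 k q \<ge> 1\<close>: it absorbs the weight of the tree and the crude estimate at scales
  below \<open>W / n\<close> into the lightness. The bound \<open>q < k\<close> makes the
  \<open>k\<close>-th root of \<open>2 q + 1 / 2\<close> a constant and, with \<open>k < n\<close>,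
  keeps the number of scales activated by one tree edge logarithmic. Time is amortized. Inside a
  window every step is charged to an edge of the window, so only the clusters that it meets may be
  reset. Work linear in \<open>n\<close> is charged to an active scale or to a tree weight passed by
  a skip.\<close>

definition reach :: "'v set \<Rightarrow> 'v set set \<Rightarrow> ('v set \<Rightarrow> real) \<Rightarrow> 'v \<Rightarrow> 'v \<Rightarrow> real \<Rightarrow> bool" where
  "reach V H w u v d \<longleftrightarrow> (\<exists>p. walk V H p \<and> hd p = u \<and> last p = v \<and> walk_weight w p \<le> d)"

lemma walk_weight_Cons:
  assumes "p \<noteq> []"
  shows "walk_weight w (a # p) = w {a, hd p} + walk_weight w p"
proof -
  obtain m where m: "length p = Suc m" using assms by (cases p) auto
  show ?thesis
    by (simp add: walk_weight_def m sum.lessThan_Suc_shift hd_conv_nth assms del: sum.lessThan_Suc)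
qed

lemma walk_weight_singleton [simp]: "walk_weight w [a] = 0"
  by (simp add: walk_weight_def)

lemma walk_Cons:
  assumes "p \<noteq> []"
  shows "walk V H (a # p) \<longleftrightarrow> a \<in> V \<and> {a, hd p} \<in> H \<and> walk V H p"
  using assms by (auto simp: walk_def successively_Cons)

lemma walk_singleton [simp]: "walk V H [a] \<longleftrightarrow> a \<in> V"
  by (auto simp: walk_def)

lemma reach_mono: "reach V H w u v d \<Longrightarrow> d \<le> d' \<Longrightarrow> reach V H w u v d'"
  by (auto simp: reach_def intro: order_trans)

lemma reach_superset:
  assumes "reach V H w u v d" "H \<subseteq> H'"
  shows "reach V H' w u v d"
proof -
  have "walk V H p \<Longrightarrow> walk V H' p" for p
    using assms(2) by (auto simp: walk_def intro: successively_mono)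
  then show ?thesis using assms(1) by (auto simp: reach_def)
qed

lemma reach_refl: "u \<in> V \<Longrightarrow> 0 \<le> d \<Longrightarrow> reach V H w u u d"
  unfolding reach_def by (intro exI[of _ "[u]"]) auto

lemma reach_step:
  assumes "reach V H w v x d" "u \<in> V" "{u, v} \<in> H"
  shows "reach V H w u x (w {u, v} + d)"
proof -
  obtain p where p: "walk V H p" "hd p = v" "last p = x" "walk_weight w p \<le> d"
    using assms by (auto simp: reach_def)
  then have "p \<noteq> []" by (auto simp: walk_def)
  then show ?thesis
    unfolding reach_def using p assms
    by (intro exI[of _ "u # p"]) (auto simp: walk_Cons walk_weight_Cons)
qed

lemma reach_edge:
  "u \<in> V \<Longrightarrow> v \<in> V \<Longrightarrow> {u, v} \<in> H \<Longrightarrow> w {u, v} \<le> d \<Longrightarrow> reach V H w u v d"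
  using reach_step[OF reach_refl[of v V 0 H w], of u] reach_mono by fastforce

lemma reach_trans:
  assumes "reach V H w u v d" "reach V H w v x d'"
  shows "reach V H w u x (d + d')"
proof -
  have "walk V H p \<Longrightarrow> last p = v \<Longrightarrow> reach V H w (hd p) x (walk_weight w p + d')" for p
  proof (induction p)
    case Nil then show ?case by (simp add: walk_def)
  next
    case (Cons a p)
    show ?case
    proof (cases "p = []")
      case True then show ?thesis using Cons assms(2) by simp
    next
      case False
      then have "walk V H p" "a \<in> V" "{a, hd p} \<in> H" using Cons.prems(1) by (simp_all add: walk_Cons)
      then show ?thesis
        using reach_step[OF Cons.IH, of a] Cons.prems False
        by (simp add: walk_weight_Cons algebra_simps)
    qed
  qed
  then show ?thesis using assms(1) unfolding reach_def[of V H w u v]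
    by (metis add_le_cancel_right reach_mono)
qed

lemma reach_sym:
  assumes "reach V H w u v d"
  shows "reach V H w v u d"
proof -
  have "walk V H p \<Longrightarrow> reach V H w (last p) (hd p) (walk_weight w p)" for p
  proof (induction p)
    case Nil then show ?case by (simp add: walk_def)
  next
    case (Cons a p)
    show ?case
    proof (cases "p = []")
      case True then show ?thesis using Cons by (simp add: reach_refl)
    next
      case False
      then have *: "walk V H p" "a \<in> V" "{a, hd p} \<in> H" using Cons.prems(1) by (simp_all add: walk_Cons)
      moreover have "hd p \<in> V" using *(1) by (auto simp: walk_def)
      ultimately have "reach V H w (hd p) a (w {a, hd p})"
        by (intro reach_edge) (auto simp: insert_commute)
      from reach_trans[OF Cons.IH[OF *(1)] this] show ?thesis
        using False by (simp add: walk_weight_Cons add.commute)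
    qed
  qed
  then show ?thesis using assms unfolding reach_def[of V H w u v] by (metis reach_mono)
qed

text \<open>An edge need not be a shortest path, so the distance in the spanner condition can be
  smaller than \<open>w {u, v}\<close>. Hence the bound per edge is first summed along an arbitrary
  walk of the graph, and only then compared with the infimum over walks.\<close>

lemma is_spannerI:
  assumes G: "weighted_graph V E w" and sub: "H \<subseteq> E" and t: "t > 0"
    and e: "\<And>u v. {u, v} \<in> E \<Longrightarrow> reach V H w u v (t * w {u, v})"
  shows "is_spanner V E w t H"
proof -
  have *: "walk V E p \<Longrightarrow> reach V H w (hd p) (last p) (t * walk_weight w p)" for p
  proof (induction p)
    case Nil then show ?case by (simp add: walk_def)
  next
    case (Cons a p)
    show ?case
    proof (cases "p = []")
      case True then show ?thesis using Cons by (simp add: reach_refl)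
    next
      case False
      then have *: "walk V E p" "a \<in> V" "{a, hd p} \<in> E" using Cons.prems(1) by (simp_all add: walk_Cons)
      from reach_trans[OF e[OF *(3)] Cons.IH[OF *(1)]] show ?thesis
        using False by (simp add: walk_weight_Cons algebra_simps)
    qed
  qed
  have "graph_dist V H w u v \<le> ereal t * graph_dist V E w u v" for u v
  proof -
    \<comment> \<open>Dividing by \<open>t\<close> leaves the bare infimum on the right, where
      \<open>INF_greatest\<close> applies.\<close>
    have "graph_dist V H w u v / ereal t \<le> graph_dist V E w u v"
      unfolding graph_dist_def[of V E]
    proof (rule INF_greatest)
      fix p assume "p \<in> {p. walk V E p \<and> hd p = u \<and> last p = v}"
      then have "reach V H w u v (t * walk_weight w p)" using * by auto
      then obtain r where r: "walk V H r" "hd r = u" "last r = v" "walk_weight w r \<le> t * walk_weight w p"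
        by (auto simp: reach_def)
      have "graph_dist V H w u v \<le> ereal (walk_weight w r)"
        unfolding graph_dist_def using r by (intro INF_lower) auto
      also have "\<dots> \<le> ereal t * ereal (walk_weight w p)" using r by simp
      finally show "graph_dist V H w u v / ereal t \<le> ereal (walk_weight w p)"
        using t by (simp add: ereal_divide_le_pos mult.commute)
    qed
    then show ?thesis using t by (simp add: ereal_divide_le_pos mult.commute)
  qed
  then show ?thesis using sub by (auto simp: is_spanner_def)
qed

section \<open>Connectivity and minimum spanning trees\<close>

text \<open>Connectivity is handled through the reflexive transitive closure of this relation,
  because cutting and rerouting is easier for closures than for vertex lists.\<close>

definition adj :: "'v set set \<Rightarrow> ('v \<times> 'v) set" where
  "adj F = {(u, v). {u, v} \<in> F}"

lemma sym_adj: "sym (adj F)"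
  by (auto simp: adj_def sym_def insert_commute)

lemma adj_rtrancl_sym: "(u, v) \<in> (adj F)\<^sup>* \<Longrightarrow> (v, u) \<in> (adj F)\<^sup>*"
  by (meson sym_adj sym_rtrancl symD)

lemma walk_imp_rtrancl:
  "walk V F p \<Longrightarrow> (hd p, last p) \<in> (adj F)\<^sup>*"
proof (induction p)
  case (Cons a p)
  then show ?case
    by (cases "p = []")
      (auto simp: walk_Cons adj_def intro: converse_rtrancl_into_rtrancl)
qed (simp add: walk_def)

lemma rtrancl_imp_walk:
  assumes "(u, v) \<in> (adj F)\<^sup>*" "v \<in> V" "\<And>e. e \<in> F \<Longrightarrow> e \<subseteq> V"
  shows "\<exists>p. walk V F p \<and> hd p = u \<and> last p = v"
  using assms(1)
proof (induction rule: converse_rtrancl_induct)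
  case base
  show ?case using assms(2) by (intro exI[of _ "[v]"]) auto
next
  case (step a b)
  then obtain p where p: "walk V F p" "hd p = b" "last p = v" by auto
  then have "p \<noteq> []" by (auto simp: walk_def)
  moreover have "{a, b} \<in> F" using step by (auto simp: adj_def)
  moreover have "a \<in> V" using assms(3)[OF \<open>{a, b} \<in> F\<close>] by auto
  ultimately show ?case using p by (intro exI[of _ "a # p"]) (auto simp: walk_Cons)
qed

lemma graph_connected_iff:
  assumes "\<And>e. e \<in> F \<Longrightarrow> e \<subseteq> V"
  shows "graph_connected V F \<longleftrightarrow> V \<noteq> {} \<and> (\<forall>u\<in>V. \<forall>v\<in>V. (u, v) \<in> (adj F)\<^sup>*)"
proof
  assume "graph_connected V F"
  then show "V \<noteq> {} \<and> (\<forall>u\<in>V. \<forall>v\<in>V. (u, v) \<in> (adj F)\<^sup>*)"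
    unfolding graph_connected_def by (metis walk_imp_rtrancl)
next
  assume "V \<noteq> {} \<and> (\<forall>u\<in>V. \<forall>v\<in>V. (u, v) \<in> (adj F)\<^sup>*)"
  then show "graph_connected V F"
    unfolding graph_connected_def using rtrancl_imp_walk[OF _ _ assms] by blast
qed

lemma rtrancl_replace:
  assumes "(u, v) \<in> (adj F)\<^sup>*" "\<And>a b. {a, b} \<in> F \<Longrightarrow> (a, b) \<in> (adj F')\<^sup>*"
  shows "(u, v) \<in> (adj F')\<^sup>*"
  using assms(1)
proof induction
  case (step y z)
  then have "(y, z) \<in> (adj F')\<^sup>*" using assms(2) by (simp add: adj_def)
  then show ?case using step by simp
qed simp

lemma finite_edges:
  assumes "weighted_graph V E w"
  shows "finite E"
proof (rule finite_subset)
  show "E \<subseteq> Pow V" using assms by (auto simp: weighted_graph_def)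
qed (use assms in \<open>simp add: weighted_graph_def\<close>)

text \<open>A connected edge set with the fewest edges is acyclic, since the closing edge of a cycle
  could be dropped. This makes the \<open>Min\<close> in \<open>mst_weight\<close> range over a
  nonempty set.\<close>

lemma ex_spanning_tree:
  assumes G: "weighted_graph V E w" and c: "graph_connected V E"
  shows "\<exists>T. spanning_tree V E T"
proof -
  have EV: "e \<in> E \<Longrightarrow> e \<subseteq> V" for e using G by (auto simp: weighted_graph_def)
  define P where "P F \<longleftrightarrow> F \<subseteq> E \<and> graph_connected V F" for F
  have "finite E" using G by (rule finite_edges)
  have "P E" using c by (simp add: P_def)
  then obtain F where F: "P F" "\<And>F'. P F' \<Longrightarrow> card F \<le> card F'"
    using ex_has_least_nat[of P E card] by auto
  have FV: "e \<in> F \<Longrightarrow> e \<subseteq> V" for e using F EV by (auto simp: P_def)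
  have "graph_acyclic V F"
    unfolding graph_acyclic_def
  proof (rule notI, elim exE conjE)
    fix p assume p: "walk V F p" "distinct p" "length p \<ge> 3" "{last p, hd p} \<in> F"
    define F' where "F' = F - {{last p, hd p}}"
    have ne: "p \<noteq> []" using p by auto
    have nth_eq: "p ! i = p ! j \<longleftrightarrow> i = j" if "i < length p" "j < length p" for i j
      using that p(2) nth_eq_iff_index_eq by blast
    \<comment> \<open>Distinctness and length at least 3 ensure that the closing edge is not among
      the edges traversed, so the walk survives its removal.\<close>
    have "{p ! i, p ! Suc i} \<noteq> {last p, hd p}" if "Suc i < length p" for i
    proof
      assume "{p ! i, p ! Suc i} = {last p, hd p}"
      then have "p ! i = p ! (length p - 1) \<or> p ! i = p ! 0 \<and> p ! Suc i = p ! (length p - 1)"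
        unfolding last_conv_nth[OF ne] hd_conv_nth[OF ne] doubleton_eq_iff by auto
      then have "i = length p - 1 \<or> i = 0 \<and> Suc i = length p - 1"
        using nth_eq[of i "length p - 1"] nth_eq[of i 0] nth_eq[of "Suc i" "length p - 1"] that by force
      then show False using that p(3) by auto
    qed
    then have "walk V F' p"
      using p(1) by (auto simp: walk_def F'_def successively_conv_nth)
    then have hl: "(hd p, last p) \<in> (adj F')\<^sup>*" by (rule walk_imp_rtrancl)
    have "(a, b) \<in> (adj F')\<^sup>*" if "{a, b} \<in> F" for a b
    proof (cases "{a, b} = {last p, hd p}")
      case True
      then show ?thesis using hl adj_rtrancl_sym[OF hl] by (auto simp: doubleton_eq_iff)
    next
      case False
      then show ?thesis using that by (auto simp: adj_def F'_def)
    qed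
    then have "\<forall>u\<in>V. \<forall>v\<in>V. (u, v) \<in> (adj F')\<^sup>*"
      using F(1) graph_connected_iff[of F V] FV rtrancl_replace by (metis P_def)
    moreover have "V \<noteq> {}" using c by (simp add: graph_connected_def)
    ultimately have "graph_connected V F'"
      using graph_connected_iff[of F' V] FV by (auto simp: F'_def)
    then have "P F'" using F(1) by (auto simp: P_def F'_def)
    moreover have "card F' < card F"
      unfolding F'_def using p(4) F(1) \<open>finite E\<close>
      by (intro card_Diff1_less) (auto simp: P_def intro: finite_subset)
    ultimately show False using F(2) by fastforce
  qed
  then show ?thesis using F(1) by (auto simp: P_def spanning_tree_def)
qed

lemma mst_weight_attained:
  assumes G: "weighted_graph V E w" and c: "graph_connected V E"
  obtains T where "spanning_tree V E T" "mst_weight V E w = total_weight w T"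
proof -
  have "finite E" using G by (rule finite_edges)
  then have "finite {T. spanning_tree V E T}"
    by (rule finite_subset[rotated, OF finite_Pow_iff[THEN iffD2]]) (auto simp: spanning_tree_def)
  then have "mst_weight V E w \<in> total_weight w ` {T. spanning_tree V E T}"
    unfolding mst_weight_def using ex_spanning_tree[OF assms] by (intro Min_in) auto
  then show ?thesis using that by auto
qed

text \<open>Taking the last exit keeps the remainder of the path outside \<open>S\<close>. In the
  exchange argument this remainder cannot use the removed edge, which has an end in
  \<open>S\<close>.\<close>

lemma rtrancl_last_exit:
  assumes "(x, y) \<in> R\<^sup>*" "x \<in> S" "y \<notin> S"
  shows "\<exists>a b. a \<in> S \<and> b \<notin> S \<and> (a, b) \<in> R \<and> (b, y) \<in> (R \<inter> (-S) \<times> (-S))\<^sup>*"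
  using assms
proof (induction rule: rtrancl_induct)
  case (step y z)
  show ?case
  proof (cases "y \<in> S")
    case True
    then show ?thesis using step by blast
  next
    case False
    then obtain a b where ab: "a \<in> S" "b \<notin> S" "(a, b) \<in> R" "(b, y) \<in> (R \<inter> (-S) \<times> (-S))\<^sup>*"
      using step by auto
    moreover have "(y, z) \<in> R \<inter> (-S) \<times> (-S)" using False step by auto
    ultimately show ?thesis by (meson rtrancl.rtrancl_into_rtrancl)
  qed
qed auto

section \<open>Prim orders\<close>

text \<open>Vertices are identified with their position in the order in which Prim's algorithm adds them;
  \<open>pp i\<close> and \<open>key i\<close> are the parent of position \<open>i\<close> and the weight of the edge to it. The single
  consequence of the greedy choice that is needed is \<open>cut_min\<close>.\<close>

locale prim_order =
  fixes n :: nat and E :: "nat set set" and w :: "nat set \<Rightarrow> real"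
    and ord pos pp :: "nat \<Rightarrow> nat" and key :: "nat \<Rightarrow> real"
  assumes G: "weighted_graph {..<n} E w"
    and ord: "\<And>i. i < n \<Longrightarrow> ord i < n \<and> pos (ord i) = i"
    and pos: "\<And>v. v < n \<Longrightarrow> pos v < n \<and> ord (pos v) = v"
    and pp: "\<And>i. 0 < i \<Longrightarrow> i < n \<Longrightarrow> pp i < i"
    and tree_edge: "\<And>i. 0 < i \<Longrightarrow> i < n \<Longrightarrow> {ord i, ord (pp i)} \<in> E \<and> w {ord i, ord (pp i)} = key i"
    and cut_min: "\<And>i u v. 0 < i \<Longrightarrow> i < n \<Longrightarrow> {u, v} \<in> E \<Longrightarrow> pos u < i \<Longrightarrow> i \<le> pos v \<Longrightarrow> key i \<le> w {u, v}"
begin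

section \<open>Minimality of the tree given by a Prim order\<close>

definition tedge :: "nat \<Rightarrow> nat set" where "tedge i = {ord i, ord (pp i)}"

definition tweight :: real where "tweight = (\<Sum>i\<in>{0<..<n}. key i)"

lemma E_vertices: "{u, v} \<in> E \<Longrightarrow> u < n \<and> v < n \<and> u \<noteq> v"
  using G by (fastforce simp: weighted_graph_def doubleton_eq_iff)

lemma E_pos: "e \<in> E \<Longrightarrow> 0 < w e"
  using G by (auto simp: weighted_graph_def)

lemma E_sub: "e \<in> E \<Longrightarrow> e \<subseteq> {..<n}"
  using G by (auto simp: weighted_graph_def)

lemma key_pos: "0 < i \<Longrightarrow> i < n \<Longrightarrow> 0 < key i"
  using tree_edge E_pos by metis

lemma ord_inj: "i < n \<Longrightarrow> j < n \<Longrightarrow> ord i = ord j \<longleftrightarrow> i = j"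
  by (metis ord)

lemma tree_root_path:
  "i < j \<Longrightarrow> j \<le> n \<Longrightarrow> (ord i, ord 0) \<in> (adj (tedge ` {0<..<j}))\<^sup>*"
proof (induction i rule: less_induct)
  case (less i)
  show ?case
  proof (cases "i = 0")
    case False
    then have "pp i < i" using pp less by auto
    then have "(ord (pp i), ord 0) \<in> (adj (tedge ` {0<..<j}))\<^sup>*" using less by auto
    moreover have "(ord i, ord (pp i)) \<in> adj (tedge ` {0<..<j})"
      using False less unfolding adj_def by (auto intro!: image_eqI[of _ tedge i] simp: tedge_def)
    ultimately show ?thesis by (rule converse_rtrancl_into_rtrancl[rotated])
  qed simp
qed

text \<open>The cut below position \<open>j\<close> separates \<open>ord j\<close> from its parent,
  so a path in \<open>F\<close> between them crosses it, and by \<open>cut_min\<close> the crossing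
  edge weighs at least \<open>key j\<close>. Trading it for \<open>tedge j\<close> keeps
  connectivity and does not increase the weight.\<close>

lemma exchange:
  assumes F: "F \<subseteq> E" "graph_connected {..<n} F" "tedge ` {0<..<j} \<subseteq> F" and j: "0 < j" "j < n"
  shows "\<exists>F'\<subseteq>E. graph_connected {..<n} F' \<and> tedge ` {0<..<Suc j} \<subseteq> F' \<and>
    total_weight w F' \<le> total_weight w F"
proof (cases "tedge j \<in> F")
  case True
  have "{0<..<Suc j} = insert j {0<..<j}" using j by auto
  then have "tedge ` {0<..<Suc j} \<subseteq> F" using True F(3) by simp
  then show ?thesis using F by blast
next
  case False
  have FV: "e \<in> F \<Longrightarrow> e \<subseteq> {..<n}" for e using F(1) E_sub by auto
  define S where "S = ord ` {..<j}"
  have inS: "v \<in> S \<longleftrightarrow> pos v < j" if "v < n" for v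
  proof
    assume "v \<in> S"
    then show "pos v < j" using ord j by (auto simp: S_def)
  next
    assume "pos v < j"
    then show "v \<in> S" using pos[OF that] unfolding S_def by (intro image_eqI[of _ _ "pos v"]) auto
  qed
  have x: "ord (pp j) \<in> S" unfolding S_def using pp j by auto
  have y: "ord j \<notin> S" using inS[of "ord j"] ord j by auto
  have "ord (pp j) < n" "ord j < n" using ord pp j by (auto intro: order_less_trans)
  then have "(ord (pp j), ord j) \<in> (adj F)\<^sup>*"
    using F(2) graph_connected_iff[of F "{..<n}", OF FV] by auto
  from rtrancl_last_exit[OF this x y] obtain a b where ab: "a \<in> S" "b \<notin> S" "(a, b) \<in> adj F"
    "(b, ord j) \<in> (adj F \<inter> (-S) \<times> (-S))\<^sup>*" by blast
  have abF: "{a, b} \<in> F" using ab by (simp add: adj_def)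
  then have abE: "{a, b} \<in> E" using F by auto
  define F' where "F' = insert (tedge j) (F - {{a, b}})"
  have abn: "a < n" "b < n" using E_vertices[OF abE] by auto
  have "key j \<le> w {a, b}"
    using cut_min[OF j abE] inS abn ab by auto
  moreover have fin: "finite F" using F(1) finite_edges[OF G] finite_subset by blast
  moreover have "total_weight w F' = key j + (total_weight w F - w {a, b})"
    unfolding total_weight_def F'_def using fin False abF tree_edge[OF j]
    by (simp add: sum_diff1 tedge_def)
  ultimately have wt: "total_weight w F' \<le> total_weight w F" by simp
  have sub: "F' \<subseteq> E" unfolding F'_def using F tree_edge[OF j] by (auto simp: tedge_def)
  \<comment> \<open>The removed edge has an end outside \<open>S\<close>, so none of the earlier
    tree edges is lost.\<close>
  have tS: "tedge i \<subseteq> S" if "i \<in> {0<..<j}" for i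
    unfolding tedge_def S_def using that pp[of i] j by auto
  then have tF': "tedge ` {0<..<j} \<subseteq> F'"
  proof (intro subsetI)
    fix e assume "e \<in> tedge ` {0<..<j}"
    then have "e \<in> F" "e \<subseteq> S" using F(3) tS by blast+
    then show "e \<in> F'" using ab(2) by (auto simp: F'_def)
  qed
  have adj_mono: "A \<subseteq> B \<Longrightarrow> adj A \<subseteq> adj B" for A B :: "nat set set" by (auto simp: adj_def)
  obtain ia where ia: "a = ord ia" "ia < j" using ab(1) by (auto simp: S_def)
  have "(ord ia, ord 0) \<in> (adj F')\<^sup>*" "(ord (pp j), ord 0) \<in> (adj F')\<^sup>*"
    using tree_root_path[of ia j] tree_root_path[of "pp j" j] ia j pp[of j]
      rtrancl_mono[OF adj_mono[OF tF']] by auto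
  then have "(a, ord (pp j)) \<in> (adj F')\<^sup>*" using ia by (meson adj_rtrancl_sym rtrancl_trans)
  moreover have "(ord (pp j), ord j) \<in> adj F'" by (auto simp: adj_def F'_def tedge_def insert_commute)
  \<comment> \<open>The tail outside \<open>S\<close> avoids \<open>a\<close>, hence the removed
    edge.\<close>
  moreover have "adj F \<inter> (-S) \<times> (-S) \<subseteq> adj F'"
    using ab(1) by (auto simp: adj_def F'_def doubleton_eq_iff)
  then have "(b, ord j) \<in> (adj F')\<^sup>*" using ab(4) rtrancl_mono by blast
  ultimately have abr: "(a, b) \<in> (adj F')\<^sup>*"
    by (meson adj_rtrancl_sym rtrancl.rtrancl_into_rtrancl rtrancl_trans)
  have "(c, d) \<in> (adj F')\<^sup>*" if "{c, d} \<in> F" for c d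
  proof (cases "{c, d} = {a, b}")
    case True
    then show ?thesis using abr adj_rtrancl_sym[OF abr] by (auto simp: doubleton_eq_iff)
  next
    case False
    then show ?thesis using that by (auto simp: adj_def F'_def)
  qed
  then have "\<forall>u\<in>{..<n}. \<forall>v\<in>{..<n}. (u, v) \<in> (adj F')\<^sup>*"
    using F(2) graph_connected_iff[of F "{..<n}", OF FV] rtrancl_replace[of _ _ F F'] by blast
  moreover have "e \<in> F' \<Longrightarrow> e \<subseteq> {..<n}" for e using sub E_sub by auto
  moreover have "{..<n} \<noteq> {}" using j by auto
  ultimately have "graph_connected {..<n} F'" using graph_connected_iff[of F' "{..<n}"] by blast
  moreover have "{0<..<Suc j} = insert j {0<..<j}" using j by auto
  then have "tedge ` {0<..<Suc j} \<subseteq> F'" using tF' by (auto simp: F'_def)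
  ultimately show ?thesis using wt sub by blast
qed

text \<open>The end with the larger position is the child, so an edge determines its index. Thus
  \<open>tweight\<close>, a sum over positions, is the weight of the set of tree edges.\<close>

lemma inj_tedge: "inj_on tedge {0<..<n}"
proof (rule inj_onI)
  have lt: "i \<le> j" if "i \<in> {0<..<n}" "j \<in> {0<..<n}" "tedge i = tedge j" for i j
  proof -
    have "pp i < i" "pp j < j" "i < n" "j < n" using pp that by auto
    moreover have "ord i = ord j \<or> ord i = ord (pp j)"
      using that by (auto simp: tedge_def doubleton_eq_iff)
    ultimately show ?thesis
      using ord_inj[of i j] ord_inj[of i "pp j"] by (auto simp: less_imp_le)
  qed
  fix i j assume "i \<in> {0<..<n}" "j \<in> {0<..<n}" "tedge i = tedge j"
  then show "i = j" using lt[of i j] lt[of j i] by auto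
qed

text \<open>Iterating \<open>exchange\<close> turns \<open>F\<close> into a set that contains the
  whole tree. The claim is made for connected sets and not just for trees because acyclicity is not
  tracked through the exchanges.\<close>

lemma tweight_le_connected:
  assumes F: "F \<subseteq> E" "graph_connected {..<n} F"
  shows "tweight \<le> total_weight w F"
proof -
  have "n > 0" using F(2) by (auto simp: graph_connected_def)
  have "\<exists>F'\<subseteq>E. graph_connected {..<n} F' \<and> tedge ` {0<..<j} \<subseteq> F' \<and>
    total_weight w F' \<le> total_weight w F" if "j \<le> n" for j
    using that
  proof (induction j)
    case 0
    then show ?case using F by (intro exI[of _ F]) auto
  next
    case (Suc j)
    then obtain F' where F': "F'\<subseteq>E" "graph_connected {..<n} F'" "tedge ` {0<..<j} \<subseteq> F'"
      "total_weight w F' \<le> total_weight w F" by auto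
    show ?case
    proof (cases "j = 0")
      case True
      then show ?thesis using F' by (intro exI[of _ F']) auto
    next
      case False
      then obtain F'' where "F''\<subseteq>E" "graph_connected {..<n} F''" "tedge ` {0<..<Suc j} \<subseteq> F''"
        "total_weight w F'' \<le> total_weight w F'" using exchange[OF F'(1-3)] Suc.prems by auto
      then show ?thesis using F'(4) by (intro exI[of _ F'']) auto
    qed
  qed
  from this[OF order_refl] obtain F' where F': "F'\<subseteq>E" "tedge ` {0<..<n} \<subseteq> F'"
    "total_weight w F' \<le> total_weight w F" by auto
  have "tweight = sum w (tedge ` {0<..<n})"
    unfolding tweight_def sum.reindex[OF inj_tedge] using tree_edge
    by (intro sum.cong) (auto simp: tedge_def)
  also have "\<dots> \<le> sum w F'"
    using F'(1,2) finite_subset[OF F'(1) finite_edges[OF G]] E_pos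
    by (intro sum_mono2) (force intro: less_imp_le)+
  finally show ?thesis using F'(3) by (simp add: total_weight_def)
qed

text \<open>\<open>ctop L i\<close> is the first position of the component of \<open>i\<close> in the forest of the tree edges in \<open>L\<close>,
  when \<open>L\<close> is given by a weight threshold: such components are contiguous in the Prim order.\<close>

primrec ctop :: "(nat \<Rightarrow> bool) \<Rightarrow> nat \<Rightarrow> nat" where
  "ctop L 0 = 0"
| "ctop L (Suc i) = (if L (Suc i) then ctop L i else Suc i)"

lemma ctop_interval:
  assumes "a \<le> b" "\<And>i. a < i \<Longrightarrow> i \<le> b \<Longrightarrow> L i"
  shows "ctop L b = ctop L a"
  using assms by (induction b rule: dec_induct) auto

text \<open>For \<open>a \<le> b\<close> the edge crosses the cut below every \<open>i\<close> with
  \<open>a < i \<le> b\<close>, so \<open>cut_min\<close> bounds all these keys by its weight. Hence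
  \<open>L\<close> holds on the whole interval between the ends.\<close>

lemma ctop_edge:
  assumes e: "{ord a, ord b} \<in> E" "a < n" "b < n"
    and L: "\<And>i. 0 < i \<Longrightarrow> i < n \<Longrightarrow> key i \<le> w {ord a, ord b} \<Longrightarrow> L i"
  shows "ctop L a = ctop L b"
proof -
  have *: "ctop L b = ctop L a"
    if "a \<le> b" "{ord a, ord b} \<in> E" "a < n" "b < n"
      "\<And>i. 0 < i \<Longrightarrow> i < n \<Longrightarrow> key i \<le> w {ord a, ord b} \<Longrightarrow> L i" for a b
  proof (rule ctop_interval[OF that(1)])
    fix i assume "a < i" "i \<le> b"
    then show "L i" using that cut_min[of i "ord a" "ord b"] ord by auto
  qed
  show ?thesis
  proof (cases "a \<le> b")
    case True
    then show ?thesis using *[OF _ e L] by simp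
  next
    case False
    have "{ord b, ord a} = {ord a, ord b}" by auto
    then show ?thesis using *[of b a] e L False by simp
  qed
qed

lemma ctop_pp:
  assumes i: "0 < i" "i < n" "L i" and L: "\<And>i j. L i \<Longrightarrow> 0 < j \<Longrightarrow> j < n \<Longrightarrow> key j \<le> key i \<Longrightarrow> L j"
  shows "ctop L (pp i) = ctop L i"
proof (rule sym, rule ctop_edge)
  show "{ord i, ord (pp i)} \<in> E" "i < n" "pp i < n" using tree_edge pp i by (auto intro: order_less_trans)
next
  fix j assume "0 < j" "j < n" "key j \<le> w {ord i, ord (pp i)}"
  then show "L j" using L[OF i(3)] tree_edge[OF i(1,2)] by simp
qed

lemma reach_tree:
  assumes "tedge ` {0<..<n} \<subseteq> H" "0 < i" "i < n" "key i \<le> d"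
  shows "reach {..<n} H w (ord i) (ord (pp i)) d"
  using assms tree_edge[of i] ord[of i] ord[of "pp i"] pp[of i]
  by (intro reach_edge) (auto simp: tedge_def)

text \<open>The climb uses tree edges in \<open>L\<close> at positions up to \<open>i\<close>.
  Charging all of these, and not only those on the path, reduces the induction to a set
  inclusion.\<close>

lemma reach_top:
  assumes H: "tedge ` {0<..<n} \<subseteq> H"
    and L: "\<And>i j. L i \<Longrightarrow> 0 < j \<Longrightarrow> j < n \<Longrightarrow> key j \<le> key i \<Longrightarrow> L j" and "i < n"
  shows "reach {..<n} H w (ord i) (ord (ctop L i)) (\<Sum>j\<in>{j. 0 < j \<and> j \<le> i \<and> L j}. key j)"
  using \<open>i < n\<close>
proof (induction i rule: less_induct)
  case (less i)
  show ?case
  proof (cases "0 < i \<and> L i")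
    case False
    then have "ctop L i = i" by (cases i) auto
    then show ?thesis using less.prems ord[of i]
      by (auto intro!: reach_refl sum_nonneg less_imp_le[OF key_pos])
  next
    case True
    then have p: "pp i < i" using pp less by auto
    have "reach {..<n} H w (ord i) (ord (ctop L i)) (key i + (\<Sum>j\<in>{j. 0 < j \<and> j \<le> pp i \<and> L j}. key j))"
      using reach_trans[OF reach_tree[OF H, of i] less.IH[OF p]] True less.prems p ctop_pp[OF _ _ _ L]
      by auto
    moreover have "key i + (\<Sum>j\<in>{j. 0 < j \<and> j \<le> pp i \<and> L j}. key j) =
      (\<Sum>j\<in>insert i {j. 0 < j \<and> j \<le> pp i \<and> L j}. key j)" using p by (subst sum.insert) auto
    moreover have "\<dots> \<le> (\<Sum>j\<in>{j. 0 < j \<and> j \<le> i \<and> L j}. key j)"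
      using p True less.prems by (intro sum_mono2) (auto intro!: less_imp_le[OF key_pos])
    ultimately show ?thesis using reach_mono by metis
  qed
qed

text \<open>Both ends climb to the top of their common component in the forest of tree edges of
  weight at most \<open>w {u, v}\<close>, and each climb is charged at most \<open>n - 1\<close>
  edges. This serves the skipped scales and the case \<open>n \<le> k\<close>.\<close>

lemma reach_light:
  assumes H: "tedge ` {0<..<n} \<subseteq> H" and e: "{u, v} \<in> E" and c: "0 \<le> c"
    and light: "\<And>i. 0 < i \<Longrightarrow> i < n \<Longrightarrow> key i \<le> w {u, v} \<Longrightarrow> key i \<le> c"
  shows "reach {..<n} H w u v (2 * (real n - 1) * c)"
proof -
  define L where "L i \<longleftrightarrow> key i \<le> w {u, v}" for i
  have uv: "u < n" "v < n" using E_vertices[OF e] by auto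
  have *: "reach {..<n} H w u (ord (ctop L (pos u))) ((real n - 1) * c)" if "u < n" for u
  proof -
    have p: "pos u < n" "ord (pos u) = u" using pos that by auto
    have "(\<Sum>j\<in>{j. 0 < j \<and> j \<le> pos u \<and> L j}. key j) \<le> (\<Sum>j\<in>{j. 0 < j \<and> j \<le> pos u \<and> L j}. c)"
      using light p by (intro sum_mono) (auto simp: L_def)
    also have "\<dots> \<le> (\<Sum>j\<in>{0<..<n}. c)" using p c by (intro sum_mono2) auto
    also have "\<dots> = (real n - 1) * c" using that by (simp add: of_nat_diff)
    finally show ?thesis
      using reach_top[OF H, of L "pos u"] p by (auto simp: L_def intro: reach_mono)
  qed
  have "ctop L (pos u) = ctop L (pos v)"
    using ctop_edge[of "pos u" "pos v" L] e uv pos by (auto simp: L_def)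
  then have "reach {..<n} H w (ord (ctop L (pos u))) v ((real n - 1) * c)"
    using reach_sym[OF *[OF uv(2)]] by simp
  then have "reach {..<n} H w u v ((real n - 1) * c + (real n - 1) * c)"
    by (rule reach_trans[OF *[OF uv(1)]])
  then show ?thesis by (rule reach_mono) (simp add: algebra_simps)
qed

section \<open>Clusterings of the tree and the number of their clusters\<close>

definition light_cuts :: "real \<Rightarrow> (nat \<Rightarrow> bool) \<Rightarrow> nat set" where
  "light_cuts \<theta> ct = {i. 0 < i \<and> i < n \<and> ct i \<and> key i < \<theta>}"

definition light_weight :: "real \<Rightarrow> real" where
  "light_weight \<theta> = (\<Sum>i\<in>{i. 0 < i \<and> i < n \<and> key i < \<theta>}. key i)"

text \<open>\<open>h i\<close> bounds the height of the part of the tree hanging below \<open>i\<close> that is merged into the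
  cluster of \<open>i\<close>; a tree edge is cut when this height would exceed \<open>R\<close>.\<close>

definition clustering ::
    "real \<Rightarrow> real \<Rightarrow> (nat \<Rightarrow> real) \<Rightarrow> (nat \<Rightarrow> bool) \<Rightarrow> (nat \<Rightarrow> nat) \<Rightarrow> bool" where
  "clustering R \<theta> h ct cid \<longleftrightarrow>
     (\<forall>i. 0 < i \<and> i < n \<and> \<not> ct i \<longrightarrow> key i < \<theta> \<and> h i + key i \<le> h (pp i)) \<and>
     (\<forall>i<n. 0 \<le> h i \<and> h i \<le> R) \<and>
     R * card (light_cuts \<theta> ct) \<le> light_weight \<theta> \<and>
     (\<forall>i<n. cid i = (if i = 0 \<or> ct i then i else cid (pp i)))"

lemma light_weight_le: "light_weight \<theta> \<le> tweight"
  unfolding light_weight_def tweight_def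
  by (intro sum_mono2) (auto intro: less_imp_le[OF key_pos])

context
  fixes R \<theta> h ct cid
  assumes cl: "clustering R \<theta> h ct cid"
begin

lemma cid_less: "i < n \<Longrightarrow> cid i < n \<and> (cid i = 0 \<or> ct (cid i))"
proof (induction i rule: less_induct)
  case (less i)
  then show ?case using cl pp[of i] unfolding clustering_def by (cases "i = 0 \<or> ct i") auto
qed

lemma card_cid_le:
  "card (cid ` {..<n}) \<le> 1 + card {i. 0 < i \<and> i < n \<and> ct i}"
proof -
  have "cid ` {..<n} \<subseteq> insert 0 {i. 0 < i \<and> i < n \<and> ct i}"
    using cid_less by fastforce
  then have "card (cid ` {..<n}) \<le> card (insert 0 {i. 0 < i \<and> i < n \<and> ct i})"
    by (intro card_mono) auto
  then show ?thesis by (simp add: card_insert_if)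
qed

text \<open>The bound telescopes: along an uncut edge \<open>h\<close> grows by at least its key, so
  the climb from \<open>i\<close> to the root of its cluster weighs at most the gain in
  \<open>h\<close>, and \<open>h\<close> takes values between 0 and \<open>R\<close>.\<close>

lemma reach_cid:
  assumes H: "tedge ` {0<..<n} \<subseteq> H" and "i < n"
  shows "reach {..<n} H w (ord i) (ord (cid i)) R"
proof -
  have "reach {..<n} H w (ord i) (ord (cid i)) (h (cid i) - h i)"
    using \<open>i < n\<close>
  proof (induction i rule: less_induct)
    case (less i)
    show ?case
    proof (cases "i = 0 \<or> ct i")
      case True
      then have "cid i = i" using cl less unfolding clustering_def by auto
      then show ?thesis using ord[of i] less.prems by (auto intro: reach_refl)
    next
      case False
      then have p: "pp i < i" "cid i = cid (pp i)" "h i + key i \<le> h (pp i)"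
        using cl less pp[of i] unfolding clustering_def by auto
      have "reach {..<n} H w (ord i) (ord (cid i)) (key i + (h (cid i) - h (pp i)))"
        using reach_trans[OF reach_tree[OF H, of i] less.IH[OF p(1)]] p False less.prems by auto
      then show ?thesis using p by (auto intro: reach_mono)
    qed
  qed
  moreover have "h (cid i) \<le> R" "0 \<le> h i" using cl cid_less assms by (auto simp: clustering_def)
  ultimately show ?thesis by (auto intro: reach_mono)
qed

text \<open>The non-isolated vertices of the cluster graph. The balls consist of such clusters only,
  so the output of a scale is charged to them and not to all clusters.\<close>

definition crossing :: "nat set" where
  "crossing = {cid a | a b. a < n \<and> b < n \<and> {ord a, ord b} \<in> E \<and> w {ord a, ord b} < \<theta> \<and> cid a \<noteq> cid b}"

lemma finite_crossing: "finite crossing"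
  by (rule finite_subset[of _ "cid ` {..<n}"]) (auto simp: crossing_def)

text \<open>A cluster that meets no light ct is an entire component of the light forest, hence isolated.\<close>

lemma card_crossing_le: "card crossing \<le> 2 * card (light_cuts \<theta> ct)"
proof -
  define L where "L i \<longleftrightarrow> key i < \<theta>" for i
  have Lc: "L i \<Longrightarrow> key j \<le> key i \<Longrightarrow> L j" for i j by (auto simp: L_def)
  have toppp: "ctop L (pp i) = ctop L i" if "0 < i" "i < n" "\<not> ct i" for i
    using ctop_pp[of i L] cl that Lc by (auto simp: clustering_def L_def)
  have topcid: "ctop L (cid i) = ctop L i" if "i < n" for i
    using that
  proof (induction i rule: less_induct)
    case (less i)
    have "pp i < i" if "0 < i" using pp less that by auto
    then show ?case using less cl toppp[of i] unfolding clustering_def by (cases "i = 0 \<or> ct i") auto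
  qed
  \<comment> \<open>A cluster is named by its root. A root that is not a light cut is the first
    position of its component in the light forest, and the second set contains it as soon as that
    component has a light cut. This is the source of the factor 2.\<close>
  have "crossing \<subseteq> light_cuts \<theta> ct \<union> ctop L ` light_cuts \<theta> ct"
  proof
    fix c assume "c \<in> crossing"
    then obtain a b where ab: "a < n" "b < n" "c = cid a" "{ord a, ord b} \<in> E" "w {ord a, ord b} < \<theta>"
      "cid a \<noteq> cid b" by (auto simp: crossing_def)
    have teq: "ctop L a = ctop L b" using ctop_edge[of a b L] ab by (auto simp: L_def)
    show "c \<in> light_cuts \<theta> ct \<union> ctop L ` light_cuts \<theta> ct"
    proof (rule ccontr)
      assume not: "c \<notin> light_cuts \<theta> ct \<union> ctop L ` light_cuts \<theta> ct"
      have c: "c < n" "c = 0 \<or> ct c" using cid_less ab by auto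
      then have topc: "ctop L c = c" using not by (cases c) (auto simp: light_cuts_def L_def)
      \<comment> \<open>With no light cut in the component, the label \<open>c\<close> spreads over
        all of it. This contradicts the edge between \<open>a\<close> and \<open>b\<close>, whose
        ends have the same top but different labels.\<close>
      have "cid i = c" if "i < n" "ctop L i = c" for i
        using that
      proof (induction i rule: less_induct)
        case (less i)
        consider "i = 0" | "0 < i" "ct i" | "0 < i" "\<not> ct i" by blast
        then show ?case
        proof cases
          case 1
          then show ?thesis using less cl by (auto simp: clustering_def)
        next
          case 2
          have "\<not> L i"
          proof
            assume "L i"
            then have "i \<in> light_cuts \<theta> ct" using 2 less.prems by (simp add: light_cuts_def L_def)
            then show False using not less.prems(2) by blast
          qed
          then have "ctop L i = i" by (cases i) auto
          then show ?thesis using 2 less cl by (auto simp: clustering_def)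
        next
          case 3
          then have "pp i < i" using less.prems pp by blast
          moreover from this have "pp i < n" using less.prems by simp
          moreover have "ctop L (pp i) = c" using 3 less.prems toppp[of i] by simp
          ultimately have "cid (pp i) = c" using less.IH by blast
          moreover have "cid i = cid (pp i)"
            using cl 3 less.prems(1) unfolding clustering_def by simp
          ultimately show ?thesis by simp
        qed
      qed
      then have "ctop L b = c \<Longrightarrow> cid b = c" using ab(2) by blast
      moreover have "ctop L a = c" using topcid[OF ab(1)] topc ab(3) by simp
      ultimately show False using ab(3,6) teq by simp
    qed
  qed
  moreover have fin: "finite (light_cuts \<theta> ct)" by (simp add: light_cuts_def)
  ultimately have "card crossing \<le> card (light_cuts \<theta> ct \<union> ctop L ` light_cuts \<theta> ct)"
    by (intro card_mono) auto
  also have "\<dots> \<le> card (light_cuts \<theta> ct) + card (ctop L ` light_cuts \<theta> ct)" by (rule card_Un_le)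
  also have "\<dots> \<le> 2 * card (light_cuts \<theta> ct)" using card_image_le[OF fin, of "ctop L"] by simp
  finally show ?thesis .
qed

lemma crossing_weight: "R * card crossing \<le> 2 * light_weight \<theta>" if "0 \<le> R"
proof -
  have "R * card crossing \<le> R * (2 * card (light_cuts \<theta> ct))"
    using card_crossing_le that by (intro mult_left_mono) linarith+
  then show ?thesis using cl unfolding clustering_def by linarith
qed

text \<open>A light cut consumes weight \<open>R\<close> by the third clause of
  \<open>clustering\<close>; a cut at an edge of weight at least \<open>\<theta>\<close> is paid for
  by that edge itself.\<close>

lemma card_cut_weight:
  assumes "0 < R" "0 < \<theta>"
  shows "real (card {i. 0 < i \<and> i < n \<and> ct i}) \<le> tweight / R + tweight / \<theta>"
proof -
  define D where "D = {i. 0 < i \<and> i < n \<and> ct i \<and> \<theta> \<le> key i}"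
  have "{i. 0 < i \<and> i < n \<and> ct i} = light_cuts \<theta> ct \<union> D" by (auto simp: D_def light_cuts_def)
  then have "card {i. 0 < i \<and> i < n \<and> ct i} \<le> card (light_cuts \<theta> ct) + card D"
    by (simp add: card_Un_le)
  moreover have "R * card (light_cuts \<theta> ct) \<le> tweight"
    using cl light_weight_le[of \<theta>] unfolding clustering_def by linarith
  moreover have "card D * \<theta> \<le> tweight"
  proof -
    have "card D * \<theta> \<le> sum key D" using sum_bounded_below[of D \<theta> key] by (simp add: D_def)
    also have "\<dots> \<le> tweight" unfolding tweight_def
      by (intro sum_mono2) (auto simp: D_def intro: less_imp_le[OF key_pos])
    finally show ?thesis .
  qed
  ultimately show ?thesis using assms
    by (smt (verit, best) mult.commute of_nat_add of_nat_mono pos_le_divide_eq)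
qed

end

end

section \<open>Sums over sets of scales\<close>

text \<open>Removing a maximal term \<open>g m\<close> leaves terms of size at most
  \<open>c * g m\<close>, again pairwise separated. So the geometric series arises by induction on
  the cardinality, without sorting the index set.\<close>

lemma sum_separated_le:
  fixes g :: "'a \<Rightarrow> real"
  assumes "finite X" and c: "0 \<le> c" "c < 1" and "0 \<le> B" and "\<And>x. x \<in> X \<Longrightarrow> 0 \<le> g x \<and> g x \<le> B"
    and "\<And>x y. x \<in> X \<Longrightarrow> y \<in> X \<Longrightarrow> x \<noteq> y \<Longrightarrow> g x \<le> c * g y \<or> g y \<le> c * g x"
  shows "sum g X \<le> B / (1 - c)"
  using assms(1,4-6)
proof (induction "card X" arbitrary: X B)
  case 0
  then show ?case using c by simp
next
  case (Suc N)
  have ne: "X \<noteq> {}" using Suc.hyps(2) by auto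
  obtain m where m: "m \<in> X" "\<And>x. x \<in> X \<Longrightarrow> g x \<le> g m"
  proof -
    have "Max (g ` X) \<in> g ` X" using ne Suc.prems(1) by simp
    then obtain m where "m \<in> X" "g m = Max (g ` X)" by auto
    then show ?thesis using that Suc.prems(1) by simp
  qed
  have gm: "0 \<le> g m" "g m \<le> B" using Suc.prems m by auto
  have *: "g x \<le> c * g m" if x: "x \<in> X - {m}" for x
  proof -
    have "g x \<le> c * g m \<or> g m \<le> c * g x" using Suc.prems(4)[of x m] x m by auto
    \<comment> \<open>If the maximum is the smaller side of the alternative, then
      \<open>g m = 0\<close> because \<open>c < 1\<close>, and all terms vanish.\<close>
    moreover have "g m \<le> c * g x \<Longrightarrow> g x \<le> c * g m"
    proof -
      assume 1: "g m \<le> c * g x"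
      have "c * g x \<le> c * g m" using m x c by (intro mult_left_mono) auto
      then have "(1 - c) * g m \<le> 0" using 1 by (simp add: algebra_simps)
      then have "g m = 0" using gm c by (auto simp: mult_le_0_iff)
      then show ?thesis using m(2)[of x] x by simp
    qed
    ultimately show ?thesis by blast
  qed
  have "sum g (X - {m}) \<le> c * g m / (1 - c)"
  proof (rule Suc.hyps(1))
    show "N = card (X - {m})" using Suc.hyps(2) m Suc.prems(1) by simp
    show "0 \<le> g x \<and> g x \<le> c * g m" if "x \<in> X - {m}" for x using *[OF that] Suc.prems(3) that by auto
  qed (use Suc.prems c gm in auto)
  then have "sum g X \<le> g m + c * g m / (1 - c)"
    using Suc.prems(1) m(1) by (simp add: sum.remove)
  also have "\<dots> = g m / (1 - c)" using c by (simp add: field_simps)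
  also have "\<dots> \<le> B / (1 - c)" using gm c by (intro divide_right_mono) auto
  finally show ?case .
qed

text \<open>Scales are weights of edges of the graph, not powers of 2, so a ratio of at least 2
  between distinct scales is all that is available.\<close>

definition separated :: "real set \<Rightarrow> bool" where
  "separated X \<longleftrightarrow> finite X \<and> (\<forall>x\<in>X. 0 < x) \<and> (\<forall>x\<in>X. \<forall>y\<in>X. x < y \<longrightarrow> 2 * x \<le> y)"

lemma separated_subset: "separated X \<Longrightarrow> Y \<subseteq> X \<Longrightarrow> separated Y"
  unfolding separated_def by (meson finite_subset subsetD)

lemma separated_insert:
  "separated X \<Longrightarrow> 0 < y \<Longrightarrow> (\<And>x. x \<in> X \<Longrightarrow> 2 * x \<le> y) \<Longrightarrow> separated (insert y X)"
  unfolding separated_def by fastforce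

lemma sum_separated_inverse:
  assumes X: "separated X" and l: "0 < l" "\<And>x. x \<in> X \<Longrightarrow> l \<le> x"
  shows "(\<Sum>x\<in>X. 1 / x) \<le> 2 / l"
proof -
  have "(\<Sum>x\<in>X. 1 / x) \<le> (1 / l) / (1 - 1 / 2)"
  proof (rule sum_separated_le)
    show "finite X" using X by (simp add: separated_def)
    show "0 \<le> 1 / x \<and> 1 / x \<le> 1 / l" if "x \<in> X" for x
    proof -
      have "0 < l" "l \<le> x" using l that by auto
      then show ?thesis by (simp add: frac_le)
    qed
    show "1 / x \<le> 1 / 2 * (1 / y) \<or> 1 / y \<le> 1 / 2 * (1 / x)" if "x \<in> X" "y \<in> X" "x \<noteq> y" for x y
    proof -
      have "0 < x" "0 < y" "2 * x \<le> y \<or> 2 * y \<le> x" using X that unfolding separated_def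
        by (auto simp: neq_iff)
      then show ?thesis by (auto simp: field_simps)
    qed
  qed (use l in auto)
  then show ?thesis by simp
qed

lemma sum_separated_le_twice:
  assumes X: "separated X" and u: "0 \<le> u" "\<And>x. x \<in> X \<Longrightarrow> x \<le> u"
  shows "(\<Sum>x\<in>X. x) \<le> 2 * u"
proof -
  have "(\<Sum>x\<in>X. x) \<le> u / (1 - 1 / 2)"
  proof (rule sum_separated_le)
    show "x \<le> 1 / 2 * y \<or> y \<le> 1 / 2 * x" if "x \<in> X" "y \<in> X" "x \<noteq> y" for x y
    proof -
      have "2 * x \<le> y \<or> 2 * y \<le> x" using X that unfolding separated_def by (auto simp: neq_iff)
      then show ?thesis by auto
    qed
  qed (use X u in \<open>auto simp: separated_def less_imp_le\<close>)
  then show ?thesis by simp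
qed

text \<open>The terms decay by the ratio \<open>2 powr (- 1 / k)\<close>. By Bernoulli
  \<open>(1 - 1 / (2 k)) ^ k \<ge> 1 / 2\<close>, so this ratio is at most
  \<open>1 - 1 / (2 k)\<close>, and the series costs a factor \<open>2 k\<close>.\<close>

lemma sum_separated_root:
  fixes k :: nat
  assumes X: "separated X" and k: "1 \<le> k" and l: "0 < l" "\<And>x. x \<in> X \<Longrightarrow> l \<le> x" and W: "0 \<le> W"
  shows "(\<Sum>x\<in>X. (W / x) powr (1 / k)) \<le> 2 * k * (W / l) powr (1 / k)"
proof -
  define c where "c = (1 / 2 :: real) powr (1 / k)"
  have "1 / 2 \<le> (1 - 1 / (2 * k)) ^ k"
    using Bernoulli_inequality[of "- 1 / (2 * k)" k] k by (simp add: field_simps)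
  then have "c \<le> ((1 - 1 / (2 * k)) ^ k) powr (1 / k)"
    unfolding c_def by (intro powr_mono2) auto
  also have "\<dots> = 1 - 1 / (2 * k)"
    using k by (simp add: powr_realpow[symmetric] powr_powr)
  finally have c: "1 / (2 * k) \<le> 1 - c" by simp
  have pos: "0 < 1 / (2 * real k)" using k by simp
  then have c1: "c < 1" using c by linarith
  have "(\<Sum>x\<in>X. (W / x) powr (1 / k)) \<le> (W / l) powr (1 / k) / (1 - c)"
  proof (rule sum_separated_le)
    show "finite X" using X by (simp add: separated_def)
    show "0 \<le> (W / x) powr (1 / k) \<and> (W / x) powr (1 / k) \<le> (W / l) powr (1 / k)" if "x \<in> X" for x
      using l(1) l(2)[OF that] W by (auto intro!: powr_mono2 divide_left_mono)
    show "(W / x) powr (1 / k) \<le> c * (W / y) powr (1 / k) \<or> (W / y) powr (1 / k) \<le> c * (W / x) powr (1 / k)"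
      if "x \<in> X" "y \<in> X" "x \<noteq> y" for x y
    proof -
      have *: "(W / y) powr (1 / k) \<le> c * (W / x) powr (1 / k)" if "0 < x" "2 * x \<le> y" for x y
      proof -
        have "W / y \<le> W / (2 * x)" using that W by (intro divide_left_mono) auto
        then have "(W / y) powr (1 / k) \<le> (1 / 2 * (W / x)) powr (1 / k)"
          using W that by (intro powr_mono2) auto
        also have "\<dots> = c * (W / x) powr (1 / k)"
          unfolding c_def by (rule powr_mult)
        finally show ?thesis .
      qed
      have "0 < x" "0 < y" "2 * x \<le> y \<or> 2 * y \<le> x" using X that unfolding separated_def
        by (auto simp: neq_iff)
      then show ?thesis using *[of x y] *[of y x] by blast
    qed
  qed (use c1 in \<open>auto simp: c_def\<close>)
  also have "\<dots> \<le> (W / l) powr (1 / k) / (1 / (2 * k))"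
    by (rule divide_left_mono[OF c]) (use c1 pos in \<open>simp_all add: mult_pos_pos\<close>)
  finally show ?thesis by (simp add: field_simps)
qed

text \<open>The maximum is at least twice the next element, so by induction
  \<open>2 ^ card X * l\<close> is at most twice the maximum; then logarithms are taken.\<close>

lemma card_separated_le:
  assumes X: "separated X" and lu: "0 < l" "l \<le> u" "\<And>x. x \<in> X \<Longrightarrow> l \<le> x \<and> x \<le> u"
  shows "real (card X) \<le> 1 + log 2 (u / l)"
proof -
  have "X \<noteq> {} \<Longrightarrow> separated X \<Longrightarrow> \<forall>x\<in>X. l \<le> x \<Longrightarrow> 2 ^ card X * l \<le> 2 * Max X" for X
  proof (induction "card X" arbitrary: X)
    case 0
    then show ?case by (simp add: separated_def)
  next
    case (Suc N)
    have fin: "finite X" using Suc by (simp add: separated_def)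
    define Y where "Y = X - {Max X}"
    have MX: "Max X \<in> X" using fin Suc by simp
    then have N: "N = card Y" using Suc fin by (simp add: Y_def)
    show ?case
    proof (cases "Y = {}")
      case True
      then have "card X = 1" using Suc.hyps(2) N by simp
      then show ?thesis using Suc.prems(3) MX by simp
    next
      case False
      have sY: "separated Y" using Suc.prems(2) by (rule separated_subset) (simp add: Y_def)
      then have "2 ^ card Y * l \<le> 2 * Max Y"
        using Suc.hyps(1)[OF N False] Suc.prems(3) by (auto simp: Y_def)
      moreover have "finite Y" using fin by (simp add: Y_def)
      then have "Max Y \<in> Y" using False by (rule Max_in)
      then have "Max Y \<in> X" "Max Y \<noteq> Max X" by (auto simp: Y_def)
      moreover have "Max Y \<le> Max X" using \<open>Max Y \<in> X\<close> fin by simp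
      ultimately have "2 * Max Y \<le> Max X" using Suc.prems(2) MX unfolding separated_def by (meson le_neq_trans)
      then show ?thesis using \<open>2 ^ card Y * l \<le> 2 * Max Y\<close> Suc.hyps(2) N by (simp flip: Suc.hyps(2))
    qed
  qed
  from this[OF _ X] have "2 ^ card X * l \<le> 2 * u" if "X \<noteq> {}"
  proof -
    have "Max X \<in> X" using X that by (simp add: separated_def)
    then show ?thesis using \<open>X \<noteq> {} \<Longrightarrow> \<forall>x\<in>X. l \<le> x \<Longrightarrow> 2 ^ card X * l \<le> 2 * Max X\<close> that lu
      by (smt (verit, best))
  qed
  then have "2 ^ card X \<le> 2 * (u / l)" using lu by (cases "X = {}") (auto simp: field_simps)
  then have "log 2 (2 ^ card X) \<le> log 2 (2 * (u / l))" using lu by (intro log_mono) auto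
  also have "\<dots> = 1 + log 2 (u / l)" using lu log_mult[of 2 "u / l" 2] by (simp add: mult.commute)
  finally show ?thesis by (simp add: log_nat_power)
qed

section \<open>Program logic\<close>

text \<open>The postcondition also receives the number of steps, so that correctness, termination
  and running time are proved together.\<close>

definition wp :: "com \<Rightarrow> state \<Rightarrow> (nat \<Rightarrow> state \<Rightarrow> bool) \<Rightarrow> bool" where
  "wp c s Q \<longleftrightarrow> (\<exists>t s'. exec c s t s' \<and> Q t s')"

inductive_cases exec_SkipE: "exec Skip s t s'"
inductive_cases exec_NAssignE: "exec (NAssign x e) s t s'"
inductive_cases exec_RAssignE: "exec (RAssign x e) s t s'"
inductive_cases exec_NStoreE: "exec (NStore a i e) s t s'"
inductive_cases exec_RStoreE: "exec (RStore a i e) s t s'"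
inductive_cases exec_SeqE: "exec (Seq c d) s t s'"
inductive_cases exec_CondE: "exec (Cond b c d) s t s'"
inductive_cases exec_WhileE: "exec (While b c) s t s'"

lemmas exec_intros = exec.intros[simplified]

lemma wp_Skip: "wp Skip s Q \<longleftrightarrow> Q 1 s"
  by (auto simp: wp_def intro: exec_intros elim: exec_SkipE)

lemma wp_NAssign: "wp (NAssign x e) s Q \<longleftrightarrow> Q 1 (s\<lparr>nvar := (nvar s)(x := nval e s)\<rparr>)"
  by (auto simp: wp_def intro: exec_intros elim: exec_NAssignE)

lemma wp_RAssign: "wp (RAssign x e) s Q \<longleftrightarrow> Q 1 (s\<lparr>rvar := (rvar s)(x := rval e s)\<rparr>)"
  by (auto simp: wp_def intro: exec_intros elim: exec_RAssignE)

lemma wp_NStore: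
  "wp (NStore a i e) s Q \<longleftrightarrow> Q 1 (s\<lparr>narr := (narr s)(a := (narr s a)(nval i s := nval e s))\<rparr>)"
  by (auto simp: wp_def intro: exec_intros elim: exec_NStoreE)

lemma wp_RStore:
  "wp (RStore a i e) s Q \<longleftrightarrow> Q 1 (s\<lparr>rarr := (rarr s)(a := (rarr s a)(nval i s := rval e s))\<rparr>)"
  by (auto simp: wp_def intro: exec_intros elim: exec_RStoreE)

lemma wp_Seq: "wp (Seq c d) s Q \<longleftrightarrow> wp c s (\<lambda>t s'. wp d s' (\<lambda>t' s''. Q (t + t') s''))"
  by (auto simp: wp_def intro: exec_intros elim!: exec_SeqE)

lemma wp_Cond:
  "wp (Cond b c d) s Q \<longleftrightarrow> (if bval b s then wp c s (\<lambda>t. Q (1 + t)) else wp d s (\<lambda>t. Q (1 + t)))"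
  by (auto simp: wp_def intro: exec_intros elim!: exec_CondE)

lemmas wp_simps = wp_Skip wp_NAssign wp_RAssign wp_NStore wp_RStore wp_Seq wp_Cond

lemma wp_mono: "wp c s Q \<Longrightarrow> (\<And>t s'. Q t s' \<Longrightarrow> Q' t s') \<Longrightarrow> wp c s Q'"
  by (auto simp: wp_def)

text \<open>Register and array names are static, so the names that a program can write are computed
  from its syntax, for each of the four kinds. Everything else is unchanged by a run
  (\<open>exec_unch\<close>).\<close>

fun nws :: "com \<Rightarrow> string set" where
  "nws (NAssign x e) = {x}"
| "nws (Seq c d) = nws c \<union> nws d"
| "nws (Cond b c d) = nws c \<union> nws d"
| "nws (While b c) = nws c"
| "nws _ = {}"

fun rws :: "com \<Rightarrow> string set" where
  "rws (RAssign x e) = {x}"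
| "rws (Seq c d) = rws c \<union> rws d"
| "rws (Cond b c d) = rws c \<union> rws d"
| "rws (While b c) = rws c"
| "rws _ = {}"

fun naws :: "com \<Rightarrow> string set" where
  "naws (NStore a i e) = {a}"
| "naws (Seq c d) = naws c \<union> naws d"
| "naws (Cond b c d) = naws c \<union> naws d"
| "naws (While b c) = naws c"
| "naws _ = {}"

fun raws :: "com \<Rightarrow> string set" where
  "raws (RStore a i e) = {a}"
| "raws (Seq c d) = raws c \<union> raws d"
| "raws (Cond b c d) = raws c \<union> raws d"
| "raws (While b c) = raws c"
| "raws _ = {}"

definition unch :: "com \<Rightarrow> state \<Rightarrow> state \<Rightarrow> bool" where
  "unch c s s' \<longleftrightarrow> (\<forall>x. x \<notin> nws c \<longrightarrow> nvar s' x = nvar s x) \<and> (\<forall>x. x \<notin> rws c \<longrightarrow> rvar s' x = rvar s x) \<and>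
     (\<forall>x. x \<notin> naws c \<longrightarrow> narr s' x = narr s x) \<and> (\<forall>x. x \<notin> raws c \<longrightarrow> rarr s' x = rarr s x)"

lemma exec_unch: "exec c s t s' \<Longrightarrow> unch c s s'"
  by (induction rule: exec.induct) (auto simp: unch_def)

text \<open>Lets a specification mention only what a program changes; the rest is recovered from
  \<open>unch\<close> at the place of use.\<close>

lemma wp_frame: "wp c s Q \<Longrightarrow> (\<And>t s'. unch c s s' \<Longrightarrow> Q t s' \<Longrightarrow> Q' t s') \<Longrightarrow> wp c s Q'"
  using exec_unch by (fastforce simp: wp_def)

text \<open>Termination comes from the bound on the time elapsed.\<close>

lemma wp_While:
  assumes "I 0 s"
    and bound: "\<And>t s. I t s \<Longrightarrow> t \<le> B"
    and step: "\<And>t s'. unch (While b c) s s' \<Longrightarrow> I t s' \<Longrightarrow> bval b s' \<Longrightarrow> wp c s' (\<lambda>t' s''. I (Suc (t + t')) s'')"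
    and exit: "\<And>t s'. unch (While b c) s s' \<Longrightarrow> I t s' \<Longrightarrow> \<not> bval b s' \<Longrightarrow> Q (Suc t) s'"
  shows "wp (While b c) s Q"
proof -
  have "I t s' \<Longrightarrow> unch (While b c) s s' \<Longrightarrow> wp (While b c) s' (\<lambda>t' s''. Q (t + t') s'')" for t s'
  proof (induction "Suc B - t" arbitrary: t s' rule: less_induct)
    case less
    show ?case
    proof (cases "bval b s'")
      case True
      from step[OF less.prems(2,1) True] obtain t1 s1 where
        1: "exec c s' t1 s1" "I (Suc (t + t1)) s1" by (auto simp: wp_def)
      have "unch (While b c) s s1"
        using exec_unch[OF 1(1)] less.prems(2) by (simp add: unch_def)
      moreover have "Suc B - Suc (t + t1) < Suc B - t" using bound[OF less.prems(1)] by simp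
      ultimately have "wp (While b c) s1 (\<lambda>t' s''. Q (Suc (t + t1) + t') s'')"
        using less.hyps 1 by blast
      then obtain t2 s2 where "exec (While b c) s1 t2 s2" "Q (Suc (t + t1) + t2) s2" by (auto simp: wp_def)
      then show ?thesis
        unfolding wp_def using exec.WhileTrue[OF True 1(1)] by (intro exI[of _ "1 + t1 + t2"] exI[of _ s2]) (auto simp: add.assoc)
    next
      case False
      then show ?thesis
        unfolding wp_def using exit[OF less.prems(2,1) False] exec.WhileFalse[OF False]
        by (intro exI[of _ 1] exI[of _ s']) auto
    qed
  qed
  from this[OF assms(1)] show ?thesis by (simp add: unch_def)
qed

definition For :: "string \<Rightarrow> string \<Rightarrow> com \<Rightarrow> com" where
  "For i b c = While (NLess (NVar i) (NVar b)) (Seq c (NAssign i (NPlus (NVar i) (NConst 1))))"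

lemma For_writes [simp]:
  "nws (For i b c) = insert i (nws c)" "rws (For i b c) = rws c"
  "naws (For i b c) = naws c" "raws (For i b c) = raws c"
  by (auto simp: For_def)

text \<open>The 2 added per round pays for the test and the increment, the final \<open>Suc\<close>
  for the failing test. As the body writes neither counter nor bound, the value \<open>N\<close> can
  be fixed at the start.\<close>

lemma wp_For:
  assumes vars: "i \<notin> nws c" "b \<notin> nws c" "i \<noteq> b" and start: "nvar s i = a" "nvar s b = N" "a \<le> N"
    and init: "I a 0 s"
    and step: "\<And>j t s'. a \<le> j \<Longrightarrow> j < N \<Longrightarrow> unch (For i b c) s s' \<Longrightarrow> nvar s' i = j \<Longrightarrow> I j t s' \<Longrightarrow>
      wp c s' (\<lambda>t' s''. I (Suc j) (t + t' + 2) (s''\<lparr>nvar := (nvar s'')(i := Suc j)\<rparr>))"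
    and exit: "\<And>t s'. unch (For i b c) s s' \<Longrightarrow> nvar s' i = N \<Longrightarrow> I N t s' \<Longrightarrow> Q (Suc t) s'"
  shows "wp (For i b c) s Q"
proof -
  have "a \<le> j \<Longrightarrow> j \<le> N \<Longrightarrow> nvar s' i = j \<Longrightarrow> I j t s' \<Longrightarrow> unch (For i b c) s s' \<Longrightarrow>
    wp (For i b c) s' (\<lambda>t' s''. Q (t + t') s'')" for j t s'
  proof (induction "N - j" arbitrary: j t s' rule: less_induct)
    case less
    have bN: "nvar s' b = N" using less.prems(5) start vars by (simp add: unch_def)
    show ?case
    proof (cases "j < N")
      case True
      from step[OF less.prems(1) True less.prems(5,3,4)] obtain t1 s1 where
        1: "exec c s' t1 s1" "I (Suc j) (t + t1 + 2) (s1\<lparr>nvar := (nvar s1)(i := Suc j)\<rparr>)" by (auto simp: wp_def)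
      let ?s2 = "s1\<lparr>nvar := (nvar s1)(i := Suc j)\<rparr>"
      have u: "unch c s' s1" using exec_unch[OF 1(1)] .
      then have i1: "nvar s1 i = j" using vars less.prems(3) by (simp add: unch_def)
      have 2: "exec (Seq c (NAssign i (NPlus (NVar i) (NConst 1)))) s' (t1 + 1) ?s2"
        using exec.Seq[OF 1(1) exec.NAssign[of i "NPlus (NVar i) (NConst 1)"]] i1 by simp
      have "unch (For i b c) s ?s2" using u less.prems(5) by (simp add: unch_def)
      moreover have "N - Suc j < N - j" using True by simp
      ultimately have "wp (For i b c) ?s2 (\<lambda>t' s''. Q ((t + t1 + 2) + t') s'')"
        using True less.prems(1) 1(2) by (intro less.hyps) auto
      then obtain t3 s3 where "exec (For i b c) ?s2 t3 s3" "Q (t + t1 + 2 + t3) s3" by (auto simp: wp_def)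
      moreover from this(1) have "exec (For i b c) s' (1 + (t1 + 1) + t3) s3"
        unfolding For_def using 2 True bN less.prems(3) by (intro exec.WhileTrue) auto
      ultimately show ?thesis
        unfolding wp_def by (intro exI[of _ "1 + (t1 + 1) + t3"] exI[of _ s3]) (auto simp: add_ac)
    next
      case False
      then have "j = N" using less.prems by simp
      then have "Q (t + 1) s'" "exec (For i b c) s' 1 s'"
        using exit[OF less.prems(5)] less.prems bN unfolding For_def by (auto intro!: exec_intros)
      then show ?thesis unfolding wp_def by blast
    qed
  qed
  from this[OF order_refl start(3,1) init] show ?thesis by (simp add: unch_def)
qed

notation Seq (infixr ";;" 60)

section \<open>The program\<close>

abbreviation (input) NZ :: rexp where "NZ \<equiv> RNat (NConst 0)"
abbreviation (input) BOr :: "bexp \<Rightarrow> bexp \<Rightarrow> bexp" where "BOr a b \<equiv> BNot (BAnd (BNot a) (BNot b))"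
abbreviation (input) incr :: "string \<Rightarrow> com" where "incr x \<equiv> NAssign x (NPlus (NVar x) (NConst 1))"

text \<open>Row offsets \<open>u * n\<close> are tabulated by repeated addition, because indices
  cannot be multiplied.\<close>

definition fill_rows :: com where
  "fill_rows = For ''i'' ''n'' (
     NStore ''row'' (NVar ''i'') (NVar ''c'') ;;
     NAssign ''c'' (NPlus (NVar ''c'') (NVar ''n'')))"

definition fill_entries :: com where
  "fill_entries = For ''i'' ''m'' (
     RStore ''mat'' (NPlus (NArr ''row'' (NArr ''src'' (NVar ''i''))) (NArr ''dst'' (NVar ''i''))) (RArr ''wt'' (NVar ''i'')) ;;
     RStore ''mat'' (NPlus (NArr ''row'' (NArr ''dst'' (NVar ''i''))) (NArr ''src'' (NVar ''i''))) (RArr ''wt'' (NVar ''i'')))"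

text \<open>One pass over the vertices both relaxes along the row of the vertex added last and
  selects the nearest vertex outside the tree. In the real arrays 0 stands for a missing edge, which
  is safe since weights are positive.\<close>

definition prim_scan :: com where
  "prim_scan = For ''j'' ''n'' (
     Cond (NLess (NArr ''done'' (NVar ''j'')) (NConst 1))
       (Cond (BAnd (RLess NZ (RArr ''mat'' (NPlus (NVar ''c'') (NVar ''j''))))
               (BOr (BNot (RLess NZ (RArr ''best'' (NVar ''j''))))
                 (RLess (RArr ''mat'' (NPlus (NVar ''c'') (NVar ''j''))) (RArr ''best'' (NVar ''j'')))))
          (RStore ''best'' (NVar ''j'') (RArr ''mat'' (NPlus (NVar ''c'') (NVar ''j''))) ;;
           NStore ''bp'' (NVar ''j'') (NVar ''cur'')) Skip ;;
        Cond (BAnd (RLess NZ (RArr ''best'' (NVar ''j'')))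
               (BOr (BNot (RLess NZ (RVar ''bst''))) (RLess (RArr ''best'' (NVar ''j'')) (RVar ''bst''))))
          (RAssign ''bst'' (RArr ''best'' (NVar ''j'')) ;; NAssign ''nx'' (NVar ''j'')) Skip)
       Skip)"

definition prim_add :: com where
  "prim_add =
     NAssign ''cur'' (NVar ''nx'') ;;
     NStore ''done'' (NVar ''cur'') (NConst 1) ;;
     NStore ''ord'' (NVar ''i'') (NVar ''cur'') ;;
     NStore ''pp'' (NVar ''i'') (NArr ''pos'' (NArr ''bp'' (NVar ''cur''))) ;;
     NStore ''pos'' (NVar ''cur'') (NVar ''i'') ;;
     RStore ''key'' (NVar ''i'') (RVar ''bst'') ;;
     NStore ''outsrc'' (NVar ''outm'') (NVar ''cur'') ;;
     NStore ''outdst'' (NVar ''outm'') (NArr ''bp'' (NVar ''cur'')) ;;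
     incr ''outm''"

definition prim_loop :: com where
  "prim_loop = For ''i'' ''n'' (
     NAssign ''c'' (NArr ''row'' (NVar ''cur'')) ;; NAssign ''j'' (NConst 0) ;; RAssign ''bst'' NZ ;;
     prim_scan ;; prim_add)"

definition prim :: com where
  "prim = fill_rows ;; NAssign ''i'' (NConst 0) ;; fill_entries ;;
     NStore ''done'' (NConst 0) (NConst 1) ;; NAssign ''i'' (NConst 1) ;; prim_loop"

lemma prim_writes [simp]:
  "nws prim = {''i'', ''c'', ''j'', ''nx'', ''cur'', ''outm''}"
  "rws prim = {''bst''}"
  "naws prim = {''row'', ''bp'', ''done'', ''ord'', ''pos'', ''pp'', ''outsrc'', ''outdst''}"
  "raws prim = {''mat'', ''best'', ''key''}"
  by (auto simp: prim_def fill_rows_def fill_entries_def prim_loop_def prim_scan_def prim_add_def)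

section \<open>Prim's algorithm\<close>

locale spanner_input =
  fixes n :: nat and E :: "nat set set" and w :: "nat set \<Rightarrow> real"
    and es :: "(nat \<times> nat \<times> real) list" and k :: nat and q \<rho> :: real
  assumes G: "weighted_graph {..<n} E w" and conn: "graph_connected {..<n} E"
    and es: "is_edge_list E w es" and k: "1 \<le> k" and q: "1 / (2 * real k - 1) < q" "q < real k"
    and \<rho>: "1 < \<rho>" "\<rho> \<le> 2"
begin

section \<open>The input and its adjacency matrix\<close>

abbreviation m :: nat where "m \<equiv> length es"
definition S :: "nat \<Rightarrow> nat" where "S i = fst (es ! i)"
definition D :: "nat \<Rightarrow> nat" where "D i = fst (snd (es ! i))"
abbreviation ew :: "nat \<Rightarrow> real" where "ew i \<equiv> w {S i, D i}"

lemma es_nth: "i < m \<Longrightarrow> {S i, D i} \<in> E \<and> snd (snd (es ! i)) = ew i"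
proof -
  assume i: "i < m"
  obtain u v x where uvx: "es ! i = (u, v, x)" by (cases "es ! i") auto
  then have "(u, v, x) \<in> set es" using i by (metis nth_mem)
  then have "x = w {u, v}" "{u, v} \<in> (\<lambda>(u, v, x). {u, v}) ` set es"
    using es unfolding is_edge_list_def by (blast, auto intro: image_eqI[of _ _ "(u, v, x)"])
  moreover have "(\<lambda>(u, v, x). {u, v}) ` set es = E" using es unfolding is_edge_list_def by simp
  ultimately show ?thesis using uvx unfolding S_def D_def by simp
qed

lemma E_nth:
  assumes "e \<in> E"
  obtains i where "i < m" "e = {S i, D i}"
proof -
  have "e \<in> (\<lambda>(u, v, x). {u, v}) ` set es" using es assms by (simp add: is_edge_list_def)
  then obtain a where "a \<in> set es" "e = (\<lambda>(u, v, x). {u, v}) a" by auto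
  then obtain i where "i < m" "e = (\<lambda>(u, v, x). {u, v}) (es ! i)" by (auto simp: in_set_conv_nth)
  then show ?thesis using that by (auto simp: S_def D_def split: prod.splits)
qed

lemma E_lt: "{u, v} \<in> E \<Longrightarrow> u < n \<and> v < n \<and> u \<noteq> v"
  using G by (fastforce simp: weighted_graph_def doubleton_eq_iff)

lemma E_wpos: "e \<in> E \<Longrightarrow> 0 < w e"
  using G by (auto simp: weighted_graph_def)

lemma SD: "i < m \<Longrightarrow> S i < n \<and> D i < n \<and> S i \<noteq> D i"
  using es_nth E_lt by blast

lemma n_pos: "0 < n"
  using conn by (auto simp: graph_connected_def)

lemma m_le: "m \<le> n * n"
proof -
  have "inj_on (\<lambda>i. (S i, D i)) {..<m}"
  proof (rule inj_onI)
    fix i j assume ij: "i \<in> {..<m}" "j \<in> {..<m}" "(S i, D i) = (S j, D j)"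
    then have "map (\<lambda>(u, v, x). {u, v}) es ! i = map (\<lambda>(u, v, x). {u, v}) es ! j"
      by (auto simp: S_def D_def split: prod.splits)
    then show "i = j" using es ij unfolding is_edge_list_def
      by (metis length_map lessThan_iff nth_eq_iff_index_eq)
  qed
  moreover have "(\<lambda>i. (S i, D i)) ` {..<m} \<subseteq> {..<n} \<times> {..<n}" using SD by auto
  ultimately have "card {..<m} \<le> card ({..<n} \<times> {..<n})" by (intro card_inj_on_le) auto
  then show ?thesis by simp
qed

text \<open>No part of the program writes these names, so the predicate is carried through every
  phase by \<open>unch\<close>.\<close>

definition inp :: "state \<Rightarrow> bool" where
  "inp s \<longleftrightarrow> nvar s ''n'' = n \<and> nvar s ''m'' = m \<and> nvar s ''k'' = k \<and> rvar s ''q'' = q \<and> rvar s ''rho'' = \<rho> \<and>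
     (\<forall>i<m. narr s ''src'' i = S i \<and> narr s ''dst'' i = D i \<and> rarr s ''wt'' i = ew i)"

lemma inp_input: "inp (input_state n es k q \<rho>)"
  using es_nth by (simp add: inp_def input_state_def S_def D_def)

definition mx :: "nat \<Rightarrow> nat \<Rightarrow> real" where
  "mx u v = (if {u, v} \<in> E then w {u, v} else 0)"

lemma idx_eq: "u < n \<Longrightarrow> v < n \<Longrightarrow> u' < n \<Longrightarrow> v' < n \<Longrightarrow> u * n + v = u' * n + v' \<longleftrightarrow> u = u' \<and> v = (v' :: nat)"
  by (metis add.commute div_mult_self3 div_less add_cancel_right_left add_left_imp_eq gr_implies_not0)

lemma wp_fill_rows:
  assumes "inp s" "nvar s ''i'' = 0" "nvar s ''c'' = 0"
  shows "wp fill_rows s (\<lambda>t s'. t \<le> 4 * n + 1 \<and> (\<forall>u<n. narr s' ''row'' u = u * n))"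
  unfolding fill_rows_def
  by (rule wp_For[where a = 0 and N = n and
        I = "\<lambda>j t s. nvar s ''c'' = j * n \<and> (\<forall>u<j. narr s ''row'' u = u * n) \<and> t \<le> 4 * j"])
    (use assms in \<open>auto simp: inp_def wp_simps unch_def less_Suc_eq\<close>)

definition filled :: "(nat \<Rightarrow> real) \<Rightarrow> nat \<Rightarrow> bool" where
  "filled f j \<longleftrightarrow> (\<forall>u<n. \<forall>v<n. f (u * n + v) = (if \<exists>e<j. {S e, D e} = {u, v} then w {u, v} else 0))"

lemma filled_Suc:
  assumes f: "filled f j" and j: "j < m"
  shows "filled (f(S j * n + D j := ew j, D j * n + S j := ew j)) (Suc j)"
  unfolding filled_def
proof (intro allI impI)
  fix u v assume uv: "u < n" "v < n"
  have 1: "u * n + v = D j * n + S j \<longleftrightarrow> u = D j \<and> v = S j" "u * n + v = S j * n + D j \<longleftrightarrow> u = S j \<and> v = D j"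
    using idx_eq uv SD[OF j] by blast+
  have 2: "f (u * n + v) = (if \<exists>e<j. {S e, D e} = {u, v} then w {u, v} else 0)"
    using f uv by (simp add: filled_def)
  have 3: "{S j, D j} = {u, v} \<longleftrightarrow> u = D j \<and> v = S j \<or> u = S j \<and> v = D j" by (auto simp: doubleton_eq_iff)
  show "(f(S j * n + D j := ew j, D j * n + S j := ew j)) (u * n + v) =
      (if \<exists>e<Suc j. {S e, D e} = {u, v} then w {u, v} else 0)"
  proof (cases "{S j, D j} = {u, v}")
    case True
    then have "(f(S j * n + D j := ew j, D j * n + S j := ew j)) (u * n + v) = ew j"
      unfolding fun_upd_apply 1 3 by argo
    then show ?thesis using True by (metis lessI)
  next
    case False
    then have "(\<exists>e<Suc j. {S e, D e} = {u, v}) \<longleftrightarrow> (\<exists>e<j. {S e, D e} = {u, v})" by (auto simp: less_Suc_eq)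
    moreover have "\<not> (u = D j \<and> v = S j)" "\<not> (u = S j \<and> v = D j)" using 3 False by blast+
    then have "(f(S j * n + D j := ew j, D j * n + S j := ew j)) (u * n + v) = f (u * n + v)"
      unfolding fun_upd_apply 1 by argo
    ultimately show ?thesis using 2 by presburger
  qed
qed

lemma wp_fill_entries:
  assumes "inp s" "nvar s ''i'' = 0" "\<forall>u<n. narr s ''row'' u = u * n" "rarr s ''mat'' = (\<lambda>_. 0)"
  shows "wp fill_entries s (\<lambda>t s'. t \<le> 4 * m + 1 \<and> (\<forall>u<n. \<forall>v<n. rarr s' ''mat'' (u * n + v) = mx u v))"
  unfolding fill_entries_def
proof (rule wp_For[where a = 0 and N = m and I = "\<lambda>j t s. t \<le> 4 * j \<and> filled (rarr s ''mat'') j"], goal_cases)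
  case (8 j t s')
  then have "narr s' ''src'' j = S j" "narr s' ''dst'' j = D j" "rarr s' ''wt'' j = ew j"
    "narr s' ''row'' (S j) = S j * n" "narr s' ''row'' (D j) = D j * n"
    using assms SD[of j] by (auto simp: unch_def inp_def)
  then show ?case using 8 filled_Suc by (simp add: wp_simps)
next
  case (9 t s')
  have "(\<exists>e<m. {S e, D e} = {u, v}) \<longleftrightarrow> {u, v} \<in> E" for u v
    using es_nth E_nth by metis
  then show ?case using 9 by (auto simp: mx_def filled_def)
qed (use assms in \<open>auto simp: inp_def filled_def\<close>)

text \<open>A value \<open>b\<close> that is not positive encodes that no vertex of \<open>A\<close>
  is adjacent to \<open>v\<close>.\<close>

definition best_edge :: "nat set \<Rightarrow> nat \<Rightarrow> real \<Rightarrow> nat \<Rightarrow> bool" where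
  "best_edge A v b p \<longleftrightarrow> (0 < b \<longrightarrow> p \<in> A \<and> {p, v} \<in> E \<and> w {p, v} = b) \<and>
     (\<forall>u\<in>A. {u, v} \<in> E \<longrightarrow> 0 < b \<and> b \<le> w {u, v})"

text \<open>Two counters are needed because a round first relaxes the entry of a vertex and then
  offers it to the selection: entries below \<open>j1\<close> know the new vertex \<open>c\<close>,
  those below \<open>j2\<close> have been compared with \<open>bst\<close>.\<close>

definition scan :: "nat set \<Rightarrow> nat \<Rightarrow> nat \<Rightarrow> nat \<Rightarrow> (nat \<Rightarrow> real) \<Rightarrow> (nat \<Rightarrow> nat) \<Rightarrow> real \<Rightarrow> nat \<Rightarrow> bool" where
  "scan A c j1 j2 best bp bst nx \<longleftrightarrow>
     (\<forall>v<n. v \<notin> insert c A \<longrightarrow> best_edge (if v < j1 then insert c A else A) v (best v) (bp v)) \<and>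
     (0 < bst \<longrightarrow> nx < n \<and> nx \<notin> insert c A \<and> nx < j2 \<and> best nx = bst) \<and>
     (\<forall>v<j2. v \<notin> insert c A \<longrightarrow> 0 < best v \<longrightarrow> 0 < bst \<and> bst \<le> best v)"

lemma scan_done:
  assumes "scan A c j j best bp bst nx" "j \<in> insert c A"
  shows "scan A c (Suc j) (Suc j) best bp bst nx"
proof -
  have "v \<noteq> c \<Longrightarrow> v \<notin> A \<Longrightarrow> v < Suc j \<longleftrightarrow> v < j" for v using assms(2) by (auto simp: less_Suc_eq)
  then show ?thesis using assms(1) unfolding scan_def by auto
qed

lemma scan_keep:
  assumes s: "scan A c j j best bp bst nx" and x: "\<not> (0 < mx c j \<and> (\<not> 0 < best j \<or> mx c j < best j))"
  shows "scan A c (Suc j) j best bp bst nx"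
proof -
  have "best_edge A j (best j) (bp j) \<Longrightarrow> best_edge (insert c A) j (best j) (bp j)"
    using x E_wpos by (auto simp: best_edge_def mx_def split: if_splits)
  then show ?thesis using s by (auto simp: scan_def less_Suc_eq)
qed

lemma scan_improve:
  assumes s: "scan A c j j best bp bst nx" and x: "0 < mx c j" "\<not> 0 < best j \<or> mx c j < best j"
  shows "scan A c (Suc j) j (best(j := mx c j)) (bp(j := c)) bst nx"
proof -
  have "best_edge A j (best j) (bp j) \<Longrightarrow> best_edge (insert c A) j (mx c j) c"
    using x by (auto simp: best_edge_def mx_def split: if_splits)
  then show ?thesis using s by (auto simp: scan_def less_Suc_eq)
qed

lemma scan_select:
  assumes "scan A c (Suc j) j best bp bst nx" "j \<notin> insert c A" "j < n" "0 < best j" "\<not> 0 < bst \<or> best j < bst"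
  shows "scan A c (Suc j) (Suc j) best bp (best j) j"
  using assms unfolding scan_def by (auto simp: less_Suc_eq)

lemma scan_no_select:
  assumes "scan A c (Suc j) j best bp bst nx" "\<not> (0 < best j \<and> (\<not> 0 < bst \<or> best j < bst))"
  shows "scan A c (Suc j) (Suc j) best bp bst nx"
  using assms unfolding scan_def by (auto simp: less_Suc_eq)

lemma wp_prim_scan:
  assumes "inp s" "nvar s ''j'' = 0" "\<forall>v<n. rarr s ''mat'' (nvar s ''c'' + v) = mx (nvar s ''cur'') v"
    and dn: "\<forall>v<n. narr s ''done'' v < 1 \<longleftrightarrow> v \<notin> insert (nvar s ''cur'') A"
    and "scan A (nvar s ''cur'') 0 0 (rarr s ''best'') (narr s ''bp'') (rvar s ''bst'') (nvar s ''nx'')"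
  shows "wp prim_scan s (\<lambda>t s'. t \<le> 9 * n + 1 \<and>
    scan A (nvar s ''cur'') n n (rarr s' ''best'') (narr s' ''bp'') (rvar s' ''bst'') (nvar s' ''nx''))"
  unfolding prim_scan_def
proof (rule wp_For[where a = 0 and N = n and I = "\<lambda>j t s'. t \<le> 9 * j \<and>
    scan A (nvar s ''cur'') j j (rarr s' ''best'') (narr s' ''bp'') (rvar s' ''bst'') (nvar s' ''nx'')"], goal_cases)
  case (8 j t s')
  have mat: "rarr s' ''mat'' (nvar s' ''c'' + j) = mx (nvar s ''cur'') j" and cur: "nvar s' ''cur'' = nvar s ''cur''"
    and dnj: "narr s' ''done'' j = 0 \<longleftrightarrow> j \<notin> insert (nvar s ''cur'') A"
    using assms(3) dn 8(2,3) by (auto simp: unch_def)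
  have j: "nvar s' ''j'' = j" by (rule 8)
  have I: "scan A (nvar s ''cur'') j j (rarr s' ''best'') (narr s' ''bp'') (rvar s' ''bst'') (nvar s' ''nx'')"
    and t: "t \<le> 9 * j" using 8 by auto
  show ?case
  proof (cases "j \<in> insert (nvar s ''cur'') A")
    case True
    then have "narr s' ''done'' j \<noteq> 0" using dnj by simp
    then show ?thesis using scan_done[OF I True] t by (simp add: wp_simps j)
  next
    case False
    then have d0: "narr s' ''done'' j = 0" using dnj by simp
    let ?x = "mx (nvar s ''cur'') j"
    define b' where "b' = (if 0 < ?x \<and> (\<not> 0 < rarr s' ''best'' j \<or> ?x < rarr s' ''best'' j)
      then (rarr s' ''best'')(j := ?x) else rarr s' ''best'')"
    define p' where "p' = (if 0 < ?x \<and> (\<not> 0 < rarr s' ''best'' j \<or> ?x < rarr s' ''best'' j)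
      then (narr s' ''bp'')(j := nvar s ''cur'') else narr s' ''bp'')"
    have I2: "scan A (nvar s ''cur'') (Suc j) j b' p' (rvar s' ''bst'') (nvar s' ''nx'')"
      using scan_keep[OF I] scan_improve[OF I] by (auto simp: b'_def p'_def)
    have I3: "scan A (nvar s ''cur'') (Suc j) (Suc j) b' p'
      (if 0 < b' j \<and> (\<not> 0 < rvar s' ''bst'' \<or> b' j < rvar s' ''bst'') then b' j else rvar s' ''bst'')
      (if 0 < b' j \<and> (\<not> 0 < rvar s' ''bst'' \<or> b' j < rvar s' ''bst'') then j else nvar s' ''nx'')"
      using scan_select[OF I2 False] scan_no_select[OF I2] 8(2) by auto
    let ?c1 = "0 < ?x \<and> (\<not> 0 < rarr s' ''best'' j \<or> ?x < rarr s' ''best'' j)"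
    let ?c2 = "0 < b' j \<and> (\<not> 0 < rvar s' ''bst'' \<or> b' j < rvar s' ''bst'')"
    show ?thesis
    proof (cases ?c1)
      case c1: True
      then have b': "b' = (rarr s' ''best'')(j := ?x)" and p': "p' = (narr s' ''bp'')(j := nvar s ''cur'')"
        by (simp_all add: b'_def p'_def)
      show ?thesis
      proof (cases ?c2)
        case True
        then show ?thesis using I3 t c1 unfolding b' p' by (auto simp add: wp_simps j mat cur d0)
      next
        case False
        then show ?thesis using I3 t c1 unfolding b' p' by (auto simp add: wp_simps j mat cur d0)
      qed
    next
      case c1: False
      then have b': "b' = rarr s' ''best''" and p': "p' = narr s' ''bp''"
        by (auto simp: b'_def p'_def)
      show ?thesis
      proof (cases ?c2)
        case True
        then show ?thesis using I3 t c1 unfolding b' p' by (auto simp add: wp_simps j mat cur d0)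
      next
        case False
        then show ?thesis using I3 t c1 unfolding b' p' by (auto simp add: wp_simps j mat cur d0)
      qed
    qed
  qed
qed (use assms in \<open>auto simp: inp_def\<close>)

text \<open>The array \<open>best\<close> lags by one vertex: the row of \<open>cur\<close>, the
  vertex added last, is scanned only in the next round. Hence its sources are the first
  \<open>i - 1\<close> vertices.\<close>

definition prim_inv :: "nat \<Rightarrow> (nat \<Rightarrow> nat) \<Rightarrow> (nat \<Rightarrow> nat) \<Rightarrow> (nat \<Rightarrow> nat) \<Rightarrow> (nat \<Rightarrow> real) \<Rightarrow> nat \<Rightarrow>
    (nat \<Rightarrow> nat) \<Rightarrow> (nat \<Rightarrow> real) \<Rightarrow> (nat \<Rightarrow> nat) \<Rightarrow> bool" where
  "prim_inv i ord pos pp key cur dn best bp \<longleftrightarrow> 1 \<le> i \<and> i \<le> n \<and>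
     (\<forall>a<i. ord a < n \<and> pos (ord a) = a) \<and> cur = ord (i - 1) \<and>
     (\<forall>v<n. dn v < 1 \<longleftrightarrow> v \<notin> ord ` {..<i}) \<and>
     (\<forall>a. 0 < a \<and> a < i \<longrightarrow> pp a < a \<and> {ord a, ord (pp a)} \<in> E \<and> w {ord a, ord (pp a)} = key a) \<and>
     (\<forall>a u v. 0 < a \<and> a < i \<and> {u, v} \<in> E \<and> u \<in> ord ` {..<a} \<and> v \<notin> ord ` {..<a} \<longrightarrow> key a \<le> w {u, v}) \<and>
     (\<forall>v<n. v \<notin> ord ` {..<i} \<longrightarrow> best_edge (ord ` {..<i - 1}) v (best v) (bp v))"

lemma prim_inv_scan:
  assumes "prim_inv i ord pos pp key cur dn best bp"
  shows "scan (ord ` {..<i - 1}) cur 0 0 best bp 0 nx" "insert cur (ord ` {..<i - 1}) = ord ` {..<i}"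
proof -
  have "{..<i} = insert (i - 1) {..<i - 1}" using assms by (auto simp: prim_inv_def)
  then show *: "insert cur (ord ` {..<i - 1}) = ord ` {..<i}"
    using assms unfolding prim_inv_def by (metis image_insert)
  show "scan (ord ` {..<i - 1}) cur 0 0 best bp 0 nx"
    unfolding scan_def * using assms by (auto simp: prim_inv_def)
qed

lemma crossing_edge:
  assumes "A \<subseteq> {..<n}" "A \<noteq> {}" "A \<noteq> {..<n}"
  obtains u v where "u \<in> A" "v < n" "v \<notin> A" "{u, v} \<in> E"
proof -
  have EV: "e \<in> E \<Longrightarrow> e \<subseteq> {..<n}" for e using G by (auto simp: weighted_graph_def)
  obtain x y where xy: "x \<in> A" "y \<notin> A" "y < n" using assms by blast
  then have "(x, y) \<in> (adj E)\<^sup>*" using graph_connected_iff[OF EV] conn assms by auto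
  from rtrancl_last_exit[OF this xy(1,2)] obtain u v where "u \<in> A" "v \<notin> A" "(u, v) \<in> adj E" by auto
  moreover from this have "{u, v} \<in> E" by (simp add: adj_def)
  ultimately show ?thesis using that E_lt by blast
qed

text \<open>The selected \<open>bst\<close> is the minimum over all edges that leave the tree, which
  is \<open>cut_min\<close> for the new position. Connectedness provides such an edge, so the
  selection never fails.\<close>

lemma prim_inv_Suc:
  assumes P: "prim_inv i ord pos pp key cur dn best0 bp0" and i: "i < n"
    and sc: "scan (ord ` {..<i - 1}) cur n n best bp bst nx"
  shows "prim_inv (Suc i) (ord(i := nx)) (pos(nx := i)) (pp(i := pos (bp nx))) (key(i := bst)) nx
    (dn(nx := 1)) best bp"
proof -
  let ?A = "ord ` {..<i}"
  have A: "insert cur (ord ` {..<i - 1}) = ?A" using prim_inv_scan(2)[OF P] .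
  have o: "ord a < n" "pos (ord a) = a" if "a < i" for a using P that by (auto simp: prim_inv_def)
  have i1: "1 \<le> i" using P by (simp add: prim_inv_def)
  have "inj_on ord {..<i}" using o by (metis inj_onI lessThan_iff)
  then have "card ?A = i" by (simp add: card_image)
  then have "?A \<noteq> {..<n}" using i by auto
  moreover have "?A \<subseteq> {..<n}" "?A \<noteq> {}" using o i1 by (auto simp: lessThan_empty_iff)
  ultimately obtain u0 v0 where uv0: "u0 \<in> ?A" "v0 < n" "v0 \<notin> ?A" "{u0, v0} \<in> E" using crossing_edge by metis
  have best: "best_edge ?A v (best v) (bp v)" if "v < n" "v \<notin> ?A" for v
    using conjunct1[OF sc[unfolded scan_def A]] that by simp
  \<comment> \<open>Minimality of \<open>bst\<close> over the outer vertices is combined with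
    minimality of \<open>best\<close> at each of them.\<close>
  have cross: "0 < bst \<and> bst \<le> w {u, v}" if "u \<in> ?A" "v \<notin> ?A" "{u, v} \<in> E" for u v
  proof -
    have v: "v < n" using E_lt that by blast
    then have "0 < best v \<and> best v \<le> w {u, v}" using best[of v] that unfolding best_edge_def by blast
    moreover from this have "0 < bst \<and> bst \<le> best v"
      using conjunct2[OF conjunct2[OF sc[unfolded scan_def A]]] v that(2) by blast
    ultimately show ?thesis by linarith
  qed
  then have "0 < bst" using uv0 by blast
  then have nx: "nx < n" "nx \<notin> ?A" "best nx = bst" using conjunct1[OF conjunct2[OF sc[unfolded scan_def A]]] by auto
  then have bpx: "bp nx \<in> ?A" "{bp nx, nx} \<in> E" "w {bp nx, nx} = bst"
    using best[OF nx(1,2)] \<open>0 < bst\<close> by (auto simp: best_edge_def)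
  have pb: "pos (bp nx) < i" "ord (pos (bp nx)) = bp nx" using bpx(1) o by auto
  have im: "(ord(i := nx)) ` {..<a} = ord ` {..<a}" if "a \<le> i" for a
    using that by (intro image_cong) auto
  have imS: "(ord(i := nx)) ` {..<Suc i} = insert nx ?A"
    unfolding lessThan_Suc image_insert im[OF order_refl] by simp
  have nxo: "nx \<noteq> ord a" if "a < i" for a using nx(2) that by auto
  show ?thesis
    unfolding prim_inv_def
  proof (intro conjI allI impI)
    fix a assume "a < Suc i"
    then show "(ord(i := nx)) a < n" "(pos(nx := i)) ((ord(i := nx)) a) = a"
      using o nx(1) nxo by (auto simp: less_Suc_eq)
  next
    fix v assume "v < n"
    then show "(dn(nx := 1)) v < 1 \<longleftrightarrow> v \<notin> (ord(i := nx)) ` {..<Suc i}"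
      unfolding imS using P by (simp add: prim_inv_def)
  next
    fix a assume a: "0 < a \<and> a < Suc i"
    have "pp a < a" if "a < i" using P a that by (simp add: prim_inv_def)
    then show "(pp(i := pos (bp nx))) a < a" using pb a by (auto simp: less_Suc_eq)
    show "{(ord(i := nx)) a, (ord(i := nx)) ((pp(i := pos (bp nx))) a)} \<in> E"
      "w {(ord(i := nx)) a, (ord(i := nx)) ((pp(i := pos (bp nx))) a)} = (key(i := bst)) a"
    proof -
      let ?g = "\<lambda>a. (ord(i := nx)) a" and ?p = "\<lambda>a. (pp(i := pos (bp nx))) a"
      have "{?g a, ?g (?p a)} \<in> E \<and> w {?g a, ?g (?p a)} = (key(i := bst)) a"
      proof (cases "a = i")
        case True
        then have "{?g a, ?g (?p a)} = {bp nx, nx}" using pb by auto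
        then show ?thesis using bpx(2,3) True by simp
      next
        case False
        then have *: "a < i" "pp a < a" "{ord a, ord (pp a)} \<in> E" "w {ord a, ord (pp a)} = key a"
          using a P by (auto simp: prim_inv_def)
        then show ?thesis by auto
      qed
      then show "{?g a, ?g (?p a)} \<in> E" "w {?g a, ?g (?p a)} = (key(i := bst)) a" by blast+
    qed
  next
    fix a u v
    assume a: "0 < a \<and> a < Suc i \<and> {u, v} \<in> E \<and> u \<in> (ord(i := nx)) ` {..<a} \<and> v \<notin> (ord(i := nx)) ` {..<a}"
    then have uv: "u \<in> ord ` {..<a}" "v \<notin> ord ` {..<a}" using im[of a] by auto
    show "(key(i := bst)) a \<le> w {u, v}"
    proof (cases "a = i")
      case True
      then show ?thesis using cross[of u v] uv a by simp
    next
      case False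
      then have "a < i" using a by simp
      then have "key a \<le> w {u, v}" using P a uv unfolding prim_inv_def by blast
      then show ?thesis using False by simp
    qed
  next
    fix v assume v: "v < n" "v \<notin> (ord(i := nx)) ` {..<Suc i}"
    then have "v \<notin> ?A" unfolding imS by blast
    then show "best_edge ((ord(i := nx)) ` {..<Suc i - 1}) v (best v) (bp v)"
      unfolding diff_Suc_1 im[OF order_refl] by (rule best[OF v(1)])
  qed (use i in auto)
qed

lemma prim_inv_parent:
  assumes P: "prim_inv i ord pos pp key cur dn best0 bp0" and i: "i < n"
    and sc: "scan (ord ` {..<i - 1}) cur n n best bp bst nx"
  shows "bp nx \<in> ord ` {..<i} \<and> nx \<notin> ord ` {..<i}"
proof -
  let ?g = "ord(i := nx)" and ?p = "pp(i := pos (bp nx))"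
  have P': "prim_inv (Suc i) ?g (pos(nx := i)) ?p (key(i := bst)) nx (dn(nx := 1)) best bp"
    by (rule prim_inv_Suc[OF assms])
  have *: "(pos(nx := i)) (?g a) = a" if "a < Suc i" for a using P' that by (simp add: prim_inv_def)
  have "nx \<noteq> ord a" if "a < i" for a using *[of a] that by auto
  then have nx: "nx \<notin> ord ` {..<i}" by auto
  have A: "insert cur (ord ` {..<i - 1}) = ord ` {..<i}" using prim_inv_scan(2)[OF P] .
  have "1 \<le> i" using P by (simp add: prim_inv_def)
  then have "0 < (key(i := bst)) i"
    using P' E_wpos unfolding prim_inv_def by (metis One_nat_def Suc_le_lessD lessI)
  then have "0 < bst" by simp
  then have "nx < n" "best nx = bst" using conjunct1[OF conjunct2[OF sc[unfolded scan_def A]]] by auto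
  then show ?thesis using nx \<open>0 < bst\<close> conjunct1[OF sc[unfolded scan_def A]] by (auto simp: best_edge_def)
qed

text \<open>Position 0 is the root and has no tree edge, so slot \<open>a\<close> holds the edge of
  position \<open>Suc a\<close>.\<close>

definition tree_out :: "nat \<Rightarrow> (nat \<Rightarrow> nat) \<Rightarrow> (nat \<Rightarrow> nat) \<Rightarrow> nat \<Rightarrow> (nat \<Rightarrow> nat) \<Rightarrow> (nat \<Rightarrow> nat) \<Rightarrow> bool" where
  "tree_out i ord pp outm src dst \<longleftrightarrow> outm = i - 1 \<and> 1 \<le> i \<and>
     (\<forall>a<i - 1. src a = ord (Suc a) \<and> dst a = ord (pp (Suc a)))"

lemma tree_out_Suc:
  assumes T: "tree_out i ord pp outm src dst" and P: "prim_inv i ord pos pp key cur dn best0 bp0"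
    and P': "prim_inv (Suc i) (ord(i := nx)) pos' (pp(i := p)) key' cur' dn' best bp" and p: "p < i" "ord p = b"
  shows "tree_out (Suc i) (ord(i := nx)) (pp(i := p)) (Suc outm) (src(outm := nx)) (dst(outm := b))"
  unfolding tree_out_def
proof (intro conjI allI impI)
  fix a assume a: "a < Suc i - 1"
  have pp: "pp (Suc a) < Suc a" if "Suc a < i" using P that by (simp add: prim_inv_def)
  show "(src(outm := nx)) a = (ord(i := nx)) (Suc a)" using T a by (auto simp: tree_out_def)
  show "(dst(outm := b)) a = (ord(i := nx)) ((pp(i := p)) (Suc a))"
    using T a p pp by (cases "Suc a = i") (auto simp: tree_out_def)
qed (use T in \<open>auto simp: tree_out_def\<close>)

lemma wp_prim_loop:
  assumes inp: "inp s" and row: "\<forall>u<n. narr s ''row'' u = u * n"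
    and mat: "\<forall>u<n. \<forall>v<n. rarr s ''mat'' (u * n + v) = mx u v"
    and i: "nvar s ''i'' = 1" and cur: "nvar s ''cur'' = 0" and out: "nvar s ''outm'' = 0"
    and init: "narr s ''done'' = (\<lambda>_. 0)(0 := 1)" "narr s ''ord'' 0 = 0" "narr s ''pos'' 0 = 0"
      "rarr s ''best'' = (\<lambda>_. 0)"
  shows "wp prim_loop s (\<lambda>t s'. t \<le> 24 * n * n + 1 \<and>
    (\<exists>dn best bp. prim_inv n (narr s' ''ord'') (narr s' ''pos'') (narr s' ''pp'') (rarr s' ''key'') (nvar s' ''cur'') dn best bp) \<and>
    tree_out n (narr s' ''ord'') (narr s' ''pp'') (nvar s' ''outm'') (narr s' ''outsrc'') (narr s' ''outdst''))"
  unfolding prim_loop_def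
proof (rule wp_For[where a = 1 and N = n and I = "\<lambda>i t s'. t \<le> i * (9 * n + 15) \<and>
    prim_inv i (narr s' ''ord'') (narr s' ''pos'') (narr s' ''pp'') (rarr s' ''key'') (nvar s' ''cur'') (narr s' ''done'') (rarr s' ''best'') (narr s' ''bp'') \<and>
    tree_out i (narr s' ''ord'') (narr s' ''pp'') (nvar s' ''outm'') (narr s' ''outsrc'') (narr s' ''outdst'')"], goal_cases)
  case 7
  have "prim_inv 1 (narr s ''ord'') (narr s ''pos'') (narr s ''pp'') (rarr s ''key'') 0 ((\<lambda>_. 0)(0 := 1)) (\<lambda>_. 0) (narr s ''bp'')"
    using n_pos init by (auto simp: prim_inv_def best_edge_def lessThan_Suc)
  then show ?case using init cur out by (simp add: tree_out_def)
next
  case (8 i t s')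
  let ?A = "narr s' ''ord'' ` {..<i - 1}"
  have P: "prim_inv i (narr s' ''ord'') (narr s' ''pos'') (narr s' ''pp'') (rarr s' ''key'') (nvar s' ''cur'') (narr s' ''done'') (rarr s' ''best'') (narr s' ''bp'')"
    and T: "tree_out i (narr s' ''ord'') (narr s' ''pp'') (nvar s' ''outm'') (narr s' ''outsrc'') (narr s' ''outdst'')"
    and t: "t \<le> i * (9 * n + 15)" using 8 by auto
  have ceq: "nvar s' ''cur'' < n" using P unfolding prim_inv_def by simp
  let ?s1 = "s'\<lparr>nvar := (nvar s')(''c'' := nvar s' ''cur'' * n, ''j'' := 0), rvar := (rvar s')(''bst'' := 0)\<rparr>"
  have un: "narr s' ''row'' = narr s ''row''" "rarr s' ''mat'' = rarr s ''mat''"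
    using 8(3) by (auto simp: unch_def prim_scan_def prim_add_def)
  have inp': "inp s'" using inp 8(3) by (auto simp: unch_def prim_scan_def prim_add_def inp_def)
  have sc: "wp prim_scan ?s1 (\<lambda>t s''. t \<le> 9 * n + 1 \<and>
    scan ?A (nvar ?s1 ''cur'') n n (rarr s'' ''best'') (narr s'' ''bp'') (rvar s'' ''bst'') (nvar s'' ''nx''))"
  proof (rule wp_prim_scan)
    show "inp ?s1" using inp' by (simp add: inp_def)
    show "\<forall>v<n. rarr ?s1 ''mat'' (nvar ?s1 ''c'' + v) = mx (nvar ?s1 ''cur'') v"
      using mat ceq by (simp add: un)
    show "\<forall>v<n. (narr ?s1 ''done'' v < 1) = (v \<notin> insert (nvar ?s1 ''cur'') ?A)"
      using prim_inv_scan(2)[OF P] P by (simp add: prim_inv_def)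
    show "scan ?A (nvar ?s1 ''cur'') 0 0 (rarr ?s1 ''best'') (narr ?s1 ''bp'') (rvar ?s1 ''bst'') (nvar ?s1 ''nx'')"
      using prim_inv_scan(1)[OF P] by simp
  qed simp
  have "wp (prim_scan ;; prim_add) ?s1 (\<lambda>t' s''. t' \<le> 9 * n + 10 \<and>
    prim_inv (Suc i) (narr s'' ''ord'') (narr s'' ''pos'') (narr s'' ''pp'') (rarr s'' ''key'') (nvar s'' ''cur'') (narr s'' ''done'') (rarr s'' ''best'') (narr s'' ''bp'') \<and>
    tree_out (Suc i) (narr s'' ''ord'') (narr s'' ''pp'') (nvar s'' ''outm'') (narr s'' ''outsrc'') (narr s'' ''outdst''))"
    unfolding wp_Seq
  proof (rule wp_frame[OF sc], goal_cases)
    case (1 t' s'')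
    have eq: "narr s'' ''ord'' = narr s' ''ord''" "narr s'' ''pos'' = narr s' ''pos''" "narr s'' ''pp'' = narr s' ''pp''"
      "rarr s'' ''key'' = rarr s' ''key''" "narr s'' ''done'' = narr s' ''done''" "nvar s'' ''i'' = i"
      "nvar s'' ''outm'' = nvar s' ''outm''" "narr s'' ''outsrc'' = narr s' ''outsrc''" "narr s'' ''outdst'' = narr s' ''outdst''"
      using 1(1) 8(4) by (auto simp: unch_def prim_scan_def)
    have sc': "scan ?A (nvar s' ''cur'') n n (rarr s'' ''best'') (narr s'' ''bp'') (rvar s'' ''bst'') (nvar s'' ''nx'')"
      using 1(2) by simp
    note P' = prim_inv_Suc[OF P 8(2) sc']
    let ?b = "narr s'' ''bp'' (nvar s'' ''nx'')"
    have pos_ok: "narr s' ''pos'' ?b < i \<and> narr s' ''ord'' (narr s' ''pos'' ?b) = ?b \<and> ?b \<noteq> nvar s'' ''nx''"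
    proof -
      have i: "0 < i" using 8 by simp
      from P' i have 1: "narr s' ''pos'' ?b < i" unfolding prim_inv_def by (metis fun_upd_same lessI)
      have bA: "?b \<in> narr s' ''ord'' ` {..<i}"
        using prim_inv_parent[OF P 8(2) sc'] by blast
      from bA obtain a where a: "a < i" "?b = narr s' ''ord'' a" by auto
      have oa: "narr s' ''pos'' (narr s' ''ord'' a) = a" using P a by (simp add: prim_inv_def)
      have "?b \<noteq> nvar s'' ''nx''" using prim_inv_parent[OF P 8(2) sc'] by metis
      then show ?thesis using 1 a oa by simp
    qed
    have T': "tree_out (Suc i) ((narr s' ''ord'')(i := nvar s'' ''nx'')) ((narr s' ''pp'')(i := narr s' ''pos'' ?b))
      (Suc (nvar s' ''outm'')) ((narr s' ''outsrc'')(nvar s' ''outm'' := nvar s'' ''nx''))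
      ((narr s' ''outdst'')(nvar s' ''outm'' := ?b))"
      by (rule tree_out_Suc[OF T P P']) (use pos_ok in auto)
    show ?case using P' T' 1(2) unfolding prim_add_def by (simp add: wp_simps eq)
  qed
  then show ?case
    unfolding wp_Seq using t ceq row
    by (simp add: wp_simps un) (erule wp_mono, erule wp_mono, simp add: algebra_simps)
next
  case (9 t s')
  have "n * (9 * n + 15) \<le> 24 * n * n" using n_pos by (simp add: algebra_simps)
  then have "t \<le> 24 * n * n" using 9(3) by (meson le_trans)
  then show ?case using 9(3) by auto
qed (use assms n_pos in \<open>auto simp: inp_def prim_scan_def prim_add_def\<close>)

text \<open>The left inverse makes \<open>ord\<close> injective on \<open>{..<n}\<close>, hence
  surjective by counting, which yields the other inverse law.\<close>

lemma prim_inv_prim_order: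
  assumes P: "prim_inv n ord pos pp key cur dn best bp"
  shows "prim_order n E w ord pos pp key"
proof -
  have o: "ord a < n" "pos (ord a) = a" if "a < n" for a using P that by (auto simp: prim_inv_def)
  have "inj_on ord {..<n}" using o by (metis inj_onI lessThan_iff)
  then have "ord ` {..<n} = {..<n}" using o by (intro card_subset_eq) (auto simp: card_image)
  then have p: "pos v < n \<and> ord (pos v) = v" if "v < n" for v
    using that o by (metis imageE lessThan_iff)
  show ?thesis
  proof
    fix i u v assume i: "0 < i" "i < n" "{u, v} \<in> E" "pos u < i" "i \<le> pos v"
    have uv: "u < n" "v < n" using E_lt i by auto
    have "u \<in> ord ` {..<i}" using p[OF uv(1)] i by (intro image_eqI[of _ _ "pos u"]) auto
    moreover have "v \<notin> ord ` {..<i}" using i o by auto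
    ultimately show "key i \<le> w {u, v}" using P i unfolding prim_inv_def by blast
  qed (use P o p G in \<open>auto simp: prim_inv_def\<close>)
qed

definition tree_state :: "state \<Rightarrow> bool" where
  "tree_state s \<longleftrightarrow> prim_order n E w (narr s ''ord'') (narr s ''pos'') (narr s ''pp'') (rarr s ''key'')"

lemma wp_prim:
  assumes inp: "inp s" and init: "nvar s ''i'' = 0" "nvar s ''c'' = 0" "nvar s ''cur'' = 0" "nvar s ''outm'' = 0"
    "rarr s ''mat'' = (\<lambda>_. 0)" "narr s ''done'' = (\<lambda>_. 0)" "narr s ''ord'' 0 = 0" "narr s ''pos'' 0 = 0"
    "rarr s ''best'' = (\<lambda>_. 0)"
  shows "wp prim s (\<lambda>t s'. t \<le> 40 * n * n \<and> tree_state s' \<and>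
    tree_out n (narr s' ''ord'') (narr s' ''pp'') (nvar s' ''outm'') (narr s' ''outsrc'') (narr s' ''outdst''))"
  unfolding prim_def wp_Seq
proof (rule wp_frame[OF wp_fill_rows[OF inp init(1,2)]], goal_cases)
  case (1 t1 s1)
  let ?s1 = "s1\<lparr>nvar := (nvar s1)(''i'' := 0)\<rparr>"
  have inp1: "inp s1" and init1: "nvar s1 ''cur'' = 0" "nvar s1 ''outm'' = 0"
    "rarr s1 ''mat'' = (\<lambda>_. 0)" "narr s1 ''done'' = (\<lambda>_. 0)" "narr s1 ''ord'' 0 = 0" "narr s1 ''pos'' 0 = 0"
    "rarr s1 ''best'' = (\<lambda>_. 0)"
    using 1(1) inp init by (auto simp: unch_def fill_rows_def inp_def)
  have F: "wp fill_entries ?s1 (\<lambda>t s'. t \<le> 4 * m + 1 \<and> (\<forall>u<n. \<forall>v<n. rarr s' ''mat'' (u * n + v) = mx u v))"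
    by (rule wp_fill_entries) (use inp1 init1 1(2) in \<open>auto simp: inp_def\<close>)
  show ?case unfolding wp_NAssign nval.simps
  proof (rule wp_frame[OF F], goal_cases)
    case (1 t2 s2)
    let ?s2 = "s2\<lparr>narr := (narr s2)(''done'' := (\<lambda>_. 0)(0 := 1)), nvar := (nvar s2)(''i'' := 1)\<rparr>"
    have dn: "narr s2 ''done'' = (\<lambda>_. 0)" using 1(1) init1 by (auto simp: unch_def fill_entries_def)
    have L: "wp prim_loop ?s2 (\<lambda>t s'. t \<le> 24 * n * n + 1 \<and>
      (\<exists>dn best bp. prim_inv n (narr s' ''ord'') (narr s' ''pos'') (narr s' ''pp'') (rarr s' ''key'') (nvar s' ''cur'') dn best bp) \<and>
      tree_out n (narr s' ''ord'') (narr s' ''pp'') (nvar s' ''outm'') (narr s' ''outsrc'') (narr s' ''outdst''))"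
      by (rule wp_prim_loop)
        (use 1 inp1 init1 \<open>t1 \<le> 4 * n + 1 \<and> (\<forall>u<n. narr s1 ''row'' u = u * n)\<close> in
          \<open>auto simp: unch_def fill_entries_def inp_def\<close>)
    have "1 \<le> n" "n \<le> n * n" "m \<le> n * n" using n_pos m_le by auto
    then have tt: "t1 + (1 + (t2 + (2 + t))) \<le> 40 * n * n" if "t \<le> 24 * n * n + 1" for t
      using that 1(2) \<open>t1 \<le> 4 * n + 1 \<and> (\<forall>u<n. narr s1 ''row'' u = u * n)\<close> by linarith
    show ?case
      unfolding wp_NAssign wp_NStore nval.simps
      by (simp add: dn) (rule wp_mono[OF L[simplified]], use tt prim_inv_prim_order in \<open>auto simp: tree_state_def\<close>)
  qed
qed

end

section \<open>Sorting the edges\<close>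

text \<open>With truncated subtraction this is the minimum.\<close>

abbreviation (input) NMin :: "nexp \<Rightarrow> nexp \<Rightarrow> nexp" where "NMin a b \<equiv> NMinus a (NMinus a b)"

text \<open>Sorting is bottom-up merge sort, which needs neither recursion nor a stack.\<close>

definition merge_loop :: com where
  "merge_loop = For ''c'' ''hi'' (
     Cond (BAnd (NLess (NVar ''i'') (NVar ''mid''))
         (BOr (BNot (NLess (NVar ''j'') (NVar ''hi'')))
           (BNot (RLess (RArr ''wt'' (NArr ''o'' (NVar ''j''))) (RArr ''wt'' (NArr ''o'' (NVar ''i'')))))))
       (NStore ''o2'' (NVar ''c'') (NArr ''o'' (NVar ''i'')) ;; incr ''i'')
       (NStore ''o2'' (NVar ''c'') (NArr ''o'' (NVar ''j'')) ;; incr ''j''))"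

definition merge_pass :: com where
  "merge_pass = While (NLess (NVar ''lo'') (NVar ''m'')) (
     NAssign ''mid'' (NMin (NPlus (NVar ''lo'') (NVar ''wd'')) (NVar ''m'')) ;;
     NAssign ''hi'' (NMin (NPlus (NVar ''mid'') (NVar ''wd'')) (NVar ''m'')) ;;
     NAssign ''i'' (NVar ''lo'') ;; NAssign ''j'' (NVar ''mid'') ;; NAssign ''c'' (NVar ''lo'') ;;
     merge_loop ;;
     NAssign ''lo'' (NVar ''hi''))"

definition copy_back :: com where
  "copy_back = For ''i'' ''m'' (NStore ''o'' (NVar ''i'') (NArr ''o2'' (NVar ''i'')))"

definition sort_loop :: com where
  "sort_loop = While (NLess (NVar ''wd'') (NVar ''m'')) (
     NAssign ''lo'' (NConst 0) ;; merge_pass ;; NAssign ''i'' (NConst 0) ;; copy_back ;;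
     NAssign ''wd'' (NPlus (NVar ''wd'') (NVar ''wd'')))"

definition sort_init :: com where
  "sort_init = For ''i'' ''m'' (NStore ''o'' (NVar ''i'') (NVar ''i''))"

definition sort_edges :: com where
  "sort_edges = NAssign ''i'' (NConst 0) ;; sort_init ;; NAssign ''wd'' (NConst 1) ;; sort_loop"

lemma sort_writes [simp]:
  "nws sort_edges = {''i'', ''j'', ''c'', ''lo'', ''mid'', ''hi'', ''wd''}" "rws sort_edges = {}"
  "naws sort_edges = {''o'', ''o2''}" "raws sort_edges = {}"
  by (auto simp: sort_edges_def sort_init_def sort_loop_def copy_back_def merge_pass_def merge_loop_def)

lemma merge_loop_writes [simp]:
  "nws merge_loop = {''i'', ''j'', ''c''}" "rws merge_loop = {}" "naws merge_loop = {''o2''}" "raws merge_loop = {}"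
  by (auto simp: merge_loop_def)

lemma merge_pass_writes [simp]:
  "nws merge_pass = {''i'', ''j'', ''c'', ''lo'', ''mid'', ''hi''}" "rws merge_pass = {}"
  "naws merge_pass = {''o2''}" "raws merge_pass = {}"
  by (auto simp: merge_pass_def)

definition srt :: "(nat \<Rightarrow> real) \<Rightarrow> (nat \<Rightarrow> nat) \<Rightarrow> nat \<Rightarrow> nat \<Rightarrow> bool" where
  "srt W f a b \<longleftrightarrow> (\<forall>i j. a \<le> i \<and> i \<le> j \<and> j < b \<longrightarrow> W (f i) \<le> W (f j))"

text \<open>The equation \<open>c + mid = i + j\<close> says, without subtraction, that the write
  position counts the entries consumed from both runs. The last clause is what permits appending the
  smaller head.\<close>

definition merged :: "(nat \<Rightarrow> real) \<Rightarrow> (nat \<Rightarrow> nat) \<Rightarrow> (nat \<Rightarrow> nat) \<Rightarrow> nat \<Rightarrow> nat \<Rightarrow> nat \<Rightarrow> nat \<Rightarrow> nat \<Rightarrow> nat \<Rightarrow> bool" where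
  "merged W f g lo mid hi i j c \<longleftrightarrow> lo \<le> i \<and> i \<le> mid \<and> mid \<le> j \<and> j \<le> hi \<and> c + mid = i + j \<and>
     srt W f lo mid \<and> srt W f mid hi \<and> srt W g lo c \<and> g ` {lo..<c} = f ` ({lo..<i} \<union> {mid..<j}) \<and>
     (\<forall>x\<in>{lo..<c}. \<forall>y\<in>{i..<mid} \<union> {j..<hi}. W (g x) \<le> W (f y))"

lemma merged_append:
  assumes g: "srt W g lo c" "g ` {lo..<c} = f ` A" "lo \<le> c" and x: "\<And>y. y \<in> {lo..<c} \<Longrightarrow> W (g y) \<le> W x"
  shows "srt W (g(c := x)) lo (Suc c)" "(g(c := x)) ` {lo..<Suc c} = insert x (f ` A)"
    "y \<in> {lo..<Suc c} \<Longrightarrow> (g(c := x)) y = (if y = c then x else g y)"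
proof -
  show "srt W (g(c := x)) lo (Suc c)"
    unfolding srt_def
  proof (intro allI impI)
    fix i j assume ij: "lo \<le> i \<and> i \<le> j \<and> j < Suc c"
    show "W ((g(c := x)) i) \<le> W ((g(c := x)) j)"
      using ij x[of i] g(1) unfolding srt_def by (cases "j = c"; cases "i = c") auto
  qed
  have "(g(c := x)) ` {lo..<c} = g ` {lo..<c}" by (intro image_cong) auto
  then show "(g(c := x)) ` {lo..<Suc c} = insert x (f ` A)"
    unfolding atLeastLessThanSuc if_P[OF g(3)] image_insert fun_upd_same g(2) by simp
qed auto

lemma merged_left:
  assumes M: "merged W f g lo mid hi i j c" and i: "i < mid" "j < hi \<Longrightarrow> W (f i) \<le> W (f j)"
  shows "merged W f (g(c := f i)) lo mid hi (Suc i) j (Suc c)"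
proof -
  have b: "lo \<le> i" "mid \<le> j" "j \<le> hi" "c + mid = i + j" "srt W f lo mid" "srt W f mid hi" "lo \<le> c"
    "srt W g lo c" "g ` {lo..<c} = f ` ({lo..<i} \<union> {mid..<j})"
    "\<And>x y. x\<in>{lo..<c} \<Longrightarrow> y\<in>{i..<mid} \<union> {j..<hi} \<Longrightarrow> W (g x) \<le> W (f y)"
    using M by (auto simp: merged_def)
  have fi: "W (f i) \<le> W (f y)" if "y \<in> {Suc i..<mid} \<union> {j..<hi}" for y
  proof (cases "y < mid")
    case True
    then show ?thesis using that b unfolding srt_def by auto
  next
    case False
    then have "j < hi" "W (f j) \<le> W (f y)" using that b unfolding srt_def by auto
    then show ?thesis using i by simp
  qed
  note A = merged_append[OF b(8,9,7), of "f i"]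
  have "{lo..<Suc i} = insert i {lo..<i}" using b by auto
  then have "insert (f i) (f ` ({lo..<i} \<union> {mid..<j})) = f ` ({lo..<Suc i} \<union> {mid..<j})" by simp
  then show ?thesis
    unfolding merged_def using A(1,2) b i fi by (auto simp: A(3))
qed

lemma merged_right:
  assumes M: "merged W f g lo mid hi i j c" and i: "j < hi" "i < mid \<Longrightarrow> W (f j) \<le> W (f i)"
  shows "merged W f (g(c := f j)) lo mid hi i (Suc j) (Suc c)"
proof -
  have b: "lo \<le> i" "i \<le> mid" "mid \<le> j" "c + mid = i + j" "srt W f lo mid" "srt W f mid hi" "lo \<le> c"
    "srt W g lo c" "g ` {lo..<c} = f ` ({lo..<i} \<union> {mid..<j})"
    "\<And>x y. x\<in>{lo..<c} \<Longrightarrow> y\<in>{i..<mid} \<union> {j..<hi} \<Longrightarrow> W (g x) \<le> W (f y)"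
    using M by (auto simp: merged_def)
  have fi: "W (f j) \<le> W (f y)" if "y \<in> {i..<mid} \<union> {Suc j..<hi}" for y
  proof (cases "y < mid")
    case False
    then show ?thesis using that b unfolding srt_def by auto
  next
    case True
    then have "i < mid" "W (f i) \<le> W (f y)" using that b unfolding srt_def by auto
    then show ?thesis using i by simp
  qed
  note A = merged_append[OF b(8,9,7), of "f j"]
  have "{mid..<Suc j} = insert j {mid..<j}" using b by auto
  then have "insert (f j) (f ` ({lo..<i} \<union> {mid..<j})) = f ` ({lo..<i} \<union> {mid..<Suc j})" by simp
  then show ?thesis
    unfolding merged_def using A(1,2) b i fi by (auto simp: A(3))
qed

text \<open>Blocks start at multiples of \<open>wd\<close>; the \<open>min\<close> accounts for a
  shorter last block.\<close>

definition blocks :: "(nat \<Rightarrow> real) \<Rightarrow> (nat \<Rightarrow> nat) \<Rightarrow> nat \<Rightarrow> nat \<Rightarrow> nat \<Rightarrow> bool" where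
  "blocks W f N wd lo \<longleftrightarrow> (\<forall>a. a * wd < lo \<longrightarrow> srt W f (a * wd) (min (a * wd + wd) N))"

text \<open>Invariant of a merge pass: the blocks of length \<open>2 * wd\<close> below \<open>lo\<close> have been merged from \<open>f\<close> into \<open>g\<close>.\<close>

definition half_merged :: "(nat \<Rightarrow> real) \<Rightarrow> (nat \<Rightarrow> nat) \<Rightarrow> (nat \<Rightarrow> nat) \<Rightarrow> nat \<Rightarrow> nat \<Rightarrow> nat \<Rightarrow> bool" where
  "half_merged W f g N wd lo \<longleftrightarrow> lo \<le> N \<and> (lo = N \<or> (\<exists>a. lo = a * (wd + wd))) \<and>
     g ` {..<lo} = f ` {..<lo} \<and> blocks W g N (wd + wd) lo"

lemma half_merged_start:
  assumes H: "half_merged W f g N wd lo" and B: "blocks W f N wd N" and lo: "lo < N" and wd: "0 < wd"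
    and mid: "mid = min (lo + wd) N" and hi: "hi = min (mid + wd) N"
  shows "merged W f g lo mid hi lo mid lo"
proof -
  obtain a where a: "lo = a * (wd + wd)" using H lo by (auto simp: half_merged_def)
  have "lo = (a * 2) * wd" using a by simp
  then have "srt W f lo mid" using B lo unfolding blocks_def mid by blast
  moreover have "srt W f mid hi"
  proof (cases "mid < N")
    case True
    then have "mid = (a * 2 + 1) * wd" using mid a by (simp add: algebra_simps)
    then show ?thesis using B True unfolding blocks_def hi by metis
  next
    case False
    then show ?thesis using hi mid by (auto simp: srt_def)
  qed
  ultimately show ?thesis using lo mid hi by (auto simp: merged_def srt_def)
qed

lemma half_merged_step:
  assumes H: "half_merged W f g N wd lo" and lo: "lo < N" and wd: "0 < wd"
    and mid: "mid = min (lo + wd) N" and hi: "hi = min (mid + wd) N"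
    and M: "merged W f g' lo mid hi i j hi" and g': "\<And>x. x < lo \<Longrightarrow> g' x = g x"
  shows "half_merged W f g' N wd hi"
proof -
  obtain a where a: "lo = a * (wd + wd)" using H lo by (auto simp: half_merged_def)
  have ij: "i = mid" "j = hi" using M by (auto simp: merged_def)
  have hi': "hi = min (lo + (wd + wd)) N" "lo < hi" using mid hi lo wd by auto
  have "g' ` {..<hi} = f ` {..<hi}"
  proof -
    have 1: "{..<hi} = {..<lo} \<union> {lo..<hi}" using hi' by auto
    have "{lo..<mid} \<union> {mid..<hi} = {lo..<hi}" using mid hi lo by auto
    then have "g' ` {lo..<hi} = f ` {lo..<hi}" using M ij by (simp add: merged_def)
    moreover have "g' ` {..<lo} = f ` {..<lo}" using H g' by (auto simp: half_merged_def image_def)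
    ultimately show ?thesis unfolding 1 by (simp add: image_Un)
  qed
  moreover have "blocks W g' N (wd + wd) hi"
    unfolding blocks_def
  proof (intro allI impI)
    fix b assume b: "b * (wd + wd) < hi"
    show "srt W g' (b * (wd + wd)) (min (b * (wd + wd) + (wd + wd)) N)"
    proof (cases "b < a")
      case True
      then have "b + 1 \<le> a" by simp
      then have "(b + 1) * (wd + wd) \<le> lo" unfolding a by (rule mult_right_mono) simp
      then have le: "b * (wd + wd) + (wd + wd) \<le> lo" by (simp add: algebra_simps)
      then have "b * (wd + wd) < lo" using wd by simp
      then have "srt W g (b * (wd + wd)) (min (b * (wd + wd) + (wd + wd)) N)"
        using H by (auto simp: half_merged_def blocks_def)
      then show ?thesis using le g' by (auto simp: srt_def)
    next
      case False
      have "b = a"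
      proof (rule ccontr)
        assume "b \<noteq> a"
        then have "a + 1 \<le> b" using False by simp
        then have "(a + 1) * (wd + wd) \<le> b * (wd + wd)" by (rule mult_right_mono) simp
        then show False using b hi' a by (simp add: algebra_simps)
      qed
      then show ?thesis using M hi' a by (simp add: merged_def)
    qed
  qed
  moreover have "hi = N \<or> (\<exists>a. hi = a * (wd + wd))"
    using hi' a by (metis add_mult_distrib min_def mult_1 add.commute)
  ultimately show ?thesis using hi by (simp add: half_merged_def)
qed

context spanner_input
begin

lemma wp_merge_loop:
  assumes inp: "inp s" and M: "merged ew f (narr s ''o2'') lo mid hi lo mid lo" and f: "f = narr s ''o''" "f ` {..<m} \<subseteq> {..<m}"
    and st: "nvar s ''i'' = lo" "nvar s ''j'' = mid" "nvar s ''c'' = lo" "nvar s ''mid'' = mid" "nvar s ''hi'' = hi" "hi \<le> m" "lo \<le> hi"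
  shows "wp merge_loop s (\<lambda>t s'. t \<le> 5 * (hi - lo) + 1 \<and> (\<exists>i j. merged ew f (narr s' ''o2'') lo mid hi i j hi) \<and>
    (\<forall>x<lo. narr s' ''o2'' x = narr s ''o2'' x))"
  unfolding merge_loop_def
proof (rule wp_For[where a = lo and N = hi and I = "\<lambda>c t s'. t \<le> 5 * (c - lo) \<and>
    merged ew f (narr s' ''o2'') lo mid hi (nvar s' ''i'') (nvar s' ''j'') c \<and> (\<forall>x<lo. narr s' ''o2'' x = narr s ''o2'' x)"], goal_cases)
  case (8 c t s')
  let ?i = "nvar s' ''i''" and ?j = "nvar s' ''j''"
  have M': "merged ew f (narr s' ''o2'') lo mid hi ?i ?j c" and t: "t \<le> 5 * (c - lo)"
    and k: "\<forall>x<lo. narr s' ''o2'' x = narr s ''o2'' x" using 8(5) by auto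
  have eq: "nvar s' ''mid'' = mid" "nvar s' ''hi'' = hi" "narr s' ''o'' = f" "nvar s' ''c'' = c"
    using 8(3,4) st f by (auto simp: unch_def)
  have wt: "rarr s' ''wt'' x = ew x" if "x < m" for x
    using 8(3) inp that by (auto simp: unch_def inp_def)
  have bnd: "c + mid = ?i + ?j" "?i \<le> mid" "?j \<le> hi" "mid \<le> ?j" using M' by (auto simp: merged_def)
  have fm: "f x < m" if "x < hi" for x using f(2) that st(6) by (meson image_subset_iff lessThan_iff order_less_le_trans)
  have "lo \<le> c" by (rule 8)
  then have t': "t + 5 \<le> 5 * (Suc c - lo)" using t by linarith
  show ?case
  proof (cases "?i < mid \<and> (\<not> ?j < hi \<or> \<not> ew (f ?j) < ew (f ?i))")
    case True
    have "?j < hi \<Longrightarrow> rarr s' ''wt'' (f ?j) = ew (f ?j)" "rarr s' ''wt'' (f ?i) = ew (f ?i)"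
      using True wt fm bnd by auto
    moreover have "merged ew f ((narr s' ''o2'')(c := f ?i)) lo mid hi (Suc ?i) ?j (Suc c)"
      using merged_left[OF M'] True by auto
    ultimately show ?thesis using True t' k \<open>lo \<le> c\<close> by (auto simp: wp_simps eq)
  next
    case False
    have j: "?j < hi" using False bnd 8(2) by auto
    then have *: "rarr s' ''wt'' (f ?j) = ew (f ?j)" "?i < mid \<Longrightarrow> rarr s' ''wt'' (f ?i) = ew (f ?i)"
      using wt fm bnd by auto
    have "merged ew f ((narr s' ''o2'')(c := f ?j)) lo mid hi ?i (Suc ?j) (Suc c)"
      using merged_right[OF M'] False j by auto
    then show ?thesis using False j * t' k \<open>lo \<le> c\<close> by (auto simp: wp_simps eq)
  qed
qed (use assms in auto)

lemma wp_merge_pass: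
  assumes inp: "inp s" and f: "f = narr s ''o''" "f ` {..<m} = {..<m}" and B: "blocks ew f m wd m" and wd: "0 < wd"
    and st: "nvar s ''wd'' = wd" "nvar s ''lo'' = 0"
  shows "wp merge_pass s (\<lambda>t s'. t \<le> 13 * m + 1 \<and> half_merged ew f (narr s' ''o2'') m wd m)"
  unfolding merge_pass_def
proof (rule wp_While[where B = "13 * m" and I = "\<lambda>t s'. t \<le> 13 * nvar s' ''lo'' \<and> half_merged ew f (narr s' ''o2'') m wd (nvar s' ''lo'')"],
    goal_cases)
  case 1
  then show ?case using st by (auto simp: half_merged_def blocks_def)
next
  case (2 t s')
  then show ?case by (auto simp: half_merged_def)
next
  case (3 t s')
  let ?lo = "nvar s' ''lo''"
  define mid where "mid = min (?lo + wd) m"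
  define hi where "hi = min (mid + wd) m"
  have H: "half_merged ew f (narr s' ''o2'') m wd ?lo" and t: "t \<le> 13 * ?lo" using 3 by auto
  have eq: "nvar s' ''wd'' = wd" "narr s' ''o'' = f" "nvar s' ''m'' = m" and inp': "inp s'"
    using 3(1) inp f st by (auto simp: unch_def inp_def)
  have lo: "?lo < m" using 3(3) eq by simp
  have mh: "?lo + wd - (?lo + wd - m) = mid" "mid + wd - (mid + wd - m) = hi" unfolding mid_def hi_def by auto
  have lh: "?lo < hi" "hi \<le> m" using lo wd by (auto simp: mid_def hi_def)
  have M: "merged ew f (narr s' ''o2'') ?lo mid hi ?lo mid ?lo"
    by (rule half_merged_start[OF H B lo wd mid_def hi_def])
  let ?s1 = "s'\<lparr>nvar := (nvar s')(''mid'' := mid, ''hi'' := hi, ''i'' := ?lo, ''j'' := mid, ''c'' := ?lo)\<rparr>"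
  have "wp merge_loop ?s1 (\<lambda>t s''. t \<le> 5 * (hi - ?lo) + 1 \<and> (\<exists>i j. merged ew f (narr s'' ''o2'') ?lo mid hi i j hi) \<and>
    (\<forall>x<?lo. narr s'' ''o2'' x = narr ?s1 ''o2'' x))"
    by (rule wp_merge_loop) (use inp' M f eq lh in \<open>auto simp: inp_def\<close>)
  then have "wp merge_loop ?s1 (\<lambda>t' s''. Suc (t + (5 + t' + 1)) \<le> 13 * hi \<and> half_merged ew f (narr s'' ''o2'') m wd hi \<and> nvar s'' ''hi'' = hi)"
  proof (rule wp_frame, goal_cases)
    case (1 t' s'')
    then have "half_merged ew f (narr s'' ''o2'') m wd hi"
      using half_merged_step[OF H lo wd mid_def hi_def] by auto
    moreover have "nvar s'' ''hi'' = hi" using 1(1) by (simp add: unch_def)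
    moreover have "Suc (t + (5 + t' + 1)) \<le> 13 * hi"
      using 1(2) t lh by linarith
    ultimately show ?case by blast
  qed
  then show ?case
    by (simp add: wp_simps mh eq) (erule wp_mono, simp)
next
  case (4 t s')
  have "nvar s' ''m'' = m" using 4(1) inp by (auto simp: unch_def inp_def)
  then have "nvar s' ''lo'' = m" using 4 by (auto simp: half_merged_def)
  then show ?case using 4 by simp
qed

lemma wp_copy_back:
  assumes inp: "inp s" and i: "nvar s ''i'' = 0"
  shows "wp copy_back s (\<lambda>t s'. t \<le> 3 * m + 1 \<and> (\<forall>x<m. narr s' ''o'' x = narr s ''o2'' x))"
  unfolding copy_back_def
  by (rule wp_For[where a = 0 and N = m and I = "\<lambda>j t s'. t \<le> 3 * j \<and> (\<forall>x<j. narr s' ''o'' x = narr s ''o2'' x)"])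
    (use assms in \<open>auto simp: inp_def unch_def wp_simps less_Suc_eq\<close>)

lemma wp_sort_init:
  assumes inp: "inp s" and i: "nvar s ''i'' = 0"
  shows "wp sort_init s (\<lambda>t s'. t \<le> 3 * m + 1 \<and> (\<forall>x<m. narr s' ''o'' x = x))"
  unfolding sort_init_def
  by (rule wp_For[where a = 0 and N = m and I = "\<lambda>j t s'. t \<le> 3 * j \<and> (\<forall>x<j. narr s' ''o'' x = x)"])
    (use assms in \<open>auto simp: inp_def unch_def wp_simps less_Suc_eq\<close>)

definition sorted_state :: "state \<Rightarrow> bool" where
  "sorted_state s \<longleftrightarrow> bij_betw (narr s ''o'') {..<m} {..<m} \<and> srt ew (narr s ''o'') 0 m"

lemma blocks_cong: "(\<And>x. x < N \<Longrightarrow> f x = g x) \<Longrightarrow> blocks W f N wd lo \<longleftrightarrow> blocks W g N wd lo"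
  by (simp add: blocks_def srt_def)

lemma wp_sort_loop:
  assumes inp: "inp s" and o: "\<forall>x<m. narr s ''o'' x = x" and wd: "nvar s ''wd'' = 1"
  shows "wp sort_loop s (\<lambda>t s'. real t \<le> 23 * m * (1 + log 2 (max 1 m)) + 1 \<and> sorted_state s')"
  unfolding sort_loop_def
\<comment> \<open>Before each test the width is \<open>2 ^ p\<close> after \<open>p\<close> passes,
  and \<open>2 ^ (p - 1) < m\<close> because the previous test succeeded. This bounds the number of
  passes by one plus a logarithm; for termination the crude \<open>p \<le> m\<close> is
  enough.\<close>
proof (rule wp_While[where B = "23 * m * m" and I = "\<lambda>t s'. \<exists>p. nvar s' ''wd'' = 2 ^ p \<and> (p = 0 \<or> 2 ^ (p - 1) < m) \<and> t \<le> 23 * m * p \<and>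
    narr s' ''o'' ` {..<m} = {..<m} \<and> blocks ew (narr s' ''o'') m (2 ^ p) m"], goal_cases)
  case 1
  have "narr s ''o'' ` {..<m} = (\<lambda>x. x) ` {..<m}" using o by (intro image_cong) auto
  moreover have "blocks ew (narr s ''o'') m 1 m"
    unfolding blocks_def srt_def
  proof (intro allI impI)
    fix a i j assume "a * 1 \<le> i \<and> i \<le> j \<and> j < min (a * 1 + 1) m"
    then have "i = j" by simp
    then show "ew (narr s ''o'' i) \<le> ew (narr s ''o'' j)" by simp
  qed
  ultimately show ?case using wd by (intro exI[of _ 0]) auto
next
  case (2 t s')
  then obtain p where p: "p = 0 \<or> 2 ^ (p - 1) < m" "t \<le> 23 * m * p" by auto
  have "p - 1 < 2 ^ (p - 1)" by (rule less_exp)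
  then have "p \<le> m \<or> p = 0" using p(1) by linarith
  then have "23 * m * p \<le> 23 * m * m" by auto
  then show ?case using p(2) by linarith
next
  case (3 t s')
  then obtain p where p: "nvar s' ''wd'' = 2 ^ p" "t \<le> 23 * m * p" "narr s' ''o'' ` {..<m} = {..<m}"
    "blocks ew (narr s' ''o'') m (2 ^ p) m" by auto
  have inp': "inp s'" using 3(1) inp by (auto simp: unch_def inp_def copy_back_def)
  then have less: "2 ^ p < m" using 3(3) p by (simp add: inp_def)
  let ?s1 = "s'\<lparr>nvar := (nvar s')(''lo'' := 0)\<rparr>"
  have mp: "wp merge_pass ?s1 (\<lambda>t s''. t \<le> 13 * m + 1 \<and> half_merged ew (narr s' ''o'') (narr s'' ''o2'') m (2 ^ p) m)"
    by (rule wp_merge_pass) (use inp' p in \<open>auto simp: inp_def\<close>)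
  have "wp merge_pass ?s1 (\<lambda>t1 s1. wp copy_back (s1\<lparr>nvar := (nvar s1)(''i'' := 0)\<rparr>)
    (\<lambda>t2 s2. t1 + t2 \<le> 16 * m + 2 \<and> narr s2 ''o'' ` {..<m} = {..<m} \<and> blocks ew (narr s2 ''o'') m (2 ^ Suc p) m \<and>
      nvar s2 ''wd'' = 2 ^ p))"
  proof (rule wp_frame[OF mp], goal_cases)
    case (1 t1 s1)
    have inp1: "inp s1" using 1(1) inp' by (auto simp: unch_def inp_def)
    have "wp copy_back (s1\<lparr>nvar := (nvar s1)(''i'' := 0)\<rparr>) (\<lambda>t s'. t \<le> 3 * m + 1 \<and> (\<forall>x<m. narr s' ''o'' x = narr (s1\<lparr>nvar := (nvar s1)(''i'' := 0)\<rparr>) ''o2'' x))"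
      by (rule wp_copy_back) (use inp1 in \<open>auto simp: inp_def\<close>)
    then show ?case
    proof (rule wp_frame, goal_cases)
      case (1 t2 s2)
      have eq: "\<And>x. x < m \<Longrightarrow> narr s2 ''o'' x = narr s1 ''o2'' x" using 1(2) by simp
      have H: "half_merged ew (narr s' ''o'') (narr s1 ''o2'') m (2 ^ p) m" "t1 \<le> 13 * m + 1"
        using \<open>t1 \<le> 13 * m + 1 \<and> half_merged ew (narr s' ''o'') (narr s1 ''o2'') m (2 ^ p) m\<close> by auto
      have "narr s2 ''o'' ` {..<m} = narr s1 ''o2'' ` {..<m}" using eq by (intro image_cong) auto
      moreover have "blocks ew (narr s2 ''o'') m (2 ^ Suc p) m"
      proof -
        have "(2::nat) ^ p + 2 ^ p = 2 ^ Suc p" by simp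
        then have "blocks ew (narr s1 ''o2'') m (2 ^ Suc p) m" using H(1) unfolding half_merged_def by metis
        then show ?thesis using blocks_cong[of m "narr s2 ''o''" "narr s1 ''o2''"] eq by blast
      qed
      moreover have "nvar s2 ''wd'' = nvar s1 ''wd''" using 1(1) by (simp add: unch_def copy_back_def)
      moreover have "nvar s1 ''wd'' = 2 ^ p" using \<open>unch merge_pass _ s1\<close> p by (simp add: unch_def)
      ultimately show ?case using H 1(2) p unfolding half_merged_def by auto
    qed
  qed
  then show ?case
    unfolding wp_Seq wp_NAssign nval.simps
  proof (elim wp_mono, goal_cases)
    case (1 t1 s1 t2 s2)
    then have "Suc (t + (1 + (t1 + (1 + (t2 + 1))))) \<le> 23 * m * Suc p" using p(2) less by simp
    then show ?case using 1 less by (intro exI[of _ "Suc p"]) simp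
  qed
next
  case (4 t s')
  then obtain p where p: "nvar s' ''wd'' = 2 ^ p" "t \<le> 23 * m * p" "narr s' ''o'' ` {..<m} = {..<m}"
    "blocks ew (narr s' ''o'') m (2 ^ p) m" "p = 0 \<or> 2 ^ (p - 1) < m" by auto
  have "nvar s' ''m'' = m" using 4(1) inp by (auto simp: unch_def inp_def copy_back_def)
  then have ge: "m \<le> 2 ^ p" using 4(3) p by simp
  have "inj_on (narr s' ''o'') {..<m}" using p(3) by (intro eq_card_imp_inj_on) auto
  then have "bij_betw (narr s' ''o'') {..<m} {..<m}" using p(3) by (simp add: bij_betw_def)
  moreover have "srt ew (narr s' ''o'') 0 m"
    using p(4)[unfolded blocks_def, rule_format, of 0] ge by (cases "m = 0") (auto simp: srt_def min_def)
  moreover have "real p \<le> 1 + log 2 (max 1 m)"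
  proof (cases "p = 0")
    case False
    then have "2 ^ (p - 1) \<le> m" using p(5) by simp
    then have "real (2 ^ (p - 1)) \<le> max 1 m" by linarith
    then have "log 2 (real (2 ^ (p - 1))) \<le> log 2 (max 1 m)" by (intro log_mono) auto
    then show ?thesis using False by (simp add: log_nat_power of_nat_diff)
  qed simp
  then have "23 * m * real p \<le> 23 * m * (1 + log 2 (max 1 m))" by (intro mult_left_mono) auto
  moreover have "real t \<le> 23 * m * real p" using p(2) by (metis of_nat_le_iff of_nat_mult of_nat_numeral)
  ultimately show ?case by (auto simp: sorted_state_def)
qed

lemma wp_sort_edges:
  assumes inp: "inp s"
  shows "wp sort_edges s (\<lambda>t s'. real t \<le> 30 * m * (1 + log 2 (max 1 m)) + 5 \<and> sorted_state s')"
  unfolding sort_edges_def wp_Seq wp_NAssign nval.simps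
proof (rule wp_frame[OF wp_sort_init], goal_cases)
  case (3 t1 s1)
  have "wp sort_loop (s1\<lparr>nvar := (nvar s1)(''wd'' := 1)\<rparr>) (\<lambda>t s'. real t \<le> 23 * m * (1 + log 2 (max 1 m)) + 1 \<and> sorted_state s')"
    by (rule wp_sort_loop) (use 3 inp in \<open>auto simp: unch_def inp_def sort_init_def\<close>)
  then show ?case
  proof (rule wp_mono, goal_cases)
    case (1 t2 s2)
    define x where "x = real m * (1 + log 2 (max 1 m))"
    have "real m * 1 \<le> x" unfolding x_def by (intro mult_left_mono) auto
    moreover have "real t1 \<le> 3 * m + 1" using 3(2) by linarith
    moreover have "real t2 \<le> 23 * x + 1" using 1 by (simp add: x_def mult.assoc)
    ultimately have "real (1 + (t1 + (1 + t2))) \<le> 30 * x + 5" by simp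
    then show ?case using 1 by (simp add: x_def mult.assoc)
  qed
qed (use inp in \<open>auto simp: inp_def\<close>)

end

section \<open>Clustering\<close>

definition clear_heights :: com where
  "clear_heights = For ''i'' ''n'' (RStore ''hh'' (NVar ''i'') NZ)"

text \<open>Since \<open>pp i < i\<close>, the downward order visits children before parents, so
  \<open>hh\<close> is final at \<open>i\<close> when it is inspected.\<close>

definition cut_tree :: com where
  "cut_tree = While (NLess (NConst 1) (NVar ''i'')) (
     NAssign ''i'' (NMinus (NVar ''i'') (NConst 1)) ;;
     RAssign ''t'' (RPlus (RArr ''hh'' (NVar ''i'')) (RArr ''key'' (NVar ''i''))) ;;
     Cond (BAnd (BNot (RLess (RVar ''R'') (RVar ''t''))) (RLess (RArr ''key'' (NVar ''i'')) (RVar ''y2'')))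
       (NStore ''cut'' (NVar ''i'') (NConst 0) ;;
        Cond (RLess (RArr ''hh'' (NArr ''pp'' (NVar ''i''))) (RVar ''t''))
          (RStore ''hh'' (NArr ''pp'' (NVar ''i'')) (RVar ''t'')) Skip)
       (NStore ''cut'' (NVar ''i'') (NConst 1)))"

definition label_clusters :: com where
  "label_clusters = For ''i'' ''n'' (
     Cond (NLess (NArr ''cut'' (NVar ''i'')) (NConst 1))
       (NStore ''cid'' (NVar ''i'') (NArr ''cid'' (NArr ''pp'' (NVar ''i''))))
       (NStore ''cid'' (NVar ''i'') (NVar ''i'') ;; incr ''cnt''))"

definition power_loop :: com where
  "power_loop = For ''i'' ''k'' (RAssign ''pw'' (RTimes (RVar ''pw'') (RNat (NVar ''b''))))"

text \<open>The least positive \<open>b\<close> with \<open>b ^ k \<ge> cnt\<close> is found by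
  trial. The powers live in a real register because naturals cannot be multiplied.\<close>

definition root_loop :: com where
  "root_loop = While (RLess (RVar ''pw'') (RNat (NVar ''cnt''))) (
     incr ''b'' ;; RAssign ''pw'' (RNat (NConst 1)) ;; NAssign ''i'' (NConst 0) ;; power_loop)"

definition cluster :: com where
  "cluster = RAssign ''R'' (RDiv (RVar ''y'') (RVar ''q'')) ;; RAssign ''y2'' (RPlus (RVar ''y'') (RVar ''y'')) ;;
     NAssign ''i'' (NConst 0) ;; clear_heights ;; NAssign ''i'' (NVar ''n'') ;; cut_tree ;;
     NStore ''cid'' (NConst 0) (NConst 0) ;; NAssign ''cnt'' (NConst 1) ;; NAssign ''i'' (NConst 1) ;; label_clusters ;;
     NAssign ''b'' (NConst 1) ;; RAssign ''pw'' (RNat (NConst 1)) ;; root_loop"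

lemma cluster_writes [simp]:
  "nws cluster = {''i'', ''cnt'', ''b''}" "rws cluster = {''R'', ''y2'', ''t'', ''pw''}"
  "naws cluster = {''cut'', ''cid''}" "raws cluster = {''hh''}"
  by (auto simp: cluster_def clear_heights_def cut_tree_def label_clusters_def power_loop_def root_loop_def)

text \<open>Brings updates of different record fields into a fixed order, so that equal states
  become syntactically equal.\<close>

lemma upd_norm:
  "s\<lparr>nvar := a, rvar := b\<rparr> = s\<lparr>rvar := b, nvar := a\<rparr>" "s\<lparr>nvar := a, narr := c\<rparr> = s\<lparr>narr := c, nvar := a\<rparr>"
  "s\<lparr>nvar := a, rarr := d\<rparr> = s\<lparr>rarr := d, nvar := a\<rparr>" "s\<lparr>rvar := b, narr := c\<rparr> = s\<lparr>narr := c, rvar := b\<rparr>"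
  "s\<lparr>rvar := b, rarr := d\<rparr> = s\<lparr>rarr := d, rvar := b\<rparr>" "s\<lparr>narr := c, rarr := d\<rparr> = s\<lparr>rarr := d, narr := c\<rparr>"
  for s :: state
  by simp_all

section \<open>The potential argument behind the cuts\<close>

context prim_order
begin

text \<open>The third clause is a potential: the heights of the positions still to be visited, plus
  \<open>R\<close> for every light cut made so far, are covered by the weight of the light tree
  edges already visited.\<close>

definition rev_inv :: "real \<Rightarrow> real \<Rightarrow> nat \<Rightarrow> (nat \<Rightarrow> real) \<Rightarrow> (nat \<Rightarrow> nat) \<Rightarrow> bool" where
  "rev_inv R \<theta> i h ct \<longleftrightarrow>
     (\<forall>j. i \<le> j \<and> 0 < j \<and> j < n \<and> \<not> 0 < ct j \<longrightarrow> key j < \<theta> \<and> h j + key j \<le> h (pp j)) \<and>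
     (\<forall>j<n. 0 \<le> h j \<and> h j \<le> R) \<and>
     (\<Sum>j<i. h j) + R * card {j. i \<le> j \<and> 0 < j \<and> j < n \<and> 0 < ct j \<and> key j < \<theta>} \<le>
       (\<Sum>j | i \<le> j \<and> 0 < j \<and> j < n \<and> key j < \<theta>. key j)"

definition labelled :: "(nat \<Rightarrow> nat) \<Rightarrow> (nat \<Rightarrow> nat) \<Rightarrow> nat \<Rightarrow> bool" where
  "labelled ct cid j \<longleftrightarrow> (\<forall>i<j. cid i = (if i = 0 \<or> 0 < ct i then i else cid (pp i)))"

lemma labelled_Suc:
  assumes L: "labelled ct cid j" and j: "0 < j" "j < n"
  shows "labelled ct (cid(j := (if 0 < ct j then j else cid (pp j)))) (Suc j)"
  unfolding labelled_def
proof (intro allI impI)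
  fix i assume "i < Suc j"
  then consider "i = j" | "i < j" by linarith
  then show "(cid(j := if 0 < ct j then j else cid (pp j))) i = (if i = 0 \<or> 0 < ct i then i else
    (cid(j := if 0 < ct j then j else cid (pp j))) (pp i))"
  proof cases
    case 1
    then show ?thesis using pp[OF j] j by auto
  next
    case 2
    then show ?thesis using L[unfolded labelled_def, rule_format, OF 2] pp[of i] j by auto
  qed
qed

lemma rev_inv_start:
  assumes "0 \<le> R"
  shows "rev_inv R \<theta> n (\<lambda>i. if i < n then 0 else h i) ct"
proof -
  have *: "{j. n \<le> j \<and> 0 < j \<and> j < n \<and> key j < \<theta>} = {}" "{j. n \<le> j \<and> 0 < j \<and> j < n \<and> 0 < ct j \<and> key j < \<theta>} = {}" by auto
  show ?thesis unfolding rev_inv_def * using assms by simp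
qed

lemma light_range:
  assumes "0 < i" "i < n"
  shows "{j. i \<le> j \<and> 0 < j \<and> j < n \<and> key j < \<theta>} =
    (if key i < \<theta> then insert i {j. Suc i \<le> j \<and> 0 < j \<and> j < n \<and> key j < \<theta>}
     else {j. Suc i \<le> j \<and> 0 < j \<and> j < n \<and> key j < \<theta>})"
  using assms by (auto simp: Suc_le_eq le_less)

lemma light_sum:
  assumes "0 < i" "i < n"
  shows "(\<Sum>j | i \<le> j \<and> 0 < j \<and> j < n \<and> key j < \<theta>. key j) =
    (if key i < \<theta> then key i else 0) + (\<Sum>j | Suc i \<le> j \<and> 0 < j \<and> j < n \<and> key j < \<theta>. key j)"
  unfolding light_range[OF assms] by auto

text \<open>The new height of the parent is a maximum, hence at most the sum of the two nonnegative
  candidates. So \<open>h i\<close> leaves the sum of heights, at most \<open>h i + key i\<close>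
  enters it, and the difference is paid by the edge, which is light.\<close>

lemma rev_inv_merge:
  assumes I: "rev_inv R \<theta> (Suc i) h ct" and i: "0 < i" "i < n" and R: "h i + key i \<le> R" "key i < \<theta>"
  shows "rev_inv R \<theta> i (if h (pp i) < h i + key i then h(pp i := h i + key i) else h) (ct(i := 0))"
proof -
  define h' where "h' = (if h (pp i) < h i + key i then h(pp i := h i + key i) else h)"
  have p: "pp i < i" using pp i by blast
  have hh: "h j \<le> h' j" for j by (auto simp: h'_def)
  have hj: "h' j = h j" if "i \<le> j" for j using that p by (auto simp: h'_def)
  have hp: "h i + key i \<le> h' (pp i)" by (auto simp: h'_def)
  have h0: "0 \<le> h j \<and> h j \<le> R" if "j < n" for j using I that by (simp add: rev_inv_def)
  have k: "0 < key i" using key_pos i by blast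
  have "(\<Sum>j<i. h' j) \<le> (\<Sum>j<i. h j) + (h i + key i)"
  proof -
    have "(\<Sum>j<i. h' j) = h' (pp i) + (\<Sum>j\<in>{..<i} - {pp i}. h' j)" using p by (simp add: sum.remove)
    also have "(\<Sum>j\<in>{..<i} - {pp i}. h' j) = (\<Sum>j\<in>{..<i} - {pp i}. h j)" by (intro sum.cong) (auto simp: h'_def)
    also have "h' (pp i) \<le> h (pp i) + (h i + key i)" using h0[of i] h0[of "pp i"] i p k by (auto simp: h'_def)
    also have "h (pp i) + (h i + key i) + (\<Sum>j\<in>{..<i} - {pp i}. h j) = (\<Sum>j<i. h j) + (h i + key i)"
      using p by (simp add: sum.remove[of "{..<i}" "pp i"])
    finally show ?thesis by simp
  qed
  moreover have "{j. i \<le> j \<and> 0 < j \<and> j < n \<and> 0 < (ct(i := 0)) j \<and> key j < \<theta>} =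
    {j. Suc i \<le> j \<and> 0 < j \<and> j < n \<and> 0 < ct j \<and> key j < \<theta>}" by (auto simp: Suc_le_eq le_less)
  moreover have "(\<Sum>j<Suc i. h j) + R * card {j. Suc i \<le> j \<and> 0 < j \<and> j < n \<and> 0 < ct j \<and> key j < \<theta>} \<le>
       (\<Sum>j | Suc i \<le> j \<and> 0 < j \<and> j < n \<and> key j < \<theta>. key j)" using I by (simp add: rev_inv_def)
  ultimately have 3: "(\<Sum>j<i. h' j) + R * card {j. i \<le> j \<and> 0 < j \<and> j < n \<and> 0 < (ct(i := 0)) j \<and> key j < \<theta>} \<le>
       (\<Sum>j | i \<le> j \<and> 0 < j \<and> j < n \<and> key j < \<theta>. key j)" using R(2) light_sum[OF i, of \<theta>] by simp
  have 2: "\<forall>j<n. 0 \<le> h' j \<and> h' j \<le> R" using h0 R(1) h0[OF i(2)] k by (auto simp: h'_def)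
  have 1: "key j < \<theta> \<and> h' j + key j \<le> h' (pp j)" if j: "i \<le> j \<and> 0 < j \<and> j < n \<and> \<not> 0 < (ct(i := 0)) j" for j
  proof (cases "j = i")
    case True
    then show ?thesis using R hp hj by simp
  next
    case False
    then have "key j < \<theta>" "h j + key j \<le> h (pp j)" using I j by (auto simp: rev_inv_def)
    then show ?thesis using hj[of j] hh[of "pp j"] j by auto
  qed
  show ?thesis unfolding h'_def[symmetric] rev_inv_def using 1 2 3 by blast
qed

text \<open>A light edge is cut because \<open>h i + key i > R\<close>: the height
  \<open>h i\<close> leaves the sum and \<open>key i\<close> joins the right side, and together they
  pay for \<open>R\<close>. A heavy cut is not counted.\<close>

lemma rev_inv_cut:
  assumes I: "rev_inv R \<theta> (Suc i) h ct" and i: "0 < i" "i < n" and R: "\<not> (h i + key i \<le> R \<and> key i < \<theta>)" "0 \<le> R"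
  shows "rev_inv R \<theta> i h (ct(i := 1))"
proof -
  have h0: "0 \<le> h i" using I i by (simp add: rev_inv_def)
  let ?C = "{j. Suc i \<le> j \<and> 0 < j \<and> j < n \<and> 0 < ct j \<and> key j < \<theta>}"
  have C: "{j. i \<le> j \<and> 0 < j \<and> j < n \<and> 0 < (ct(i := 1)) j \<and> key j < \<theta>} = (if key i < \<theta> then insert i ?C else ?C)"
    using i by (auto simp: Suc_le_eq le_less)
  have "R * card (if key i < \<theta> then insert i ?C else ?C) \<le> R * card ?C + (if key i < \<theta> then h i + key i else 0)"
    using R by (auto simp: algebra_simps)
  moreover have "(\<Sum>j<Suc i. h j) + R * card ?C \<le> (\<Sum>j | Suc i \<le> j \<and> 0 < j \<and> j < n \<and> key j < \<theta>. key j)"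
    using I by (simp add: rev_inv_def)
  ultimately have 3: "(\<Sum>j<i. h j) + R * card {j. i \<le> j \<and> 0 < j \<and> j < n \<and> 0 < (ct(i := 1)) j \<and> key j < \<theta>} \<le>
       (\<Sum>j | i \<le> j \<and> 0 < j \<and> j < n \<and> key j < \<theta>. key j)"
    unfolding C light_sum[OF i, of \<theta>] using h0 by (auto split: if_splits)
  have 1: "key j < \<theta> \<and> h j + key j \<le> h (pp j)" if j: "i \<le> j \<and> 0 < j \<and> j < n \<and> \<not> 0 < (ct(i := 1)) j" for j
  proof -
    have "j \<noteq> i" using j by auto
    then show ?thesis using I j by (auto simp: rev_inv_def)
  qed
  have 2: "\<forall>j<n. 0 \<le> h j \<and> h j \<le> R" using I by (simp add: rev_inv_def)
  show ?thesis unfolding rev_inv_def using 1 2 3 by blast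
qed

lemma rev_inv_clustering:
  assumes I: "rev_inv R \<theta> 1 h ct" and cid: "\<forall>i<n. cid i = (if i = 0 \<or> 0 < ct i then i else cid (pp i))" and n: "0 < n"
  shows "clustering R \<theta> h (\<lambda>i. 0 < ct i) cid"
proof -
  have "{j. 1 \<le> j \<and> 0 < j \<and> j < n \<and> 0 < ct j \<and> key j < \<theta>} = light_cuts \<theta> (\<lambda>i. 0 < ct i)"
    by (auto simp: light_cuts_def)
  moreover have "(\<Sum>j | 1 \<le> j \<and> 0 < j \<and> j < n \<and> key j < \<theta>. key j) = light_weight \<theta>"
    unfolding light_weight_def by (intro sum.cong) auto
  moreover have "0 \<le> (\<Sum>j<1. h j)" using I n by (simp add: rev_inv_def)
  ultimately have "R * card (light_cuts \<theta> (\<lambda>i. 0 < ct i)) \<le> light_weight \<theta>"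
    using I unfolding rev_inv_def by simp
  then show ?thesis using I cid unfolding clustering_def rev_inv_def by auto
qed

end

context spanner_input
begin

lemma q_pos: "0 < q"
proof -
  have "0 < 1 / (2 * real k - 1)" using k by simp
  then show ?thesis using q(1) by linarith
qed

lemma wp_clear_heights:
  assumes "inp s" "nvar s ''i'' = 0"
  shows "wp clear_heights s (\<lambda>t s'. t \<le> 3 * n + 1 \<and> (\<exists>h. rarr s' ''hh'' = (\<lambda>i. if i < n then 0 else h i)))"
  unfolding clear_heights_def
  by (rule wp_For[where a = 0 and N = n and I = "\<lambda>j t s'. t \<le> 3 * j \<and> (\<exists>h. rarr s' ''hh'' = (\<lambda>i. if i < j then 0 else h i))"])
    (use assms in \<open>auto simp: inp_def wp_simps fun_eq_iff less_Suc_eq\<close>)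

lemma wp_cut_tree:
  assumes P: "prim_order n E w ord pos pp key" and st: "narr s ''pp'' = pp" "rarr s ''key'' = key" "rvar s ''R'' = R" "rvar s ''y2'' = \<theta>"
    and R: "0 \<le> R" and I: "prim_order.rev_inv n pp key R \<theta> n (rarr s ''hh'') (narr s ''cut'')" and i: "nvar s ''i'' = n"
  shows "wp cut_tree s (\<lambda>t s'. t \<le> 7 * n + 1 \<and> prim_order.rev_inv n pp key R \<theta> 1 (rarr s' ''hh'') (narr s' ''cut''))"
proof -
  interpret prim_order n E w ord pos pp key by (rule P)
  show ?thesis
    unfolding cut_tree_def
  proof (rule wp_While[where B = "7 * n" and I = "\<lambda>t s'. 1 \<le> nvar s' ''i'' \<and> t + 7 * nvar s' ''i'' \<le> 7 * n \<and>
      rev_inv R \<theta> (nvar s' ''i'') (rarr s' ''hh'') (narr s' ''cut'')"], goal_cases)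
    case 1
    then show ?case using I i n_pos by simp
  next
    case (3 t s')
    then obtain i' where i': "nvar s' ''i'' = Suc i'" "0 < i'" by (cases "nvar s' ''i''") auto
    have lt: "i' < n" "Suc (t + 6) + 7 * i' \<le> 7 * n" using 3(2) i' by auto
    have eq: "narr s' ''pp'' = pp" "rarr s' ''key'' = key" "rvar s' ''R'' = R" "rvar s' ''y2'' = \<theta>"
      using 3(1) st by (auto simp: unch_def)
    have J: "rev_inv R \<theta> (Suc i') (rarr s' ''hh'') (narr s' ''cut'')" using 3(2) i' by simp
    let ?h = "rarr s' ''hh''"
    show ?case
    proof (cases "\<not> R < ?h i' + key i' \<and> key i' < \<theta>")
      case True
      then have "rev_inv R \<theta> i' (if ?h (pp i') < ?h i' + key i' then ?h(pp i' := ?h i' + key i') else ?h) ((narr s' ''cut'')(i' := 0))"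
        using rev_inv_merge[OF J i'(2) lt(1)] by simp
      then show ?thesis using True i' lt by (auto simp: wp_simps eq)
    next
      case False
      then have "rev_inv R \<theta> i' ?h ((narr s' ''cut'')(i' := 1))"
        using rev_inv_cut[OF J i'(2) lt(1) _ R] by auto
      then show ?thesis using False i' lt by (auto simp: wp_simps eq)
    qed
  next
    case (4 t s')
    then have "nvar s' ''i'' = 1" by auto
    then show ?case using 4 by auto
  qed auto
qed

lemma wp_label_clusters:
  assumes P: "prim_order n E w ord pos pp key" and st: "narr s ''pp'' = pp" "narr s ''cid'' 0 = 0" "nvar s ''cnt'' = 1" "nvar s ''i'' = 1"
    and inp: "inp s" and ct: "ct = narr s ''cut''"
  shows "wp label_clusters s (\<lambda>t s'. t \<le> 5 * n + 1 \<and>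
    (\<forall>i<n. narr s' ''cid'' i = (if i = 0 \<or> 0 < ct i then i else narr s' ''cid'' (pp i))) \<and>
    nvar s' ''cnt'' = 1 + card {i. 0 < i \<and> i < n \<and> 0 < ct i})"
proof -
  interpret prim_order n E w ord pos pp key by (rule P)
  show ?thesis
    unfolding label_clusters_def
  proof (rule wp_For[where a = 1 and N = n and I = "\<lambda>j t s'. t \<le> 5 * j \<and>
    labelled ct (narr s' ''cid'') j \<and>
    nvar s' ''cnt'' = 1 + card {i. 0 < i \<and> i < j \<and> 0 < ct i}"], goal_cases)
    case (8 j t s')
    have eq: "narr s' ''pp'' = pp" "narr s' ''cut'' = ct" using 8(3) st ct by (auto simp: unch_def)
    have set: "{i. 0 < i \<and> i < Suc j \<and> 0 < ct i} = (if 0 < ct j then insert j {i. 0 < i \<and> i < j \<and> 0 < ct i} else {i. 0 < i \<and> i < j \<and> 0 < ct i})"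
      using 8(1) by (auto simp: less_Suc_eq)
    have L: "labelled ct ((narr s' ''cid'')(j := (if 0 < ct j then j else narr s' ''cid'' (pp j)))) (Suc j)"
      by (rule labelled_Suc) (use 8 in auto)
    show ?case using 8(4,5) set L
      by (cases "0 < ct j") (simp_all add: wp_simps eq)
  next
    case 7
    then show ?case using st by (auto simp: less_Suc_eq labelled_def)
  next
    case (9 t s')
    then show ?case by (auto simp: labelled_def)
  qed (use assms n_pos in \<open>auto simp: inp_def\<close>)
qed

lemma wp_power_loop:
  assumes "inp s" "nvar s ''i'' = 0" "rvar s ''pw'' = 1"
  shows "wp power_loop s (\<lambda>t s'. t \<le> 3 * k + 1 \<and> rvar s' ''pw'' = real (nvar s ''b'' ^ k))"
  unfolding power_loop_def
  by (rule wp_For[where a = 0 and N = k and I = "\<lambda>j t s'. t \<le> 3 * j \<and> rvar s' ''pw'' = real (nvar s ''b'' ^ j)"])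
    (use assms in \<open>auto simp: inp_def wp_simps unch_def\<close>)

lemma wp_root_loop:
  assumes inp: "inp s" and st: "nvar s ''b'' = 1" "rvar s ''pw'' = 1" "nvar s ''cnt'' = c"
  shows "wp root_loop s (\<lambda>t s'. t \<le> (3 * k + 5) * nvar s' ''b'' \<and> 1 \<le> nvar s' ''b'' \<and> c \<le> nvar s' ''b'' ^ k \<and>
    (nvar s' ''b'' = 1 \<or> (nvar s' ''b'' - 1) ^ k < c))"
  unfolding root_loop_def
proof (rule wp_While[where B = "(3 * k + 5) * Suc c" and I = "\<lambda>t s'. 1 \<le> nvar s' ''b'' \<and> rvar s' ''pw'' = real (nvar s' ''b'' ^ k) \<and>
    t \<le> (3 * k + 5) * (nvar s' ''b'' - 1) \<and> (nvar s' ''b'' = 1 \<or> (nvar s' ''b'' - 1) ^ k < c)"], goal_cases)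
  case (2 t s')
  \<comment> \<open>As \<open>k \<ge> 1\<close>, \<open>b - 1 \<le> (b - 1) ^ k < c\<close> unless
    \<open>b = 1\<close>, which bounds the number of trials.\<close>
  have "(nvar s' ''b'' - 1) \<le> (nvar s' ''b'' - 1) ^ k \<or> nvar s' ''b'' - 1 = 0"
    using k by (metis le_less_trans less_one not_le self_le_power)
  then have "nvar s' ''b'' - 1 \<le> Suc c" using 2 by auto
  then have "(3 * k + 5) * (nvar s' ''b'' - 1) \<le> (3 * k + 5) * Suc c" by (rule mult_le_mono2)
  then show ?case using 2 by linarith
next
  case (3 t s')
  let ?b = "nvar s' ''b''"
  let ?s1 = "s'\<lparr>nvar := (nvar s')(''b'' := Suc ?b, ''i'' := 0), rvar := (rvar s')(''pw'' := 1)\<rparr>"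
  have c: "nvar s' ''cnt'' = c" and inp': "inp s'" using 3(1) st inp by (auto simp: unch_def power_loop_def inp_def)
  have "wp power_loop ?s1 (\<lambda>t s'. t \<le> 3 * k + 1 \<and> rvar s' ''pw'' = real (nvar ?s1 ''b'' ^ k))"
    by (rule wp_power_loop) (use inp' in \<open>auto simp: inp_def\<close>)
  then have "wp power_loop ?s1 (\<lambda>t s'. t \<le> 3 * k + 1 \<and> rvar s' ''pw'' = real (Suc ?b ^ k) \<and> nvar s' ''b'' = Suc ?b)"
    by (rule wp_frame) (auto simp: unch_def power_loop_def)
  then have W: "wp power_loop ?s1 (\<lambda>t' s''. Suc (t + (3 + t')) \<le> (3 * k + 5) * ?b \<and> rvar s'' ''pw'' = real (Suc ?b ^ k) \<and> nvar s'' ''b'' = Suc ?b)"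
  proof (rule wp_mono, goal_cases)
    case (1 t' s'')
    have "(3 * k + 5) * ?b = (3 * k + 5) * (?b - 1) + (3 * k + 5)" using 3(2) by (cases ?b) auto
    then show ?case using 1 3(2) by auto
  qed
  have "real (?b ^ k) < real c" using 3(2,3) c by simp
  then have "?b ^ k < c" by (simp only: of_nat_less_iff)
  then show ?case using W by (simp add: wp_simps upd_norm) (erule wp_mono, auto)
next
  case (4 t s')
  let ?b = "nvar s' ''b''"
  have c: "nvar s' ''cnt'' = c" using 4(1) st by (auto simp: unch_def power_loop_def)
  have "real c \<le> real (?b ^ k)" using 4(2,3) c by simp
  then have "c \<le> ?b ^ k" by (simp only: of_nat_le_iff)
  moreover have "(3 * k + 5) * ?b = (3 * k + 5) * (?b - 1) + (3 * k + 5)" using 4(2) by (cases ?b) auto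
  ultimately show ?case using 4(2) by simp
qed (use st in auto)

lemma wp_cluster:
  assumes P: "prim_order n E w ord pos pp key" and st: "narr s ''pp'' = pp" "rarr s ''key'' = key"
    and inp: "inp s" and y: "rvar s ''y'' = x" "0 < x"
  shows "wp cluster s (\<lambda>t s'. t \<le> 30 * n + (3 * k + 5) * nvar s' ''b'' \<and>
    rvar s' ''R'' = x / q \<and> rvar s' ''y2'' = 2 * x \<and>
    (\<exists>h ct. prim_order.clustering n pp key (x / q) (2 * x) h ct (narr s' ''cid'') \<and>
      (let c = 1 + card {i. 0 < i \<and> i < n \<and> ct i}; b = nvar s' ''b'' in
        1 \<le> b \<and> c \<le> b ^ k \<and> (b = 1 \<or> (b - 1) ^ k < c))))"
proof -
  interpret prim_order n E w ord pos pp key by (rule P)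
  let ?s1 = "s\<lparr>rvar := (rvar s)(''R'' := x / q, ''y2'' := x + x), nvar := (nvar s)(''i'' := 0)\<rparr>"
  have R: "0 \<le> x / q" using y q_pos by simp
  have q: "rvar s ''q'' = q" using inp by (simp add: inp_def)
  have 1: "wp clear_heights ?s1 (\<lambda>t s'. t \<le> 3 * n + 1 \<and> (\<exists>h. rarr s' ''hh'' = (\<lambda>i. if i < n then 0 else h i)))"
    by (rule wp_clear_heights) (use inp in \<open>auto simp: inp_def\<close>)
  have "wp (clear_heights ;; NAssign ''i'' (NVar ''n'') ;; cut_tree) ?s1 (\<lambda>t s'. t \<le> 10 * n + 3 \<and> rev_inv (x / q) (x + x) 1 (rarr s' ''hh'') (narr s' ''cut''))"
    unfolding wp_Seq wp_NAssign
  proof (rule wp_frame[OF 1], goal_cases)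
    case (1 t1 s2)
    then obtain h where h: "rarr s2 ''hh'' = (\<lambda>i. if i < n then 0 else h i)" by blast
    have un: "narr s2 ''pp'' = pp" "rarr s2 ''key'' = key" "rvar s2 ''R'' = x / q" "rvar s2 ''y2'' = x + x" "nvar s2 ''n'' = n"
      using 1(1) st inp by (auto simp: unch_def clear_heights_def inp_def)
    have "wp cut_tree (s2\<lparr>nvar := (nvar s2)(''i'' := nval (NVar ''n'') s2)\<rparr>) (\<lambda>t s'. t \<le> 7 * n + 1 \<and> rev_inv (x / q) (x + x) 1 (rarr s' ''hh'') (narr s' ''cut''))"
      by (rule wp_cut_tree[OF P]) (use un R h rev_inv_start[OF R] in auto)
    then show ?case by (rule wp_mono) (use 1(2) in auto)
  qed
  then have A: "wp (clear_heights ;; NAssign ''i'' (NVar ''n'') ;; cut_tree) ?s1 (\<lambda>t s'. t \<le> 10 * n + 3 \<and>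
     rev_inv (x / q) (x + x) 1 (rarr s' ''hh'') (narr s' ''cut'') \<and> inp s' \<and> narr s' ''pp'' = pp \<and> rvar s' ''R'' = x / q \<and> rvar s' ''y2'' = x + x)"
    by (rule wp_frame) (use inp st in \<open>auto simp: unch_def clear_heights_def cut_tree_def inp_def\<close>)
  have B: "wp (NStore ''cid'' (NConst 0) (NConst 0) ;; NAssign ''cnt'' (NConst 1) ;; NAssign ''i'' (NConst 1) ;; label_clusters ;;
     NAssign ''b'' (NConst 1) ;; RAssign ''pw'' (RNat (NConst 1)) ;; root_loop) s2
     (\<lambda>t s'. t \<le> 5 * n + 7 + (3 * k + 5) * nvar s' ''b'' \<and> rvar s' ''R'' = x / q \<and> rvar s' ''y2'' = x + x \<and>
       clustering (x / q) (x + x) (rarr s2 ''hh'') (\<lambda>i. 0 < narr s2 ''cut'' i) (narr s' ''cid'') \<and>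
      (let c = 1 + card {i. 0 < i \<and> i < n \<and> 0 < narr s2 ''cut'' i}; b = nvar s' ''b'' in
        1 \<le> b \<and> c \<le> b ^ k \<and> (b = 1 \<or> (b - 1) ^ k < c)))"
    if s2: "rev_inv (x / q) (x + x) 1 (rarr s2 ''hh'') (narr s2 ''cut'') \<and> inp s2 \<and> narr s2 ''pp'' = pp \<and> rvar s2 ''R'' = x / q \<and> rvar s2 ''y2'' = x + x" for s2
  proof -
    let ?s3 = "s2\<lparr>narr := (narr s2)(''cid'' := (narr s2 ''cid'')(0 := 0)), nvar := (nvar s2)(''cnt'' := 1, ''i'' := 1)\<rparr>"
    let ?ct = "narr s2 ''cut''"
    have L: "wp label_clusters ?s3 (\<lambda>t s'. t \<le> 5 * n + 1 \<and>
      (\<forall>i<n. narr s' ''cid'' i = (if i = 0 \<or> 0 < ?ct i then i else narr s' ''cid'' (pp i))) \<and>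
      nvar s' ''cnt'' = 1 + card {i. 0 < i \<and> i < n \<and> 0 < ?ct i})"
      by (rule wp_label_clusters[OF P]) (use s2 in \<open>auto simp: inp_def\<close>)
    show ?thesis
      unfolding wp_Seq wp_NAssign wp_NStore wp_RAssign nval.simps rval.simps
    proof (simp add: fun_upd_twist[of "''i''" "''cnt''"], rule wp_frame[OF L[simplified]], goal_cases)
      case (1 t3 s3)
      have inp3: "inp s3" using 1(1) s2 by (auto simp: unch_def label_clusters_def inp_def)
      have cl: "clustering (x / q) (x + x) (rarr s2 ''hh'') (\<lambda>i. 0 < ?ct i) (narr s3 ''cid'')"
        by (rule rev_inv_clustering) (use s2 1(2) n_pos in auto)
      have "wp root_loop (s3\<lparr>nvar := (nvar s3)(''b'' := 1), rvar := (rvar s3)(''pw'' := 1)\<rparr>)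
        (\<lambda>t s'. t \<le> (3 * k + 5) * nvar s' ''b'' \<and> 1 \<le> nvar s' ''b'' \<and> 1 + card {i. 0 < i \<and> i < n \<and> 0 < ?ct i} \<le> nvar s' ''b'' ^ k \<and>
        (nvar s' ''b'' = 1 \<or> (nvar s' ''b'' - 1) ^ k < 1 + card {i. 0 < i \<and> i < n \<and> 0 < ?ct i}))"
        by (rule wp_root_loop) (use inp3 1(2) in \<open>auto simp: inp_def\<close>)
      then have "wp root_loop (s3\<lparr>nvar := (nvar s3)(''b'' := 1), rvar := (rvar s3)(''pw'' := 1)\<rparr>)
        (\<lambda>t4 s'. Suc (Suc (Suc (t3 + Suc (Suc t4)))) \<le> 5 * n + 7 + (3 * k + 5) * nvar s' ''b'' \<and> rvar s' ''R'' = x / q \<and> rvar s' ''y2'' = x + x \<and>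
         clustering (x / q) (x + x) (rarr s2 ''hh'') (\<lambda>i. 0 < narr s2 ''cut'' i) (narr s' ''cid'') \<and>
        (let c = 1 + card {i. 0 < i \<and> i < n \<and> 0 < narr s2 ''cut'' i}; b = nvar s' ''b'' in
          1 \<le> b \<and> c \<le> b ^ k \<and> (b = 1 \<or> (b - 1) ^ k < c)))"
      proof (rule wp_frame, goal_cases)
        case (1 t4 s4)
        have "narr s4 ''cid'' = narr s3 ''cid''" "rvar s4 ''R'' = rvar s3 ''R''" "rvar s4 ''y2'' = rvar s3 ''y2''"
          using 1(1) by (auto simp: unch_def root_loop_def power_loop_def)
        moreover have "rvar s3 ''R'' = x / q" "rvar s3 ''y2'' = x + x"
          using \<open>unch label_clusters _ s3\<close> s2 by (auto simp: unch_def label_clusters_def)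
        ultimately show ?case using 1(2) cl \<open>t3 \<le> _ \<and> _\<close> by (simp add: Let_def)
      qed
      then show ?case by (simp add: upd_norm)
    qed
  qed
  have Q: "wp (clear_heights ;; NAssign ''i'' (NVar ''n'') ;; cut_tree) ?s1 (\<lambda>t1 s2. wp (NStore ''cid'' (NConst 0) (NConst 0) ;; NAssign ''cnt'' (NConst 1) ;; NAssign ''i'' (NConst 1) ;; label_clusters ;;
     NAssign ''b'' (NConst 1) ;; RAssign ''pw'' (RNat (NConst 1)) ;; root_loop) s2 (\<lambda>t2 s'. 3 + t1 + t2 \<le> 30 * n + (3 * k + 5) * nvar s' ''b'' \<and> rvar s' ''R'' = x / q \<and> rvar s' ''y2'' = 2 * x \<and>
    (\<exists>h ct. clustering (x / q) (2 * x) h ct (narr s' ''cid'') \<and>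
      (let c = 1 + card {i. 0 < i \<and> i < n \<and> ct i}; b = nvar s' ''b'' in
        1 \<le> b \<and> c \<le> b ^ k \<and> (b = 1 \<or> (b - 1) ^ k < c)))))"
  proof (rule wp_mono[OF A], goal_cases)
    case (1 t1 s2)
    have "x + x = 2 * x" by simp
    show ?case
      by (rule wp_mono[OF B[OF conjunct2[OF 1]]]) (use 1 n_pos in \<open>unfold \<open>x + x = 2 * x\<close>, force\<close>)
  qed
  have eight: "8 + a = Suc (Suc (Suc (Suc (Suc (Suc (Suc (Suc a)))))))" for a :: nat by simp
  show ?thesis
    unfolding cluster_def using Q y q by (simp add: wp_Seq wp_RAssign wp_NAssign add.assoc eight)
qed

end

section \<open>Ball growing in the cluster graph\<close>

text \<open>The flag \<open>del\<close> marks the interiors of earlier balls as well as the clusters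
  already queued; in both cases the cell requires no new output edge.\<close>

definition scan_adj :: com where
  "scan_adj = While (NLess (NConst 0) (NVar ''h'')) (
     NAssign ''h'' (NMinus (NVar ''h'') (NConst 1)) ;;
     NAssign ''d'' (NArr ''tgt'' (NVar ''h'')) ;;
     Cond (NLess (NArr ''del'' (NVar ''d'')) (NConst 1))
       (NStore ''del'' (NVar ''d'') (NConst 1) ;;
        NStore ''que'' (NVar ''hi'') (NVar ''d'') ;; incr ''hi'' ;;
        NStore ''outsrc'' (NVar ''outm'') (NArr ''src'' (NArr ''he'' (NVar ''h''))) ;;
        NStore ''outdst'' (NVar ''outm'') (NArr ''dst'' (NArr ''he'' (NVar ''h''))) ;; incr ''outm'') Skip ;;
     NAssign ''h'' (NArr ''nxh'' (NVar ''h'')))"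

definition expand :: com where
  "expand = For ''lo'' ''old'' (NAssign ''h'' (NArr ''head'' (NArr ''que'' (NVar ''lo''))) ;; scan_adj)"

text \<open>In a round, \<open>old\<close> is the size of the ball before and \<open>hi\<close> its
  size after; the first round that grows it by a factor of at most \<open>b\<close> is the
  last.\<close>

definition grow_loop :: com where
  "grow_loop = While (NLess (NConst 0) (NVar ''go'')) (
     NAssign ''old'' (NVar ''hi'') ;; expand ;;
     Cond (RLess (RTimes (RNat (NVar ''b'')) (RNat (NVar ''old''))) (RNat (NVar ''hi''))) Skip (NAssign ''go'' (NConst 0)))"

text \<open>The last layer does not belong to the interior, so its flags are cleared and its
  clusters remain available to later balls.\<close>

definition release :: com where
  "release = While (NLess (NVar ''old'') (NVar ''hi'')) (
     NAssign ''hi'' (NMinus (NVar ''hi'') (NConst 1)) ;;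
     NStore ''del'' (NArr ''que'' (NVar ''hi'')) (NConst 0))"

definition grow :: com where
  "grow = NStore ''que'' (NConst 0) (NVar ''a'') ;; NStore ''del'' (NVar ''a'') (NConst 1) ;;
     NAssign ''lo'' (NConst 0) ;; NAssign ''hi'' (NConst 1) ;; NAssign ''go'' (NConst 1) ;; grow_loop ;; release"

lemma scan_adj_writes [simp]:
  "nws scan_adj = {''h'', ''d'', ''hi'', ''outm''}" "rws scan_adj = {}"
  "naws scan_adj = {''del'', ''que'', ''outsrc'', ''outdst''}" "raws scan_adj = {}"
  by (auto simp: scan_adj_def)

lemma expand_writes [simp]:
  "nws expand = {''lo'', ''h'', ''d'', ''hi'', ''outm''}" "rws expand = {}"
  "naws expand = {''del'', ''que'', ''outsrc'', ''outdst''}" "raws expand = {}"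
  by (auto simp: expand_def)

lemma grow_loop_writes [simp]:
  "nws grow_loop = {''old'', ''go'', ''lo'', ''h'', ''d'', ''hi'', ''outm''}" "rws grow_loop = {}"
  "naws grow_loop = {''del'', ''que'', ''outsrc'', ''outdst''}" "raws grow_loop = {}"
  by (auto simp: grow_loop_def)

lemma release_writes [simp]:
  "nws release = {''hi''}" "rws release = {}" "naws release = {''del''}" "raws release = {}"
  by (auto simp: release_def)

lemma grow_writes [simp]:
  "nws grow = {''old'', ''go'', ''lo'', ''h'', ''d'', ''hi'', ''outm''}" "rws grow = {}"
  "naws grow = {''del'', ''que'', ''outsrc'', ''outdst''}" "raws grow = {}"
  by (auto simp: grow_def)

text \<open>Linked lists with \<open>0\<close> as null pointer and \<open>Suc x\<close> pointing to the cell \<open>x\<close>.\<close>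

primrec chain :: "(nat \<Rightarrow> nat) \<Rightarrow> nat \<Rightarrow> nat list \<Rightarrow> bool" where
  "chain nx h [] \<longleftrightarrow> h = 0"
| "chain nx h (x # l) \<longleftrightarrow> h = Suc x \<and> chain nx (nx x) l"

definition edges_of :: "nat \<Rightarrow> (nat \<Rightarrow> nat) \<Rightarrow> (nat \<Rightarrow> nat) \<Rightarrow> nat set set" where
  "edges_of om os od = (\<lambda>j. {os j, od j}) ` {..<om}"

lemma edges_of_Suc: "edges_of (Suc om) (os(om := u)) (od(om := v)) = insert {u, v} (edges_of om os od)"
proof -
  have "(\<lambda>j. {(os(om := u)) j, (od(om := v)) j}) ` {..<om} = (\<lambda>j. {os j, od j}) ` {..<om}"
    by (intro image_cong) auto
  then show ?thesis by (simp add: edges_of_def lessThan_Suc)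
qed

text \<open>The output is append-only. Therefore a detour found once stays valid
  (\<open>reach_superset\<close>), and new entries can be constrained by \<open>P\<close>
  separately.\<close>

definition out_ext :: "(nat set \<Rightarrow> bool) \<Rightarrow> nat \<Rightarrow> (nat \<Rightarrow> nat) \<Rightarrow> (nat \<Rightarrow> nat) \<Rightarrow>
    nat \<Rightarrow> (nat \<Rightarrow> nat) \<Rightarrow> (nat \<Rightarrow> nat) \<Rightarrow> bool" where
  "out_ext P om0 os0 od0 om os od \<longleftrightarrow> om0 \<le> om \<and> (\<forall>j<om0. os j = os0 j \<and> od j = od0 j) \<and>
     (\<forall>j. om0 \<le> j \<and> j < om \<longrightarrow> P {os j, od j})"

lemma out_ext_refl: "out_ext P om os od om os od"
  by (auto simp: out_ext_def)

lemma out_ext_trans: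
  "out_ext P a as ad b bs bd \<Longrightarrow> out_ext P b bs bd c cs cd \<Longrightarrow> out_ext P a as ad c cs cd"
  unfolding out_ext_def by (auto simp: order_less_le_trans) (metis not_le)

lemma out_ext_Suc: "out_ext P a as ad om os od \<Longrightarrow> P {u, v} \<Longrightarrow> out_ext P a as ad (Suc om) (os(om := u)) (od(om := v))"
  by (auto simp: out_ext_def less_Suc_eq)

lemma out_ext_edges: "out_ext P a as ad b bs bd \<Longrightarrow> edges_of a as ad \<subseteq> edges_of b bs bd"
  unfolding out_ext_def edges_of_def by force

text \<open>The cluster graph as an abstract multigraph: \<open>L c\<close> lists the adjacency
  cells at \<open>c\<close>, \<open>tg x\<close> is the far end of cell \<open>x\<close>, and
  \<open>{ex x, ey x}\<close> the underlying edge of the input. All geometry is condensed in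
  \<open>Lw\<close>, which bounds one step between cluster roots once this edge and the tree
  \<open>T\<close> are in the output.\<close>

locale ball_graph =
  fixes n :: nat and w :: "nat set \<Rightarrow> real" and ord :: "nat \<Rightarrow> nat" and T :: "nat set set"
    and V :: "nat set" and L :: "nat \<Rightarrow> nat list" and tg ex ey :: "nat \<Rightarrow> nat" and P :: "nat set \<Rightarrow> bool"
    and Lw :: real and b k :: nat
  assumes finV: "finite V" and tgV: "\<And>c x. c \<in> V \<Longrightarrow> x \<in> set (L c) \<Longrightarrow> tg x \<in> V"
    and opposite: "\<And>c x. c \<in> V \<Longrightarrow> x \<in> set (L c) \<Longrightarrow> \<exists>x'\<in>set (L (tg x)). tg x' = c"
    and out: "\<And>c x. c \<in> V \<Longrightarrow> x \<in> set (L c) \<Longrightarrow> P {ex x, ey x}"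
    and step: "\<And>c x H. c \<in> V \<Longrightarrow> x \<in> set (L c) \<Longrightarrow> {ex x, ey x} \<in> H \<Longrightarrow> T \<subseteq> H \<Longrightarrow>
      reach {..<n} H w (ord c) (ord (tg x)) Lw"
    and ordV: "\<And>c. c \<in> V \<Longrightarrow> ord c < n" and Lw: "0 \<le> Lw" and b: "1 \<le> b" and k: "1 \<le> k" and cardV: "card V \<le> b ^ k"
begin

section \<open>Breadth-first search with a growth test\<close>

definition adj_state :: "state \<Rightarrow> bool" where
  "adj_state s \<longleftrightarrow> nvar s ''b'' = b \<and> (\<forall>c\<in>V. chain (narr s ''nxh'') (narr s ''head'' c) (L c) \<and> (\<forall>x\<in>set (L c).
     narr s ''tgt'' x = tg x \<and> narr s ''src'' (narr s ''he'' x) = ex x \<and> narr s ''dst'' (narr s ''he'' x) = ey x))"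

text \<open>A snapshot inside a round: queue positions below \<open>old\<close> lie within
  \<open>r\<close> steps of the centre \<open>a\<close>, later ones within \<open>r + 1\<close>; the
  lists at positions below \<open>lo\<close> and the part \<open>l1\<close> of the next list have
  been scanned. The equation \<open>om + 1 = om0 + hi\<close> says that every queued cluster except
  the centre contributed one edge. The final clause charges queue entries to scanned cells, for the
  running time.\<close>

definition ball :: "nat set \<Rightarrow> nat \<Rightarrow> nat \<Rightarrow> nat \<Rightarrow> nat \<Rightarrow> nat list \<Rightarrow> nat \<Rightarrow> (nat \<Rightarrow> nat) \<Rightarrow> (nat \<Rightarrow> nat) \<Rightarrow>
    nat \<Rightarrow> (nat \<Rightarrow> nat) \<Rightarrow> (nat \<Rightarrow> nat) \<Rightarrow> nat \<Rightarrow> (nat \<Rightarrow> nat) \<Rightarrow> (nat \<Rightarrow> nat) \<Rightarrow> bool" where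
  "ball D0 a r old lo l1 hi qu dl om0 os0 od0 om os od \<longleftrightarrow>
     old \<le> hi \<and> 0 < hi \<and> qu 0 = a \<and> inj_on qu {..<hi} \<and> qu ` {..<hi} \<subseteq> V - D0 \<and>
     (\<forall>c\<in>V. 0 < dl c \<longleftrightarrow> c \<in> D0 \<union> qu ` {..<hi}) \<and>
     (\<forall>i<hi. reach {..<n} (edges_of om os od) w (ord a) (ord (qu i)) (real (if i < old then r else Suc r) * Lw)) \<and>
     (\<forall>i<lo. \<forall>x\<in>set (L (qu i)). tg x \<in> D0 \<union> qu ` {..<hi}) \<and>
     (\<forall>x\<in>set l1. tg x \<in> D0 \<union> qu ` {..<hi}) \<and>
     out_ext P om0 os0 od0 om os od \<and> om + 1 = om0 + hi \<and> T \<subseteq> edges_of om0 os0 od0 \<and>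
     hi \<le> Suc ((\<Sum>i<lo. length (L (qu i))) + length l1)"

lemma ball_skip:
  assumes "ball D0 a r old lo l1 hi qu dl om0 os0 od0 om os od" "lo < hi" "x \<in> set (L (qu lo))" "0 < dl (tg x)"
  shows "ball D0 a r old lo (l1 @ [x]) hi qu dl om0 os0 od0 om os od"
proof -
  have "qu lo \<in> V" using assms(1,2) by (auto simp: ball_def)
  then have "tg x \<in> V" using tgV assms(3) by blast
  then have "tg x \<in> D0 \<union> qu ` {..<hi}" using assms(1,4) by (simp add: ball_def)
  then show ?thesis using assms(1) by (simp add: ball_def)
qed

text \<open>The cell is scanned from a cluster within \<open>r\<close> steps of the centre, so one
  more step of length \<open>Lw\<close>, through the edge just output, reaches the new
  cluster.\<close>

lemma ball_add:
  assumes B: "ball D0 a r old lo l1 hi qu dl om0 os0 od0 om os od" and lo: "lo < old" and x: "x \<in> set (L (qu lo))"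
    and d: "\<not> 0 < dl (tg x)"
  shows "ball D0 a r old lo (l1 @ [x]) (Suc hi) (qu(hi := tg x)) (dl(tg x := 1)) om0 os0 od0
    (Suc om) (os(om := ex x)) (od(om := ey x))"
proof -
  let ?H = "edges_of om os od" and ?H' = "edges_of (Suc om) (os(om := ex x)) (od(om := ey x))"
  let ?q = "qu(hi := tg x)"
  have b: "old \<le> hi" "0 < hi" "qu 0 = a" "inj_on qu {..<hi}" "qu ` {..<hi} \<subseteq> V - D0"
     "\<forall>c\<in>V. 0 < dl c \<longleftrightarrow> c \<in> D0 \<union> qu ` {..<hi}"
     "\<And>i. i<hi \<Longrightarrow> reach {..<n} ?H w (ord a) (ord (qu i)) (real (if i < old then r else Suc r) * Lw)"
     "\<forall>i<lo. \<forall>x\<in>set (L (qu i)). tg x \<in> D0 \<union> qu ` {..<hi}"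
     "\<forall>x\<in>set l1. tg x \<in> D0 \<union> qu ` {..<hi}"
     "out_ext P om0 os0 od0 om os od" "om + 1 = om0 + hi" "T \<subseteq> edges_of om0 os0 od0"
     "hi \<le> Suc ((\<Sum>i<lo. length (L (qu i))) + length l1)"
    using B by (auto simp: ball_def)
  have "qu lo \<in> qu ` {..<hi}" using lo b(1) by simp
  then have c: "qu lo \<in> V" using b(5) by blast
  then have tV: "tg x \<in> V" using tgV x by blast
  then have new: "tg x \<notin> D0" "tg x \<notin> qu ` {..<hi}" using b(6) d by auto
  have im: "?q ` {..<Suc hi} = insert (tg x) (qu ` {..<hi})"
  proof -
    have "?q ` {..<hi} = qu ` {..<hi}" by (intro image_cong) auto
    then show ?thesis by (simp only: lessThan_Suc image_insert fun_upd_same)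
  qed
  have HH: "?H \<subseteq> ?H'" by (auto simp: edges_of_Suc)
  have inj: "inj_on ?q {..<Suc hi}"
  proof -
    have "inj_on ?q {..<hi}" using b(4) by (intro inj_on_cong[THEN iffD1, OF _ b(4)]) auto
    moreover have "?q ` {..<hi} = qu ` {..<hi}" by (intro image_cong) auto
    ultimately show ?thesis using new(2) by (simp only: lessThan_Suc inj_on_insert) auto
  qed
  have qlo: "?q i = qu i" if "i < hi" for i using that by simp
  have reach: "reach {..<n} ?H' w (ord a) (ord (?q i)) (real (if i < old then r else Suc r) * Lw)" if i: "i < Suc hi" for i
  proof (cases "i = hi")
    case False
    then have "i < hi" using i by simp
    then show ?thesis using reach_superset[OF b(7) HH] by simp
  next
    case True
    have TH: "T \<subseteq> ?H'" using b(12) out_ext_edges[OF b(10)] HH by blast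
    have "reach {..<n} ?H' w (ord (qu lo)) (ord (tg x)) Lw"
      by (rule step[OF c x _ TH]) (simp add: edges_of_Suc)
    moreover have "reach {..<n} ?H' w (ord a) (ord (qu lo)) (real r * Lw)"
      using reach_superset[OF b(7)[of lo] HH] lo b(1) by simp
    ultimately have "reach {..<n} ?H' w (ord a) (ord (tg x)) (real r * Lw + Lw)" by (rule reach_trans[rotated])
    then show ?thesis using True b(1) by (simp add: algebra_simps)
  qed
  have sm: "(\<Sum>i<lo. length (L (?q i))) = (\<Sum>i<lo. length (L (qu i)))"
    using lo b(1) by (intro sum.cong) auto
  show ?thesis
    unfolding ball_def im sm
  proof (intro conjI)
    show "\<forall>c\<in>V. (0 < (dl(tg x := 1)) c) = (c \<in> D0 \<union> insert (tg x) (qu ` {..<hi}))" using b(6) by auto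
    show "\<forall>i<Suc hi. reach {..<n} ?H' w (ord a) (ord (?q i)) (real (if i < old then r else Suc r) * Lw)"
      using reach by blast
    show "\<forall>i<lo. \<forall>y\<in>set (L (?q i)). tg y \<in> D0 \<union> insert (tg x) (qu ` {..<hi})"
      using b(8) lo b(1) by auto
    show "out_ext P om0 os0 od0 (Suc om) (os(om := ex x)) (od(om := ey x))"
      by (rule out_ext_Suc[OF b(10) out[OF c x]])
    show "insert (tg x) (qu ` {..<hi}) \<subseteq> V - D0" using b(5) tV new by blast
  qed (use b inj in auto)
qed

lemma ball_next:
  assumes "ball D0 a r old lo (L (qu lo)) hi qu dl om0 os0 od0 om os od"
  shows "ball D0 a r old (Suc lo) [] hi qu dl om0 os0 od0 om os od"
  using assms by (auto simp: ball_def less_Suc_eq)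

lemma ball_round:
  assumes "ball D0 a r old lo [] hi qu dl om0 os0 od0 om os od"
  shows "ball D0 a (Suc r) hi lo [] hi qu dl om0 os0 od0 om os od"
proof -
  have "real (if i < old then r else Suc r) * Lw \<le> real (Suc r) * Lw" for i
    using Lw by (intro mult_right_mono) auto
  then have "reach {..<n} (edges_of om os od) w (ord a) (ord (qu i)) (real (if i < hi then Suc r else Suc (Suc r)) * Lw)"
    if "i < hi" for i
  proof -
    have "reach {..<n} (edges_of om os od) w (ord a) (ord (qu i)) (real (if i < old then r else Suc r) * Lw)"
      using assms that unfolding ball_def by blast
    then have "reach {..<n} (edges_of om os od) w (ord a) (ord (qu i)) (real (Suc r) * Lw)"
      by (rule reach_mono) fact
    then show ?thesis using that by simp
  qed
  then show ?thesis using assms by (auto simp: ball_def)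
qed

lemma ball_card: "ball D0 a r old lo l1 hi qu dl om0 os0 od0 om os od \<Longrightarrow> hi \<le> card V"
  unfolding ball_def using card_mono[OF finV, of "qu ` {..<hi}"] by (auto simp: card_image)

abbreviation (input) ballS where
  "ballS D0 a r old lo l1 om0 os0 od0 s \<equiv> ball D0 a r old lo l1 (nvar s ''hi'') (narr s ''que'') (narr s ''del'') om0 os0 od0
     (nvar s ''outm'') (narr s ''outsrc'') (narr s ''outdst'')"

lemma wp_scan_adj:
  assumes A: "adj_state s" and B: "ballS D0 a r old lo [] om0 os0 od0 s" and lo: "lo < old"
    and h: "nvar s ''h'' = narr s ''head'' (narr s ''que'' lo)"
  shows "wp scan_adj s (\<lambda>t s'. t \<le> 12 * length (L (narr s ''que'' lo)) + 1 \<and>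
    ballS D0 a r old lo (L (narr s ''que'' lo)) om0 os0 od0 s' \<and> (\<forall>i<old. narr s' ''que'' i = narr s ''que'' i))"
proof -
  define c where "c = narr s ''que'' lo"
  have "c \<in> narr s ''que'' ` {..<nvar s ''hi''}" using B lo by (simp add: ball_def c_def)
  then have cV: "c \<in> V" using B unfolding ball_def by blast
  show ?thesis
    unfolding scan_adj_def c_def[symmetric]
  proof (rule wp_While[where B = "12 * length (L c)" and I = "\<lambda>t s'. \<exists>l1 l2. L c = l1 @ l2 \<and> chain (narr s ''nxh'') (nvar s' ''h'') l2 \<and>
      ballS D0 a r old lo l1 om0 os0 od0 s' \<and> t \<le> 12 * length l1 \<and> (\<forall>i<old. narr s' ''que'' i = narr s ''que'' i)"], goal_cases)
    case 1
    show ?case using A B cV h by (intro exI[of _ "[]"] exI[of _ "L c"]) (auto simp: adj_state_def c_def)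
  next
    case (3 t s')
    then obtain l1 l2 where l: "L c = l1 @ l2" "chain (narr s ''nxh'') (nvar s' ''h'') l2"
      "ballS D0 a r old lo l1 om0 os0 od0 s'" "t \<le> 12 * length l1" "\<forall>i<old. narr s' ''que'' i = narr s ''que'' i" by blast
    obtain x l3 where x: "l2 = x # l3" using l(2) 3(3) by (cases l2) auto
    then have hx: "nvar s' ''h'' = Suc x" "chain (narr s ''nxh'') (narr s ''nxh'' x) l3" using l(2) by auto
    have xc: "x \<in> set (L c)" "L c = (l1 @ [x]) @ l3" using l(1) x by auto
    have ql: "narr s' ''que'' lo = c" using l(5) lo by (simp add: c_def)
    have eq: "narr s' ''tgt'' x = tg x" "narr s' ''src'' (narr s' ''he'' x) = ex x" "narr s' ''dst'' (narr s' ''he'' x) = ey x"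
      "narr s' ''nxh'' = narr s ''nxh''"
      using 3(1) A cV xc by (auto simp: unch_def adj_state_def)
    have oh: "old \<le> nvar s' ''hi''" using l(3) by (simp add: ball_def)
    show ?case
    proof (cases "0 < narr s' ''del'' (tg x)")
      case True
      have "ballS D0 a r old lo (l1 @ [x]) om0 os0 od0 s'"
        using ball_skip[OF l(3)] oh lo xc ql True by simp
      then show ?thesis using True l(4,5) hx xc
        by (simp add: wp_simps eq) (rule exI[of _ "l1 @ [x]"], rule exI[of _ l3], simp)
    next
      case False
      have "ball D0 a r old lo (l1 @ [x]) (Suc (nvar s' ''hi'')) ((narr s' ''que'')(nvar s' ''hi'' := tg x)) ((narr s' ''del'')(tg x := 1)) om0 os0 od0
        (Suc (nvar s' ''outm'')) ((narr s' ''outsrc'')(nvar s' ''outm'' := ex x)) ((narr s' ''outdst'')(nvar s' ''outm'' := ey x))"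
        using ball_add[OF l(3) lo] xc ql False by simp
      then show ?thesis using False l(4,5) hx xc oh
        by (simp add: wp_simps eq) (rule exI[of _ "l1 @ [x]"], rule exI[of _ l3], simp)
    qed
  next
    case (4 t s')
    then obtain l1 l2 where l: "L c = l1 @ l2" "chain (narr s ''nxh'') (nvar s' ''h'') l2"
      "ballS D0 a r old lo l1 om0 os0 od0 s'" "t \<le> 12 * length l1" "\<forall>i<old. narr s' ''que'' i = narr s ''que'' i" by blast
    have "l2 = []" using l(2) 4(3) by (cases l2) auto
    then show ?case using l by simp
  qed auto
qed

lemma wp_expand:
  assumes A: "adj_state s" and B: "ballS D0 a r old lo [] om0 os0 od0 s" and lo: "lo \<le> old"
    and st: "nvar s ''lo'' = lo" "nvar s ''old'' = old"
  shows "wp expand s (\<lambda>t s'. t \<le> (\<Sum>i\<in>{lo..<old}. 12 * length (L (narr s' ''que'' i)) + 4) + 1 \<and>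
    ballS D0 a r old old [] om0 os0 od0 s' \<and> (\<forall>i<old. narr s' ''que'' i = narr s ''que'' i) \<and> nvar s' ''lo'' = old)"
  unfolding expand_def
proof (rule wp_For[where a = lo and N = old and I = "\<lambda>j t s'. t \<le> (\<Sum>i\<in>{lo..<j}. 12 * length (L (narr s ''que'' i)) + 4) \<and>
    ballS D0 a r old j [] om0 os0 od0 s' \<and> (\<forall>i<old. narr s' ''que'' i = narr s ''que'' i)"], goal_cases)
  case (8 j t s')
  have A': "adj_state s'" using A 8(3) by (auto simp: adj_state_def unch_def)
  let ?s1 = "s'\<lparr>nvar := (nvar s')(''h'' := narr s' ''head'' (narr s' ''que'' j))\<rparr>"
  have "wp scan_adj ?s1 (\<lambda>t s''. t \<le> 12 * length (L (narr ?s1 ''que'' j)) + 1 \<and>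
    ballS D0 a r old j (L (narr ?s1 ''que'' j)) om0 os0 od0 s'' \<and> (\<forall>i<old. narr s'' ''que'' i = narr ?s1 ''que'' i))"
    by (rule wp_scan_adj) (use A' 8 in \<open>auto simp: adj_state_def\<close>)
  then have "wp scan_adj ?s1 (\<lambda>t' s''. t + Suc t' + 2 \<le> (\<Sum>i\<in>{lo..<Suc j}. 12 * length (L (narr s ''que'' i)) + 4) \<and>
    ballS D0 a r old (Suc j) [] om0 os0 od0 s'' \<and> (\<forall>i<old. narr s'' ''que'' i = narr s ''que'' i))"
  proof (rule wp_mono, goal_cases)
    case (1 t' s'')
    have q: "narr s' ''que'' j = narr s ''que'' j" "narr s'' ''que'' j = narr s ''que'' j" using 1 8 by auto
    then have "ballS D0 a r old (Suc j) [] om0 os0 od0 s''" using 1 by (intro ball_next) simp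
    moreover have "(\<Sum>i\<in>{lo..<Suc j}. 12 * length (L (narr s ''que'' i)) + 4) =
      (\<Sum>i\<in>{lo..<j}. 12 * length (L (narr s ''que'' i)) + 4) + (12 * length (L (narr s ''que'' j)) + 4)"
      using 8(1) by simp
    ultimately show ?case using 1 8 q by simp
  qed
  then show ?case using 8(1,4) by (simp add: wp_simps)
next
  case (9 t s')
  have "(\<Sum>i\<in>{lo..<old}. 12 * length (L (narr s' ''que'' i)) + 4) = (\<Sum>i\<in>{lo..<old}. 12 * length (L (narr s ''que'' i)) + 4)"
    using 9 by (intro sum.cong) auto
  then show ?case using 9 by simp
qed (use B lo st in auto)

text \<open>The queue lists distinct clusters of \<open>V\<close>. This turns the cost of the
  scanned prefix into a bound known in advance, as \<open>wp_While\<close> requires.\<close>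

lemma sum_queue_le:
  fixes g :: "nat \<Rightarrow> nat"
  assumes "ball D0 a r old lo l1 hi qu dl om0 os0 od0 om os od" "j \<le> hi"
  shows "(\<Sum>i<j. g (qu i)) \<le> sum g V"
proof -
  have inj: "inj_on qu {..<j}" using assms by (auto simp: ball_def intro: inj_on_subset)
  have "(\<Sum>i<j. g (qu i)) = sum g (qu ` {..<j})" by (simp only: sum.reindex[OF inj] o_def)
  also have "\<dots> \<le> sum g V"
  proof (intro sum_mono2 finV)
    have "qu ` {..<j} \<subseteq> qu ` {..<hi}" using assms(2) by (intro image_mono) auto
    moreover have "qu ` {..<hi} \<subseteq> V - D0" using assms(1) by (simp add: ball_def)
    ultimately show "qu ` {..<j} \<subseteq> V" by blast
  qed simp
  finally show ?thesis .
qed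

definition gcost :: "(nat \<Rightarrow> nat) \<Rightarrow> nat \<Rightarrow> nat" where
  "gcost qu lo = (\<Sum>i<lo. 12 * length (L (qu i)) + 20)"

lemma wp_grow_loop:
  assumes A: "adj_state s" and B: "ballS D0 a 0 1 0 [] om0 os0 od0 s"
    and st: "nvar s ''lo'' = 0" "nvar s ''go'' = 1" "nvar s ''hi'' = 1"
  shows "wp grow_loop s (\<lambda>t s'. \<exists>r<k. t \<le> gcost (narr s' ''que'') (nvar s' ''old'') + 1 \<and>
     ballS D0 a r (nvar s' ''old'') (nvar s' ''old'') [] om0 os0 od0 s' \<and> 1 \<le> nvar s' ''old'' \<and> nvar s' ''hi'' \<le> b * nvar s' ''old'')"
  unfolding grow_loop_def
proof (rule wp_While[where B = "\<Sum>c\<in>V. 12 * length (L c) + 20" and I = "\<lambda>t s'. \<exists>r<k. t \<le> gcost (narr s' ''que'') (nvar s' ''lo'') \<and>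
    (if 0 < nvar s' ''go'' then nvar s' ''lo'' < nvar s' ''hi'' \<and> (r = 0 \<or> b ^ r < nvar s' ''hi'') \<and>
        ballS D0 a r (nvar s' ''hi'') (nvar s' ''lo'') [] om0 os0 od0 s'
     else nvar s' ''lo'' = nvar s' ''old'' \<and> 1 \<le> nvar s' ''old'' \<and> nvar s' ''hi'' \<le> b * nvar s' ''old'' \<and>
       ballS D0 a r (nvar s' ''old'') (nvar s' ''old'') [] om0 os0 od0 s')"], goal_cases)
  case 1
  show ?case using B st k by (intro exI[of _ 0]) (auto simp: gcost_def)
next
  case (2 t s')
  then obtain r where r: "t \<le> gcost (narr s' ''que'') (nvar s' ''lo'') \<and> (if 0 < nvar s' ''go'' then nvar s' ''lo'' < nvar s' ''hi'' \<and> (r = 0 \<or> b ^ r < nvar s' ''hi'') \<and>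
        ballS D0 a r (nvar s' ''hi'') (nvar s' ''lo'') [] om0 os0 od0 s'
     else nvar s' ''lo'' = nvar s' ''old'' \<and> 1 \<le> nvar s' ''old'' \<and> nvar s' ''hi'' \<le> b * nvar s' ''old'' \<and>
       ballS D0 a r (nvar s' ''old'') (nvar s' ''old'') [] om0 os0 od0 s')" by blast
  have "\<exists>old lo. ballS D0 a r old lo [] om0 os0 od0 s' \<and> nvar s' ''lo'' \<le> nvar s' ''hi''"
  proof (cases "0 < nvar s' ''go''")
    case True
    then show ?thesis using r by auto
  next
    case False
    then have "ballS D0 a r (nvar s' ''old'') (nvar s' ''old'') [] om0 os0 od0 s'" "nvar s' ''lo'' = nvar s' ''old''" using r by auto
    moreover from this have "nvar s' ''old'' \<le> nvar s' ''hi''" by (simp add: ball_def)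
    ultimately show ?thesis by auto
  qed
  then obtain old lo where B: "ballS D0 a r old lo [] om0 os0 od0 s'" "nvar s' ''lo'' \<le> nvar s' ''hi''" by blast
  show ?case using sum_queue_le[OF B, of "\<lambda>c. 12 * length (L c) + 20"] r unfolding gcost_def by linarith
next
  case (3 t s')
  then obtain r where r: "r < k" "t \<le> gcost (narr s' ''que'') (nvar s' ''lo'')" "nvar s' ''lo'' < nvar s' ''hi''"
    "r = 0 \<or> b ^ r < nvar s' ''hi''" "ballS D0 a r (nvar s' ''hi'') (nvar s' ''lo'') [] om0 os0 od0 s'" by auto
  let ?hi = "nvar s' ''hi''" and ?lo = "nvar s' ''lo''"
  let ?s1 = "s'\<lparr>nvar := (nvar s')(''old'' := ?hi)\<rparr>"
  have A': "adj_state s'" using A 3(1) by (auto simp: adj_state_def unch_def)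
  then have b': "nvar s' ''b'' = b" by (simp add: adj_state_def)
  have "wp expand ?s1 (\<lambda>t s''. t \<le> (\<Sum>i\<in>{?lo..<?hi}. 12 * length (L (narr s'' ''que'' i)) + 4) + 1 \<and>
    ballS D0 a r ?hi ?hi [] om0 os0 od0 s'' \<and> (\<forall>i<?hi. narr s'' ''que'' i = narr ?s1 ''que'' i) \<and> nvar s'' ''lo'' = ?hi)"
    by (rule wp_expand) (use A' r in \<open>auto simp: adj_state_def\<close>)
  then have "wp (expand ;; Cond (RLess (RTimes (RNat (NVar ''b'')) (RNat (NVar ''old''))) (RNat (NVar ''hi''))) Skip (NAssign ''go'' (NConst 0))) ?s1
    (\<lambda>t' s''. \<exists>r<k. Suc (t + Suc t') \<le> gcost (narr s'' ''que'') (nvar s'' ''lo'') \<and>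
    (if 0 < nvar s'' ''go'' then nvar s'' ''lo'' < nvar s'' ''hi'' \<and> (r = 0 \<or> b ^ r < nvar s'' ''hi'') \<and>
        ballS D0 a r (nvar s'' ''hi'') (nvar s'' ''lo'') [] om0 os0 od0 s''
     else nvar s'' ''lo'' = nvar s'' ''old'' \<and> 1 \<le> nvar s'' ''old'' \<and> nvar s'' ''hi'' \<le> b * nvar s'' ''old'' \<and>
       ballS D0 a r (nvar s'' ''old'') (nvar s'' ''old'') [] om0 os0 od0 s''))"
    unfolding wp_Seq
  proof (rule wp_frame, goal_cases)
    case (1 t1 s2)
    have eq: "nvar s2 ''old'' = ?hi" "nvar s2 ''b'' = b" "nvar s2 ''go'' = nvar s' ''go''" "nvar s2 ''lo'' = ?hi"
      using 1 b' by (auto simp: unch_def)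
    have go: "0 < nvar s' ''go''" using 3(3) by simp
    have B2: "ballS D0 a r ?hi ?hi [] om0 os0 od0 s2" using 1(2) by blast
    \<comment> \<open>The constant 20 per entry in \<open>gcost\<close> exceeds the 4 spent by
      \<open>expand\<close>. As every round starts with \<open>lo < hi\<close>, the surplus of at
      least 16 pays for the overhead of the round.\<close>
    have cost: "Suc (t + Suc (t1 + 2)) \<le> gcost (narr s2 ''que'') ?hi"
    proof -
      have "gcost (narr s' ''que'') ?lo = gcost (narr s2 ''que'') ?lo"
        unfolding gcost_def using 1(2) r(3) by (intro sum.cong) auto
      moreover have "gcost (narr s2 ''que'') ?hi = gcost (narr s2 ''que'') ?lo + (\<Sum>i\<in>{?lo..<?hi}. 12 * length (L (narr s2 ''que'' i)) + 20)"
        unfolding gcost_def using r(3) by (simp add: sum.atLeastLessThan_concat[of 0, symmetric] lessThan_atLeast0)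
      moreover have "(\<Sum>i\<in>{?lo..<?hi}. 12 * length (L (narr s2 ''que'' i)) + 20) = (\<Sum>i\<in>{?lo..<?hi}. 12 * length (L (narr s2 ''que'' i)) + 4) + 16 * (?hi - ?lo)"
        by (simp add: sum.distrib)
      ultimately show ?thesis using 1(2) r(2,3) by linarith
    qed
    have "1 \<le> ?hi" using r(3) by simp
    show ?case
    proof (cases "b * ?hi < nvar s2 ''hi''")
      case True
      have "b ^ r \<le> ?hi" using r(4) \<open>1 \<le> ?hi\<close> by auto
      then have "b ^ Suc r \<le> b * ?hi" by simp
      then have 1: "b ^ Suc r < nvar s2 ''hi''" using True by (rule le_less_trans)
      \<comment> \<open>After \<open>Suc r\<close> growing rounds the ball has more than
        \<open>b ^ Suc r\<close> clusters, while \<open>V\<close> has at most \<open>b ^ k\<close>.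
        This keeps the radius below \<open>k\<close>.\<close>
      then have "b ^ Suc r < b ^ k" using ball_card[OF B2] cardV by simp
      then have "Suc r < k" using b by (metis leI less_le_not_le power_increasing)
      moreover have "1 * ?hi \<le> b * ?hi" using b by (rule mult_le_mono1)
      then have "?hi < nvar s2 ''hi''" using True by linarith
      moreover have "real b * real ?hi < real (nvar s2 ''hi'')" using True by (simp only: of_nat_mult[symmetric] of_nat_less_iff)
      ultimately show ?thesis
        using go 1 cost ball_round[OF B2] by (auto simp: wp_simps eq intro!: exI[of _ "Suc r"])
    next
      case False
      have "\<not> real b * real ?hi < real (nvar s2 ''hi'')" using False by (simp only: of_nat_mult[symmetric] of_nat_less_iff not_False_eq_True)
      then show ?thesis
        using go cost B2 False r(1) \<open>1 \<le> ?hi\<close> by (auto simp: wp_simps eq intro!: exI[of _ "r"])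
    qed
  qed
  then show ?case by (simp add: wp_Seq wp_NAssign)
next
  case (4 t s')
  then show ?case by auto
qed

definition deleted :: "(nat \<Rightarrow> nat) \<Rightarrow> nat set \<Rightarrow> bool" where
  "deleted dl A \<longleftrightarrow> (\<forall>c\<in>V. 0 < dl c \<longleftrightarrow> c \<in> A)"

lemma wp_release:
  assumes B: "ballS D0 a r old lo l1 om0 os0 od0 s" and st: "nvar s ''old'' = old"
  shows "wp release s (\<lambda>t s'. t \<le> 3 * (nvar s ''hi'' - old) + 1 \<and> deleted (narr s' ''del'') (D0 \<union> narr s ''que'' ` {..<old}))"
proof -
  define hi where "hi = nvar s ''hi''"
  define qu where "qu = narr s ''que''"
  have b: "old \<le> hi" "inj_on qu {..<hi}" "qu ` {..<hi} \<subseteq> V - D0" "deleted (narr s ''del'') (D0 \<union> qu ` {..<hi})"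
    using B unfolding ball_def hi_def qu_def deleted_def by auto
  show ?thesis
    unfolding release_def hi_def[symmetric] qu_def[symmetric]
  proof (rule wp_While[where B = "3 * (hi - old)" and I = "\<lambda>t s'. \<exists>h. nvar s' ''hi'' = h \<and> old \<le> h \<and> h \<le> hi \<and>
      t + 3 * (h - old) \<le> 3 * (hi - old) \<and> deleted (narr s' ''del'') (D0 \<union> qu ` {..<h})"], goal_cases)
    case 1
    then show ?case using b by (auto simp: hi_def)
  next
    case (3 t s')
    have un: "nvar s' ''old'' = old" "narr s' ''que'' = qu" using 3(1) st by (auto simp: unch_def qu_def)
    from 3 un obtain h where h: "nvar s' ''hi'' = Suc h" "old \<le> h" "Suc h \<le> hi"
      "t + 3 * (Suc h - old) \<le> 3 * (hi - old)" "deleted (narr s' ''del'') (D0 \<union> qu ` {..<Suc h})"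
      by (cases "nvar s' ''hi''") auto
    have "qu h \<in> qu ` {..<hi}" using h(3) by simp
    then have "qu h \<in> V - D0" using b(3) by blast
    moreover have "qu h \<notin> qu ` {..<h}"
    proof
      assume "qu h \<in> qu ` {..<h}"
      then obtain x where "x < h" "qu h = qu x" by blast
      then show False using inj_onD[OF b(2), of h x] h(3) by simp
    qed
    ultimately have "deleted ((narr s' ''del'')(qu h := 0)) (D0 \<union> qu ` {..<h})"
      using h(5) unfolding deleted_def by (auto simp: lessThan_Suc)
    then show ?case using h by (auto simp: wp_simps un)
  next
    case (4 t s')
    have un: "nvar s' ''old'' = old" using 4(1) st by (auto simp: unch_def)
    then show ?case using 4 by auto
  qed auto
qed

lemma ball_start:
  assumes "a \<in> V" "a \<notin> D0" "deleted dl D0" "T \<subseteq> edges_of om os od"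
  shows "ball D0 a 0 1 0 [] 1 (qu(0 := a)) (dl(a := 1)) om os od om os od"
  using assms ordV[of a] by (auto simp: ball_def deleted_def out_ext_refl lessThan_Suc intro!: reach_refl)

text \<open>An interior cluster is within \<open>r\<close> steps of the centre and its neighbours
  outside \<open>D0\<close> within \<open>r + 1\<close>, so the detour through the centre has at
  most \<open>2 r + 1 \<le> 2 k - 1\<close> steps. The search tree has \<open>hi - 1\<close> edges
  and \<open>hi \<le> b * old\<close>, so each interior cluster pays for \<open>b\<close> of them;
  interiors of different balls are disjoint.\<close>

lemma ball_final:
  assumes B: "ball D0 a r old old [] hi qu dl om0 os0 od0 om os od" and r: "r < k" and hi: "hi \<le> b * old" and "0 < old"
  shows "qu ` {..<old} \<subseteq> V - D0" "om \<le> om0 + b * card (qu ` {..<old})" "0 < hi" "qu 0 = a"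
    "\<And>c x. c \<in> qu ` {..<old} \<Longrightarrow> x \<in> set (L c) \<Longrightarrow>
       tg x \<in> D0 \<or> reach {..<n} (edges_of om os od) w (ord c) (ord (tg x)) ((2 * real k - 1) * Lw)"
    "3 * (hi - old) + gcost qu old \<le> (\<Sum>c\<in>qu ` {..<old}. 15 * length (L c) + 20)"
proof -
  have b: "old \<le> hi" "0 < hi" "qu 0 = a" "inj_on qu {..<hi}" "qu ` {..<hi} \<subseteq> V - D0"
     "\<And>i. i<hi \<Longrightarrow> reach {..<n} (edges_of om os od) w (ord a) (ord (qu i)) (real (if i < old then r else Suc r) * Lw)"
     "\<forall>i<old. \<forall>x\<in>set (L (qu i)). tg x \<in> D0 \<union> qu ` {..<hi}" "om + 1 = om0 + hi"
     "hi \<le> Suc (\<Sum>i<old. length (L (qu i)))"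
    using B by (auto simp: ball_def)
  have sub: "qu ` {..<old} \<subseteq> qu ` {..<hi}" using b(1) by (intro image_mono) auto
  show "qu ` {..<old} \<subseteq> V - D0" using sub b(5) by blast
  have inj: "inj_on qu {..<old}" using b(4) by (rule inj_on_subset) (use b(1) in auto)
  then have "card (qu ` {..<old}) = old" by (simp add: card_image)
  then show "om \<le> om0 + b * card (qu ` {..<old})" using b(8) hi by simp
  show "0 < hi" "qu 0 = a" by fact+
  show "tg x \<in> D0 \<or> reach {..<n} (edges_of om os od) w (ord c) (ord (tg x)) ((2 * real k - 1) * Lw)"
    if cx: "c \<in> qu ` {..<old}" "x \<in> set (L c)" for c x
  proof -
    obtain i where i: "i < old" "c = qu i" using cx by auto
    then consider "tg x \<in> D0" | j where "j < hi" "tg x = qu j" using b(7) cx by blast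
    then show ?thesis
    proof cases
      case 2
      have "reach {..<n} (edges_of om os od) w (ord a) (ord c) (real r * Lw)" using b(6)[of i] i b(1) by simp
      moreover have "reach {..<n} (edges_of om os od) w (ord a) (ord (tg x)) (real (Suc r) * Lw)"
        by (rule reach_mono[OF b(6)[of j, folded 2(2), OF 2(1)]]) (use Lw in \<open>auto intro: mult_right_mono\<close>)
      ultimately have "reach {..<n} (edges_of om os od) w (ord c) (ord (tg x)) (real r * Lw + real (Suc r) * Lw)"
        by (rule reach_trans[OF reach_sym])
      moreover have "real r * Lw + real (Suc r) * Lw = (2 * real r + 1) * Lw" by (simp add: algebra_simps)
      moreover have "(2 * real r + 1) * Lw \<le> (2 * real k - 1) * Lw" using r Lw by (intro mult_right_mono) auto
      ultimately show ?thesis by (metis reach_mono)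
    qed simp
  qed
  have re: "(\<Sum>c\<in>qu ` {..<old}. g c) = (\<Sum>i<old. g (qu i))" for g :: "nat \<Rightarrow> nat"
    by (simp only: sum.reindex[OF inj] o_def)
  have "(\<Sum>i<old. 15 * length (L (qu i)) + 20) = gcost qu old + 3 * (\<Sum>i<old. length (L (qu i)))"
    unfolding gcost_def sum_distrib_left sum.distrib[symmetric] by (intro sum.cong) auto
  moreover have "hi - old \<le> (\<Sum>i<old. length (L (qu i)))" using b(9) \<open>0 < old\<close> by linarith
  ultimately show "3 * (hi - old) + gcost qu old \<le> (\<Sum>c\<in>qu ` {..<old}. 15 * length (L c) + 20)" unfolding re by linarith
qed

lemma wp_grow:
  assumes A: "adj_state s" and a: "nvar s ''a'' = a" "a \<in> V" "a \<notin> D0" and del: "deleted (narr s ''del'') D0"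
    and T: "T \<subseteq> edges_of (nvar s ''outm'') (narr s ''outsrc'') (narr s ''outdst'')"
  shows "wp grow s (\<lambda>t s'. \<exists>B. a \<in> B \<and> B \<subseteq> V - D0 \<and> t \<le> (\<Sum>c\<in>B. 15 * length (L c) + 30) \<and> deleted (narr s' ''del'') (D0 \<union> B) \<and>
    out_ext P (nvar s ''outm'') (narr s ''outsrc'') (narr s ''outdst'') (nvar s' ''outm'') (narr s' ''outsrc'') (narr s' ''outdst'') \<and>
    nvar s' ''outm'' \<le> nvar s ''outm'' + b * card B \<and>
    (\<forall>c\<in>B. \<forall>x\<in>set (L c). tg x \<in> D0 \<or>
      reach {..<n} (edges_of (nvar s' ''outm'') (narr s' ''outsrc'') (narr s' ''outdst'')) w (ord c) (ord (tg x)) ((2 * real k - 1) * Lw)))"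
proof -
  let ?om = "nvar s ''outm''" and ?os = "narr s ''outsrc''" and ?od = "narr s ''outdst''"
  let ?s1 = "s\<lparr>narr := (narr s)(''que'' := (narr s ''que'')(0 := a), ''del'' := (narr s ''del'')(a := 1)),
    nvar := (nvar s)(''lo'' := 0, ''hi'' := 1, ''go'' := 1)\<rparr>"
  have G: "wp grow_loop ?s1 (\<lambda>t s'. \<exists>r<k. t \<le> gcost (narr s' ''que'') (nvar s' ''old'') + 1 \<and>
     ballS D0 a r (nvar s' ''old'') (nvar s' ''old'') [] ?om ?os ?od s' \<and> 1 \<le> nvar s' ''old'' \<and> nvar s' ''hi'' \<le> b * nvar s' ''old'')"
    by (rule wp_grow_loop) (use A ball_start[OF a(2,3) del T] in \<open>auto simp: adj_state_def\<close>)
  have "wp (grow_loop ;; release) ?s1 (\<lambda>t s'. \<exists>B. a \<in> B \<and> B \<subseteq> V - D0 \<and> 5 + t \<le> (\<Sum>c\<in>B. 15 * length (L c) + 30) \<and> deleted (narr s' ''del'') (D0 \<union> B) \<and>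
    out_ext P ?om ?os ?od (nvar s' ''outm'') (narr s' ''outsrc'') (narr s' ''outdst'') \<and>
    nvar s' ''outm'' \<le> ?om + b * card B \<and>
    (\<forall>c\<in>B. \<forall>x\<in>set (L c). tg x \<in> D0 \<or>
      reach {..<n} (edges_of (nvar s' ''outm'') (narr s' ''outsrc'') (narr s' ''outdst'')) w (ord c) (ord (tg x)) ((2 * real k - 1) * Lw)))"
    unfolding wp_Seq
  proof (rule wp_mono[OF G], goal_cases)
    case (1 t1 s2)
    let ?old = "nvar s2 ''old''" and ?qu = "narr s2 ''que''"
    from 1 obtain r where r: "r < k" "t1 \<le> gcost ?qu ?old + 1" "ballS D0 a r ?old ?old [] ?om ?os ?od s2" "1 \<le> ?old" "nvar s2 ''hi'' \<le> b * ?old"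
      by blast
    have o: "0 < ?old" using r by simp
    note F = ball_final[OF r(3,1,5) o]
    show ?case
    proof (rule wp_frame[OF wp_release[OF r(3) refl]], goal_cases)
      case (1 t2 s3)
      have un: "nvar s3 ''outm'' = nvar s2 ''outm''" "narr s3 ''outsrc'' = narr s2 ''outsrc''" "narr s3 ''outdst'' = narr s2 ''outdst''"
        using 1(1) by (auto simp: unch_def)
      let ?B = "?qu ` {..<?old}"
      have oe: "out_ext P ?om ?os ?od (nvar s2 ''outm'') (narr s2 ''outsrc'') (narr s2 ''outdst'')" using r(3) by (simp add: ball_def)
      have aB: "a \<in> ?B" using F(4) o by (metis imageI lessThan_iff)
      have "(\<Sum>c\<in>?B. 15 * length (L c) + 30) = (\<Sum>c\<in>?B. 15 * length (L c) + 20) + 10 * card ?B" by (simp add: sum.distrib)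
      moreover have "1 \<le> card ?B" using aB by (simp add: Suc_le_eq card_gt_0_iff) blast
      ultimately have "5 + (t1 + t2) \<le> (\<Sum>c\<in>?B. 15 * length (L c) + 30)" using 1(2) r(2) F(6) by linarith
      then show ?case
        using 1(2) F(1,2,5) aB oe unfolding un by (intro exI[of _ ?B] conjI) simp_all
    qed
  qed
  moreover have "5 + a = Suc (Suc (Suc (Suc (Suc a))))" for a :: nat by simp
  ultimately show ?thesis
    unfolding grow_def using a(1) by (simp add: wp_simps upd_norm)
qed

end

section \<open>One window of edge weights\<close>

definition load_edge :: "string \<Rightarrow> com" where
  "load_edge i = NAssign ''e'' (NArr ''o'' (NVar i)) ;;
     NAssign ''a'' (NArr ''cid'' (NArr ''pos'' (NArr ''src'' (NVar ''e'')))) ;;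
     NAssign ''c'' (NArr ''cid'' (NArr ''pos'' (NArr ''dst'' (NVar ''e''))))"

text \<open>Only the clusters met by the window are reset, which keeps the time of a window linear
  in the number of its edges.\<close>

definition collect :: com where
  "collect = While (BAnd (NLess (NVar ''p'') (NVar ''m'')) (BAnd (RLess (RArr ''wt'' (NArr ''o'' (NVar ''p''))) (RVar ''z''))
       (RLess (RArr ''wt'' (NArr ''o'' (NVar ''p''))) (RVar ''y2'')))) (
     load_edge ''p'' ;;
     NStore ''head'' (NVar ''a'') (NConst 0) ;; NStore ''head'' (NVar ''c'') (NConst 0) ;;
     NStore ''del'' (NVar ''a'') (NConst 0) ;; NStore ''del'' (NVar ''c'') (NConst 0) ;; incr ''p'')"

definition push :: "string \<Rightarrow> string \<Rightarrow> com" where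
  "push a c = NStore ''tgt'' (NVar ''h'') (NVar c) ;; NStore ''he'' (NVar ''h'') (NVar ''e'') ;;
     NStore ''nxh'' (NVar ''h'') (NArr ''head'' (NVar a)) ;; NStore ''head'' (NVar a) (NPlus (NVar ''h'') (NConst 1))"

definition build :: com where
  "build = For ''j'' ''p'' (
     load_edge ''j'' ;;
     Cond (BOr (NLess (NVar ''a'') (NVar ''c'')) (NLess (NVar ''c'') (NVar ''a'')))
       (NAssign ''h'' (NPlus (NVar ''j'') (NVar ''j'')) ;; push ''a'' ''c'' ;; incr ''h'' ;; push ''c'' ''a'') Skip)"

text \<open>Testing one end suffices: once the cluster \<open>a\<close> is deleted, all its cells
  have detours in the output, among them that of this edge.\<close>

definition seeds :: com where
  "seeds = For ''j'' ''p'' (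
     load_edge ''j'' ;;
     Cond (BAnd (BOr (NLess (NVar ''a'') (NVar ''c'')) (NLess (NVar ''c'') (NVar ''a''))) (NLess (NArr ''del'' (NVar ''a'')) (NConst 1)))
       grow Skip)"

definition fine_window :: com where
  "fine_window = NAssign ''p0'' (NVar ''p'') ;; RAssign ''z'' (RTimes (RArr ''wt'' (NArr ''o'' (NVar ''p''))) (RVar ''rho'')) ;;
     collect ;; NAssign ''j'' (NVar ''p0'') ;; build ;; NAssign ''j'' (NVar ''p0'') ;; seeds"

lemma collect_writes [simp]:
  "nws collect = {''e'', ''a'', ''c'', ''p''}" "rws collect = {}" "naws collect = {''head'', ''del''}" "raws collect = {}"
  by (auto simp: collect_def load_edge_def)

lemma build_writes [simp]:
  "nws build = {''e'', ''a'', ''c'', ''j'', ''h''}" "rws build = {}" "naws build = {''tgt'', ''he'', ''nxh'', ''head''}" "raws build = {}"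
  by (auto simp: build_def load_edge_def push_def)

lemma seeds_writes [simp]:
  "nws seeds = {''e'', ''a'', ''c'', ''j'', ''old'', ''go'', ''lo'', ''h'', ''d'', ''hi'', ''outm''}" "rws seeds = {}"
  "naws seeds = {''del'', ''que'', ''outsrc'', ''outdst''}" "raws seeds = {}"
  by (auto simp: seeds_def load_edge_def)

lemma fine_window_writes [simp]:
  "nws fine_window = {''p0'', ''p'', ''e'', ''a'', ''c'', ''j'', ''old'', ''go'', ''lo'', ''h'', ''d'', ''hi'', ''outm''}" "rws fine_window = {''z''}"
  "naws fine_window = {''head'', ''del'', ''tgt'', ''he'', ''nxh'', ''que'', ''outsrc'', ''outdst''}" "raws fine_window = {}"
  by (auto simp: fine_window_def)

lemma chain_cong: "(\<And>x. x \<in> set l \<Longrightarrow> nx x = nx' x) \<Longrightarrow> chain nx h l \<longleftrightarrow> chain nx' h l"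
  by (induction l arbitrary: h) auto

text \<open>The adjacency lists of the multigraph with edges from \<open>A i\<close> to \<open>B i\<close> for \<open>p0 \<le> i < j\<close>, without loops;
  the two halves of the edge \<open>i\<close> are the cells \<open>i + i\<close> and \<open>Suc (i + i)\<close>.\<close>

fun adjl :: "(nat \<Rightarrow> nat) \<Rightarrow> (nat \<Rightarrow> nat) \<Rightarrow> nat \<Rightarrow> nat \<Rightarrow> nat \<Rightarrow> nat list" where
  "adjl A B p0 0 c = []"
| "adjl A B p0 (Suc j) c = (if j < p0 then [] else if A j = B j then adjl A B p0 j c else
     if c = A j then (j + j) # adjl A B p0 j c else if c = B j then Suc (j + j) # adjl A B p0 j c else adjl A B p0 j c)"

lemma adjl_empty: "j \<le> p0 \<Longrightarrow> adjl A B p0 j c = []"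
  by (cases j) auto

lemma set_adjl: "set (adjl A B p0 j c) =
    {x. \<exists>i. p0 \<le> i \<and> i < j \<and> A i \<noteq> B i \<and> (x = i + i \<and> c = A i \<or> x = Suc (i + i) \<and> c = B i)}"
proof (induction j)
  case (Suc j)
  show ?case
  proof (cases "j < p0")
    case False
    have "(\<exists>i. p0 \<le> i \<and> i < Suc j \<and> Q i) \<longleftrightarrow> (\<exists>i. p0 \<le> i \<and> i < j \<and> Q i) \<or> Q j" for Q
      using False by (metis less_Suc_eq not_less)
    then show ?thesis using Suc False by auto
  qed auto
qed simp

lemma sum_length_adjl:
  assumes "finite V"
  shows "(\<Sum>c\<in>V. length (adjl A B p0 j c)) \<le> 2 * (j - p0)"
proof (induction j)
  case (Suc j)
  show ?case
  proof (cases "j < p0")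
    case False
    have "length (adjl A B p0 (Suc j) c) \<le> length (adjl A B p0 j c) + ((if c = A j then 1 else 0) + (if c = B j then 1 else 0))" for c
      using False by auto
    then have "(\<Sum>c\<in>V. length (adjl A B p0 (Suc j) c)) \<le>
      (\<Sum>c\<in>V. length (adjl A B p0 j c) + ((if c = A j then 1 else 0) + (if c = B j then 1 else 0)))" by (rule sum_mono)
    also have "\<dots> \<le> (\<Sum>c\<in>V. length (adjl A B p0 j c)) + (1 + 1)"
      unfolding sum.distrib using assms by (intro add_mono) auto
    finally show ?thesis using Suc False by simp
  qed simp
qed simp

definition linked :: "(nat \<Rightarrow> nat) \<Rightarrow> (nat \<Rightarrow> nat) \<Rightarrow> (nat \<Rightarrow> nat) \<Rightarrow> nat set \<Rightarrow> nat \<Rightarrow> nat \<Rightarrow>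
    (nat \<Rightarrow> nat) \<Rightarrow> (nat \<Rightarrow> nat) \<Rightarrow> (nat \<Rightarrow> nat) \<Rightarrow> (nat \<Rightarrow> nat) \<Rightarrow> bool" where
  "linked A B ee C p0 j hea nx tgt he \<longleftrightarrow> (\<forall>c\<in>C. chain nx (hea c) (adjl A B p0 j c)) \<and>
     (\<forall>i. p0 \<le> i \<and> i < j \<and> A i \<noteq> B i \<longrightarrow> tgt (i + i) = B i \<and> tgt (Suc (i + i)) = A i \<and> he (i + i) = ee i \<and> he (Suc (i + i)) = ee i)"

lemma linked_loop: "linked A B ee C p0 j hea nx tgt he \<Longrightarrow> p0 \<le> j \<Longrightarrow> A j = B j \<Longrightarrow> linked A B ee C p0 (Suc j) hea nx tgt he"
  by (auto simp: linked_def less_Suc_eq)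

text \<open>The cells of earlier edges have numbers below \<open>j + j\<close>, so the new pointers
  do not disturb the existing lists.\<close>

lemma linked_edge:
  assumes L: "linked A B ee C p0 j hea nx tgt he" and j: "p0 \<le> j" "A j \<noteq> B j"
  shows "linked A B ee C p0 (Suc j) (hea(A j := Suc (j + j), B j := Suc (Suc (j + j))))
    (nx(j + j := hea (A j), Suc (j + j) := hea (B j))) (tgt(j + j := B j, Suc (j + j) := A j)) (he(j + j := ee j, Suc (j + j) := ee j))"
proof -
  let ?nx = "nx(j + j := hea (A j), Suc (j + j) := hea (B j))"
  have old: "chain ?nx (hea c) (adjl A B p0 j c)" if "c \<in> C" for c
  proof -
    have "chain nx (hea c) (adjl A B p0 j c)" using L that by (simp add: linked_def)
    moreover have "nx x = ?nx x" if "x \<in> set (adjl A B p0 j c)" for x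
    proof -
      obtain i where "i < j" "x = i + i \<or> x = Suc (i + i)" using \<open>x \<in> _\<close> unfolding set_adjl by blast
      then have "x < j + j" by auto
      then show ?thesis by simp
    qed
    ultimately show ?thesis using chain_cong by blast
  qed
  have 1: "chain ?nx ((hea(A j := Suc (j + j), B j := Suc (Suc (j + j)))) c) (adjl A B p0 (Suc j) c)" if "c \<in> C" for c
    using old[OF that] j by auto
  have 2: "i + i \<noteq> j + j \<and> Suc (i + i) \<noteq> Suc (j + j) \<and> i + i \<noteq> Suc (j + j) \<and> Suc (i + i) \<noteq> j + j" if "i < j" for i
    using that by presburger
  have "(tgt(j + j := B j, Suc (j + j) := A j)) (i + i) = B i \<and> (tgt(j + j := B j, Suc (j + j) := A j)) (Suc (i + i)) = A i \<and>
    (he(j + j := ee j, Suc (j + j) := ee j)) (i + i) = ee i \<and> (he(j + j := ee j, Suc (j + j) := ee j)) (Suc (i + i)) = ee i"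
    if i: "p0 \<le> i \<and> i < Suc j \<and> A i \<noteq> B i" for i
  proof (cases "i = j")
    case False
    then have "i < j" using i by simp
    then show ?thesis using L i 2[of i] unfolding linked_def by simp
  qed simp
  then show ?thesis using 1 unfolding linked_def by blast
qed

section \<open>Serving one window of edges over a fixed tree\<close>

locale tree_input = spanner_input n E w es k q \<rho> + prim_order n E w ord pos pp key
  for n E w es k q \<rho> ord pos pp key
begin

abbreviation T :: "nat set set" where "T \<equiv> tedge ` {0<..<n}"

definition out_edges :: "state \<Rightarrow> nat set set" where
  "out_edges s = edges_of (nvar s ''outm'') (narr s ''outsrc'') (narr s ''outdst'')"

definition stretch :: real where "stretch = \<rho> * (2 * real k - 1) * (1 + 2 / q) + 2 / q"

text \<open>The walk leads from one root to \<open>u\<close> inside the cluster, along the edge, and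
  on to the other root. This sum is the step length \<open>Lw\<close> of the ball graph.\<close>

lemma reach_cluster_edge:
  assumes cl: "clustering R \<theta> h ct cid" and H: "T \<subseteq> H" "{u, v} \<in> H" and e: "{u, v} \<in> E" "w {u, v} \<le> zz"
  shows "reach {..<n} H w (ord (cid (pos u))) (ord (cid (pos v))) (zz + 2 * R)"
proof -
  have uv: "u < n" "v < n" using E_lt[OF e(1)] by auto
  then have p: "pos u < n" "pos v < n" "ord (pos u) = u" "ord (pos v) = v" using pos by auto
  have "reach {..<n} H w (ord (cid (pos u))) u R" "reach {..<n} H w v (ord (cid (pos v))) R"
    using reach_sym[OF reach_cid[OF cl H(1) p(1)]] reach_cid[OF cl H(1) p(2)] p by auto
  moreover have "reach {..<n} H w u v zz" using uv H e by (intro reach_edge) auto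
  ultimately have "reach {..<n} H w (ord (cid (pos u))) (ord (cid (pos v))) (R + zz + R)"
    using reach_trans by metis
  then show ?thesis by (rule reach_mono) simp
qed

lemma crossingI:
  assumes cl: "clustering R \<theta> h ct cid" and ab: "a < n" "b < n" "{ord a, ord b} \<in> E" "w {ord a, ord b} < \<theta>" "cid a \<noteq> cid b"
  shows "cid a \<in> crossing \<theta> cid \<and> cid b \<in> crossing \<theta> cid"
proof -
  have "{ord b, ord a} = {ord a, ord b}" by auto
  then have "{ord b, ord a} \<in> E" "w {ord b, ord a} < \<theta>" using ab by simp_all
  then show ?thesis unfolding crossing_def[OF cl] using ab by blast
qed

lemma wp_collect:
  assumes inp: "inp s" and arr: "narr s ''pos'' = pos" "narr s ''o'' = od" "narr s ''cid'' = cid" and od: "\<And>i. i < m \<Longrightarrow> od i < m"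
    and st: "nvar s ''p'' = p0" "p0 < m" "rvar s ''z'' = z" "rvar s ''y2'' = y2"
    and A: "A = (\<lambda>i. cid (pos (S (od i))))" and B: "B = (\<lambda>i. cid (pos (D (od i))))"
  shows "wp collect s (\<lambda>t s'. \<exists>p. nvar s' ''p'' = p \<and> p0 \<le> p \<and> p \<le> m \<and> t \<le> 10 * (p - p0) + 1 \<and>
    (\<forall>i. p0 \<le> i \<and> i < p \<longrightarrow> ew (od i) < z \<and> ew (od i) < y2) \<and> (p < m \<longrightarrow> z \<le> ew (od p) \<or> y2 \<le> ew (od p)) \<and>
    (\<forall>i. p0 \<le> i \<and> i < p \<longrightarrow> narr s' ''head'' (A i) = 0 \<and> narr s' ''head'' (B i) = 0) \<and>
    (\<forall>i. p0 \<le> i \<and> i < p \<longrightarrow> narr s' ''del'' (A i) = 0 \<and> narr s' ''del'' (B i) = 0))"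
proof -
  define cleared :: "(nat \<Rightarrow> nat) \<Rightarrow> nat \<Rightarrow> bool" where "cleared f p \<longleftrightarrow> (\<forall>i. p0 \<le> i \<and> i < p \<longrightarrow> f (A i) = 0 \<and> f (B i) = 0)" for f p
  define below where "below p \<longleftrightarrow> (\<forall>i. p0 \<le> i \<and> i < p \<longrightarrow> ew (od i) < z \<and> ew (od i) < y2)" for p
  have cS: "cleared (f(A p := 0, B p := 0)) (Suc p)" if "cleared f p" for f p
    using that by (auto simp: cleared_def less_Suc_eq)
  show ?thesis
    unfolding collect_def cleared_def[symmetric] below_def[symmetric]
  proof (rule wp_While[where B = "10 * m" and I = "\<lambda>t s'. \<exists>p. nvar s' ''p'' = p \<and> p0 \<le> p \<and> p \<le> m \<and> t \<le> 10 * (p - p0) \<and>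
      below p \<and> cleared (narr s' ''head'') p \<and> cleared (narr s' ''del'') p"], goal_cases)
    case 1
    show ?case using st by (auto simp: below_def cleared_def)
  next
    case (3 t s')
    obtain p where p: "nvar s' ''p'' = p" "p0 \<le> p" "p \<le> m" "t \<le> 10 * (p - p0)" "below p" "cleared (narr s' ''head'') p"
      "cleared (narr s' ''del'') p" using 3(2) by blast
    have inp': "inp s'" and un: "narr s' ''pos'' = pos" "narr s' ''o'' = od" "narr s' ''cid'' = cid" "rvar s' ''z'' = z" "rvar s' ''y2'' = y2"
      using 3(1) inp arr st by (auto simp: unch_def load_edge_def inp_def)
    have pm: "p < m" using 3(3) p(1) inp' by (simp add: inp_def)
    have src: "narr s' ''src'' (od p) = S (od p)" "narr s' ''dst'' (od p) = D (od p)" "rarr s' ''wt'' (od p) = ew (od p)"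
      using inp' od[OF pm] by (auto simp: inp_def)
    have "below (Suc p)" using p(5) 3(3) p(1) un src by (auto simp: below_def less_Suc_eq)
    moreover have "t + 10 \<le> 10 * (Suc p - p0)" using p(2,4) by simp
    ultimately show ?case using p cS[OF p(6)] cS[OF p(7)] pm by (simp add: wp_simps load_edge_def un src A B)
  next
    case (4 t s')
    obtain p where p: "nvar s' ''p'' = p" "p0 \<le> p" "p \<le> m" "t \<le> 10 * (p - p0)" "below p" "cleared (narr s' ''head'') p"
      "cleared (narr s' ''del'') p" using 4(2) by blast
    have inp': "inp s'" and un: "narr s' ''o'' = od" "rvar s' ''z'' = z" "rvar s' ''y2'' = y2"
      using 4(1) inp arr st by (auto simp: unch_def load_edge_def inp_def)
    have "z \<le> ew (od p) \<or> y2 \<le> ew (od p)" if "p < m"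
      using that 4(3) p(1) un inp' od[OF that] by (auto simp: inp_def)
    then show ?case using p by auto
  qed auto
qed

lemma wp_build:
  assumes inp: "inp s" and arr: "narr s ''pos'' = pos" "narr s ''o'' = od" "narr s ''cid'' = cid" and od: "\<And>i. i < m \<Longrightarrow> od i < m"
    and st: "nvar s ''p'' = p" "nvar s ''j'' = p0" "p0 \<le> p" "p \<le> m"
    and A: "A = (\<lambda>i. cid (pos (S (od i))))" and B: "B = (\<lambda>i. cid (pos (D (od i))))"
    and C: "C = A ` {p0..<p} \<union> B ` {p0..<p}"
    and clr: "\<forall>i. p0 \<le> i \<and> i < p \<longrightarrow> narr s ''head'' (A i) = 0 \<and> narr s ''head'' (B i) = 0"
  shows "wp build s (\<lambda>t s'. t \<le> 16 * (p - p0) + 1 \<and>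
    linked A B od C p0 p (narr s' ''head'') (narr s' ''nxh'') (narr s' ''tgt'') (narr s' ''he''))"
  unfolding build_def
proof (rule wp_For[where a = p0 and N = p and I = "\<lambda>j t s'. t \<le> 16 * (j - p0) \<and>
    linked A B od C p0 j (narr s' ''head'') (narr s' ''nxh'') (narr s' ''tgt'') (narr s' ''he'')"], goal_cases)
  case 7
  show ?case using clr C by (auto simp: linked_def adjl_empty)
next
  case (8 j t s')
  have inp': "inp s'" and un: "narr s' ''pos'' = pos" "narr s' ''o'' = od" "narr s' ''cid'' = cid"
    using 8(3) inp arr by (auto simp: unch_def load_edge_def push_def inp_def)
  have jm: "j < m" using 8 st by simp
  have src: "narr s' ''src'' (od j) = S (od j)" "narr s' ''dst'' (od j) = D (od j)"
    using inp' od[OF jm] by (auto simp: inp_def)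
  have AB: "cid (pos (S (od j))) = A j" "cid (pos (D (od j))) = B j" using A B by auto
  have t: "t + 16 \<le> 16 * (Suc j - p0)" using 8(1) conjunct1[OF 8(5)] by linarith
  show ?case
  proof (cases "A j = B j")
    case True
    then show ?thesis using linked_loop[OF conjunct2[OF 8(5)] 8(1)] t 8(4) by (simp add: wp_simps load_edge_def un src AB)
  next
    case False
    then have "A j < B j \<or> B j < A j" by auto
    then show ?thesis using False linked_edge[OF conjunct2[OF 8(5)] 8(1)] t 8(4)
      by (auto simp: wp_simps load_edge_def push_def un src AB)
  qed
qed (use st in \<open>auto simp: load_edge_def push_def\<close>)

lemma wp_seeds:
  assumes BG: "ball_graph n w ord T V L tg ex ey P Lw b k" and adj: "ball_graph.adj_state V L tg ex ey b s"
    and inp: "inp s" and arr: "narr s ''pos'' = pos" "narr s ''o'' = od" "narr s ''cid'' = cid" and od: "\<And>i. i < m \<Longrightarrow> od i < m"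
    and st: "nvar s ''p'' = p" "nvar s ''j'' = p0" "p0 \<le> p" "p \<le> m"
    and A: "A = (\<lambda>i. cid (pos (S (od i))))" and B: "B = (\<lambda>i. cid (pos (D (od i))))"
    and V: "\<And>i. p0 \<le> i \<Longrightarrow> i < p \<Longrightarrow> A i \<noteq> B i \<Longrightarrow> A i \<in> V" and del: "\<And>c. c \<in> V \<Longrightarrow> narr s ''del'' c = 0" and T: "T \<subseteq> out_edges s"
  shows "wp seeds s (\<lambda>t s'. \<exists>D0\<subseteq>V. t \<le> 10 * (p - p0) + (\<Sum>c\<in>D0. 15 * length (L c) + 30) + 1 \<and>
    (\<forall>i. p0 \<le> i \<and> i < p \<and> A i \<noteq> B i \<longrightarrow> A i \<in> D0) \<and>
    out_ext P (nvar s ''outm'') (narr s ''outsrc'') (narr s ''outdst'') (nvar s' ''outm'') (narr s' ''outsrc'') (narr s' ''outdst'') \<and>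
    nvar s' ''outm'' \<le> nvar s ''outm'' + b * card D0 \<and>
    (\<forall>c\<in>D0. \<forall>x\<in>set (L c). reach {..<n} (out_edges s') w (ord c) (ord (tg x)) ((2 * real k - 1) * Lw)))"
proof -
  interpret ball_graph n w ord T V L tg ex ey P Lw b k by (rule BG)
  define cert where "cert om os oe D0 \<longleftrightarrow> (\<forall>c\<in>D0. \<forall>x\<in>set (L c). reach {..<n} (edges_of om os oe) w (ord c) (ord (tg x)) ((2 * real k - 1) * Lw))"
    for om os oe D0
  define cov where "cov j D0 \<longleftrightarrow> (\<forall>i. p0 \<le> i \<and> i < j \<and> A i \<noteq> B i \<longrightarrow> A i \<in> D0)" for j D0
  let ?g = "\<lambda>D0. \<Sum>c\<in>D0. 15 * length (L c) + 30"
  let ?I = "\<lambda>j t s' D0. D0 \<subseteq> V \<and> t \<le> 10 * (j - p0) + ?g D0 \<and> cov j D0 \<and> deleted (narr s' ''del'') D0 \<and>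
    out_ext P (nvar s ''outm'') (narr s ''outsrc'') (narr s ''outdst'') (nvar s' ''outm'') (narr s' ''outsrc'') (narr s' ''outdst'') \<and>
    nvar s' ''outm'' \<le> nvar s ''outm'' + b * card D0 \<and> cert (nvar s' ''outm'') (narr s' ''outsrc'') (narr s' ''outdst'') D0"
  show ?thesis
    unfolding seeds_def out_edges_def cert_def[symmetric] cov_def[symmetric]
  proof (rule wp_For[where a = p0 and N = p and I = "\<lambda>j t s'. \<exists>D0. ?I j t s' D0"], goal_cases)
    case 7
    show ?case using del by (intro exI[of _ "{}"]) (auto simp: cov_def cert_def deleted_def out_ext_refl)
  next
    case (8 j t s')
    have inp': "inp s'" and un: "narr s' ''pos'' = pos" "narr s' ''o'' = od" "narr s' ''cid'' = cid"
      using 8(3) inp arr by (auto simp: unch_def load_edge_def inp_def)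
    have ad': "adj_state s'" using 8(3) adj by (auto simp: unch_def load_edge_def adj_state_def)
    have jm: "j < m" using 8 st by simp
    have src: "narr s' ''src'' (od j) = S (od j)" "narr s' ''dst'' (od j) = D (od j)"
      using inp' od[OF jm] by (auto simp: inp_def)
    have AB: "cid (pos (S (od j))) = A j" "cid (pos (D (od j))) = B j" using A B by auto
    obtain D0 where D0: "?I j t s' D0" using 8(5) by blast
    have finD: "finite D0" using D0 finV finite_subset by blast
    have covS: "cov (Suc j) D1" if "cov j D1" "A j \<noteq> B j \<Longrightarrow> A j \<in> D1" for D1
      using that by (auto simp: cov_def less_Suc_eq)
    show ?case
    proof (cases "A j \<noteq> B j \<and> narr s' ''del'' (A j) = 0")
      case False
      have "A j \<noteq> B j \<Longrightarrow> A j \<in> D0" using False D0 V[OF 8(1,2)] by (auto simp: deleted_def)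
      then have "?I (Suc j) (t + 7) s' D0" using D0 covS[of D0] 8(1) by auto
      then show ?thesis using False 8(4)
        by (auto simp: wp_simps load_edge_def un src AB intro!: exI[of _ D0])
    next
      case True
      then have neq: "A j < B j \<or> B j < A j" by auto
      let ?s1 = "s'\<lparr>nvar := (nvar s')(''e'' := od j, ''a'' := A j, ''c'' := B j)\<rparr>"
      have T': "T \<subseteq> edges_of (nvar s' ''outm'') (narr s' ''outsrc'') (narr s' ''outdst'')"
        using subset_trans[OF T[unfolded out_edges_def] out_ext_edges] conjunct1[OF conjunct2[OF conjunct2[OF conjunct2[OF conjunct2[OF D0]]]]] by metis
      have AjV: "A j \<in> V" "A j \<notin> D0" using V[OF 8(1,2)] True D0 by (auto simp: deleted_def)
      have G: "wp grow ?s1 (\<lambda>t s''. \<exists>B. A j \<in> B \<and> B \<subseteq> V - D0 \<and> t \<le> ?g B \<and> deleted (narr s'' ''del'') (D0 \<union> B) \<and>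
        out_ext P (nvar ?s1 ''outm'') (narr ?s1 ''outsrc'') (narr ?s1 ''outdst'') (nvar s'' ''outm'') (narr s'' ''outsrc'') (narr s'' ''outdst'') \<and>
        nvar s'' ''outm'' \<le> nvar ?s1 ''outm'' + b * card B \<and>
        (\<forall>c\<in>B. \<forall>x\<in>set (L c). tg x \<in> D0 \<or>
          reach {..<n} (edges_of (nvar s'' ''outm'') (narr s'' ''outsrc'') (narr s'' ''outdst'')) w (ord c) (ord (tg x)) ((2 * real k - 1) * Lw)))"
        by (rule wp_grow) (use ad' AjV D0 T' in \<open>auto simp: adj_state_def\<close>)
      have "wp grow ?s1 (\<lambda>t' s''. \<exists>D1. ?I (Suc j) (t + (6 + t')) s'' D1)"
      proof (rule wp_mono[OF G], goal_cases)
        case (1 t' s'')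
        then obtain X where X: "A j \<in> X" "X \<subseteq> V - D0" "t' \<le> ?g X" "deleted (narr s'' ''del'') (D0 \<union> X)"
          "out_ext P (nvar s' ''outm'') (narr s' ''outsrc'') (narr s' ''outdst'') (nvar s'' ''outm'') (narr s'' ''outsrc'') (narr s'' ''outdst'')"
          "nvar s'' ''outm'' \<le> nvar s' ''outm'' + b * card X"
          "\<And>c x. c \<in> X \<Longrightarrow> x \<in> set (L c) \<Longrightarrow> tg x \<in> D0 \<or>
            reach {..<n} (edges_of (nvar s'' ''outm'') (narr s'' ''outsrc'') (narr s'' ''outdst'')) w (ord c) (ord (tg x)) ((2 * real k - 1) * Lw)"
          by auto
        let ?H = "edges_of (nvar s'' ''outm'') (narr s'' ''outsrc'') (narr s'' ''outdst'')"
        have finX: "finite X" using X(2) finV finite_subset by blast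
        have dis: "D0 \<inter> X = {}" using X(2) by blast
        have g: "?g (D0 \<union> X) = ?g D0 + ?g X" "card (D0 \<union> X) = card D0 + card X"
          using finD finX dis by (auto simp: sum.union_disjoint card_Un_disjoint)
        have old: "reach {..<n} ?H w (ord c) (ord (tg x)) ((2 * real k - 1) * Lw)" if "c \<in> D0" "x \<in> set (L c)" for c x
          using D0 that reach_superset[OF _ out_ext_edges[OF X(5)]] unfolding cert_def by blast
        have "reach {..<n} ?H w (ord c) (ord (tg x)) ((2 * real k - 1) * Lw)" if c: "c \<in> X" "x \<in> set (L c)" for c x
        \<comment> \<open>A cell into an earlier ball was certified there from the other side;
          \<open>opposite\<close> provides the reverse cell with the same two ends.\<close>
        proof (cases "tg x \<in> D0")
          case True
          have "c \<in> V" using c X(2) by blast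
          then obtain x' where x': "x' \<in> set (L (tg x))" "tg x' = c" using opposite c(2) by blast
          show ?thesis using reach_sym[OF old[OF True x'(1)]] x'(2) by simp
        next
          case False
          then show ?thesis using X(7)[OF c] by blast
        qed
        then have "cert (nvar s'' ''outm'') (narr s'' ''outsrc'') (narr s'' ''outdst'') (D0 \<union> X)"
          using old unfolding cert_def by blast
        moreover have "cov (Suc j) (D0 \<union> X)" using D0 X(1) by (auto simp: cov_def less_Suc_eq)
        moreover have "t + (6 + t') \<le> 10 * (Suc j - p0) + ?g (D0 \<union> X)" using D0 X(3) g 8(1) by (simp add: Suc_diff_le)
        moreover have "nvar s'' ''outm'' \<le> nvar s ''outm'' + b * card (D0 \<union> X)" using D0 X(6) unfolding g by (simp add: algebra_simps)
        moreover have "out_ext P (nvar s ''outm'') (narr s ''outsrc'') (narr s ''outdst'') (nvar s'' ''outm'') (narr s'' ''outsrc'') (narr s'' ''outdst'')"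
          using D0 X(5) out_ext_trans by blast
        moreover have "D0 \<union> X \<subseteq> V" using D0 X(2) by blast
        ultimately show ?case using X(4) by blast
      qed
      moreover have "t + (6 + a) = Suc (Suc (Suc (Suc (Suc (Suc (t + a))))))" for a by simp
      ultimately show ?thesis using True neq 8(4)
        by (simp add: wp_simps load_edge_def un src AB)
    qed
  next
    case (9 t s')
    then show ?case by (auto simp: cert_def cov_def)
  qed (use st in \<open>auto simp: load_edge_def\<close>)
qed

text \<open>The left side consists of \<open>2 k - 1\<close> steps, each an edge of the window and
  two passages of radius \<open>x / q\<close>, and of the two passages inside the end clusters.
  Bounding \<open>x\<close> by \<open>y\<close> and putting the factor \<open>\<rho> \<ge> 1\<close>
  in front of the passages of the steps as well gives the product form of the stretch.\<close>

lemma stretch_window: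
  assumes x: "x \<le> y0" "y0 \<le> y" "0 < x"
  shows "(2 * real k - 1) * (\<rho> * y0 + 2 * (x / q)) + 2 * (x / q) \<le> stretch * y"
proof -
  have kk: "1 \<le> 2 * real k - 1" using k by simp
  have y: "0 < y" "x \<le> y" using x by auto
  have xq: "x / q \<le> y / q" using y q_pos by (intro divide_right_mono) auto
  have "\<rho> * y0 + 2 * (x / q) \<le> \<rho> * y + \<rho> * (2 * (y / q))"
  proof -
    have "\<rho> * y0 \<le> \<rho> * y" using x \<rho> by (intro mult_left_mono) auto
    moreover have "1 * (2 * (y / q)) \<le> \<rho> * (2 * (y / q))" using \<rho> y q_pos by (intro mult_right_mono) auto
    ultimately show ?thesis using xq by linarith
  qed
  then have "(2 * real k - 1) * (\<rho> * y0 + 2 * (x / q)) \<le> (2 * real k - 1) * (\<rho> * y + \<rho> * (2 * (y / q)))"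
    using kk by (intro mult_left_mono) auto
  moreover have "stretch * y = (2 * real k - 1) * (\<rho> * y + \<rho> * (2 * (y / q))) + 2 * (y / q)"
    unfolding stretch_def by (simp add: algebra_simps diff_divide_distrib)
  ultimately show ?thesis using xq by linarith
qed

abbreviation small :: "real \<Rightarrow> nat set \<Rightarrow> bool" where "small \<theta> e \<equiv> e \<in> E \<and> w e < \<theta>"

abbreviation extends :: "real \<Rightarrow> state \<Rightarrow> state \<Rightarrow> bool" where
  "extends \<theta> s s' \<equiv> out_ext (small \<theta>) (nvar s ''outm'') (narr s ''outsrc'') (narr s ''outdst'')
     (nvar s' ''outm'') (narr s' ''outsrc'') (narr s' ''outdst'')"

lemma wp_fine_window:
  assumes inp: "inp s" and arr: "narr s ''pos'' = pos" "narr s ''o'' = od" "narr s ''cid'' = cid"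
    and od: "\<And>i. i < m \<Longrightarrow> od i < m" and srt: "srt ew od 0 m"
    and st: "nvar s ''p'' = p0" "p0 < m" "rvar s ''y2'' = 2 * x" "nvar s ''b'' = bb"
    and x: "0 < x" "x \<le> ew (od p0)" "ew (od p0) < 2 * x"
    and cl: "clustering (x / q) (2 * x) h ct cid" and bb: "1 \<le> bb" "card (cid ` {..<n}) \<le> bb ^ k" and T: "T \<subseteq> out_edges s"
  shows "wp fine_window s (\<lambda>t s'. \<exists>p. nvar s' ''p'' = p \<and> p0 < p \<and> p \<le> m \<and> t \<le> 200 * (p - p0) \<and>
    (\<forall>i. p0 \<le> i \<and> i < p \<longrightarrow> ew (od i) < 2 * x \<and> reach {..<n} (out_edges s') w (S (od i)) (D (od i)) (stretch * ew (od i))) \<and>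
    (p < m \<longrightarrow> 2 * x \<le> ew (od p) \<or> \<rho> * ew (od p0) \<le> ew (od p)) \<and>
    extends (2 * x) s s' \<and> nvar s' ''outm'' \<le> nvar s ''outm'' + bb * card (crossing (2 * x) cid))"
proof -
  define A where "A = (\<lambda>i. cid (pos (S (od i))))"
  define B where "B = (\<lambda>i. cid (pos (D (od i))))"
  define z where "z = ew (od p0) * \<rho>"
  have z: "ew (od p0) < z" using x \<rho> by (simp add: z_def)
  let ?s1 = "s\<lparr>nvar := (nvar s)(''p0'' := p0), rvar := (rvar s)(''z'' := z)\<rparr>"
  have inp1: "inp ?s1" using inp by (simp add: inp_def)
  have wt0: "rarr s ''wt'' (od p0) = ew (od p0)" "rvar s ''rho'' = \<rho>" using inp od st by (auto simp: inp_def)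
  have C: "wp collect ?s1 (\<lambda>t s'. \<exists>p. nvar s' ''p'' = p \<and> p0 \<le> p \<and> p \<le> m \<and> t \<le> 10 * (p - p0) + 1 \<and>
    (\<forall>i. p0 \<le> i \<and> i < p \<longrightarrow> ew (od i) < z \<and> ew (od i) < 2 * x) \<and> (p < m \<longrightarrow> z \<le> ew (od p) \<or> 2 * x \<le> ew (od p)) \<and>
    (\<forall>i. p0 \<le> i \<and> i < p \<longrightarrow> narr s' ''head'' (A i) = 0 \<and> narr s' ''head'' (B i) = 0) \<and>
    (\<forall>i. p0 \<le> i \<and> i < p \<longrightarrow> narr s' ''del'' (A i) = 0 \<and> narr s' ''del'' (B i) = 0))"
    by (rule wp_collect[where cid = cid]) (use inp1 arr od st in \<open>auto simp: A_def B_def\<close>)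
  have "wp collect ?s1 (\<lambda>t1 s2. wp build (s2\<lparr>nvar := (nvar s2)(''j'' := nvar s2 ''p0'')\<rparr>) (\<lambda>t2 s3. wp seeds (s3\<lparr>nvar := (nvar s3)(''j'' := nvar s3 ''p0'')\<rparr>)
    (\<lambda>t3 s'. \<exists>p. nvar s' ''p'' = p \<and> p0 < p \<and> p \<le> m \<and> t1 + t2 + t3 + 4 \<le> 200 * (p - p0) \<and>
    (\<forall>i. p0 \<le> i \<and> i < p \<longrightarrow> ew (od i) < 2 * x \<and> reach {..<n} (out_edges s') w (S (od i)) (D (od i)) (stretch * ew (od i))) \<and>
    (p < m \<longrightarrow> 2 * x \<le> ew (od p) \<or> \<rho> * ew (od p0) \<le> ew (od p)) \<and>
    extends (2 * x) s s' \<and> nvar s' ''outm'' \<le> nvar s ''outm'' + bb * card (crossing (2 * x) cid))))"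
  proof (rule wp_frame[OF C], goal_cases)
    case (1 t1 s2)
    then obtain p where p: "nvar s2 ''p'' = p" "p0 \<le> p" "p \<le> m" "t1 \<le> 10 * (p - p0) + 1"
      "\<And>i. p0 \<le> i \<Longrightarrow> i < p \<Longrightarrow> ew (od i) < z \<and> ew (od i) < 2 * x" "p < m \<Longrightarrow> z \<le> ew (od p) \<or> 2 * x \<le> ew (od p)"
      "\<forall>i. p0 \<le> i \<and> i < p \<longrightarrow> narr s2 ''head'' (A i) = 0 \<and> narr s2 ''head'' (B i) = 0"
      "\<forall>i. p0 \<le> i \<and> i < p \<longrightarrow> narr s2 ''del'' (A i) = 0 \<and> narr s2 ''del'' (B i) = 0" by blast
    have pp0: "p0 < p" using p(2,6) z x(3) st(2) by (cases "p = p0") auto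
    have un2: "inp s2" "narr s2 ''pos'' = pos" "narr s2 ''o'' = od" "narr s2 ''cid'' = cid" "nvar s2 ''b'' = bb" "nvar s2 ''p0'' = p0"
      "nvar s2 ''outm'' = nvar s ''outm''" "narr s2 ''outsrc'' = narr s ''outsrc''" "narr s2 ''outdst'' = narr s ''outdst''"
      using 1(1) inp1 arr st by (auto simp: unch_def inp_def)
    let ?C = "A ` {p0..<p} \<union> B ` {p0..<p}"
    let ?s2 = "s2\<lparr>nvar := (nvar s2)(''j'' := p0)\<rparr>"
    have Bd: "wp build ?s2 (\<lambda>t s'. t \<le> 16 * (p - p0) + 1 \<and>
      linked A B od ?C p0 p (narr s' ''head'') (narr s' ''nxh'') (narr s' ''tgt'') (narr s' ''he''))"
      by (rule wp_build[where cid = cid]) (use un2 od p in \<open>auto simp: A_def B_def inp_def\<close>)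
    show ?case
      unfolding un2(6)
    proof (rule wp_frame[OF Bd], goal_cases)
      case (1 t2 s3)
      have un3: "inp s3" "narr s3 ''pos'' = pos" "narr s3 ''o'' = od" "narr s3 ''cid'' = cid" "nvar s3 ''b'' = bb" "nvar s3 ''p0'' = p0"
        "nvar s3 ''p'' = p" "nvar s3 ''outm'' = nvar s ''outm''" "narr s3 ''outsrc'' = narr s ''outsrc''" "narr s3 ''outdst'' = narr s ''outdst''"
        "narr s3 ''del'' = narr s2 ''del''"
        using 1(1) un2 p by (auto simp: unch_def inp_def)
      define V where "V = A ` {i\<in>{p0..<p}. A i \<noteq> B i} \<union> B ` {i\<in>{p0..<p}. A i \<noteq> B i}"
      define L where "L = adjl A B p0 p"
      define tg where "tg = narr s3 ''tgt''"
      define ex where "ex = (\<lambda>x. narr s3 ''src'' (narr s3 ''he'' x))"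
      define ey where "ey = (\<lambda>x. narr s3 ''dst'' (narr s3 ''he'' x))"
      define Lw where "Lw = \<rho> * ew (od p0) + 2 * (x / q)"
      have VC: "V \<subseteq> ?C" by (auto simp: V_def)
      have lk: "\<forall>c\<in>?C. chain (narr s3 ''nxh'') (narr s3 ''head'' c) (L c)"
        "\<And>i. p0 \<le> i \<Longrightarrow> i < p \<Longrightarrow> A i \<noteq> B i \<Longrightarrow> tg (i + i) = B i \<and> tg (Suc (i + i)) = A i \<and> narr s3 ''he'' (i + i) = od i \<and> narr s3 ''he'' (Suc (i + i)) = od i"
        using 1(2) unfolding linked_def L_def tg_def by auto
      have sd: "narr s3 ''src'' (od i) = S (od i)" "narr s3 ''dst'' (od i) = D (od i)" if "i < p" for i
        using un3(1) od[of i] that p(3) by (auto simp: inp_def)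
      have edge: "{S (od i), D (od i)} \<in> E" if "i < p" for i using es_nth od that p(3) by auto
      have half: "\<exists>i. p0 \<le> i \<and> i < p \<and> A i \<noteq> B i \<and>
          (x = i + i \<and> c = A i \<and> tg x = B i \<and> ex x = S (od i) \<and> ey x = D (od i) \<or>
           x = Suc (i + i) \<and> c = B i \<and> tg x = A i \<and> ex x = S (od i) \<and> ey x = D (od i))" if "x \<in> set (L c)" for c x
      proof -
        have "\<exists>i. p0 \<le> i \<and> i < p \<and> A i \<noteq> B i \<and> (x = i + i \<and> c = A i \<or> x = Suc (i + i) \<and> c = B i)"
          using that unfolding L_def set_adjl by simp
        then obtain i where i: "p0 \<le> i" "i < p" "A i \<noteq> B i" "x = i + i \<and> c = A i \<or> x = Suc (i + i) \<and> c = B i"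
          by blast
        then show ?thesis using lk(2)[OF i(1-3)] sd[OF i(2)] by (intro exI[of _ i]) (auto simp: ex_def ey_def)
      qed
      have fV: "i + i \<in> set (L (A i)) \<and> Suc (i + i) \<in> set (L (B i))" if "p0 \<le> i" "i < p" "A i \<noteq> B i" for i
        using that unfolding L_def set_adjl by blast
      have fin: "finite V" by (simp add: V_def)
      have cidV: "V \<subseteq> cid ` {..<n}"
        unfolding V_def A_def B_def using SD od p(3) pos by fastforce
      have cr: "V \<subseteq> crossing (2 * x) cid"
      proof
        fix c assume "c \<in> V"
        then obtain i where i: "p0 \<le> i" "i < p" "A i \<noteq> B i" "c = A i \<or> c = B i" by (auto simp: V_def)
        have lt: "S (od i) < n" "D (od i) < n" using E_lt[OF edge[OF i(2)]] by auto
        let ?a = "pos (S (od i))" and ?b = "pos (D (od i))"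
        have ab: "?a < n" "?b < n" "ord ?a = S (od i)" "ord ?b = D (od i)" using pos lt by auto
        have "ew (od i) < 2 * x" using p(5) i by blast
        then have "cid ?a \<in> crossing (2 * x) cid \<and> cid ?b \<in> crossing (2 * x) cid"
          using i(3) ab edge[OF i(2)] by (intro crossingI[OF cl]) (simp_all add: A_def B_def)
        then show "c \<in> crossing (2 * x) cid" using i(4) by (auto simp: A_def B_def)
      qed
      have zz: "ew (od i) \<le> \<rho> * ew (od p0)" if "p0 \<le> i" "i < p" for i
        using p(5)[OF that] by (simp add: z_def mult.commute)
      have BG: "ball_graph n w ord T V L tg ex ey (small (2 * x)) Lw bb k"
      proof
        fix c xx assume c: "c \<in> V" and xx: "xx \<in> set (L c)"
        obtain i where i: "p0 \<le> i" "i < p" "A i \<noteq> B i"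
          "xx = i + i \<and> c = A i \<and> tg xx = B i \<and> ex xx = S (od i) \<and> ey xx = D (od i) \<or>
           xx = Suc (i + i) \<and> c = B i \<and> tg xx = A i \<and> ex xx = S (od i) \<and> ey xx = D (od i)" using half[OF xx] by blast
        have iN: "i \<in> {i\<in>{p0..<p}. A i \<noteq> B i}" using i by simp
        show "tg xx \<in> V" using i(4) iN unfolding V_def by blast
        show "\<exists>x'\<in>set (L (tg xx)). tg x' = c" using i(4) fV[OF i(1-3)] lk(2)[OF i(1-3)] by metis
        show "small (2 * x) {ex xx, ey xx}" using i(4) edge[OF i(2)] p(5)[OF i(1,2)] by auto
        fix H assume H: "{ex xx, ey xx} \<in> H" "T \<subseteq> H"
        have Hi: "{S (od i), D (od i)} \<in> H" using i(4) H(1) by auto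
        have "reach {..<n} H w (ord (A i)) (ord (B i)) Lw"
          unfolding A_def B_def Lw_def by (rule reach_cluster_edge[OF cl H(2) Hi edge[OF i(2)] zz[OF i(1,2)]])
        then show "reach {..<n} H w (ord c) (ord (tg xx)) Lw" using i(4) reach_sym by metis
      next
        show "ord c < n" if "c \<in> V" for c
          using cid_less[OF cl] cidV that ord by blast
        have "0 < ew (od p0)" using x by linarith
        then show "0 \<le> Lw" unfolding Lw_def using \<rho> x q_pos by simp
        have "card V \<le> card (cid ` {..<n})" using cidV by (intro card_mono) auto
        then show "card V \<le> bb ^ k" using bb(2) by linarith
      qed (use fin bb k in auto)
      interpret bg: ball_graph n w ord T V L tg ex ey "small (2 * x)" Lw bb k by (rule BG)
      let ?s3 = "s3\<lparr>nvar := (nvar s3)(''j'' := p0)\<rparr>"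
      have adj3: "bg.adj_state ?s3"
        unfolding bg.adj_state_def using lk(1) VC un3(5) by (auto simp: tg_def ex_def ey_def)
      have Sd: "wp seeds ?s3 (\<lambda>t s'. \<exists>D0\<subseteq>V. t \<le> 10 * (p - p0) + (\<Sum>c\<in>D0. 15 * length (L c) + 30) + 1 \<and>
        (\<forall>i. p0 \<le> i \<and> i < p \<and> A i \<noteq> B i \<longrightarrow> A i \<in> D0) \<and>
        extends (2 * x) ?s3 s' \<and> nvar s' ''outm'' \<le> nvar ?s3 ''outm'' + bb * card D0 \<and>
        (\<forall>c\<in>D0. \<forall>x\<in>set (L c). reach {..<n} (out_edges s') w (ord c) (ord (tg x)) ((2 * real k - 1) * Lw)))"
      proof (rule wp_seeds[OF BG adj3 _ _ _ _ od])
        show "A i \<in> V" if "p0 \<le> i" "i < p" "A i \<noteq> B i" for i using that by (auto simp: V_def)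
        show "narr ?s3 ''del'' c = 0" if "c \<in> V" for c using that VC p(8) un3 by auto
      qed (use un3 p T in \<open>auto simp: inp_def A_def B_def out_edges_def\<close>)
      show ?case
        unfolding un3(6)
      proof (rule wp_frame[OF Sd], goal_cases)
        case (1 t3 s')
        then obtain D0 where D0: "D0 \<subseteq> V" "t3 \<le> 10 * (p - p0) + (\<Sum>c\<in>D0. 15 * length (L c) + 30) + 1"
          "\<forall>i. p0 \<le> i \<and> i < p \<and> A i \<noteq> B i \<longrightarrow> A i \<in> D0" "extends (2 * x) ?s3 s'" "nvar s' ''outm'' \<le> nvar ?s3 ''outm'' + bb * card D0"
          "\<And>c x. c \<in> D0 \<Longrightarrow> x \<in> set (L c) \<Longrightarrow> reach {..<n} (out_edges s') w (ord c) (ord (tg x)) ((2 * real k - 1) * Lw)" by blast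
        \<comment> \<open>Every cluster of \<open>V\<close> has a nonempty list, so the constant 30
          is absorbed by its cells. With at most two cells per edge, all balls of the window cost at
          most \<open>90 * (p - p0)\<close>.\<close>
        have "(\<Sum>c\<in>D0. 15 * length (L c) + 30) \<le> (\<Sum>c\<in>V. 45 * length (L c))"
        proof -
          have "15 * length (L c) + 30 \<le> 45 * length (L c)" if "c \<in> V" for c
          proof -
            have "L c \<noteq> []" using that fV unfolding V_def by fastforce
            then show ?thesis by (cases "L c") auto
          qed
          then have "(\<Sum>c\<in>D0. 15 * length (L c) + 30) \<le> (\<Sum>c\<in>D0. 45 * length (L c))" using D0(1) by (intro sum_mono) blast
          also have "\<dots> \<le> (\<Sum>c\<in>V. 45 * length (L c))" using D0(1) fin by (intro sum_mono2) auto
          finally show ?thesis .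
        qed
        also have "\<dots> \<le> 90 * (p - p0)"
          using sum_length_adjl[OF fin, of A B p0 p] unfolding L_def by (simp add: sum_distrib_left[symmetric])
        finally have time: "t1 + t2 + t3 + 4 \<le> 200 * (p - p0)" using D0(2) p(4) \<open>t2 \<le> _ \<and> _\<close> pp0 by linarith
        have "card D0 \<le> card (crossing (2 * x) cid)"
          using D0(1) cr finite_crossing[OF cl] by (intro card_mono) auto
        then have mono: "bb * card D0 \<le> bb * card (crossing (2 * x) cid)" by (rule mult_le_mono2)
        have "nvar s' ''outm'' \<le> nvar s ''outm'' + bb * card D0" using D0(5) un3(8) by simp
        then have cnt: "nvar s' ''outm'' \<le> nvar s ''outm'' + bb * card (crossing (2 * x) cid)"
          using mono by linarith
        have ext: "extends (2 * x) s s'" using D0(4) un3 by simp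
        have TH: "T \<subseteq> out_edges s'" using T out_ext_edges[OF ext] by (auto simp: out_edges_def)
        have cert: "ew (od i) < 2 * x \<and> reach {..<n} (out_edges s') w (S (od i)) (D (od i)) (stretch * ew (od i))" if i: "p0 \<le> i \<and> i < p" for i
        proof
          show lt: "ew (od i) < 2 * x" using p(5) i by blast
          have mon: "ew (od p0) \<le> ew (od i)" using srt i p(3) by (auto simp: srt_def)
          let ?u = "S (od i)" and ?v = "D (od i)"
          have uv: "?u < n" "?v < n" using E_lt[OF edge] i by auto
          have ru: "reach {..<n} (out_edges s') w ?u (ord (A i)) (x / q)" "reach {..<n} (out_edges s') w (ord (B i)) ?v (x / q)"
            using reach_cid[OF cl TH, of "pos ?u"] reach_sym[OF reach_cid[OF cl TH, of "pos ?v"]] pos uv by (auto simp: A_def B_def)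
          have rab: "reach {..<n} (out_edges s') w (ord (A i)) (ord (B i)) ((2 * real k - 1) * Lw)"
          \<comment> \<open>An edge inside a cluster is served by the tree alone.\<close>
          proof (cases "A i = B i")
            case True
            have "A i < n" using cid_less[OF cl] pos uv by (auto simp: A_def)
            moreover have "0 \<le> (2 * real k - 1) * Lw" using k bg.Lw by simp
            ultimately show ?thesis using True ord by (auto intro!: reach_refl)
          next
            case False
            then have "A i \<in> D0" "i + i \<in> set (L (A i))" "tg (i + i) = B i" using D0(3) i fV lk(2) by auto
            then show ?thesis using D0(6) by metis
          qed
          have "reach {..<n} (out_edges s') w ?u ?v (x / q + (2 * real k - 1) * Lw + x / q)"
            by (rule reach_trans[OF reach_trans[OF ru(1) rab] ru(2)])
          moreover have "x / q + (2 * real k - 1) * Lw + x / q \<le> stretch * ew (od i)"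
            using stretch_window[OF x(2) mon x(1)] unfolding Lw_def by linarith
          ultimately show "reach {..<n} (out_edges s') w ?u ?v (stretch * ew (od i))" by (rule reach_mono)
        qed
        have pv: "nvar s' ''p'' = p" using 1(1) un3 by (simp add: unch_def)
        have "p < m \<Longrightarrow> 2 * x \<le> ew (od p) \<or> \<rho> * ew (od p0) \<le> ew (od p)" using p(6) by (auto simp: z_def mult.commute)
        then show ?case using pv pp0 p(3) time cert ext cnt by blast
      qed
    qed
  qed
  moreover have "a + b + c + 4 = Suc (Suc (Suc (Suc (a + (b + c)))))" for a b c :: nat by simp
  ultimately show ?thesis
    unfolding fine_window_def wp_Seq wp_NAssign wp_RAssign
    using st(1) wt0 arr by (simp add: z_def)
qed

end

section \<open>The main loop\<close>

definition fine_loop :: com where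
  "fine_loop = While (BAnd (NLess (NVar ''p'') (NVar ''m'')) (RLess (RArr ''wt'' (NArr ''o'' (NVar ''p''))) (RVar ''y2''))) fine_window"

text \<open>The flag \<open>act\<close> records a tree edge that makes the scale worth processing.
  The register \<open>nxt\<close> becomes the least tree weight of at least \<open>2 y\<close>, with
  0 for none: all edges lighter than \<open>nxt\<close> see the same light forest, so one skip may
  pass over many scales.\<close>

definition tree_scan :: com where
  "tree_scan = For ''i'' ''n'' (
     Cond (RLess (RArr ''key'' (NVar ''i'')) (RPlus (RVar ''y'') (RVar ''y'')))
       (Cond (RLess (RVar ''y'') (RTimes (RTimes (RVar ''q'') (RNat (NVar ''n''))) (RArr ''key'' (NVar ''i'')))) (NAssign ''act'' (NConst 1)) Skip)
       (Cond (BOr (BNot (RLess NZ (RVar ''nxt''))) (RLess (RArr ''key'' (NVar ''i'')) (RVar ''nxt'')))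
         (RAssign ''nxt'' (RArr ''key'' (NVar ''i''))) Skip))"

definition skip_loop :: com where
  "skip_loop = While (BAnd (NLess (NVar ''p'') (NVar ''m'')) (RLess (RArr ''wt'' (NArr ''o'' (NVar ''p''))) (RVar ''nxt''))) (incr ''p'')"

definition main_loop :: com where
  "main_loop = While (NLess (NVar ''p'') (NVar ''m'')) (
     RAssign ''y'' (RArr ''wt'' (NArr ''o'' (NVar ''p''))) ;;
     NAssign ''act'' (NConst 0) ;; RAssign ''nxt'' NZ ;; NAssign ''i'' (NConst 1) ;; tree_scan ;;
     Cond (NLess (NVar ''act'') (NConst 1))
       (Cond (RLess NZ (RVar ''nxt'')) skip_loop (NAssign ''p'' (NVar ''m'')))
       (cluster ;; fine_loop))"

definition light_spanner :: com where
  "light_spanner = prim ;; Cond (NLess (NVar ''k'') (NVar ''n'')) (sort_edges ;; NAssign ''p'' (NConst 0) ;; main_loop) Skip"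

lemma fine_loop_writes [simp]:
  "nws fine_loop = nws fine_window" "rws fine_loop = rws fine_window" "naws fine_loop = naws fine_window" "raws fine_loop = raws fine_window"
  by (simp_all only: fine_loop_def nws.simps rws.simps naws.simps raws.simps)

lemma tree_scan_writes [simp]:
  "nws tree_scan = {''i'', ''act''}" "rws tree_scan = {''nxt''}" "naws tree_scan = {}" "raws tree_scan = {}"
  by (auto simp: tree_scan_def)

lemma skip_loop_writes [simp]:
  "nws skip_loop = {''p''}" "rws skip_loop = {}" "naws skip_loop = {}" "raws skip_loop = {}"
  by (auto simp: skip_loop_def)

context tree_input
begin

lemma wp_fine_loop:
  assumes inp: "inp s" and arr: "narr s ''pos'' = pos" "narr s ''o'' = od" "narr s ''cid'' = cid"
    and od: "\<And>i. i < m \<Longrightarrow> od i < m" and srt: "srt ew od 0 m"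
    and st: "nvar s ''p'' = p0" "p0 < m" "rvar s ''y2'' = 2 * x" "nvar s ''b'' = bb"
    and x: "0 < x" "x = ew (od p0)"
    and cl: "clustering (x / q) (2 * x) h ct cid" and bb: "1 \<le> bb" "card (cid ` {..<n}) \<le> bb ^ k" and T: "T \<subseteq> out_edges s"
  shows "wp fine_loop s (\<lambda>t s'. \<exists>p f. nvar s' ''p'' = p \<and> p0 \<le> p \<and> p \<le> m \<and> t \<le> 201 * (p - p0) + 1 \<and>
    (\<forall>i. p0 \<le> i \<and> i < p \<longrightarrow> reach {..<n} (out_edges s') w (S (od i)) (D (od i)) (stretch * ew (od i))) \<and>
    (p < m \<longrightarrow> 2 * x \<le> ew (od p)) \<and>
    extends (2 * x) s s' \<and> nvar s' ''outm'' \<le> nvar s ''outm'' + f * (bb * card (crossing (2 * x) cid)) \<and> real f \<le> 2 / (\<rho> - 1))"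
proof -
  define N where "N = bb * card (crossing (2 * x) cid)"
  define cert where "cert s' a b \<longleftrightarrow> (\<forall>i. a \<le> i \<and> i < b \<longrightarrow> reach {..<n} (out_edges s') w (S (od i)) (D (od i)) (stretch * ew (od i)))" for s' a b
  \<comment> \<open>Consecutive windows start at weights of ratio at least \<open>\<rho>\<close>
    inside \<open>[x, 2 x)\<close>, so \<open>f\<close> windows satisfy
    \<open>\<rho> ^ (f - 1) < 2\<close>. Bernoulli gives
    \<open>(f - 1) * (\<rho> - 1) \<le> 1\<close>, and \<open>\<rho> \<le> 2\<close> gives the
    bound.\<close>
  have fle: "real f \<le> 2 / (\<rho> - 1)" if "f = 0 \<or> \<rho> ^ (f - 1) < 2" for f
  proof (cases "f = 0")
    case True
    then show ?thesis using \<rho> by simp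
  next
    case False
    have "1 + real (f - 1) * (\<rho> - 1) \<le> \<rho> ^ (f - 1)" using Bernoulli_inequality[of "\<rho> - 1" "f - 1"] \<rho> by simp
    then have "(real f - 1) * (\<rho> - 1) \<le> 1" using that False by (simp add: of_nat_diff)
    then have "real f * (\<rho> - 1) \<le> 2" using \<rho> by (simp add: algebra_simps)
    then show ?thesis using \<rho> by (simp add: pos_le_divide_eq)
  qed
  show ?thesis
    unfolding fine_loop_def N_def[symmetric] cert_def[symmetric]
  proof (rule wp_While[where B = "201 * m" and I = "\<lambda>t s'. \<exists>p f. nvar s' ''p'' = p \<and> p0 \<le> p \<and> p \<le> m \<and> t \<le> 201 * (p - p0) \<and>
      cert s' p0 p \<and> extends (2 * x) s s' \<and> nvar s' ''outm'' \<le> nvar s ''outm'' + f * N \<and> (f = 0 \<or> \<rho> ^ (f - 1) < 2) \<and>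
      (p < m \<and> ew (od p) < 2 * x \<longrightarrow> \<rho> ^ f * x \<le> ew (od p))"], goal_cases)
    case 1
    show ?case using st x by (intro exI[of _ p0] exI[of _ 0]) (auto simp: cert_def out_ext_refl)
  next
    case (3 t s')
    obtain p f where p: "nvar s' ''p'' = p" "p0 \<le> p" "p \<le> m" "t \<le> 201 * (p - p0)" "cert s' p0 p" "extends (2 * x) s s'"
      "nvar s' ''outm'' \<le> nvar s ''outm'' + f * N" "p < m \<and> ew (od p) < 2 * x \<longrightarrow> \<rho> ^ f * x \<le> ew (od p)" using 3(2) by blast
    have inp': "inp s'" and un: "narr s' ''pos'' = pos" "narr s' ''o'' = od" "narr s' ''cid'' = cid" "rvar s' ''y2'' = 2 * x" "nvar s' ''b'' = bb"
      using 3(1) inp arr st by (auto simp: unch_def inp_def)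
    have pm: "p < m" using 3(3) p(1) inp' by (simp add: inp_def)
    have lt: "ew (od p) < 2 * x" using 3(3) p(1) un inp' od[OF pm] by (auto simp: inp_def)
    have ge: "x \<le> ew (od p)" using srt p(2) pm x(2) by (auto simp: srt_def)
    have T': "T \<subseteq> out_edges s'" using T out_ext_edges[OF p(6)] by (auto simp: out_edges_def)
    have fx: "\<rho> ^ f * x \<le> ew (od p)" using p(8) pm lt by blast
    then have "\<rho> ^ f * x < 2 * x" using lt by linarith
    then have f2: "\<rho> ^ f < 2" using x(1) by simp
    show ?case
    proof (rule wp_mono[OF wp_fine_window[OF inp' un(1-3) od srt p(1) pm un(4,5) x(1) ge lt cl bb T']], goal_cases)
      case (2 t' s'')
      then obtain p' where p': "nvar s'' ''p'' = p'" "p < p'" "p' \<le> m" "t' \<le> 200 * (p' - p)"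
        "cert s'' p p'" "p' < m \<longrightarrow> 2 * x \<le> ew (od p') \<or> \<rho> * ew (od p) \<le> ew (od p')"
        "extends (2 * x) s' s''" "nvar s'' ''outm'' \<le> nvar s' ''outm'' + N" unfolding N_def cert_def by blast
      have c1: "cert s'' p0 p" using p(5) reach_superset[OF _ out_ext_edges[OF p'(7)]] unfolding cert_def out_edges_def by blast
      have c2: "cert s'' p0 p'" unfolding cert_def
      proof (intro allI impI)
        fix i assume "p0 \<le> i \<and> i < p'"
        then show "reach {..<n} (out_edges s'') w (S (od i)) (D (od i)) (stretch * ew (od i))"
          using c1 p'(5) unfolding cert_def by (cases "i < p") auto
      qed
      have e2: "extends (2 * x) s s''" using p(6) p'(7) by (rule out_ext_trans)
      have o2: "nvar s'' ''outm'' \<le> nvar s ''outm'' + Suc f * N" using p(7) p'(8) by simp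
      have f3: "\<rho> ^ Suc f * x \<le> ew (od p')" if "p' < m \<and> ew (od p') < 2 * x"
      proof -
        have "\<rho> * ew (od p) \<le> ew (od p')" using p'(6) that by auto
        moreover have "\<rho> * (\<rho> ^ f * x) \<le> \<rho> * ew (od p)" using fx \<rho> by (intro mult_left_mono) auto
        ultimately show ?thesis by (simp add: mult.assoc)
      qed
      have "Suc (t + t') \<le> 201 * (p' - p0)" using p(2,4) p'(2,4) by linarith
      then show ?case using p'(1-3) p(2) c2 e2 o2 f2 f3 by (intro exI[of _ p'] exI[of _ "Suc f"]) auto
    qed
  next
    case (4 t s')
    obtain p f where p: "nvar s' ''p'' = p" "p0 \<le> p" "p \<le> m" "t \<le> 201 * (p - p0)" "cert s' p0 p" "extends (2 * x) s s'"
      "nvar s' ''outm'' \<le> nvar s ''outm'' + f * N" "f = 0 \<or> \<rho> ^ (f - 1) < 2" using 4(2) by blast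
    have inp': "inp s'" and un: "narr s' ''o'' = od" "rvar s' ''y2'' = 2 * x"
      using 4(1) inp arr st by (auto simp: unch_def inp_def)
    have "2 * x \<le> ew (od p)" if "p < m" using 4(3) that p(1) un inp' od[OF that] by (auto simp: inp_def)
    then show ?case using p fle[OF p(8)] by (intro exI[of _ p] exI[of _ f]) auto
  qed auto
qed

section \<open>Active and skipped scales\<close>

definition scale_act :: "real \<Rightarrow> nat \<Rightarrow> bool" where
  "scale_act y j \<longleftrightarrow> (\<exists>i. 0 < i \<and> i < j \<and> key i < 2 * y \<and> y < q * n * key i)"

definition scale_next :: "real \<Rightarrow> nat \<Rightarrow> real \<Rightarrow> bool" where
  "scale_next y j nxt \<longleftrightarrow> (0 < nxt \<longrightarrow> (\<exists>i. 0 < i \<and> i < j \<and> nxt = key i \<and> 2 * y \<le> key i)) \<and>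
     (\<forall>i. 0 < i \<and> i < j \<and> 2 * y \<le> key i \<longrightarrow> 0 < nxt \<and> nxt \<le> key i)"

lemma wp_tree_scan:
  assumes inp: "inp s" and arr: "rarr s ''key'' = key" and st: "rvar s ''y'' = y" "nvar s ''act'' = 0" "rvar s ''nxt'' = 0" "nvar s ''i'' = 1"
  shows "wp tree_scan s (\<lambda>t s'. t \<le> 5 * n + 1 \<and> (0 < nvar s' ''act'' \<longleftrightarrow> scale_act y n) \<and> scale_next y n (rvar s' ''nxt''))"
  unfolding tree_scan_def
proof (rule wp_For[where a = 1 and N = n and I = "\<lambda>j t s'. t \<le> 5 * j \<and> (0 < nvar s' ''act'' \<longleftrightarrow> scale_act y j) \<and> scale_next y j (rvar s' ''nxt'')"],
    goal_cases)
  case 7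
  show ?case using st by (auto simp: scale_act_def scale_next_def)
next
  case (8 j t s')
  have un: "rarr s' ''key'' = key" "rvar s' ''y'' = y" "rvar s' ''q'' = q" "nvar s' ''n'' = n"
    using 8(3) inp arr st by (auto simp: unch_def inp_def)
  have a: "scale_act y (Suc j) \<longleftrightarrow> scale_act y j \<or> key j < 2 * y \<and> y < q * n * key j"
    using 8(1) unfolding scale_act_def less_Suc_eq by (metis One_nat_def Suc_le_lessD)
  have kp: "0 < key j" using key_pos 8 by simp
  have s1: "scale_next y (Suc j) v" if "scale_next y j v" "\<not> 2 * y \<le> key j \<or> 0 < v \<and> v \<le> key j" for v
    using that by (auto simp: scale_next_def less_Suc_eq)
  have s2: "scale_next y (Suc j) (key j)" if "scale_next y j v" "2 * y \<le> key j" "\<not> 0 < v \<or> key j < v" for v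
    unfolding scale_next_def
  proof (intro conjI impI allI)
    show "\<exists>i. 0 < i \<and> i < Suc j \<and> key j = key i \<and> 2 * y \<le> key i" using that(2) 8(1) by (intro exI[of _ j]) auto
    fix i assume i: "0 < i \<and> i < Suc j \<and> 2 * y \<le> key i"
    show "0 < key j" by (rule kp)
    show "key j \<le> key i"
    proof (cases "i = j")
      case False
      then have "0 < v \<and> v \<le> key i" using that(1) i by (auto simp: scale_next_def)
      then show ?thesis using that(3) by auto
    qed simp
  qed
  have yy: "y + y = 2 * y" by simp
  have I: "t \<le> 5 * j" "0 < nvar s' ''act'' \<longleftrightarrow> scale_act y j" "scale_next y j (rvar s' ''nxt'')" using 8(5) by auto
  show ?case
  proof (cases "key j < 2 * y")
    case True
    then show ?thesis using I s1[OF I(3)] a 8(4) by (auto simp: wp_simps un yy)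
  next
    case False
    then show ?thesis using I s1[OF I(3)] s2[OF I(3)] a 8(4) by (auto simp: wp_simps un yy)
  qed
qed (use assms n_pos in \<open>auto simp: inp_def\<close>)

lemma wp_skip_loop:
  assumes inp: "inp s" and arr: "narr s ''o'' = od" and od: "\<And>i. i < m \<Longrightarrow> od i < m"
    and st: "nvar s ''p'' = p0" "p0 \<le> m" "rvar s ''nxt'' = nxt"
  shows "wp skip_loop s (\<lambda>t s'. \<exists>p. nvar s' ''p'' = p \<and> p0 \<le> p \<and> p \<le> m \<and> t \<le> 2 * (p - p0) + 1 \<and>
    (\<forall>i. p0 \<le> i \<and> i < p \<longrightarrow> ew (od i) < nxt) \<and> (p < m \<longrightarrow> nxt \<le> ew (od p)))"
  unfolding skip_loop_def
proof (rule wp_While[where B = "2 * m" and I = "\<lambda>t s'. \<exists>p. nvar s' ''p'' = p \<and> p0 \<le> p \<and> p \<le> m \<and> t \<le> 2 * (p - p0) \<and>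
    (\<forall>i. p0 \<le> i \<and> i < p \<longrightarrow> ew (od i) < nxt)"], goal_cases)
  case (3 t s')
  obtain p where p: "nvar s' ''p'' = p" "p0 \<le> p" "p \<le> m" "t \<le> 2 * (p - p0)" "\<forall>i. p0 \<le> i \<and> i < p \<longrightarrow> ew (od i) < nxt" using 3(2) by blast
  have inp': "inp s'" and un: "narr s' ''o'' = od" "rvar s' ''nxt'' = nxt" using 3(1) inp arr st by (auto simp: unch_def inp_def)
  have pm: "p < m" using 3(3) p(1) inp' by (simp add: inp_def)
  have "ew (od p) < nxt" using 3(3) p(1) un inp' od[OF pm] by (auto simp: inp_def)
  then have "\<forall>i. p0 \<le> i \<and> i < Suc p \<longrightarrow> ew (od i) < nxt" using p(5) by (auto simp: less_Suc_eq)
  then show ?case using p pm by (auto simp: wp_simps)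
next
  case (4 t s')
  obtain p where p: "nvar s' ''p'' = p" "p0 \<le> p" "p \<le> m" "t \<le> 2 * (p - p0)" "\<forall>i. p0 \<le> i \<and> i < p \<longrightarrow> ew (od i) < nxt" using 4(2) by blast
  have inp': "inp s'" and un: "narr s' ''o'' = od" "rvar s' ''nxt'' = nxt" using 4(1) inp arr st by (auto simp: unch_def inp_def)
  have "nxt \<le> ew (od p)" if "p < m" using 4(3) that p(1) un inp' od[OF that] by (auto simp: inp_def)
  then show ?case using p by auto
qed (use st in auto)

text \<open>The first bound serves the skipped scales, the last one the case
  \<open>n \<le> k\<close>.\<close>

lemma stretch_ge: "2 / q \<le> stretch" "0 < stretch" "2 * real k - 1 \<le> stretch"
proof -
  have "0 < 2 / q" using q_pos by simp
  define c where "c = \<rho> * (2 * real k - 1)"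
  have "1 * (2 * real k - 1) \<le> c" unfolding c_def using \<rho> k by (intro mult_right_mono) auto
  then have c: "2 * real k - 1 \<le> c" by simp
  have k1: "1 \<le> 2 * real k - 1" using k by simp
  have "c * 1 \<le> c * (1 + 2 / q)" using c k1 \<open>0 < 2 / q\<close> by (intro mult_left_mono) auto
  moreover have "stretch = c * (1 + 2 / q) + 2 / q" by (simp add: stretch_def c_def)
  ultimately have "2 * real k - 1 \<le> stretch \<and> 2 / q \<le> stretch \<and> 0 < stretch"
    using \<open>0 < 2 / q\<close> c k1 by (intro conjI) linarith+
  then show "2 * real k - 1 \<le> stretch" "2 / q \<le> stretch" "0 < stretch" by blast+
qed

text \<open>Tree edges of weight at most \<open>ew i\<close> are lighter than any
  \<open>nxt\<close>, hence than \<open>2 y\<close>, hence at most \<open>y / (q n)\<close> as the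
  scale is inactive. By \<open>reach_light\<close> the detour over them weighs at most
  \<open>2 / q\<close> times \<open>ew i\<close>.\<close>

lemma reach_inactive:
  assumes H: "T \<subseteq> H" and e: "i < m" and y: "y \<le> ew i" and na: "\<not> scale_act y n"
    and nx: "scale_next y n nxt" "0 < nxt \<Longrightarrow> ew i < nxt"
  shows "reach {..<n} H w (S i) (D i) (stretch * ew i)"
proof -
  have eE: "{S i, D i} \<in> E" using es_nth[OF e] by blast
  then have pos: "0 < ew i" by (rule E_wpos)
  have A: "0 < q * n" using q_pos n_pos by simp
  have "reach {..<n} H w (S i) (D i) (2 * (real n - 1) * (ew i / (q * n)))"
  proof (rule reach_light[OF H eE])
    show "0 \<le> ew i / (q * n)" using pos A by simp
    fix j assume j: "0 < j" "j < n" "key j \<le> ew i"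
    have "key j < 2 * y"
    proof (rule ccontr)
      assume "\<not> key j < 2 * y"
      then have "0 < nxt \<and> nxt \<le> key j" using nx(1) j unfolding scale_next_def by auto
      then show False using nx(2) j by auto
    qed
    then have "q * n * key j \<le> y" using na j unfolding scale_act_def by force
    then have "key j * (q * n) \<le> ew i" using y by (simp add: mult.commute)
    then show "key j \<le> ew i / (q * n)" using A by (simp add: pos_le_divide_eq)
  qed
  moreover have "2 * (real n - 1) * (ew i / (q * n)) \<le> stretch * ew i"
  proof -
    have "2 * (real n - 1) * (ew i / (q * n)) \<le> 2 * real n * (ew i / (q * n))"
      using pos A by (intro mult_right_mono) auto
    also have "\<dots> = 2 / q * ew i" using n_pos by simp
    also have "\<dots> \<le> stretch * ew i" using stretch_ge(1) pos by (intro mult_right_mono) auto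
    finally show ?thesis .
  qed
  ultimately show ?thesis by (rule reach_mono)
qed

section \<open>Bounds for the output of one scale\<close>

abbreviation W :: real where "W \<equiv> tweight"

text \<open>Bounds the number of clusters when some cluster is not isolated. With
  \<open>R = x / q\<close>, light cuts contribute \<open>q * (W / x)\<close>, heavy cuts half of
  \<open>W / x\<close>, and the cluster of the root is covered by a further
  \<open>q * (W / x)\<close>.\<close>

definition kappa :: "real \<Rightarrow> real" where "kappa x = min (real n) ((2 * q + 1 / 2) * (W / x))"

definition gamma :: "real \<Rightarrow> real" where "gamma x = min (real n) (2 * (q / x) * light_weight (2 * x))"

text \<open>The factors bound the number of windows, the base \<open>b\<close> and the number of
  non-isolated clusters.\<close>

definition cost :: "real \<Rightarrow> real" where
  "cost x = 2 / (\<rho> - 1) * (2 * kappa x powr (1 / k)) * gamma x"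

lemma light_weight_nonneg: "0 \<le> light_weight \<theta>"
  unfolding light_weight_def by (intro sum_nonneg) (auto intro: less_imp_le[OF key_pos])

lemma W_nonneg: "0 \<le> W"
  unfolding tweight_def by (intro sum_nonneg) (auto intro: less_imp_le[OF key_pos])

lemma gamma_nonneg: "0 < x \<Longrightarrow> 0 \<le> gamma x"
  unfolding gamma_def using light_weight_nonneg q_pos by auto

lemma cost_nonneg: "0 < x \<Longrightarrow> 0 \<le> cost x"
  unfolding cost_def using gamma_nonneg[of x] \<rho> by (intro mult_nonneg_nonneg) auto

text \<open>Unless \<open>b = 1\<close>, \<open>b - 1\<close> is at most the root of
  \<open>c\<close>; the missing 1 is absorbed because that root is at least 1.\<close>

lemma root_bound:
  assumes c: "1 \<le> c" and b: "b = 1 \<or> (b - 1) ^ k < c"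
  shows "real b \<le> 2 * real c powr (1 / k)"
proof -
  have c1: "1 \<le> real c powr (1 / k)" using c by (intro ge_one_powr_ge_zero) auto
  show ?thesis
  proof (cases "b \<le> 1")
    case True
    then show ?thesis using c1 by linarith
  next
    case False
    then have "(b - 1) ^ k < c" "0 < b - 1" using b by auto
    then have "real (b - 1) ^ k \<le> real c" by (metis less_imp_le of_nat_le_iff of_nat_power)
    then have "(real (b - 1) ^ k) powr (1 / k) \<le> real c powr (1 / k)" by (intro powr_mono2) auto
    moreover have "(real (b - 1) ^ k) powr (1 / k) = real (b - 1)"
      using k \<open>0 < b - 1\<close> by (simp add: powr_realpow[symmetric] powr_powr)
    ultimately have "real b - 1 \<le> real c powr (1 / k)" using False by (simp add: of_nat_diff)
    then show ?thesis using c1 by linarith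
  qed
qed

lemma cost_bound:
  assumes x: "0 < x" and cl: "clustering (x / q) (2 * x) h ct cid"
    and c: "c = 1 + card {i. 0 < i \<and> i < n \<and> ct i}" and b: "bb = 1 \<or> (bb - 1) ^ k < c" and f: "real f \<le> 2 / (\<rho> - 1)"
  shows "real (f * (bb * card (crossing (2 * x) cid))) \<le> cost x" "real bb \<le> 2 * real n powr (1 / k)"
proof -
  let ?N = "card (crossing (2 * x) cid)"
  have R: "0 < x / q" using x q_pos by simp
  have "{i. 0 < i \<and> i < n \<and> ct i} \<subseteq> {0<..<n}" by auto
  then have "card {i. 0 < i \<and> i < n \<and> ct i} \<le> n - 1" using card_mono[of "{0<..<n}"] by fastforce
  then have cn: "c \<le> n" "1 \<le> c" using c n_pos by auto
  have bc: "real bb \<le> 2 * real c powr (1 / k)" using root_bound cn(2) b by blast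
  also have "\<dots> \<le> 2 * real n powr (1 / k)" using cn by (intro mult_left_mono powr_mono2) auto
  finally show "real bb \<le> 2 * real n powr (1 / k)" .
  show "real (f * (bb * ?N)) \<le> cost x"
  proof (cases "?N = 0")
    case True
    then show ?thesis using cost_nonneg[OF x] by simp
  next
    case False
    have "crossing (2 * x) cid \<subseteq> cid ` {..<n}" unfolding crossing_def[OF cl] by auto
    then have "?N \<le> n" using card_mono[of "cid ` {..<n}" "crossing (2 * x) cid"] card_image_le[of "{..<n}" cid] by simp
    moreover have "x / q * ?N \<le> 2 * light_weight (2 * x)" using crossing_weight[OF cl] R by simp
    then have "real ?N \<le> 2 * (q / x) * light_weight (2 * x)" using x q_pos by (simp add: field_simps)
    ultimately have g: "real ?N \<le> gamma x" by (simp add: gamma_def)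
    \<comment> \<open>A non-isolated cluster forces a light cut and hence
      \<open>x / q \<le> W\<close>, which absorbs the summand 1 for the cluster of the root.\<close>
    have "1 \<le> card (light_cuts (2 * x) ct)" using False card_crossing_le[OF cl] by linarith
    then have "x / q * 1 \<le> x / q * card (light_cuts (2 * x) ct)" using R by (intro mult_left_mono) auto
    also have "\<dots> \<le> W" using cl light_weight_le[of "2 * x"] unfolding clustering_def by linarith
    finally have "x \<le> q * W" using q_pos by (simp add: field_simps)
    then have "1 \<le> q * (W / x)" using x by (simp add: field_simps)
    moreover have "real c \<le> 1 + (W / (x / q) + W / (2 * x))"
      using card_cut_weight[OF cl R] x c by simp
    moreover have "W / (x / q) + W / (2 * x) = (q + 1 / 2) * (W / x)" using x q_pos by (simp add: field_simps)
    moreover have "(2 * q + 1 / 2) * (W / x) = q * (W / x) + (q + 1 / 2) * (W / x)" by (simp add: algebra_simps)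
    ultimately have "real c \<le> (2 * q + 1 / 2) * (W / x)" by linarith
    then have "real c \<le> kappa x" using cn by (simp add: kappa_def)
    then have "real c powr (1 / k) \<le> kappa x powr (1 / k)" by (intro powr_mono2) auto
    then have bk: "real bb \<le> 2 * kappa x powr (1 / k)" using bc by linarith
    have "real f * (real bb * real ?N) \<le> 2 / (\<rho> - 1) * (2 * kappa x powr (1 / k) * gamma x)"
      using f bk g gamma_nonneg[OF x] \<rho> by (intro mult_mono) auto
    then show ?thesis by (simp add: cost_def mult.assoc)
  qed
qed

text \<open>The sum runs over output slots, so an edge output twice counts twice. This makes it
  additive and an upper bound for the weight of the output set.\<close>

definition out_weight :: "state \<Rightarrow> real" where
  "out_weight s = (\<Sum>j<nvar s ''outm''. w {narr s ''outsrc'' j, narr s ''outdst'' j})"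

lemma out_weight_extends:
  assumes e: "extends \<theta> s s'" and c: "nvar s' ''outm'' \<le> nvar s ''outm'' + N" "real N \<le> r" and \<theta>: "0 \<le> \<theta>"
  shows "out_weight s' \<le> out_weight s + r * \<theta>"
proof -
  let ?a = "nvar s ''outm''" and ?b = "nvar s' ''outm''"
  let ?f = "\<lambda>j. w {narr s' ''outsrc'' j, narr s' ''outdst'' j}"
  have ab: "?a \<le> ?b" using e by (simp add: out_ext_def)
  have 1: "out_weight s' = (\<Sum>j<?a. ?f j) + (\<Sum>j\<in>{?a..<?b}. ?f j)"
    unfolding out_weight_def lessThan_atLeast0 using ab by (simp add: sum.atLeastLessThan_concat)
  have 2: "(\<Sum>j<?a. ?f j) = out_weight s"
    unfolding out_weight_def using e by (intro sum.cong) (auto simp: out_ext_def)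
  have "(\<Sum>j\<in>{?a..<?b}. ?f j) \<le> (\<Sum>j\<in>{?a..<?b}. \<theta>)"
    using e by (intro sum_mono) (auto simp: out_ext_def less_imp_le)
  moreover have "(\<Sum>j\<in>{?a..<?b}. \<theta>) = real (?b - ?a) * \<theta>" by simp
  moreover have "real (?b - ?a) * \<theta> \<le> r * \<theta>" using c \<theta> by (intro mult_right_mono) linarith+
  ultimately show ?thesis using 1 2 by linarith
qed

definition logn :: real where "logn = 4 + 2 * log 2 n"

lemma logn_ge: "4 \<le> logn"
  unfolding logn_def using n_pos by simp

text \<open>Each active scale is charged to a tree edge that activates it. For a fixed edge these
  scales lie between \<open>key i / 2\<close> and \<open>q n key i\<close>, and
  \<open>q n \<le> n ^ 2\<close> by \<open>q < k < n\<close>, so there are only logarithmically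
  many.\<close>

lemma card_active_le:
  assumes X: "separated X" "\<And>x. x \<in> X \<Longrightarrow> scale_act x n" and kn: "k < n"
  shows "real (card X) \<le> n * logn"
proof -
  have n1: "1 \<le> real n" using n_pos by simp
  have A: "0 < q * n" "q * n \<le> real n * n" using q_pos n_pos q(2) kn by (auto intro: mult_right_mono)
  have *: "real (card {x\<in>X. key i < 2 * x \<and> x < q * n * key i}) \<le> logn" if i: "0 < i" "i < n" for i
  proof (cases "{x\<in>X. key i < 2 * x \<and> x < q * n * key i} = {}")
    case True
    show ?thesis unfolding True using logn_ge by simp
  next
    case False
    then obtain x where x: "key i < 2 * x" "x < q * n * key i" by blast
    have k0: "0 < key i" using key_pos i by blast
    have "real (card {x\<in>X. key i < 2 * x \<and> x < q * n * key i}) \<le> 1 + log 2 (q * n * key i / (key i / 2))"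
    proof (rule card_separated_le)
      show "separated {x\<in>X. key i < 2 * x \<and> x < q * n * key i}" using X(1) by (rule separated_subset) auto
      show "0 < key i / 2" using k0 by simp
      show "key i / 2 \<le> q * n * key i" using x by linarith
    qed auto
    also have "q * n * key i / (key i / 2) = 2 * (q * n)" using k0 by (simp add: field_simps)
    also have "1 + log 2 (2 * (q * n)) \<le> 1 + log 2 (2 * (real n * n))" using A by (intro add_left_mono log_mono) auto
    also have "\<dots> = 2 + 2 * log 2 n" using n1 by (simp add: log_mult)
    finally show ?thesis by (simp add: logn_def)
  qed
  have "X \<subseteq> (\<Union>i\<in>{0<..<n}. {x\<in>X. key i < 2 * x \<and> x < q * n * key i})"
    using X(2) unfolding scale_act_def by fastforce
  moreover have fin: "finite X" using X(1) by (simp add: separated_def)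
  ultimately have "card X \<le> card (\<Union>i\<in>{0<..<n}. {x\<in>X. key i < 2 * x \<and> x < q * n * key i})"
    by (intro card_mono) auto
  also have "\<dots> \<le> (\<Sum>i\<in>{0<..<n}. card {x\<in>X. key i < 2 * x \<and> x < q * n * key i})" by (rule card_UN_le) simp
  finally have "real (card X) \<le> real (\<Sum>i\<in>{0<..<n}. card {x\<in>X. key i < 2 * x \<and> x < q * n * key i})"
    by (rule of_nat_mono)
  also have "\<dots> = (\<Sum>i\<in>{0<..<n}. real (card {x\<in>X. key i < 2 * x \<and> x < q * n * key i}))" by (rule of_nat_sum)
  also have "\<dots> \<le> (\<Sum>i\<in>{0<..<n}. logn)" using * by (intro sum_mono) auto
  also have "\<dots> \<le> n * logn" using logn_ge n_pos by (simp add: of_nat_diff mult_right_mono)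
  finally show ?thesis .
qed

definition scale_time :: real where "scale_time = 40 * n + (3 * real k + 5) * (2 * n powr (1 / k)) + 40"

text \<open>\<open>X\<close> collects the processed scales and \<open>sk\<close> counts the skips. A
  skip that leaves edges ends beyond a tree weight not passed before, so \<open>sk\<close> stays
  below the number of positions whose key is at most the current weight. Conditions on the edge at
  \<open>p\<close> are guarded by \<open>p < m\<close>, since after the last edge there is
  none.\<close>

definition progress :: "(nat \<Rightarrow> nat) \<Rightarrow> state \<Rightarrow> nat \<Rightarrow> nat \<Rightarrow> real set \<Rightarrow> nat \<Rightarrow> state \<Rightarrow> bool" where
  "progress od s0 t p X sk s \<longleftrightarrow> p \<le> m \<and> separated X \<and> (\<forall>x\<in>X. scale_act x n) \<and> (p < m \<longrightarrow> (\<forall>x\<in>X. 2 * x \<le> ew (od p))) \<and>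
     sk \<le> n \<and> (p < m \<longrightarrow> sk \<le> card {i. 0 < i \<and> i < n \<and> key i \<le> ew (od p)}) \<and>
     (\<forall>i<p. reach {..<n} (out_edges s) w (S (od i)) (D (od i)) (stretch * ew (od i))) \<and>
     out_edges s0 \<subseteq> out_edges s \<and> out_edges s \<subseteq> E \<and>
     real (nvar s ''outm'') \<le> real (nvar s0 ''outm'') + (\<Sum>x\<in>X. cost x) \<and>
     out_weight s \<le> out_weight s0 + (\<Sum>x\<in>X. cost x * (2 * x)) \<and>
     real t \<le> 210 * real p + real sk * (8 * n + 20) + real (card X) * scale_time"

lemma progress_time:
  assumes P: "progress od s0 t p X sk s" and kn: "k < n"
  shows "real t \<le> 210 * real m + real n * (8 * n + 20) + n * logn * scale_time"
proof -
  have "210 * real p \<le> 210 * real m" "real sk * (8 * n + 20) \<le> real n * (8 * n + 20)"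
    using P unfolding progress_def by (simp, intro mult_right_mono, simp_all)
  moreover have "separated X" "\<And>x. x \<in> X \<Longrightarrow> scale_act x n" using P unfolding progress_def by blast+
  then have "real (card X) \<le> n * logn" by (rule card_active_le[OF _ _ kn])
  then have "real (card X) * scale_time \<le> n * logn * scale_time"
    by (rule mult_right_mono) (simp add: scale_time_def)
  ultimately show ?thesis using P unfolding progress_def by linarith
qed

lemma progress_skip:
  assumes P: "progress od s0 t p X sk s" and pm: "p < m" "p < p'" "p' \<le> m" and srt: "srt ew od 0 m" and od: "\<And>i. i < m \<Longrightarrow> od i < m"
    and na: "\<not> scale_act (ew (od p)) n" and nx: "scale_next (ew (od p)) n nxt"
    and below: "\<And>i. p \<le> i \<Longrightarrow> i < p' \<Longrightarrow> 0 < nxt \<Longrightarrow> ew (od i) < nxt" and above: "p' < m \<Longrightarrow> 0 < nxt \<and> nxt \<le> ew (od p')"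
    and T: "T \<subseteq> out_edges s0" and s': "out_edges s' = out_edges s" "nvar s' ''outm'' = nvar s ''outm''" "out_weight s' = out_weight s"
    and t': "t' \<le> t + 5 * n + 12 + 2 * (p' - p)"
  shows "progress od s0 t' p' X (Suc sk) s'"
proof -
  have mon: "ew (od i) \<le> ew (od j)" if "i \<le> j" "j < m" for i j using srt that by (auto simp: srt_def)
  have y0: "0 < ew (od p)" using es_nth[OF od[OF pm(1)]] E_wpos by blast
  have H: "T \<subseteq> out_edges s'" using T P s'(1) by (auto simp: progress_def)
  have cert: "reach {..<n} (out_edges s') w (S (od i)) (D (od i)) (stretch * ew (od i))" if "i < p'" for i
  proof (cases "i < p")
    case True
    then show ?thesis using P s'(1) by (simp add: progress_def)
  next
    case False
    then show ?thesis using that pm below[of i] mon[of p i]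
      by (intro reach_inactive[OF H od _ na nx]) auto
  qed
  let ?K = "\<lambda>y. {i. 0 < i \<and> i < n \<and> key i \<le> y}"
  have fin: "finite (?K y)" for y by simp
  have skK: "sk \<le> card (?K (ew (od p)))" using P pm by (simp add: progress_def)
  have sub: "?K y \<subseteq> {0<..<n}" for y by auto
  have "card (?K (ew (od p))) \<le> card {0<..<n}" by (rule card_mono[OF _ sub]) simp
  \<comment> \<open>Only the \<open>n - 1\<close> positions other than the root are counted, so even
    a last skip past the end stays within \<open>n\<close>.\<close>
  then have skn: "Suc sk \<le> n" using skK n_pos by simp
  have sk2: "Suc sk \<le> card (?K (ew (od p')))" if p'm: "p' < m"
  proof -
    have nx0: "0 < nxt" "nxt \<le> ew (od p')" using above[OF p'm] by auto
    \<comment> \<open>The position that realizes \<open>nxt\<close> is newly counted: its key is at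
      least twice the weight at \<open>p\<close> and at most the weight at
      \<open>p'\<close>.\<close>
    then obtain i where i: "0 < i" "i < n" "nxt = key i" "2 * ew (od p) \<le> key i" using nx unfolding scale_next_def by blast
    have "insert i (?K (ew (od p))) \<subseteq> ?K (ew (od p'))" using i nx0 mon[of p p'] pm p'm by auto
    then have "card (insert i (?K (ew (od p)))) \<le> card (?K (ew (od p')))" by (intro card_mono fin)
    moreover have "i \<notin> ?K (ew (od p))" using i y0 by auto
    ultimately show ?thesis using skK fin by simp
  qed
  have sc: "\<forall>x\<in>X. 2 * x \<le> ew (od p')" if "p' < m"
    using P pm mon[of p p'] that unfolding progress_def by (meson less_imp_le order_trans)
  have "real t' \<le> real t + 5 * n + 12 + 2 * real (p' - p)" using t' by linarith
  also have "2 * real (p' - p) \<le> 210 * real p' - 210 * real p" using pm by (simp add: of_nat_diff)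
  also have "real t \<le> 210 * real p + real sk * (8 * n + 20) + real (card X) * scale_time" using P by (simp add: progress_def)
  finally have "real t' \<le> 210 * real p' + real (Suc sk) * (8 * n + 20) + real (card X) * scale_time"
    by (simp add: algebra_simps)
  then show ?thesis using P cert skn sk2 sc pm(3) unfolding progress_def s' by blast
qed

lemma progress_scale:
  assumes P: "progress od s0 t p X sk s" and pm: "p < m" "p \<le> p'" "p' \<le> m" and srt: "srt ew od 0 m" and x: "x = ew (od p)" "0 < x"
    and act: "scale_act x n" and p': "p' < m \<Longrightarrow> 2 * x \<le> ew (od p')"
    and cert: "\<And>i. p \<le> i \<Longrightarrow> i < p' \<Longrightarrow> reach {..<n} (out_edges s') w (S (od i)) (D (od i)) (stretch * ew (od i))"
    and e: "extends (2 * x) s s'" and c: "nvar s' ''outm'' \<le> nvar s ''outm'' + N" "real N \<le> cost x"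
    and t': "real t' \<le> real t + 201 * (real p' - real p) + scale_time"
  shows "progress od s0 t' p' (insert x X) sk s'"
proof -
  have mon: "ew (od i) \<le> ew (od j)" if "i \<le> j" "j < m" for i j using srt that by (auto simp: srt_def)
  have X2: "2 * x' \<le> x" if "x' \<in> X" for x' using P that pm x by (simp add: progress_def)
  have xX: "x \<notin> X" using X2[of x] x(2) by auto
  have sep: "separated (insert x X)" using P X2 x by (intro separated_insert) (auto simp: progress_def)
  have fin: "finite X" using P by (simp add: progress_def separated_def)
  have sub: "out_edges s \<subseteq> out_edges s'" using out_ext_edges[OF e] by (simp add: out_edges_def)
  have HE: "out_edges s' \<subseteq> E"
  proof
    fix f assume "f \<in> out_edges s'"
    then obtain j where j: "j < nvar s' ''outm''" "f = {narr s' ''outsrc'' j, narr s' ''outdst'' j}" by (auto simp: out_edges_def edges_of_def)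
    show "f \<in> E"
    proof (cases "j < nvar s ''outm''")
      case True
      then have "f \<in> out_edges s" using e j by (auto simp: out_edges_def edges_of_def out_ext_def)
      then show ?thesis using P by (auto simp: progress_def)
    next
      case False
      then show ?thesis using e j by (auto simp: out_ext_def)
    qed
  qed
  have ce: "reach {..<n} (out_edges s') w (S (od i)) (D (od i)) (stretch * ew (od i))" if "i < p'" for i
    using that cert[of i] P reach_superset[OF _ sub] by (cases "i < p") (auto simp: progress_def)
  have sk: "sk \<le> card {i. 0 < i \<and> i < n \<and> key i \<le> ew (od p')}" if "p' < m"
  proof -
    have "{i. 0 < i \<and> i < n \<and> key i \<le> ew (od p)} \<subseteq> {i. 0 < i \<and> i < n \<and> key i \<le> ew (od p')}"
      using mon[OF pm(2) that] by auto
    then have "card {i. 0 < i \<and> i < n \<and> key i \<le> ew (od p)} \<le> card {i. 0 < i \<and> i < n \<and> key i \<le> ew (od p')}"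
      by (intro card_mono) auto
    then show ?thesis using P pm by (auto simp: progress_def)
  qed
  have cnt: "real (nvar s' ''outm'') \<le> real (nvar s0 ''outm'') + (\<Sum>x\<in>insert x X. cost x)"
    using P c fin xX unfolding progress_def by simp
  have wt: "out_weight s' \<le> out_weight s0 + (\<Sum>x\<in>insert x X. cost x * (2 * x))"
    using P out_weight_extends[OF e c] x(2) fin xX unfolding progress_def by simp
  have "real t \<le> 210 * real p + real sk * (8 * n + 20) + real (card X) * scale_time" using P by (simp add: progress_def)
  moreover have "201 * (real p' - real p) \<le> 210 * real p' - 210 * real p" using pm by simp
  moreover have "real (card (insert x X)) * scale_time = real (card X) * scale_time + scale_time"
    using fin xX by (simp add: algebra_simps)
  ultimately have tm: "real t' \<le> 210 * real p' + real sk * (8 * n + 20) + real (card (insert x X)) * scale_time"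
    using t' by linarith
  have sc: "\<forall>x'\<in>insert x X. 2 * x' \<le> ew (od p')" if "p' < m"
    using p'[OF that] X2 x(2) by fastforce
  show ?thesis
    unfolding progress_def
    using P pm(3) sep act sc sk ce sub HE cnt wt tm unfolding progress_def by blast
qed

end

context tree_input
begin

definition total_time :: real where
  "total_time = 210 * real m + real n * (8 * n + 20) + n * logn * scale_time"

lemma out_edges_cong:
  "nvar s' ''outm'' = nvar s ''outm'' \<Longrightarrow> narr s' ''outsrc'' = narr s ''outsrc'' \<Longrightarrow> narr s' ''outdst'' = narr s ''outdst'' \<Longrightarrow>
    out_edges s' = out_edges s \<and> out_weight s' = out_weight s"
  by (simp add: out_edges_def out_weight_def)

definition ready :: "(nat \<Rightarrow> nat) \<Rightarrow> state \<Rightarrow> bool" where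
  "ready od s \<longleftrightarrow> inp s \<and> narr s ''pos'' = pos \<and> narr s ''pp'' = pp \<and> rarr s ''key'' = key \<and> narr s ''o'' = od"

text \<open>The reserve \<open>5 * n + 10\<close> in the time bound pays for the tree scan and the
  tests that precede a scale in the main loop.\<close>

lemma wp_scale:
  assumes rd: "ready od s" and od: "\<And>i. i < m \<Longrightarrow> od i < m" and srt: "srt ew od 0 m"
    and st: "nvar s ''p'' = p0" "p0 < m" "rvar s ''y'' = x" "x = ew (od p0)" and T: "T \<subseteq> out_edges s"
  shows "wp (cluster ;; fine_loop) s (\<lambda>t s'. \<exists>p N. nvar s' ''p'' = p \<and> p0 \<le> p \<and> p \<le> m \<and>
    real t + (5 * n + 10) \<le> 201 * (real p - real p0) + scale_time \<and>
    (\<forall>i. p0 \<le> i \<and> i < p \<longrightarrow> reach {..<n} (out_edges s') w (S (od i)) (D (od i)) (stretch * ew (od i))) \<and>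
    (p < m \<longrightarrow> 2 * x \<le> ew (od p)) \<and> extends (2 * x) s s' \<and> nvar s' ''outm'' \<le> nvar s ''outm'' + N \<and> real N \<le> cost x)"
proof -
  have x0: "0 < x" using st es_nth[OF od[OF st(2)]] E_wpos by blast
  have inp: "inp s" using rd by (simp add: ready_def)
  have C: "wp cluster s (\<lambda>t s'. t \<le> 30 * n + (3 * k + 5) * nvar s' ''b'' \<and>
    rvar s' ''R'' = x / q \<and> rvar s' ''y2'' = 2 * x \<and>
    (\<exists>h ct. clustering (x / q) (2 * x) h ct (narr s' ''cid'') \<and>
      (let c = 1 + card {i. 0 < i \<and> i < n \<and> ct i}; b = nvar s' ''b'' in
        1 \<le> b \<and> c \<le> b ^ k \<and> (b = 1 \<or> (b - 1) ^ k < c))))"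
    by (rule wp_cluster[OF prim_order_axioms _ _ inp st(3) x0]) (use rd in \<open>auto simp: ready_def\<close>)
  show ?thesis
    unfolding wp_Seq
  proof (rule wp_frame[OF C], goal_cases)
    case (1 t1 s1)
    then obtain h ct where cl: "clustering (x / q) (2 * x) h ct (narr s1 ''cid'')" and
      b: "1 \<le> nvar s1 ''b''" "1 + card {i. 0 < i \<and> i < n \<and> ct i} \<le> nvar s1 ''b'' ^ k"
         "nvar s1 ''b'' = 1 \<or> (nvar s1 ''b'' - 1) ^ k < 1 + card {i. 0 < i \<and> i < n \<and> ct i}"
      by (auto simp: Let_def)
    have un: "inp s1" "narr s1 ''pos'' = pos" "narr s1 ''o'' = od" "nvar s1 ''p'' = p0" and
      eq: "nvar s1 ''outm'' = nvar s ''outm''" "narr s1 ''outsrc'' = narr s ''outsrc''" "narr s1 ''outdst'' = narr s ''outdst''"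
      using 1(1) rd st by (auto simp: unch_def inp_def ready_def)
    have T1: "T \<subseteq> out_edges s1" using T out_edges_cong[OF eq] by simp
    have cc: "card (narr s1 ''cid'' ` {..<n}) \<le> nvar s1 ''b'' ^ k" using card_cid_le[OF cl] b(2) by linarith
    have y2: "rvar s1 ''y2'' = 2 * x" using 1(2) by simp
    show ?case
    proof (rule wp_mono[OF wp_fine_loop[OF un(1-3) refl od srt un(4) st(2) y2 refl x0 st(4) cl b(1) cc T1]], goal_cases)
      case (2 t2 s2)
      then obtain p f where p: "nvar s2 ''p'' = p" "p0 \<le> p" "p \<le> m" "t2 \<le> 201 * (p - p0) + 1"
        "\<forall>i. p0 \<le> i \<and> i < p \<longrightarrow> reach {..<n} (out_edges s2) w (S (od i)) (D (od i)) (stretch * ew (od i))"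
        "p < m \<longrightarrow> 2 * x \<le> ew (od p)" "extends (2 * x) s1 s2"
        "nvar s2 ''outm'' \<le> nvar s1 ''outm'' + f * (nvar s1 ''b'' * card (crossing (2 * x) (narr s1 ''cid'')))" "real f \<le> 2 / (\<rho> - 1)" by blast
      note cb = cost_bound[OF x0 cl refl b(3) p(9)]
      have "real t1 \<le> 30 * real n + (3 * real k + 5) * real (nvar s1 ''b'')"
      proof -
        have "real t1 \<le> real (30 * n + (3 * k + 5) * nvar s1 ''b'')" using 1(2) by (intro of_nat_mono) simp
        then show ?thesis by simp
      qed
      moreover have "(3 * real k + 5) * real (nvar s1 ''b'') \<le> (3 * real k + 5) * (2 * n powr (1 / k))"
        using cb(2) by (intro mult_left_mono) auto
      moreover have "real t2 \<le> 201 * (real p - real p0) + 1"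
      proof -
        have "real t2 \<le> real (201 * (p - p0) + 1)" using p(4) by (rule of_nat_mono)
        then show ?thesis using p(2) by (simp add: of_nat_diff)
      qed
      ultimately have tm: "real (t1 + t2) + (5 * n + 10) \<le> 201 * (real p - real p0) + scale_time"
        unfolding scale_time_def of_nat_add of_nat_mult of_nat_numeral by linarith
      have ext: "extends (2 * x) s s2" using p(7) unfolding eq .
      show ?case using p(1-3,5,6) p(8)[unfolded eq] cb(1) tm ext by blast
    qed
  qed
qed

lemma wp_main_loop:
  assumes rd: "ready od s0" and od: "\<And>i. i < m \<Longrightarrow> od i < m" and srt: "srt ew od 0 m"
    and p0: "nvar s0 ''p'' = 0" and T: "T \<subseteq> out_edges s0" and oE: "out_edges s0 \<subseteq> E" and kn: "k < n"
  shows "wp main_loop s0 (\<lambda>t s'. real t \<le> total_time + 1 \<and> (\<exists>p X sk t0. m \<le> p \<and> progress od s0 t0 p X sk s'))"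
  unfolding main_loop_def
proof (rule wp_While[where B = "nat \<lceil>total_time\<rceil>" and I = "\<lambda>t s. \<exists>p X sk. nvar s ''p'' = p \<and> progress od s0 t p X sk s"], goal_cases)
  case 1
  show ?case using p0 oE by (intro exI[of _ 0] exI[of _ "{}"]) (auto simp: progress_def separated_def)
next
  case (2 t s)
  then have "real t \<le> total_time" using progress_time[OF _ kn] unfolding total_time_def by blast
  then show ?case by (meson le_nat_iff of_nat_le_iff real_nat_ceiling_ge order_trans)
next
  case (4 t s)
  then obtain p X sk where p: "nvar s ''p'' = p" "progress od s0 t p X sk s" by blast
  have "inp s" using 4(1) rd by (auto simp: unch_def inp_def ready_def)
  then have "m \<le> p" using 4(3) p(1) by (simp add: inp_def)
  moreover have "real t \<le> total_time" using progress_time[OF p(2) kn] unfolding total_time_def by blast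
  ultimately show ?case using p(2) by auto
next
  case (3 t s)
  then obtain p X sk where p: "nvar s ''p'' = p" "progress od s0 t p X sk s" by blast
  have rd': "ready od s" using 3(1) rd by (auto simp: unch_def inp_def ready_def)
  have inp: "inp s" using rd' by (simp add: ready_def)
  have pm: "p < m" using 3(3) p(1) inp by (simp add: inp_def)
  define y where "y = ew (od p)"
  have y0: "0 < y" using es_nth[OF od[OF pm]] E_wpos unfolding y_def by blast
  have wt: "rarr s ''wt'' (narr s ''o'' p) = y" using rd' inp od[OF pm] by (simp add: inp_def ready_def y_def)
  let ?s1 = "s\<lparr>rvar := (rvar s)(''y'' := y, ''nxt'' := 0), nvar := (nvar s)(''act'' := 0, ''i'' := 1)\<rparr>"
  have TS: "wp tree_scan ?s1 (\<lambda>t s'. t \<le> 5 * n + 1 \<and> (0 < nvar s' ''act'' \<longleftrightarrow> scale_act y n) \<and> scale_next y n (rvar s' ''nxt''))"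
    by (rule wp_tree_scan) (use rd' in \<open>auto simp: ready_def inp_def\<close>)
  have "wp tree_scan ?s1 (\<lambda>t1 s2. wp (Cond (NLess (NVar ''act'') (NConst 1))
       (Cond (RLess NZ (RVar ''nxt'')) skip_loop (NAssign ''p'' (NVar ''m''))) (cluster ;; fine_loop)) s2
     (\<lambda>t2 s3. \<exists>p X sk. nvar s3 ''p'' = p \<and> progress od s0 (Suc (t + (4 + (t1 + t2)))) p X sk s3))"
  proof (rule wp_frame[OF TS], goal_cases)
    case (1 t1 s2)
    have t1: "t1 \<le> 5 * n + 1" and nx: "scale_next y n (rvar s2 ''nxt'')" and ac: "0 < nvar s2 ''act'' \<longleftrightarrow> scale_act y n" using 1(2) by auto
    have rd2: "ready od s2" and p2: "nvar s2 ''p'' = p" "rvar s2 ''y'' = y" and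
      eq: "nvar s2 ''outm'' = nvar s ''outm''" "narr s2 ''outsrc'' = narr s ''outsrc''" "narr s2 ''outdst'' = narr s ''outdst''"
      using 1(1) rd' p(1) by (auto simp: unch_def inp_def ready_def)
    have inp2: "inp s2" and o2: "narr s2 ''o'' = od" using rd2 by (auto simp: ready_def)
    note oe2 = out_edges_cong[OF eq]
    have skip: "progress od s0 t' p' X (Suc sk) s3" if na: "\<not> scale_act y n" and p': "p < p'" "p' \<le> m"
      and below: "\<And>i. p \<le> i \<Longrightarrow> i < p' \<Longrightarrow> 0 < rvar s2 ''nxt'' \<Longrightarrow> ew (od i) < rvar s2 ''nxt''"
      and above: "p' < m \<Longrightarrow> 0 < rvar s2 ''nxt'' \<and> rvar s2 ''nxt'' \<le> ew (od p')" and t': "t' \<le> t + 5 * n + 12 + 2 * (p' - p)"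
      and eq3: "nvar s3 ''outm'' = nvar s2 ''outm''" "narr s3 ''outsrc'' = narr s2 ''outsrc''" "narr s3 ''outdst'' = narr s2 ''outdst''"
      for p' t' s3
      using out_edges_cong[OF eq3] oe2 eq3 eq
      by (intro progress_skip[OF p(2) pm p' srt od na[unfolded y_def] nx[unfolded y_def] below above T _ _ _ t']) auto
    show ?case
    proof (cases "scale_act y n")
      case True
      then have a: "\<not> nvar s2 ''act'' < 1" using ac by simp
      have TT: "T \<subseteq> out_edges s2" using T p(2) oe2 by (auto simp: progress_def)
      have "wp (cluster ;; fine_loop) s2 (\<lambda>t2 s3. \<exists>p X sk. nvar s3 ''p'' = p \<and> progress od s0 (Suc (t + (4 + (t1 + (1 + t2))))) p X sk s3)"
      proof (rule wp_mono[OF wp_scale[OF rd2 od srt p2(1) pm p2(2) y_def TT]], goal_cases)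
        case (2 t2 s3)
        then obtain p' N where p': "nvar s3 ''p'' = p'" "p \<le> p'" "p' \<le> m" "real t2 + (5 * n + 10) \<le> 201 * (real p' - real p) + scale_time"
          "\<forall>i. p \<le> i \<and> i < p' \<longrightarrow> reach {..<n} (out_edges s3) w (S (od i)) (D (od i)) (stretch * ew (od i))"
          "p' < m \<longrightarrow> 2 * y \<le> ew (od p')" "extends (2 * y) s2 s3" "nvar s3 ''outm'' \<le> nvar s2 ''outm'' + N" "real N \<le> cost y" by blast
        have "real t1 \<le> real (5 * n + 1)" using t1 by (rule of_nat_mono)
        then have "real (Suc (t + (4 + (t1 + (1 + t2))))) \<le> real t + 201 * (real p' - real p) + scale_time" using p'(4) by simp
        then have "progress od s0 (Suc (t + (4 + (t1 + (1 + t2))))) p' (insert y X) sk s3"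
          using p' by (intro progress_scale[OF p(2) pm p'(2,3) srt y_def y0 True _ _ p'(7)[unfolded eq] p'(8)[unfolded eq] p'(9)]) auto
        then show ?case using p'(1) by blast
      qed
      then show ?thesis using a by (simp add: wp_Cond)
    next
      case False
      then have a: "nvar s2 ''act'' < 1" using ac by simp
      show ?thesis
      proof (cases "0 < rvar s2 ''nxt''")
        case nz: True
        \<comment> \<open>The next tree weight is at least \<open>2 y\<close>, so the skip passes at
          least the edge at \<open>p\<close>.\<close>
        have ylt: "y < rvar s2 ''nxt''" using nx nz y0 unfolding scale_next_def by auto
        have "wp skip_loop s2 (\<lambda>t2 s3. \<exists>p X sk. nvar s3 ''p'' = p \<and> progress od s0 (Suc (t + (4 + (t1 + (1 + (1 + t2)))))) p X sk s3)"
        proof (rule wp_frame[OF wp_skip_loop[OF inp2 o2 od p2(1) less_imp_le[OF pm] refl]], goal_cases)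
          case (2 t2 s3)
          then obtain p' where p': "nvar s3 ''p'' = p'" "p \<le> p'" "p' \<le> m" "t2 \<le> 2 * (p' - p) + 1"
            "\<forall>i. p \<le> i \<and> i < p' \<longrightarrow> ew (od i) < rvar s2 ''nxt''" "p' < m \<longrightarrow> rvar s2 ''nxt'' \<le> ew (od p')" by blast
          have "p < p'" using p'(2,6) pm ylt y_def by (cases "p = p'") auto
          then have "progress od s0 (Suc (t + (4 + (t1 + (1 + (1 + t2)))))) p' X (Suc sk) s3"
            using p'(3-6) nz t1 2(1) by (intro skip[OF False]) (auto simp: unch_def)
          then show ?case using p'(1) by blast
        qed simp
        then show ?thesis using a nz by (simp add: wp_Cond)
      next
        case nz: False
        \<comment> \<open>No heavier tree weight is left, so the tree serves all remaining
          edges.\<close>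
        have "progress od s0 (Suc (t + (4 + (t1 + 3)))) m X (Suc sk) (s2\<lparr>nvar := (nvar s2)(''p'' := m)\<rparr>)"
          using pm nz t1 by (intro skip[OF False]) auto
        then show ?thesis using a nz inp2 by (auto simp: wp_Cond wp_NAssign inp_def numeral_3_eq_3)
      qed
    qed
  qed
  moreover have "Suc (t + (4 + (t1 + t2))) = Suc (t + Suc (Suc (Suc (Suc (t1 + t2)))))" for t1 t2 by simp
  ultimately show ?case
    unfolding wp_Seq wp_NAssign wp_RAssign using p(1) wt
    by (simp add: upd_norm)
qed

end

section \<open>Size, weight and running time\<close>

context tree_input
begin

text \<open>The lower bound on \<open>q\<close>, in the form that turns estimates without
  \<open>k\<close> and \<open>q\<close> into multiples of \<open>k q\<close>.\<close>

lemma kq: "1 \<le> 2 * (real k * q)"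
proof -
  have "0 < 2 * real k - 1" using k by simp
  then have "1 < q * (2 * real k - 1)" using q(1) by (simp add: divide_less_eq)
  also have "\<dots> \<le> q * (2 * real k)" using q_pos by (intro mult_left_mono) auto
  finally show ?thesis by (simp add: mult_ac)
qed

lemma root_ge_1: "1 \<le> real n powr (1 / k)"
  using n_pos by (intro ge_one_powr_ge_zero) auto

text \<open>After exchanging the sums, a tree edge occurs at the scales
  \<open>x > key i / 2\<close>, over which \<open>key i / x\<close> sums to at most 4.\<close>

lemma sum_gamma_le:
  assumes X: "separated X"
  shows "(\<Sum>x\<in>X. gamma x) \<le> 8 * q * n"
proof -
  have fin: "finite X" and pos: "\<And>x. x \<in> X \<Longrightarrow> 0 < x" using X by (auto simp: separated_def)
  have lw: "light_weight (2 * x) = (\<Sum>i\<in>{0<..<n}. if key i < 2 * x then key i else 0)" for x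
    unfolding light_weight_def by (subst sum.inter_filter[symmetric]) (auto intro: sum.cong)
  have inner: "(\<Sum>x\<in>X. 1 / x * (if key i < 2 * x then key i else 0)) \<le> 4" if i: "i \<in> {0<..<n}" for i
  proof -
    have k0: "0 < key i" using key_pos i by auto
    have "(\<Sum>x\<in>X. 1 / x * (if key i < 2 * x then key i else 0)) = (\<Sum>x\<in>X. if key i < 2 * x then key i * (1 / x) else 0)"
      by (intro sum.cong) auto
    also have "\<dots> = (\<Sum>x\<in>{x\<in>X. key i < 2 * x}. key i * (1 / x))"
      using fin by (subst sum.inter_filter[symmetric]) auto
    also have "\<dots> = key i * (\<Sum>x\<in>{x\<in>X. key i < 2 * x}. 1 / x)" by (simp only: sum_distrib_left)
    also have "\<dots> \<le> key i * (2 / (key i / 2))"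
    proof (rule mult_left_mono)
      show "(\<Sum>x\<in>{x\<in>X. key i < 2 * x}. 1 / x) \<le> 2 / (key i / 2)"
        using k0 by (intro sum_separated_inverse separated_subset[OF X]) auto
    qed (use k0 in simp)
    also have "\<dots> = 4" using k0 by simp
    finally show ?thesis .
  qed
  have "(\<Sum>x\<in>X. gamma x) \<le> (\<Sum>x\<in>X. 2 * q * (1 / x * light_weight (2 * x)))"
  proof (rule sum_mono)
    fix x assume "x \<in> X"
    have "gamma x \<le> 2 * (q / x) * light_weight (2 * x)" by (simp add: gamma_def)
    also have "\<dots> = 2 * q * (1 / x * light_weight (2 * x))" by simp
    finally show "gamma x \<le> 2 * q * (1 / x * light_weight (2 * x))" .
  qed
  also have "\<dots> = 2 * q * (\<Sum>x\<in>X. \<Sum>i\<in>{0<..<n}. 1 / x * (if key i < 2 * x then key i else 0))"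
    by (simp only: lw sum_distrib_left)
  also have "(\<Sum>x\<in>X. \<Sum>i\<in>{0<..<n}. 1 / x * (if key i < 2 * x then key i else 0)) =
    (\<Sum>i\<in>{0<..<n}. \<Sum>x\<in>X. 1 / x * (if key i < 2 * x then key i else 0))" by (rule sum.swap)
  also have "2 * q * \<dots> \<le> 2 * q * (\<Sum>i\<in>{0<..<n}. 4)"
    using inner q_pos by (intro mult_left_mono sum_mono) auto
  also have "\<dots> \<le> 2 * q * (4 * n)" using q_pos n_pos by (intro mult_left_mono) (auto simp: of_nat_diff)
  finally show ?thesis by simp
qed

lemma sum_cost_le:
  assumes X: "separated X"
  shows "(\<Sum>x\<in>X. cost x) \<le> 32 * (real n powr (1 + 1 / k) * (q / (\<rho> - 1)))"
proof -
  have pos: "\<And>x. x \<in> X \<Longrightarrow> 0 < x" using X by (auto simp: separated_def)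
  have r: "0 < \<rho> - 1" using \<rho> by simp
  have "cost x \<le> 4 / (\<rho> - 1) * n powr (1 / k) * gamma x" if "x \<in> X" for x
  proof -
    have "0 \<le> kappa x" using pos[OF that] W_nonneg q_pos by (simp add: kappa_def)
    then have "kappa x powr (1 / k) \<le> n powr (1 / k)" by (intro powr_mono2) (auto simp: kappa_def)
    then have "2 / (\<rho> - 1) * (2 * kappa x powr (1 / k)) * gamma x \<le> 2 / (\<rho> - 1) * (2 * n powr (1 / k)) * gamma x"
      using gamma_nonneg[OF pos[OF that]] r by (intro mult_right_mono mult_left_mono) auto
    then show ?thesis by (simp add: cost_def)
  qed
  then have "(\<Sum>x\<in>X. cost x) \<le> (\<Sum>x\<in>X. 4 / (\<rho> - 1) * n powr (1 / k) * gamma x)" by (rule sum_mono)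
  also have "\<dots> = 4 / (\<rho> - 1) * n powr (1 / k) * (\<Sum>x\<in>X. gamma x)" by (simp only: sum_distrib_left)
  also have "\<dots> \<le> 4 / (\<rho> - 1) * n powr (1 / k) * (8 * q * n)"
    using sum_gamma_le[OF X] r by (intro mult_left_mono) auto
  also have "\<dots> = 32 * (n powr (1 / k) * n * (q / (\<rho> - 1)))" by simp
  also have "n powr (1 / k) * n = real n powr (1 + 1 / k)" using n_pos by (simp add: powr_add)
  finally show ?thesis .
qed

text \<open>The scales are split at \<open>W / n\<close>. Below, the trivial bound \<open>n\<close>
  is used for both cluster counts and the scales themselves sum geometrically. Above,
  \<open>gamma x * x\<close> is at most \<open>2 q W\<close>, and the roots of \<open>W / x\<close>,
  each at most \<open>n powr (1 / k)\<close>, sum with a factor \<open>2 k\<close>.\<close>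

lemma sum_cost_weight_le:
  assumes X: "separated X" and n2: "2 \<le> n"
  shows "(\<Sum>x\<in>X. cost x * (2 * x)) \<le> 128 * (k * real n powr (1 / k) * (q / (\<rho> - 1))) * W"
proof -
  have fin: "finite X" and pos: "\<And>x. x \<in> X \<Longrightarrow> 0 < x" using X by (auto simp: separated_def)
  have r: "0 < \<rho> - 1" using \<rho> by simp
  have "key 1 \<le> W" unfolding tweight_def using n2 key_pos by (intro member_le_sum) (auto intro: less_imp_le)
  then have W0: "0 < W" using key_pos[of 1] n2 by simp
  define N where "N = real n powr (1 / k)"
  define X1 where "X1 = {x\<in>X. x \<le> W / n}"
  define X2 where "X2 = {x\<in>X. \<not> x \<le> W / n}"
  have s12: "separated X1" "separated X2" using separated_subset[OF X] by (auto simp: X1_def X2_def)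
  have N0: "0 \<le> N" by (simp add: N_def)
  have kap: "0 \<le> kappa x" if "x \<in> X" for x using pos[OF that] W_nonneg q_pos by (simp add: kappa_def)
  have c: "cost x * (2 * x) = 8 / (\<rho> - 1) * (kappa x powr (1 / k) * (gamma x * x))" for x by (simp add: cost_def)
  have "(\<Sum>x\<in>X1. kappa x powr (1 / k) * (gamma x * x)) \<le> (\<Sum>x\<in>X1. N * (n * x))"
  proof (rule sum_mono)
    fix x assume "x \<in> X1"
    then have x: "x \<in> X" by (simp add: X1_def)
    have "kappa x powr (1 / k) \<le> N" unfolding N_def using kap[OF x] by (intro powr_mono2) (auto simp: kappa_def)
    moreover have "gamma x * x \<le> n * x" using pos[OF x] by (intro mult_right_mono) (auto simp: gamma_def)
    ultimately show "kappa x powr (1 / k) * (gamma x * x) \<le> N * (n * x)"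
      using N0 gamma_nonneg[OF pos[OF x]] pos[OF x] by (intro mult_mono) auto
  qed
  also have "\<dots> = N * (n * (\<Sum>x\<in>X1. x))" by (simp only: sum_distrib_left)
  also have "\<dots> \<le> N * (n * (2 * (W / n)))"
    using N0 W_nonneg by (intro mult_left_mono sum_separated_le_twice s12) (auto simp: X1_def)
  also have "\<dots> = 2 * N * W * 1" using n_pos by simp
  \<comment> \<open>The small scales produce no factor \<open>k q\<close>; it is inserted by
    \<open>kq\<close>.\<close>
  also have "\<dots> \<le> 2 * N * W * (2 * (real k * q))" using kq N0 W_nonneg by (intro mult_left_mono) auto
  finally have A: "(\<Sum>x\<in>X1. kappa x powr (1 / k) * (gamma x * x)) \<le> 4 * (k * N * q * W)" by (simp add: mult_ac)
  have "(\<Sum>x\<in>X2. kappa x powr (1 / k) * (gamma x * x)) \<le> (\<Sum>x\<in>X2. 6 * q * W * (W / x) powr (1 / k))"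
  proof (rule sum_mono)
    fix x assume "x \<in> X2"
    then have x: "x \<in> X" "0 < x" using pos by (auto simp: X2_def)
    have "kappa x powr (1 / k) \<le> ((2 * q + 1 / 2) * (W / x)) powr (1 / k)"
      using kap[OF x(1)] by (intro powr_mono2) (auto simp: kappa_def)
    also have "\<dots> = (2 * q + 1 / 2) powr (1 / k) * (W / x) powr (1 / k)" by (rule powr_mult)
    \<comment> \<open>Since \<open>q < k\<close>,
      \<open>2 q + 1 / 2 \<le> 1 + 2 k \<le> 3 ^ k\<close>, so the \<open>k\<close>-th root of this
      factor is at most 3.\<close>
    also have "(2 * q + 1 / 2) powr (1 / k) \<le> (3 ^ k) powr (1 / k)"
    proof (intro powr_mono2)
      have "1 + real k * 2 \<le> 3 ^ k" using Bernoulli_inequality[of 2 k] by simp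
      then show "2 * q + 1 / 2 \<le> 3 ^ k" using q(2) by linarith
    qed (use q_pos in auto)
    also have "(3 ^ k :: real) powr (1 / k) = 3" using k by (simp add: powr_realpow[symmetric] powr_powr)
    finally have kp: "kappa x powr (1 / k) \<le> 3 * (W / x) powr (1 / k)" by (simp add: mult_right_mono)
    have "gamma x * x \<le> 2 * (q / x) * light_weight (2 * x) * x" using x by (intro mult_right_mono) (auto simp: gamma_def)
    also have "\<dots> = 2 * q * light_weight (2 * x)" using x by simp
    also have "\<dots> \<le> 2 * q * W" using q_pos light_weight_le by (intro mult_left_mono) auto
    finally have g: "gamma x * x \<le> 2 * q * W" .
    have "kappa x powr (1 / k) * (gamma x * x) \<le> 3 * (W / x) powr (1 / k) * (2 * q * W)"
      by (rule mult_mono[OF kp g]) (use gamma_nonneg[OF x(2)] x(2) in auto)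
    then show "kappa x powr (1 / k) * (gamma x * x) \<le> 6 * q * W * (W / x) powr (1 / k)" by (simp add: mult_ac)
  qed
  also have "\<dots> = 6 * q * W * (\<Sum>x\<in>X2. (W / x) powr (1 / k))" by (simp only: sum_distrib_left)
  also have "\<dots> \<le> 6 * q * W * (2 * k * (W / (W / n)) powr (1 / k))"
    using q_pos W0 n_pos k by (intro mult_left_mono sum_separated_root s12) (auto simp: X2_def)
  also have "W / (W / n) = n" using W0 by simp
  finally have B: "(\<Sum>x\<in>X2. kappa x powr (1 / k) * (gamma x * x)) \<le> 12 * (k * N * q * W)" by (simp add: N_def mult_ac)
  have "X = X1 \<union> X2" "X1 \<inter> X2 = {}" "finite X1" "finite X2" using fin by (auto simp: X1_def X2_def)
  then have "(\<Sum>x\<in>X. kappa x powr (1 / k) * (gamma x * x)) =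
    (\<Sum>x\<in>X1. kappa x powr (1 / k) * (gamma x * x)) + (\<Sum>x\<in>X2. kappa x powr (1 / k) * (gamma x * x))"
    by (simp only: sum.union_disjoint)
  then have "(\<Sum>x\<in>X. kappa x powr (1 / k) * (gamma x * x)) \<le> 16 * (k * N * q * W)" using A B by linarith
  then have "8 / (\<rho> - 1) * (\<Sum>x\<in>X. kappa x powr (1 / k) * (gamma x * x)) \<le> 8 / (\<rho> - 1) * (16 * (k * N * q * W))"
    using r by (intro mult_left_mono) auto
  also have "\<dots> = 128 * (k * N * (q / (\<rho> - 1))) * W" by simp
  finally show ?thesis unfolding c N_def by (simp only: sum_distrib_left)
qed

definition unit_time :: real where "unit_time = real k * real n powr (1 / k)"

text \<open>From \<open>exp y \<ge> 1 + y\<close> at \<open>y = ln n / k\<close> follows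
  \<open>k n powr (1 / k) \<ge> k + ln n\<close>. This absorbs the logarithms of sorting and of the
  number of scales.\<close>

lemma unit_time_ge: "1 \<le> unit_time" "log 2 n \<le> 2 * unit_time"
proof -
  have "1 * 1 \<le> real k * real n powr (1 / k)" using k root_ge_1 by (intro mult_mono) auto
  then show "1 \<le> unit_time" by (simp add: unit_time_def)
  have "1 + ln n / k \<le> exp (ln n / k)" by (rule exp_ge_add_one_self)
  also have "exp (ln n / k) = real n powr (1 / k)" using n_pos by (simp add: powr_def)
  finally have "real k * (1 + ln n / k) \<le> unit_time" unfolding unit_time_def by (intro mult_left_mono) auto
  then have ln: "ln n \<le> unit_time" using k by (simp add: distrib_left)
  have "1 / 2 \<le> ln (2::real)" using ln_le_minus_one[of "1 / 2"] by (simp add: ln_div)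
  have "ln n / ln 2 \<le> ln n / (1 / 2)" using \<open>1 / 2 \<le> ln 2\<close> n_pos by (intro divide_left_mono) auto
  then show "log 2 n \<le> 2 * unit_time" using ln by (simp add: log_def)
qed

lemma total_time_le: "total_time \<le> 974 * (real n ^ 2 * unit_time)"
proof -
  define Z where "Z = unit_time"
  have Z: "1 \<le> Z" "log 2 n \<le> 2 * Z" using unit_time_ge by (auto simp: Z_def)
  have n1: "1 \<le> real n" using n_pos by simp
  have nZ: "real n ^ 2 * 1 \<le> real n ^ 2 * Z" using Z by (intro mult_left_mono) auto
  have nn: "real n \<le> real n ^ 2" using n1 by (simp add: power2_eq_square)
  have "log 2 n \<le> n"
  proof -
    have "real n \<le> 2 ^ n" by (metis less_exp less_imp_le of_nat_le_iff of_nat_numeral of_nat_power)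
    then have "log 2 n \<le> log 2 (2 ^ n)" using n1 by (intro log_mono) auto
    then show ?thesis by (simp add: log_nat_power)
  qed
  \<comment> \<open>Two bounds for \<open>logn\<close> are needed: \<open>8 * Z\<close> against the
    summand of \<open>scale_time\<close> that is linear in \<open>n\<close>, and
    \<open>6 * n\<close> against the summand that is already a multiple of \<open>Z\<close>.\<close>
  then have l6: "logn \<le> 6 * real n" unfolding logn_def using n1 by linarith
  have l8: "logn \<le> 8 * Z" unfolding logn_def using Z by linarith
  have "real m \<le> real (n * n)" using m_le by (rule of_nat_mono)
  then have 1: "210 * real m \<le> 210 * (real n ^ 2 * Z)" using nZ by (simp add: power2_eq_square)
  have "real n * (8 * n + 20) = 8 * real n ^ 2 + 20 * real n" by (simp add: power2_eq_square algebra_simps)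
  then have 2: "real n * (8 * n + 20) \<le> 28 * (real n ^ 2 * Z)" using nn nZ by linarith
  have "(3 * real k + 5) * (2 * n powr (1 / k)) \<le> (8 * real k) * (2 * n powr (1 / k))" using k by (intro mult_right_mono) auto
  then have "scale_time \<le> 80 * real n + 16 * Z" unfolding scale_time_def Z_def unit_time_def using n1 by linarith
  then have "n * logn * scale_time \<le> n * logn * (80 * real n + 16 * Z)" using logn_ge by (intro mult_left_mono) auto
  also have "\<dots> = 80 * (real n ^ 2 * logn) + 16 * (n * Z * logn)" by (simp add: power2_eq_square algebra_simps)
  also have "real n ^ 2 * logn \<le> real n ^ 2 * (8 * Z)" using l8 by (intro mult_left_mono) auto
  also have "real n * Z * logn \<le> real n * Z * (6 * real n)" using l6 Z by (intro mult_left_mono) auto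
  finally have 3: "n * logn * scale_time \<le> 736 * (real n ^ 2 * Z)" by (simp add: power2_eq_square algebra_simps)
  show ?thesis using 1 2 3 unfolding total_time_def Z_def[symmetric] by linarith
qed

lemma sort_time_le: "30 * m * (1 + log 2 (max 1 m)) + 5 \<le> 155 * (real n ^ 2 * unit_time)"
proof -
  define Z where "Z = unit_time"
  have Z: "1 \<le> Z" "log 2 n \<le> 2 * Z" using unit_time_ge by (auto simp: Z_def)
  have n1: "1 \<le> real n" using n_pos by simp
  have "real (max 1 m) \<le> real (n * n)" using m_le n_pos by (intro of_nat_mono) auto
  then have "log 2 (max 1 m) \<le> log 2 (real n * real n)" by (intro log_mono) auto
  also have "\<dots> = 2 * log 2 n" using n1 by (simp add: log_mult)
  finally have l: "1 + log 2 (max 1 m) \<le> 5 * Z" using Z by linarith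
  have "real m \<le> real (n * n)" using m_le by (rule of_nat_mono)
  then have "30 * real m * (1 + log 2 (max 1 m)) \<le> 30 * (real n * real n) * (5 * Z)"
    using l by (intro mult_mono) auto
  moreover have "1 * 1 \<le> real n ^ 2 * Z" using Z n1 by (intro mult_mono) auto
  moreover have "30 * (real n * real n) * (5 * Z) = 150 * (real n ^ 2 * Z)" by (simp add: power2_eq_square)
  ultimately show ?thesis unfolding Z_def[symmetric] by linarith
qed

lemma time_powr: "real k * real n powr (2 + 1 / real k) = real n ^ 2 * unit_time"
proof -
  have "real n powr (2 + 1 / k) = real n powr 2 * real n powr (1 / k)" by (rule powr_add)
  also have "real n powr 2 = real n ^ 2" using n_pos by simp
  finally show ?thesis by (simp add: unit_time_def)
qed

section \<open>Assembling the three bounds\<close>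

lemma output_edges_out_edges: "output_edges s = out_edges s"
  by (simp add: output_edges_def out_edges_def edges_of_def)

lemma tree_out_edges:
  assumes "tree_out n ord pp (nvar s ''outm'') (narr s ''outsrc'') (narr s ''outdst'')"
  shows "out_edges s = T" "out_weight s = W" "nvar s ''outm'' = n - 1"
proof -
  have o: "nvar s ''outm'' = n - 1" "\<And>a. a < n - 1 \<Longrightarrow> {narr s ''outsrc'' a, narr s ''outdst'' a} = tedge (Suc a)"
    using assms by (auto simp: tree_out_def tedge_def)
  have im: "{0<..<n} = Suc ` {..<n - 1}"
  proof -
    have "x \<in> Suc ` {..<n - 1}" if "x \<in> {0<..<n}" for x
      using that by (intro image_eqI[of _ _ "x - 1"]) auto
    then show ?thesis by auto
  qed
  show "nvar s ''outm'' = n - 1" by fact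
  show "out_edges s = T"
    unfolding out_edges_def edges_of_def o(1) im image_image using o(2) by (intro image_cong) auto
  have "W = (\<Sum>a<n - 1. key (Suc a))" unfolding tweight_def im by (simp add: sum.reindex)
  moreover have "w {narr s ''outsrc'' a, narr s ''outdst'' a} = key (Suc a)" if "a < n - 1" for a
    using o(2)[OF that] tree_edge[of "Suc a"] that by (simp add: tedge_def)
  ultimately show "out_weight s = W" unfolding out_weight_def o(1) by simp
qed

lemma T_sub: "T \<subseteq> E"
  using tree_edge by (auto simp: tedge_def)

lemma is_spanner_reach:
  assumes "H \<subseteq> E" and r: "\<And>i. i < m \<Longrightarrow> reach {..<n} H w (S i) (D i) (stretch * ew i)"
  shows "is_spanner {..<n} E w (\<rho> * (2 * real k - 1) * (1 + 2 / q) + 2 / q) H"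
proof (rule is_spannerI[OF G assms(1)])
  show "0 < \<rho> * (2 * real k - 1) * (1 + 2 / q) + 2 / q" using stretch_ge(2) by (simp add: stretch_def)
  fix u v assume "{u, v} \<in> E"
  then obtain i where i: "i < m" "{u, v} = {S i, D i}" by (rule E_nth)
  then have "u = S i \<and> v = D i \<or> u = D i \<and> v = S i" by (auto simp: doubleton_eq_iff)
  then show "reach {..<n} H w u v ((\<rho> * (2 * real k - 1) * (1 + 2 / q) + 2 / q) * w {u, v})"
    using r[OF i(1)] reach_sym[OF r[OF i(1)]] i(2) unfolding stretch_def by auto
qed

lemma lightness_le:
  assumes H: "H = out_edges s" "H \<subseteq> E" and c: "out_weight s \<le> c * W" "0 \<le> c"
  shows "lightness {..<n} E w H \<le> c"
proof -
  obtain F where F: "spanning_tree {..<n} E F" "mst_weight {..<n} E w = total_weight w F"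
    using mst_weight_attained[OF G conn] by blast
  then have W: "W \<le> mst_weight {..<n} E w" using tweight_le_connected by (auto simp: spanning_tree_def)
  have "total_weight w H \<le> out_weight s"
    unfolding total_weight_def H(1) out_edges_def edges_of_def out_weight_def
    using H(2) E_wpos by (intro order_trans[OF sum_image_le]) (auto simp: H(1) out_edges_def edges_of_def intro!: less_imp_le)
  then have t: "total_weight w H \<le> c * mst_weight {..<n} E w" using c W by (meson mult_left_mono order_trans)
  have "0 \<le> mst_weight {..<n} E w" using W W_nonneg by linarith
  \<comment> \<open>If the minimum spanning tree has weight 0, the quotient is 0 by the convention
    for division.\<close>
  then show ?thesis unfolding lightness_def using t c(2)
    by (cases "mst_weight {..<n} E w = 0") (auto simp: divide_le_eq)
qed

text \<open>Absorbs the tree, whose own lightness is 1, into the bound, by combining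
  \<open>kq\<close> with \<open>\<rho> - 1 \<le> 1\<close>.\<close>

lemma base_light: "1 \<le> 2 * (k * real n powr (1 / k) * (q / (\<rho> - 1)))"
proof -
  have r: "0 < \<rho> - 1" "\<rho> - 1 \<le> 1" using \<rho> by auto
  have "1 * 1 \<le> 2 * (real k * q) * real n powr (1 / k)" using kq root_ge_1 by (intro mult_mono) auto
  also have "\<dots> \<le> 2 * (real k * q) * real n powr (1 / k) / (\<rho> - 1)"
    using r q_pos by (simp add: pos_le_divide_eq mult_left_le)
  finally show ?thesis by (simp add: mult_ac)
qed

text \<open>The constant 1200 is dictated by time: 40 for the tree, 155 for sorting and 974 for the
  main loop, plus a few steps. Edge count and lightness get by with far less.\<close>

definition good_result :: "nat \<Rightarrow> state \<Rightarrow> bool" where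
  "good_result t s \<longleftrightarrow> real t \<le> 1200 * (k * real n powr (2 + 1 / k)) \<and>
     is_spanner {..<n} E w (\<rho> * (2 * real k - 1) * (1 + 2 / q) + 2 / q) (output_edges s) \<and>
     real (card (output_edges s)) \<le> 1200 * (real n powr (1 + 1 / k) * (1 + q / (\<rho> - 1))) \<and>
     lightness {..<n} E w (output_edges s) \<le> 1200 * (k * real n powr (1 / k) * (q / (\<rho> - 1)))"

lemma good_resultI:
  assumes oE: "out_edges s \<subseteq> E" and r: "\<And>i. i < m \<Longrightarrow> reach {..<n} (out_edges s) w (S i) (D i) (stretch * ew i)"
    and c: "real (nvar s ''outm'') \<le> n + 32 * (real n powr (1 + 1 / k) * (q / (\<rho> - 1)))"
    and wt: "out_weight s \<le> W + 128 * (k * real n powr (1 / k) * (q / (\<rho> - 1))) * W"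
    and t: "real t \<le> 1200 * (real n ^ 2 * unit_time)"
  shows "good_result t s"
  unfolding good_result_def output_edges_out_edges
proof (intro conjI)
  show "real t \<le> 1200 * (k * real n powr (2 + 1 / k))" using t time_powr by simp
  show "is_spanner {..<n} E w (\<rho> * (2 * real k - 1) * (1 + 2 / q) + 2 / q) (out_edges s)"
    by (rule is_spanner_reach[OF oE r])
  have "card (out_edges s) \<le> nvar s ''outm''"
    unfolding out_edges_def edges_of_def using card_image_le[of "{..<nvar s ''outm''}"] by simp
  then have "real (card (out_edges s)) \<le> real (nvar s ''outm'')" by (rule of_nat_mono)
  moreover have "real n * 1 \<le> real n * real n powr (1 / k)" using root_ge_1 by (intro mult_left_mono) auto
  then have "real n \<le> real n powr (1 + 1 / k)" using n_pos by (simp add: powr_add)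
  moreover have "0 \<le> real n powr (1 + 1 / k) * (q / (\<rho> - 1))" using q_pos \<rho> by simp
  ultimately show "real (card (out_edges s)) \<le> 1200 * (real n powr (1 + 1 / k) * (1 + q / (\<rho> - 1)))"
    using c unfolding distrib_left mult_1_right by linarith
  define c where "c = k * real n powr (1 / k) * (q / (\<rho> - 1))"
  have "1 * W \<le> 2 * c * W" unfolding c_def using base_light W_nonneg by (intro mult_right_mono) auto
  moreover have "out_weight s \<le> W + 128 * c * W" unfolding c_def by (rule wt)
  moreover have "130 * c * W = 2 * c * W + 128 * c * W" by simp
  ultimately have "out_weight s \<le> 130 * c * W" by linarith
  moreover have c0: "0 \<le> c" unfolding c_def using base_light by linarith
  ultimately have "lightness {..<n} E w (out_edges s) \<le> 130 * c" by (intro lightness_le[OF refl oE]) auto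
  then show "lightness {..<n} E w (out_edges s) \<le> 1200 * (k * real n powr (1 / k) * (q / (\<rho> - 1)))"
    unfolding c_def[symmetric] using c0 by linarith
qed

text \<open>A tree detour of at most \<open>2 (n - 1)\<close> edges, none heavier than the edge
  replaced, is within the factor \<open>2 k - 1\<close> when \<open>n \<le> k\<close>.\<close>

lemma good_tree:
  assumes to: "tree_out n ord pp (nvar s ''outm'') (narr s ''outsrc'') (narr s ''outdst'')" and t: "t \<le> 40 * n * n + 2" and kn: "n \<le> k"
  shows "good_result t s"
proof (rule good_resultI)
  note o = tree_out_edges[OF to]
  show "out_edges s \<subseteq> E" using o T_sub by simp
  have nonneg: "0 \<le> q / (\<rho> - 1)" using q_pos \<rho> by simp
  then have "0 \<le> real n powr (1 + 1 / k) * (q / (\<rho> - 1))" by (intro mult_nonneg_nonneg) auto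
  moreover have "real (n - 1) \<le> n" by simp
  ultimately show "real (nvar s ''outm'') \<le> n + 32 * (real n powr (1 + 1 / k) * (q / (\<rho> - 1)))"
    unfolding o(3) by linarith
  show "out_weight s \<le> W + 128 * (k * real n powr (1 / k) * (q / (\<rho> - 1))) * W"
  proof -
    have "0 \<le> 128 * (k * real n powr (1 / k) * (q / (\<rho> - 1))) * W"
      using nonneg W_nonneg by (intro mult_nonneg_nonneg) auto
    then show ?thesis unfolding o(2) by linarith
  qed
  have "real t \<le> real (40 * n * n + 2)" using t by (rule of_nat_mono)
  moreover have "1 \<le> real n ^ 2" "real n ^ 2 * 1 \<le> real n ^ 2 * unit_time"
    using n_pos unit_time_ge by (auto intro: mult_left_mono)
  ultimately show "real t \<le> 1200 * (real n ^ 2 * unit_time)" by (simp add: power2_eq_square)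
  fix i assume i: "i < m"
  have e: "{S i, D i} \<in> E" using es_nth[OF i] by blast
  have w0: "0 < ew i" by (rule E_wpos[OF e])
  have "reach {..<n} (out_edges s) w (S i) (D i) (2 * (real n - 1) * ew i)"
    by (rule reach_light[OF _ e]) (use o w0 in auto)
  moreover have "2 * (real n - 1) * ew i \<le> stretch * ew i"
    using stretch_ge(3) kn w0 by (intro mult_right_mono) auto
  ultimately show "reach {..<n} (out_edges s) w (S i) (D i) (stretch * ew i)" by (rule reach_mono)
qed

lemma wp_spanner_phase:
  assumes inp: "inp s" and arr: "narr s ''pos'' = pos" "narr s ''pp'' = pp" "rarr s ''key'' = key"
    and to: "tree_out n ord pp (nvar s ''outm'') (narr s ''outsrc'') (narr s ''outdst'')" and kn: "k < n"
  shows "wp (sort_edges ;; NAssign ''p'' (NConst 0) ;; main_loop) s (\<lambda>t s'. good_result (40 * n * n + t + 1) s')"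
  unfolding wp_Seq wp_NAssign
proof (rule wp_frame[OF wp_sort_edges[OF inp]], goal_cases)
  case (1 t1 s1)
  note o = tree_out_edges[OF to]
  let ?s1 = "s1\<lparr>nvar := (nvar s1)(''p'' := 0)\<rparr>"
  let ?o = "narr s1 ''o''"
  have eq: "nvar ?s1 ''outm'' = nvar s ''outm''" "narr ?s1 ''outsrc'' = narr s ''outsrc''" "narr ?s1 ''outdst'' = narr s ''outdst''"
    using 1(1) by (auto simp: unch_def)
  have rd: "ready ?o ?s1" using 1(1) inp arr by (auto simp: unch_def ready_def inp_def)
  have bij: "bij_betw ?o {..<m} {..<m}" and srt: "srt ew ?o 0 m" using 1(2) by (auto simp: sorted_state_def)
  have om: "?o i < m" if "i < m" for i using bij that by (auto simp: bij_betw_def)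
  have os: "out_edges ?s1 = T" "out_weight ?s1 = W" using out_edges_cong[OF eq] o by auto
  have "wp main_loop ?s1 (\<lambda>t2 s'. good_result (40 * n * n + (t1 + (1 + t2)) + 1) s')"
  proof (rule wp_mono[OF wp_main_loop[OF rd om srt _ _ _ kn]], goal_cases)
    case (5 t2 s')
    then obtain p X sk t0 where p: "m \<le> p" "progress ?o ?s1 t0 p X sk s'" by blast
    have n2: "2 \<le> n" using kn k by simp
    have X: "separated X" using p(2) by (simp add: progress_def)
    show ?case
    proof (rule good_resultI)
      show "out_edges s' \<subseteq> E" using p(2) by (simp add: progress_def)
      fix i assume "i < m"
      then obtain j where j: "j < m" "i = ?o j" using bij by (auto simp: bij_betw_def)
      then show "reach {..<n} (out_edges s') w (S i) (D i) (stretch * ew i)" using p by (simp add: progress_def)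
    next
      have "real (nvar s' ''outm'') \<le> real (nvar ?s1 ''outm'') + (\<Sum>x\<in>X. cost x)" using p(2) by (simp add: progress_def)
      moreover have "real (nvar ?s1 ''outm'') \<le> n" unfolding eq o(3) by simp
      ultimately show "real (nvar s' ''outm'') \<le> n + 32 * (real n powr (1 + 1 / k) * (q / (\<rho> - 1)))"
        using sum_cost_le[OF X] by linarith
      have "out_weight s' \<le> W + (\<Sum>x\<in>X. cost x * (2 * x))" using p(2) os by (simp add: progress_def)
      then show "out_weight s' \<le> W + 128 * (k * real n powr (1 / k) * (q / (\<rho> - 1))) * W"
        using sum_cost_weight_le[OF X n2] by linarith
      have "real t1 \<le> 155 * (real n ^ 2 * unit_time)" using 1(2) sort_time_le by linarith
      moreover have "real t2 \<le> 974 * (real n ^ 2 * unit_time) + 1" using 5 total_time_le by linarith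
      moreover have "1 \<le> real n ^ 2" using n_pos by simp
      moreover have "real n ^ 2 * 1 \<le> real n ^ 2 * unit_time" using unit_time_ge by (intro mult_left_mono) auto
      moreover have "real (40 * n * n + (t1 + (1 + t2)) + 1) = 40 * real n ^ 2 + real t1 + real t2 + 2" by (simp add: power2_eq_square)
      ultimately show "real (40 * n * n + (t1 + (1 + t2)) + 1) \<le> 1200 * (real n ^ 2 * unit_time)" by linarith
    qed
  qed (use os T_sub in auto)
  then show ?case by simp
qed

lemma good_result_mono: "good_result t s \<Longrightarrow> t' \<le> t \<Longrightarrow> good_result t' s"
  unfolding good_result_def by (meson of_nat_mono order_trans)

end

lemma (in spanner_input) wp_light_spanner:
  "wp light_spanner (input_state n es k q \<rho>) (\<lambda>t s.
     real t \<le> 1200 * (k * real n powr (2 + 1 / k)) \<and>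
     is_spanner {..<n} E w (\<rho> * (2 * real k - 1) * (1 + 2 / q) + 2 / q) (output_edges s) \<and>
     real (card (output_edges s)) \<le> 1200 * (real n powr (1 + 1 / k) * (1 + q / (\<rho> - 1))) \<and>
     lightness {..<n} E w (output_edges s) \<le> 1200 * (k * real n powr (1 / k) * (q / (\<rho> - 1))))"
  unfolding light_spanner_def wp_Seq
proof (rule wp_frame[OF wp_prim[OF inp_input]], goal_cases)
  case (10 t1 s1)
  let ?ord = "narr s1 ''ord''" and ?pos = "narr s1 ''pos''" and ?pp = "narr s1 ''pp''" and ?key = "rarr s1 ''key''"
  interpret tree_input n E w es k q \<rho> ?ord ?pos ?pp ?key
    using 10(2) spanner_input_axioms by (simp add: tree_state_def tree_input_def)
  have inp1: "inp s1" using 10(1) inp_input by (auto simp: unch_def inp_def)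
  have to: "tree_out n ?ord ?pp (nvar s1 ''outm'') (narr s1 ''outsrc'') (narr s1 ''outdst'')" and t1: "t1 \<le> 40 * n * n"
    using 10(2) by auto
  have kn: "bval (NLess (NVar ''k'') (NVar ''n'')) s1 \<longleftrightarrow> k < n" using inp1 by (simp add: inp_def)
  show ?case
    unfolding good_result_def[symmetric]
  proof (cases "k < n")
    case True
    have "wp (sort_edges ;; NAssign ''p'' (NConst 0) ;; main_loop) s1 (\<lambda>t s'. good_result (t1 + (1 + t)) s')"
      by (rule wp_mono[OF wp_spanner_phase[OF inp1 refl refl refl to True]]) (erule good_result_mono, use t1 in simp)
    then show "wp (Cond (NLess (NVar ''k'') (NVar ''n'')) (sort_edges ;; NAssign ''p'' (NConst 0) ;; main_loop) Skip) s1
      (\<lambda>t' s''. good_result (t1 + t') s'')"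
      using True kn by (simp only: wp_Cond if_True)
  next
    case False
    have "good_result (t1 + (1 + 1)) s1" by (rule good_tree[OF to]) (use t1 False in auto)
    then show "wp (Cond (NLess (NVar ''k'') (NVar ''n'')) (sort_edges ;; NAssign ''p'' (NConst 0) ;; main_loop) Skip) s1
      (\<lambda>t' s''. good_result (t1 + t') s'')"
      using False kn by (simp only: wp_Cond wp_Skip if_False)
  qed
qed (simp_all add: input_state_def fun_eq_iff)

theorem theorem3p3:
  "\<exists>(P :: com) (C :: real). C > 0 \<and>
    (\<forall>(n :: nat) (E :: nat set set) (w :: nat set \<Rightarrow> real) (es :: (nat \<times> nat \<times> real) list)
      (k :: nat) (q :: real) (\<rho> :: real).
      weighted_graph {..<n} E w \<longrightarrow> graph_connected {..<n} E \<longrightarrow> is_edge_list E w es \<longrightarrow>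
      k \<ge> 1 \<longrightarrow> 1 / (2 * real k - 1) < q \<longrightarrow> q < real k \<longrightarrow> 1 < \<rho> \<longrightarrow> \<rho> \<le> 2 \<longrightarrow>
      (\<exists>(t :: nat) (s :: state).
        exec P (input_state n es k q \<rho>) t s \<and>
        real t \<le> C * (real k * real n powr (2 + 1 / real k)) \<and>
        is_spanner {..<n} E w (\<rho> * (2 * real k - 1) * (1 + 2 / q) + 2 / q) (output_edges s) \<and>
        real (card (output_edges s)) \<le>
          C * (real n powr (1 + 1 / real k) * (1 + q / (\<rho> - 1))) \<and>
        lightness {..<n} E w (output_edges s) \<le>
          C * (real k * real n powr (1 / real k) * (q / (\<rho> - 1)))))"
proof (rule exI[of _ light_spanner], rule exI[of _ 1200], intro conjI allI impI)
  fix n :: nat and E :: "nat set set" and w :: "nat set \<Rightarrow> real" and es :: "(nat \<times> nat \<times> real) list"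
    and k :: nat and q \<rho> :: real
  assume "weighted_graph {..<n} E w" "graph_connected {..<n} E" "is_edge_list E w es"
    "k \<ge> 1" "1 / (2 * real k - 1) < q" "q < real k" "1 < \<rho>" "\<rho> \<le> 2"
  then interpret spanner_input n E w es k q \<rho> by unfold_locales
  show "\<exists>(t :: nat) (s :: state).
        exec light_spanner (input_state n es k q \<rho>) t s \<and>
        real t \<le> 1200 * (real k * real n powr (2 + 1 / real k)) \<and>
        is_spanner {..<n} E w (\<rho> * (2 * real k - 1) * (1 + 2 / q) + 2 / q) (output_edges s) \<and>
        real (card (output_edges s)) \<le>
          1200 * (real n powr (1 + 1 / real k) * (1 + q / (\<rho> - 1))) \<and>
        lightness {..<n} E w (output_edges s) \<le>
          1200 * (real k * real n powr (1 / real k) * (q / (\<rho> - 1)))"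
    using wp_light_spanner unfolding wp_def .
qed simp

end
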